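(* Let $P^t$ be a classical Markov semigroup in a finite state space $E$ and let $(G,\phi,q^{\otimes\mathbb{Z}})$ be a standard dilation of it. Let $\mathcal{H}=L^2(\mu_E)$, let $\mathfrak{Z}=L^2(\mu_G)$, let $$V=\sum_{i\in E,\,g\in G}|\phi(i,g)\rangle\langle i,g|,$$ a unitary operator in $\mathcal{H}\otimes\mathfrak{Z}$, and let $J$ be the $*$-automorphism of $\mathcal{B}(\mathcal{H})\otimes\big(\bigotimes_{n\in\mathbb{Z}}\mathcal{B}(\mathfrak{Z}_n)\big)$ given by $J(A)=V_1^*\,\widehat\Theta(A)\,V_1$. Then: (1) for every $F\in\mathcal{L}^\infty_{\mathbb{Z}}$, $$J(m_F)=m_{F\circ\alpha};$$ (2) taking $\upsilon=\sum_{g\in G}\sqrt{q_g}\,|g\rangle\in\mathfrak{Z}$, - for every $k\in E$, every $n\ge 1$, every $F_1,\ldots,F_n\in\mathcal{L}^\infty_{\mathbb{Z}}$ and every bounded continuous function $\eta:\mathbb{C}^n\to\mathbb{C}$, $$\mathbb{E}_k\big[\eta(F_1,\ldots,F_n)\big]=\operatorname{tr}\Big[\eta(m_{F_1},\ldots,m_{F_n})\;|k\rangle\langle k|\otimes|\upsilon^{\otimes\mathbb{Z}}\rangle\langle\upsilon^{\otimes\mathbb{Z}}|\Big];$$ - $(\mathfrak{Z},V,\upsilon)$ is a QP-dilation of the quantum dynamical semigroup $T^t$ in $\mathcal{B}(\mathcal{H})$ generated by $$Ta=\sum_{g\in G}\Big(\sum_{g'\in G}\sqrt{q_{g'}}\,V_{gg'}^*\Big)\,a\,\Big(\sum_{g''\in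 G}\sqrt{q_{g''}}\,V_{gg''}\Big),\qquad a\in\mathcal{B}(\mathcal{H}),$$ and $T^t$ extends the classical Markov semigroup $P^t$, i.e. $T m_f=m_{Pf}$ for all $f\in\mathcal{L}^\infty(\mathcal{E})$.
   Context: **Classical setting.** $\mathbb{N}=\{1,2,\ldots\}$. $E=\{1,\ldots,N\}$ is a finite set with power $\sigma$-algebra $\mathcal{E}$; $\mathcal{L}^\infty(\mathcal{E})=\mathcal{L}^\infty(E)$ is the $*$-algebra of functions $E\to\mathbb{C}$ (similarly $\mathcal{L}^\infty(G)$ for a finite set $G$). A stochastic matrix $P=(P_{ij})_{i,j\in E}$ ($P_{ij}\ge0$, $\sum_jP_{ij}=1$) acts by $(Pf)(i)=\sum_jP_{ij}f(j)$, and the classical Markov semigroup it generates is $(P^t)_{t\ge0}$. A standard dilation $(G,\phi,q^{\otimes\mathbb{Z}})$ of $P^t$ consists of a finite set $G$ (with power $\sigma$-algebra), an invertible map $\phi:E\times G\to E\times G$ and a probability $q=(q_g)_{g\in G}$ on $G$ such that the following holds. Let $\Omega=E\times G^{\mathbb{Z}}$, where $G^{\mathbb{Z}}=\prod_{n\in\mathbb{Z}}G_n$, $G_n=G$, carries the cylinder $\sigma$-algebra $\mathcal{G}$, and let $\mathcal{F}=\mathcal{E}\otimes\mathcal{G}$. For $\omega=(i,(g_n)_{n\in\mathbb{Z}})$ let $X_0(\omega)=i$, $Y_n(\omega)=g_n$, and let $\mathcal{F}_t=\sigma(X_0,Y_s;\,1\le s\le t)$. Let $\vartheta$ be the left shift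 $(g_n)_n\mapsto(g_{n+1})_n$ on $G^{\mathbb{Z}}$ (extended to $\Omega$ by the identity on $E$), let $\phi_1$ be $\phi$ acting on $E\times G_1$ (extended to $\Omega$ by the identity on the other coordinates), and let $\alpha=\vartheta\circ\phi_1:\Omega\to\Omega$, $X_t=X_0\circ\alpha^t$. Let $\mathbb{P}_k=\delta_k\otimes q^{\otimes\mathbb{Z}}$, $k\in E$. Then $(\Omega,\mathcal{F},(\mathcal{F}_t)_{t\ge0},(X_t)_{t\ge0},(\mathbb{P}_k)_{k\in E})$ is required to be a Markov chain with transition matrix $P$: $$\mathbb{P}_k(X_{t+1}=j\mid\mathcal{F}_t)=\mathbb{P}_k(X_{t+1}=j\mid X_t)=P_{X_tj}\qquad\text{for all }k,j\in E,\ t\ge0.$$ $\mathbb{E}_k$ denotes expectation with respect to $\mathbb{P}_k=\delta_k\otimes q^{\otimes\mathbb{Z}}$. **Hilbert space notation.** Scalar products are linear in the second argument; $|h'\rangle\langle h|$ is the operator $h''\mapsto\langle h|h''\rangle h'$. $\mathcal{B}(\cdot)$ denotes bounded operators. For a finite set $S$, $\mu_S$ is the uniform probability on $S$ and $\{|i\rangle\}_{i\in S}$ is the canonical orthonormal basis of $L^2(\mu_S)$ (normalized indicators of points); $|i,g\rangle=|i\rangle\otimes|g\rangle$, and $|\phi(i,g)\rangle$ is the basis vector of $L^2(\mu_E)\otimes L^2(\mu_G)=L^2(\mu_E\otimes\mu_G)$ indexed by $\phi(i,g)$. $m_f$ is the operator of multiplication by $f$; $\mathcal{D}(L^2(\mu))$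 is the abelian algebra of bounded multiplication operators in $L^2(\mu)$. For a trace class operator $\tau$ on $\mathcal{K}$, $\mathbb{E}_\tau:\mathcal{B}(\mathcal{H})\otimes\mathcal{B}(\mathcal{K})\to\mathcal{B}(\mathcal{H})$ is the map determined by $a\otimes b\mapsto a\operatorname{tr}(b\tau)$, and $\mathbb{E}_\kappa=\mathbb{E}_{|\kappa\rangle\langle\kappa|}$ for a vector $\kappa$. An operator $a$ in $\mathcal{H}$ is identified with $a\otimes 1$ in $\mathcal{H}\otimes\mathcal{K}$. The operators $V_{gg'}$ in $\mathcal{H}$ are defined by $V=\sum_{g,g'\in G}V_{gg'}\otimes|g\rangle\langle g'|$, i.e. $V_{gg'}=\sum_{i,j\in E}|i\rangle\langle i,g|\phi(j,g')\rangle\langle j|$. **Infinite tensor products.** $\mathfrak{Z}_n$, $n\in\mathbb{Z}$, are copies of $\mathfrak{Z}$; tensor products of $C^*$-algebras are spatial. $V_1$ is $V$ acting in $\mathcal{H}\otimes\mathfrak{Z}_1$, extended by the identity. $\widehat\Theta$ is the right shift on $\bigotimes_{n\in\mathbb{Z}}\mathcal{B}(\mathfrak{Z}_n)$ (it moves an operator at site $n$ to the same operator at site $n+1$), extended by the identity on $\mathcal{B}(\mathcal{H})$. For a unit vector $\upsilon\in\mathfrak{Z}$, $\mathcal{K}=\bigotimes_{n\in\mathbb{Z}}\mathfrak{Z}_n$ is the infinite tensor product with stabilizing sequence $\psi_n\equiv\upsilon$, so that $\upsilon^{\otimes\mathbb{Z}}\in\mathcal{K}$ is a unit vector, and $\bigotimes_{n\in\mathbb{Z}}\mathcal{B}(\mathfrak{Z}_n)$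 is naturally embedded in $\mathcal{B}(\mathcal{K})$. **The embedding $F\mapsto m_F$.** Let $\mathcal{L}^\infty_{\mathbb{Z}}=\mathcal{L}^\infty(\mathcal{E})\otimes\big(\bigotimes_{n\in\mathbb{Z}}\mathcal{L}^\infty(G_n)\big)$, i.e. the $C^*$-algebra of all continuous complex functions on the compact space $E\times G^{\mathbb{Z}}$, and $\mathcal{D}_{\mathbb{Z}}=\mathcal{D}(\mathcal{H})\otimes\big(\bigotimes_{n\in\mathbb{Z}}\mathcal{D}(\mathfrak{Z}_n)\big)\subseteq\mathcal{B}(\mathcal{H})\otimes\big(\bigotimes_{n\in\mathbb{Z}}\mathcal{B}(\mathfrak{Z}_n)\big)$. The map $F\mapsto m_F$ is the $*$-isomorphism $\mathcal{L}^\infty_{\mathbb{Z}}\to\mathcal{D}_{\mathbb{Z}}$ that sends each $F\in\mathcal{L}^\infty(\mathcal{E})\otimes\bigotimes_{n=-t}^t\mathcal{L}^\infty(G_n)$, $t\in\mathbb{N}$, to the multiplication operator by $F$ in $\mathcal{D}(\mathcal{H})\otimes\bigotimes_{n=-t}^t\mathcal{D}(\mathfrak{Z}_n)=\mathcal{D}\big(L^2(\mu_E\otimes\mu_G^{\otimes(2t+1)})\big)$. For commuting normal operators $m_{F_1},\ldots,m_{F_n}$, $\eta(m_{F_1},\ldots,m_{F_n})$ is the joint continuous functional calculus. **Quantum dynamical semigroup (QDS).** A discrete-time QDS in $\mathcal{B}(\mathcal{H})$ is a semigroup $(T^t)_{t\ge0}$ with $T:\mathcal{B}(\mathcal{H})\to\mathcal{B}(\mathcal{H})$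 linear, bounded, completely positive, normal and identity preserving. With $\mathcal{H}=L^2(\mu_E)$, it extends the classical Markov semigroup $P^t$ if $Tm_f=m_{Pf}$ for all $f\in\mathcal{L}^\infty(\mathcal{E})$. **QP-dilation.** Let $\mathfrak{Z}$ be a Hilbert space, $V$ a unitary in $\mathcal{H}\otimes\mathfrak{Z}$, $\upsilon\in\mathfrak{Z}$ a unit vector. The flow $j_t:\mathcal{B}(\mathcal{H})\to\mathcal{B}(\mathcal{H})\otimes\mathcal{B}\big(\bigotimes_{n=1}^t\mathfrak{Z}_n\big)$ is defined, for a given orthonormal basis $\{|z\rangle\}$ of $\mathfrak{Z}$, by $j_0=\mathrm{Id}$ and $$j_t(a)=\sum_{z,z'}j_{t-1}\Big(\mathbb{E}_{|z\rangle\langle z'|}\big[V^*(a\otimes 1_{\mathfrak{Z}})V\big]\Big)\otimes|z'\rangle\langle z|,\qquad t\ge1,$$ where $|z'\rangle\langle z|$ acts on $\mathfrak{Z}_t$. With $\mathcal{K}=\bigotimes_{n\in\mathbb{Z}}\mathfrak{Z}_n$ the infinite tensor product of the copies $\mathfrak{Z}_n$ of $\mathfrak{Z}$ with respect to the stabilizing sequence of unit vectors $\psi_n\equiv\upsilon$, let $\Theta$ be the left shift operator in $\mathcal{K}$ ($\bigotimes_n h_n\mapsto\bigotimes_n h_{n+1}$), $U=\Theta V_1$, and $J(A)=U^*AU$ on $\mathcal{B}(\mathcal{H})\otimes\mathcal{B}(\mathcal{K})$; its restriction to $\mathcal{B}(\mathcal{H})\otimes\big(\bigotimes_{n\in\mathbb{Z}}\mathcal{B}(\mathfrak{Z}_n)\big)$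 is the $*$-automorphism $A\mapsto V_1^*\widehat\Theta(A)V_1$. The term $(\mathfrak{Z},V,\upsilon)$ is a QP-dilation of the QDS $T^t$ if $$T^ta=\mathbb{E}_{\upsilon^{\otimes t}}\big[j_t(a)\big]=\mathbb{E}_{\upsilon^{\otimes\mathbb{Z}}}\big[J^t(a)\big]\qquad\text{for all }a\in\mathcal{B}(\mathcal{H}),\ t\ge0.$$ *)

theory Defs
  imports
    "HOL-Probability.Probability"
    "HOL-Library.Function_Algebras"
    "HOL-Library.Groups_Big_Fun"
begin

section \<open>Hilbert spaces of complex functions\<close>

text \<open>
  A Hilbert space is given by a set of complex functions on some type, with the pointwise linear
  structure, and a scalar product that is linear in the second argument. An operator is a function
  on vectors that is zero outside the carrier, so that equality of operators is equality of
  functions and the product of operators is composition. Sums of vectors and of operators are the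
  pointwise ones of \<^theory>\<open>HOL-Library.Function_Algebras\<close>.
\<close>

type_synonym 'x cvec = "'x \<Rightarrow> complex"
type_synonym 'x operator = "'x cvec \<Rightarrow> 'x cvec"

record 'x hilb =
  vecs :: "'x cvec set"
  ip :: "'x cvec \<Rightarrow> 'x cvec \<Rightarrow> complex"

definition scale :: "complex \<Rightarrow> 'x cvec \<Rightarrow> 'x cvec"  (infixr \<open>\<cdot>\<^sub>v\<close> 75)
  where "c \<cdot>\<^sub>v f = (\<lambda>x. c * f x)"

definition scale_op :: "complex \<Rightarrow> 'x operator \<Rightarrow> 'x operator"  (infixr \<open>\<cdot>\<^sub>o\<close> 75)
  where "c \<cdot>\<^sub>o A = (\<lambda>f. c \<cdot>\<^sub>v A f)"

definition hnorm :: "'x hilb \<Rightarrow> 'x cvec \<Rightarrow> real"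
  where "hnorm K f = sqrt (Re (ip K f f))"

definition hilbert_space :: "'x hilb \<Rightarrow> bool"
  where "hilbert_space K \<longleftrightarrow>
    0 \<in> vecs K \<and>
    (\<forall>f\<in>vecs K. \<forall>g\<in>vecs K. \<forall>c. c \<cdot>\<^sub>v f + g \<in> vecs K) \<and>
    (\<forall>f\<in>vecs K. \<forall>g\<in>vecs K. \<forall>h\<in>vecs K. \<forall>c.
      ip K h (c \<cdot>\<^sub>v f + g) = c * ip K h f + ip K h g) \<and>
    (\<forall>f\<in>vecs K. \<forall>g\<in>vecs K. ip K g f = cnj (ip K f g)) \<and>
    (\<forall>f\<in>vecs K. f \<noteq> 0 \<longrightarrow> Re (ip K f f) > 0) \<and>
    (\<forall>s. (\<forall>n::nat. s n \<in> vecs K) \<and>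
         (\<forall>\<epsilon>>0. \<exists>n0. \<forall>m\<ge>n0. \<forall>n\<ge>n0. hnorm K (s m - s n) < \<epsilon>) \<longrightarrow>
         (\<exists>f\<in>vecs K. (\<lambda>n. hnorm K (s n - f)) \<longlonglongrightarrow> 0))"

definition total_set :: "'x hilb \<Rightarrow> 'x cvec set \<Rightarrow> bool"
  where "total_set K S \<longleftrightarrow> S \<subseteq> vecs K \<and>
    (\<forall>f\<in>vecs K. \<forall>\<epsilon>>0. \<exists>D c. finite D \<and> D \<subseteq> S \<and> hnorm K (f - (\<Sum>b\<in>D. c b \<cdot>\<^sub>v b)) < \<epsilon>)"

definition onb :: "'x hilb \<Rightarrow> 'x cvec set \<Rightarrow> bool"
  where "onb K S \<longleftrightarrow> total_set K S \<and> (\<forall>b\<in>S. \<forall>b'\<in>S. ip K b b' = (if b = b' then 1 else 0))"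

subsection \<open>Bounded operators\<close>

definition bop :: "'x hilb \<Rightarrow> 'x operator set"
  where "bop K = {A.
    (\<forall>f\<in>vecs K. A f \<in> vecs K) \<and> (\<forall>f. f \<notin> vecs K \<longrightarrow> A f = 0) \<and>
    (\<forall>f\<in>vecs K. \<forall>g\<in>vecs K. \<forall>c. A (c \<cdot>\<^sub>v f + g) = c \<cdot>\<^sub>v A f + A g) \<and>
    (\<exists>C. \<forall>f\<in>vecs K. hnorm K (A f) \<le> C * hnorm K f)}"

definition opnorm :: "'x hilb \<Rightarrow> 'x operator \<Rightarrow> real"
  where "opnorm K A = (SUP f\<in>{f \<in> vecs K. hnorm K f \<le> 1}. hnorm K (A f))"

definition id_op :: "'x hilb \<Rightarrow> 'x operator"
  where "id_op K = (\<lambda>f. if f \<in> vecs K then f else 0)"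

definition adj :: "'x hilb \<Rightarrow> 'x operator \<Rightarrow> 'x operator"
  where "adj K A = (THE B. B \<in> bop K \<and> (\<forall>f\<in>vecs K. \<forall>g\<in>vecs K. ip K f (A g) = ip K (B f) g))"

definition unitary_op :: "'x hilb \<Rightarrow> 'x operator \<Rightarrow> bool"
  where "unitary_op K W \<longleftrightarrow>
    W \<in> bop K \<and> adj K W \<circ> W = id_op K \<and> W \<circ> adj K W = id_op K"

definition ketbra :: "'x hilb \<Rightarrow> 'x cvec \<Rightarrow> 'x cvec \<Rightarrow> 'x operator"
  where "ketbra K f g = (\<lambda>h. if h \<in> vecs K then ip K g h \<cdot>\<^sub>v f else 0)"

definition htrace :: "'x hilb \<Rightarrow> 'x operator \<Rightarrow> complex"
  where "htrace K A = (THE c. \<forall>S. onb K S \<longrightarrow> ((\<lambda>b. ip K b (A b)) has_sum c) S)"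

subsection \<open>*-algebras of operators and continuous functional calculus\<close>

definition cstar_subalgebra :: "'x hilb \<Rightarrow> 'x operator set \<Rightarrow> bool"
  where "cstar_subalgebra K \<BB> \<longleftrightarrow> \<BB> \<subseteq> bop K \<and> id_op K \<in> \<BB> \<and>
    (\<forall>A\<in>\<BB>. \<forall>B\<in>\<BB>. A + B \<in> \<BB> \<and> A \<circ> B \<in> \<BB>) \<and>
    (\<forall>A\<in>\<BB>. \<forall>c. c \<cdot>\<^sub>o A \<in> \<BB>) \<and> (\<forall>A\<in>\<BB>. adj K A \<in> \<BB>) \<and>
    (\<forall>A\<in>bop K. (\<forall>\<epsilon>>0. \<exists>B\<in>\<BB>. opnorm K (A - B) < \<epsilon>) \<longrightarrow> A \<in> \<BB>)"

text \<open>Preservation of the norm is automatic for bijective *-homomorphisms of C*-algebras.\<close>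

definition star_automorphism ::
    "'x hilb \<Rightarrow> 'x operator set \<Rightarrow> ('x operator \<Rightarrow> 'x operator) \<Rightarrow> bool"
  where "star_automorphism K \<BB> \<theta> \<longleftrightarrow> bij_betw \<theta> \<BB> \<BB> \<and>
    (\<forall>A\<in>\<BB>. \<forall>B\<in>\<BB>. \<theta> (A + B) = \<theta> A + \<theta> B \<and> \<theta> (A \<circ> B) = \<theta> A \<circ> \<theta> B) \<and>
    (\<forall>A\<in>\<BB>. \<forall>c. \<theta> (c \<cdot>\<^sub>o A) = c \<cdot>\<^sub>o \<theta> A) \<and>
    (\<forall>A\<in>\<BB>. \<theta> (adj K A) = adj K (\<theta> A)) \<and>
    (\<forall>A\<in>\<BB>. opnorm K (\<theta> A) = opnorm K A)"

definition cont_funs :: "'a topology \<Rightarrow> ('a \<Rightarrow> complex) set"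
  where "cont_funs X = {f. continuous_map X euclidean f}"

definition cont_star_hom ::
    "'a topology \<Rightarrow> 'x hilb \<Rightarrow> (('a \<Rightarrow> complex) \<Rightarrow> 'x operator) \<Rightarrow> bool"
  where "cont_star_hom X K \<pi> \<longleftrightarrow>
    (\<forall>f\<in>cont_funs X. \<pi> f \<in> bop K) \<and> \<pi> (\<lambda>_. 1) = id_op K \<and>
    (\<forall>f\<in>cont_funs X. \<forall>g\<in>cont_funs X.
       \<pi> (\<lambda>x. f x + g x) = \<pi> f + \<pi> g \<and> \<pi> (\<lambda>x. f x * g x) = \<pi> f \<circ> \<pi> g) \<and>
    (\<forall>f\<in>cont_funs X. \<forall>c. \<pi> (\<lambda>x. c * f x) = c \<cdot>\<^sub>o \<pi> f) \<and>
    (\<forall>f\<in>cont_funs X. \<pi> (\<lambda>x. cnj (f x)) = adj K (\<pi> f))"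

text \<open>
  The joint continuous functional calculus of commuting normal operators is the unique unital
  *-homomorphism on the continuous functions on \<open>\<complex>\<^sup>n\<close> that sends the coordinate functions to the
  given operators; it factors through the restriction to the joint spectrum.
\<close>

definition joint_cfc ::
    "'x hilb \<Rightarrow> ('n::finite \<Rightarrow> 'x operator) \<Rightarrow> (complex^'n \<Rightarrow> complex) \<Rightarrow> 'x operator"
  where "joint_cfc K N \<eta> = (THE B. \<exists>\<pi>. cont_star_hom euclidean K \<pi> \<and>
    (\<forall>j. \<pi> (\<lambda>z. z $ j) = N j) \<and> B = \<pi> \<eta>)"

subsection \<open>The spaces \<open>L\<^sup>2(\<mu>\<^sub>S)\<close>\<close>

definition L2 :: "'s set \<Rightarrow> 's hilb"
  where "L2 S = \<lparr> vecs = {f. \<forall>s. s \<notin> S \<longrightarrow> f s = 0},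
                  ip = (\<lambda>f g. (\<Sum>s\<in>S. cnj (f s) * g s) / of_nat (card S)) \<rparr>"

abbreviation L2U :: "('s::finite) hilb"
  where "L2U \<equiv> L2 UNIV"

definition ket :: "'s::finite \<Rightarrow> 's cvec"
  where "ket s = (\<lambda>x. if x = s then complex_of_real (sqrt (real CARD('s))) else 0)"

definition mult_fun :: "('s::finite \<Rightarrow> complex) \<Rightarrow> 's operator"
  where "mult_fun f = (\<lambda>h x. f x * h x)"

subsection \<open>Tensor products with \<open>\<H> = L\<^sup>2(\<mu>\<^sub>E)\<close>\<close>

text \<open>
  The space \<open>\<H> \<otimes> K\<close> is realised as \<open>L\<^sup>2(\<mu>\<^sub>E; K)\<close>; for \<open>K = L2 S\<close> it is
  \<open>L\<^sup>2(\<mu>\<^sub>E \<otimes> \<mu>\<^sub>S)\<close>.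
\<close>

definition Htens :: "'x hilb \<Rightarrow> ('e::finite \<times> 'x) hilb"
  where "Htens K = \<lparr> vecs = {\<Phi>. \<forall>i. (\<lambda>x. \<Phi> (i, x)) \<in> vecs K},
    ip = (\<lambda>\<Phi> \<Psi>. (\<Sum>i\<in>UNIV. ip K (\<lambda>x. \<Phi> (i, x)) (\<lambda>x. \<Psi> (i, x))) / of_nat CARD('e)) \<rparr>"

definition vtens :: "'e cvec \<Rightarrow> 'x cvec \<Rightarrow> ('e \<times> 'x) cvec"  (infixr \<open>\<otimes>\<^sub>v\<close> 70)
  where "f \<otimes>\<^sub>v \<kappa> = (\<lambda>(i, x). f i * \<kappa> x)"

text \<open>The operator \<open>a \<otimes> 1\<^sub>K\<close>.\<close>

definition amp :: "'x hilb \<Rightarrow> 'e::finite operator \<Rightarrow> ('e \<times> 'x) operator"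
  where "amp K a = (\<lambda>\<Phi>. if \<Phi> \<in> vecs (Htens K) then (\<lambda>(i, x). a (\<lambda>j. \<Phi> (j, x)) i) else 0)"

text \<open>
  \<open>cond_exp K \<kappa> \<kappa>'\<close> is \<open>\<EE>\<^sub>\<tau>\<close> for \<open>\<tau> = |\<kappa>\<rangle>\<langle>\<kappa>'|\<close>. Since
  \<open>tr ((a \<otimes> b) (|j\<rangle>\<langle>i| \<otimes> \<tau>)) = \<langle>i|a|j\<rangle> tr (b \<tau>)\<close>, the matrix elements below say that
  \<open>a \<otimes> b\<close> is mapped to \<open>tr (b \<tau>) a\<close>.
\<close>

definition cond_exp ::
    "'x hilb \<Rightarrow> 'x cvec \<Rightarrow> 'x cvec \<Rightarrow> ('e::finite \<times> 'x) operator \<Rightarrow> 'e operator"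
  where "cond_exp K \<kappa> \<kappa>' A = (\<Sum>i\<in>UNIV. \<Sum>j\<in>UNIV.
    htrace (Htens K) (A \<circ> ketbra (Htens K) (ket j \<otimes>\<^sub>v \<kappa>) (ket i \<otimes>\<^sub>v \<kappa>'))
      \<cdot>\<^sub>o ketbra L2U (ket i) (ket j))"

section \<open>Standard dilations of classical Markov semigroups\<close>

definition stochastic :: "('e::finite \<Rightarrow> 'e \<Rightarrow> real) \<Rightarrow> bool"
  where "stochastic P \<longleftrightarrow> (\<forall>i j. P i j \<ge> 0) \<and> (\<forall>i. (\<Sum>j\<in>UNIV. P i j) = 1)"

definition markov_op :: "('e::finite \<Rightarrow> 'e \<Rightarrow> real) \<Rightarrow> ('e \<Rightarrow> complex) \<Rightarrow> 'e \<Rightarrow> complex"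
  where "markov_op P f = (\<lambda>i. \<Sum>j\<in>UNIV. complex_of_real (P i j) * f j)"

type_synonym ('e, 'g) path = "'e \<times> (int \<Rightarrow> 'g)"

definition path_shift :: "('e, 'g) path \<Rightarrow> ('e, 'g) path"
  where "path_shift = (\<lambda>(i, g). (i, \<lambda>n. g (n + 1)))"

definition act1 :: "('e \<times> 'g \<Rightarrow> 'e \<times> 'g) \<Rightarrow> ('e, 'g) path \<Rightarrow> ('e, 'g) path"
  where "act1 \<phi> = (\<lambda>(i, g). (fst (\<phi> (i, g 1)), g(1 := snd (\<phi> (i, g 1)))))"

definition alpha :: "('e \<times> 'g \<Rightarrow> 'e \<times> 'g) \<Rightarrow> ('e, 'g) path \<Rightarrow> ('e, 'g) path"
  where "alpha \<phi> = path_shift \<circ> act1 \<phi>"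

definition chain :: "('e \<times> 'g \<Rightarrow> 'e \<times> 'g) \<Rightarrow> nat \<Rightarrow> ('e, 'g) path \<Rightarrow> 'e"
  where "chain \<phi> t = fst \<circ> (alpha \<phi> ^^ t)"

definition path_measure :: "'g pmf \<Rightarrow> 'e \<Rightarrow> ('e, 'g) path measure"
  where "path_measure q k =
    measure_pmf (return_pmf k) \<Otimes>\<^sub>M (\<Pi>\<^sub>M n\<in>(UNIV::int set). measure_pmf q)"

definition history :: "nat \<Rightarrow> ('e, 'g) path measure"
  where "history t = sigma UNIV
    ({fst -` A | A. True} \<union> {(\<lambda>\<omega>. snd \<omega> s) -` A | s A. 1 \<le> s \<and> s \<le> int t})"

definition standard_dilation ::
    "('e::finite \<Rightarrow> 'e \<Rightarrow> real) \<Rightarrow> ('e \<times> 'g::finite \<Rightarrow> 'e \<times> 'g) \<Rightarrow> 'g pmf \<Rightarrow> bool"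
  where "standard_dilation P \<phi> q \<longleftrightarrow> bij \<phi> \<and>
    (\<forall>k j t.
      (AE \<omega> in path_measure q k.
        real_cond_exp (path_measure q k) (history t)
          (indicator {\<omega>. chain \<phi> (Suc t) \<omega> = j}) \<omega> = P (chain \<phi> t \<omega>) j) \<and>
      (AE \<omega> in path_measure q k.
        real_cond_exp (path_measure q k)
          (vimage_algebra UNIV (chain \<phi> t) (count_space UNIV))
          (indicator {\<omega>. chain \<phi> (Suc t) \<omega> = j}) \<omega> = P (chain \<phi> t \<omega>) j))"

definition path_topology :: "('e, 'g) path topology"
  where "path_topology =
    prod_topology (discrete_topology UNIV) (product_topology (\<lambda>_. discrete_topology UNIV) UNIV)"

section \<open>Infinite tensor products\<close>

text \<open>
  \<open>infinite_tensor \<upsilon> K T\<close> states that \<open>K\<close>, with the elementary tensors \<open>T h = \<Otimes>\<^sub>n h\<^sub>n\<close>, is the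
  infinite tensor product of the copies \<open>\<ZZ>\<^sub>n\<close>, \<open>n \<in> \<int>\<close>, of \<open>\<ZZ> = L\<^sup>2(\<mu>\<^sub>G)\<close> with respect to the
  stabilising sequence constantly equal to \<open>\<upsilon>\<close>. This determines \<open>(K, T)\<close> up to a unique unitary.
\<close>

definition stab :: "'g cvec \<Rightarrow> (int \<Rightarrow> 'g cvec) set"
  where "stab \<upsilon> = {h. finite {n. h n \<noteq> \<upsilon>}}"

definition infinite_tensor ::
    "'g::finite cvec \<Rightarrow> 'x hilb \<Rightarrow> ((int \<Rightarrow> 'g cvec) \<Rightarrow> 'x cvec) \<Rightarrow> bool"
  where "infinite_tensor \<upsilon> K T \<longleftrightarrow>
    hnorm L2U \<upsilon> = 1 \<and> hilbert_space K \<and>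
    (\<forall>h\<in>stab \<upsilon>. \<forall>h'\<in>stab \<upsilon>. ip K (T h) (T h') = Prod_any (\<lambda>n. ip L2U (h n) (h' n))) \<and>
    total_set K (T ` stab \<upsilon>)"

text \<open>
  In the following, \<open>(\<upsilon>, K, T)\<close> is as above. An operator \<open>B\<close> in \<open>\<H> \<otimes> \<ZZ>\<close>, acting in
  \<open>\<H> \<otimes> \<ZZ>\<^sub>n\<close> and extended by the identity:
\<close>

definition site_op ::
    "'g::finite cvec \<Rightarrow> 'x hilb \<Rightarrow> ((int \<Rightarrow> 'g cvec) \<Rightarrow> 'x cvec) \<Rightarrow>
     int \<Rightarrow> ('e::finite \<times> 'g) operator \<Rightarrow> ('e \<times> 'x) operator"
  where "site_op \<upsilon> K T n B = (THE W. W \<in> bop (Htens K) \<and>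
    (\<forall>i g. \<forall>h\<in>stab \<upsilon>. W (ket i \<otimes>\<^sub>v T (h(n := ket g))) =
      (\<Sum>j\<in>UNIV. \<Sum>g'\<in>UNIV. ip (Htens L2U) (ket j \<otimes>\<^sub>v ket g') (B (ket i \<otimes>\<^sub>v ket g))
          \<cdot>\<^sub>v (ket j \<otimes>\<^sub>v T (h(n := ket g'))))))"

text \<open>The C*-algebra \<open>\<B>(\<H>) \<otimes> (\<Otimes>\<^sub>n \<B>(\<ZZ>\<^sub>n))\<close>, embedded in \<open>\<B>(\<H> \<otimes> K)\<close>:\<close>

definition local_algebra ::
    "'g::finite cvec \<Rightarrow> 'x hilb \<Rightarrow> ((int \<Rightarrow> 'g cvec) \<Rightarrow> 'x cvec) \<Rightarrow>
     ('e::finite \<times> 'x) operator set"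
  where "local_algebra \<upsilon> K T =
    \<Inter>{\<BB>. cstar_subalgebra (Htens K) \<BB> \<and> (\<forall>n. \<forall>B\<in>bop (Htens L2U). site_op \<upsilon> K T n B \<in> \<BB>)}"

definition right_shift ::
    "'g::finite cvec \<Rightarrow> 'x hilb \<Rightarrow> ((int \<Rightarrow> 'g cvec) \<Rightarrow> 'x cvec) \<Rightarrow>
     ('e::finite \<times> 'x) operator \<Rightarrow> ('e \<times> 'x) operator"
  where "right_shift \<upsilon> K T A = (THE A'. \<exists>\<theta>.
    star_automorphism (Htens K) (local_algebra \<upsilon> K T) \<theta> \<and>
    (\<forall>n. \<forall>B\<in>bop (Htens L2U). \<theta> (site_op \<upsilon> K T n B) = site_op \<upsilon> K T (n + 1) B) \<and> A' = \<theta> A)"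

text \<open>The automorphism \<open>A \<mapsto> V\<^sub>1\<^sup>* \<Theta>(A) V\<^sub>1\<close> of the local algebra, with \<open>\<Theta>\<close> the right shift:\<close>

definition local_J ::
    "'g::finite cvec \<Rightarrow> 'x hilb \<Rightarrow> ((int \<Rightarrow> 'g cvec) \<Rightarrow> 'x cvec) \<Rightarrow>
     ('e::finite \<times> 'g) operator \<Rightarrow> ('e \<times> 'x) operator \<Rightarrow> ('e \<times> 'x) operator"
  where "local_J \<upsilon> K T V A =
    adj (Htens K) (site_op \<upsilon> K T 1 V) \<circ> right_shift \<upsilon> K T A \<circ> site_op \<upsilon> K T 1 V"

definition left_shift_op ::
    "'g::finite cvec \<Rightarrow> 'x hilb \<Rightarrow> ((int \<Rightarrow> 'g cvec) \<Rightarrow> 'x cvec) \<Rightarrow> ('e::finite \<times> 'x) operator"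
  where "left_shift_op \<upsilon> K T = (THE W. W \<in> bop (Htens K) \<and>
    (\<forall>f. \<forall>h\<in>stab \<upsilon>. W (f \<otimes>\<^sub>v T h) = f \<otimes>\<^sub>v T (\<lambda>n. h (n + 1))))"

definition global_J ::
    "'g::finite cvec \<Rightarrow> 'x hilb \<Rightarrow> ((int \<Rightarrow> 'g cvec) \<Rightarrow> 'x cvec) \<Rightarrow>
     ('e::finite \<times> 'g) operator \<Rightarrow> ('e \<times> 'x) operator \<Rightarrow> ('e \<times> 'x) operator"
  where "global_J \<upsilon> K T V A =
    (let U = left_shift_op \<upsilon> K T \<circ> site_op \<upsilon> K T 1 V in adj (Htens K) U \<circ> A \<circ> U)"

subsection \<open>Multiplication operators\<close>

definition cylinder :: "nat \<Rightarrow> (('e, 'g) path \<Rightarrow> complex) \<Rightarrow> bool"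
  where "cylinder t F \<longleftrightarrow>
    (\<forall>i x y. (\<forall>n. \<bar>n\<bar> \<le> int t \<longrightarrow> x n = y n) \<longrightarrow> F (i, x) = F (i, y))"

text \<open>
  Multiplication by \<open>F\<close> in \<open>L\<^sup>2(\<mu>\<^sub>E \<otimes> \<mu>\<^sub>G\<^bsup>\<otimes>(2t+1)\<^esup>)\<close>, extended by the identity on the sites
  outside \<open>{-t..t}\<close>; it is diagonal in the basis of the normalised indicators of points.
\<close>

definition mult_cyl ::
    "'g::finite cvec \<Rightarrow> 'x hilb \<Rightarrow> ((int \<Rightarrow> 'g cvec) \<Rightarrow> 'x cvec) \<Rightarrow>
     nat \<Rightarrow> (('e::finite, 'g) path \<Rightarrow> complex) \<Rightarrow> ('e \<times> 'x) operator"
  where "mult_cyl \<upsilon> K T t F = (THE W. W \<in> bop (Htens K) \<and>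
    (\<forall>i x. \<forall>h\<in>stab \<upsilon>. (\<forall>n. \<bar>n\<bar> \<le> int t \<longrightarrow> h n = ket (x n)) \<longrightarrow>
      W (ket i \<otimes>\<^sub>v T h) = F (i, x) \<cdot>\<^sub>v (ket i \<otimes>\<^sub>v T h)))"

text \<open>
  The image of the *-homomorphism below is automatically the closure of the algebra of
  multiplication operators by cylinder functions.
\<close>

definition mult_op ::
    "'g::finite cvec \<Rightarrow> 'x hilb \<Rightarrow> ((int \<Rightarrow> 'g cvec) \<Rightarrow> 'x cvec) \<Rightarrow>
     (('e::finite, 'g) path \<Rightarrow> complex) \<Rightarrow> ('e \<times> 'x) operator"
  where "mult_op \<upsilon> K T F = (THE A. \<exists>\<pi>.
    cont_star_hom path_topology (Htens K) \<pi> \<and>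
    (\<forall>t F'. cylinder t F' \<longrightarrow> \<pi> F' = mult_cyl \<upsilon> K T t F') \<and> A = \<pi> F)"

section \<open>Quantum dynamical semigroups and their dilations\<close>

definition positive_matrix :: "'x hilb \<Rightarrow> nat \<Rightarrow> (nat \<Rightarrow> nat \<Rightarrow> 'x operator) \<Rightarrow> bool"
  where "positive_matrix K n A \<longleftrightarrow> (\<forall>f. (\<forall>k<n. f k \<in> vecs K) \<longrightarrow>
    (\<Sum>k<n. \<Sum>l<n. ip K (f k) (A k l (f l))) \<in> \<real>\<^sub>\<ge>\<^sub>0)"

definition completely_positive :: "'x hilb \<Rightarrow> ('x operator \<Rightarrow> 'x operator) \<Rightarrow> bool"
  where "completely_positive K T \<longleftrightarrow> (\<forall>n A. (\<forall>k<n. \<forall>l<n. A k l \<in> bop K) \<longrightarrow>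
    positive_matrix K n A \<longrightarrow> positive_matrix K n (\<lambda>k l. T (A k l)))"

text \<open>
  Normality is \<open>\<sigma>\<close>-weak continuity, i.e. the existence of a predual map on trace class operators.
  Every operator in \<open>L\<^sup>2(\<mu>\<^sub>E)\<close> is trace class.
\<close>

definition normal_map :: "('e::finite operator \<Rightarrow> 'e operator) \<Rightarrow> bool"
  where "normal_map T \<longleftrightarrow> (\<forall>\<tau>\<in>bop L2U. \<exists>\<tau>'\<in>bop L2U. \<forall>a\<in>bop L2U.
    htrace L2U (T a \<circ> \<tau>) = htrace L2U (a \<circ> \<tau>'))"

text \<open>The map \<open>T\<close> generates the discrete-time semigroup of its iterates \<open>T ^^ t\<close>.\<close>

definition qds_generator :: "('e::finite operator \<Rightarrow> 'e operator) \<Rightarrow> bool"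
  where "qds_generator T \<longleftrightarrow>
    (\<forall>a\<in>bop L2U. T a \<in> bop L2U) \<and>
    (\<forall>a\<in>bop L2U. \<forall>b\<in>bop L2U. \<forall>c. T (c \<cdot>\<^sub>o a + b) = c \<cdot>\<^sub>o T a + T b) \<and>
    (\<exists>C. \<forall>a\<in>bop L2U. opnorm L2U (T a) \<le> C * opnorm L2U a) \<and>
    completely_positive L2U T \<and> normal_map T \<and> T (id_op L2U) = id_op L2U"

text \<open>
  \<open>\<Otimes>\<^sub>n \<ZZ>\<^sub>n\<close> over \<open>n = 1, \<dots>, t\<close> is \<open>L\<^sup>2(\<mu>\<^sub>G\<^bsup>\<otimes>t\<^esup>)\<close>, where \<open>G\<^sup>t\<close> is the set of lists of
  length \<open>t\<close>.
\<close>

definition words :: "nat \<Rightarrow> 'g list set"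
  where "words t = {xs. length xs = t}"

definition tpower :: "nat \<Rightarrow> 'g cvec \<Rightarrow> 'g list cvec"
  where "tpower t \<upsilon> = (\<lambda>xs. if xs \<in> words t then \<Prod>x\<leftarrow>xs. \<upsilon> x else 0)"

text \<open>
  \<open>C \<otimes> |z'\<rangle>\<langle>z|\<close>, where \<open>C\<close> acts in \<open>\<H> \<otimes> \<ZZ>\<^sub>1 \<otimes> \<dots> \<otimes> \<ZZ>\<^sub>t\<close> and \<open>|z'\<rangle>\<langle>z|\<close> acts in
  \<open>\<ZZ>\<^sub>t\<^sub>+\<^sub>1\<close>:
\<close>

definition append_ketbra ::
    "nat \<Rightarrow> ('e::finite \<times> 'g::finite list) operator \<Rightarrow> 'g cvec \<Rightarrow> 'g cvec \<Rightarrow>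
     ('e \<times> 'g list) operator"
  where "append_ketbra t C z' z = (\<lambda>\<Phi>. if \<Phi> \<in> vecs (Htens (L2 (words (Suc t)))) then
    (\<lambda>(i, xs). if xs \<in> words (Suc t) then
       C (\<lambda>(j, ys). ip L2U z (\<lambda>g. \<Phi> (j, ys @ [g]))) (i, butlast xs) * z' (last xs) else 0)
    else 0)"

primrec flow ::
    "'g cvec set \<Rightarrow> ('e::finite \<times> 'g::finite) operator \<Rightarrow> nat \<Rightarrow>
     'e operator \<Rightarrow> ('e \<times> 'g list) operator"
  where
    "flow Z V 0 = (\<lambda>a. amp (L2 (words 0)) a)"
  | "flow Z V (Suc t) = (\<lambda>a. \<Sum>z\<in>Z. \<Sum>z'\<in>Z. append_ketbra t
       (flow Z V t (cond_exp L2U z z' (adj (Htens L2U) V \<circ> amp L2U a \<circ> V))) z' z)"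

definition qp_dilation ::
    "'x hilb \<Rightarrow> ((int \<Rightarrow> 'g cvec) \<Rightarrow> 'x cvec) \<Rightarrow>
     ('e::finite \<times> 'g::finite) operator \<Rightarrow> 'g cvec \<Rightarrow> ('e operator \<Rightarrow> 'e operator) \<Rightarrow> bool"
  where "qp_dilation K T V \<upsilon> S \<longleftrightarrow>
    unitary_op (Htens L2U) V \<and> hnorm L2U \<upsilon> = 1 \<and> infinite_tensor \<upsilon> K T \<and>
    (\<forall>a\<in>bop L2U. \<forall>t.
      (\<forall>Z. onb L2U Z \<longrightarrow>
        (S ^^ t) a = cond_exp (L2 (words t)) (tpower t \<upsilon>) (tpower t \<upsilon>) (flow Z V t a)) \<and>
      (S ^^ t) a = cond_exp K (T (\<lambda>_. \<upsilon>)) (T (\<lambda>_. \<upsilon>)) ((global_J \<upsilon> K T V ^^ t) (amp K a)))"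

subsection \<open>The dilation associated with \<open>(G, \<phi>, q)\<close>\<close>

definition dil_V :: "('e::finite \<times> 'g::finite \<Rightarrow> 'e \<times> 'g) \<Rightarrow> ('e \<times> 'g) operator"
  where "dil_V \<phi> = (\<Sum>i\<in>UNIV. \<Sum>g\<in>UNIV. ketbra (Htens L2U)
    (ket (fst (\<phi> (i, g))) \<otimes>\<^sub>v ket (snd (\<phi> (i, g)))) (ket i \<otimes>\<^sub>v ket g))"

definition block :: "('e::finite \<times> 'g::finite) operator \<Rightarrow> 'g \<Rightarrow> 'g \<Rightarrow> 'e operator"
  where "block V g g' = (\<Sum>i\<in>UNIV. \<Sum>j\<in>UNIV.
    ip (Htens L2U) (ket i \<otimes>\<^sub>v ket g) (V (ket j \<otimes>\<^sub>v ket g')) \<cdot>\<^sub>o ketbra L2U (ket i) (ket j))"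

definition dil_vec :: "'g::finite pmf \<Rightarrow> 'g cvec"
  where "dil_vec q = (\<Sum>g\<in>UNIV. complex_of_real (sqrt (pmf q g)) \<cdot>\<^sub>v ket g)"

definition dil_T ::
    "('e::finite \<times> 'g::finite \<Rightarrow> 'e \<times> 'g) \<Rightarrow> 'g pmf \<Rightarrow> 'e operator \<Rightarrow> 'e operator"
  where "dil_T \<phi> q a = (\<Sum>g\<in>UNIV.
    (\<Sum>g'\<in>UNIV. complex_of_real (sqrt (pmf q g')) \<cdot>\<^sub>o adj L2U (block (dil_V \<phi>) g g')) \<circ> a \<circ>
    (\<Sum>g'\<in>UNIV. complex_of_real (sqrt (pmf q g')) \<cdot>\<^sub>o block (dil_V \<phi>) g g'))"

section \<open>Existence of infinite tensor products\<close>

text \<open>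
  The space \<open>l\<^sup>2\<close> over the finitely supported families of basis indices realises
  \<^const>\<open>infinite_tensor\<close>, for an orthonormal basis of \<open>\<ZZ>\<close> that contains the unit vector.
\<close>

definition ell2 :: "'x set \<Rightarrow> 'x hilb"
  where "ell2 X = \<lparr> vecs = {f. (\<forall>x. x \<notin> X \<longrightarrow> f x = 0) \<and> (\<lambda>x. (cmod (f x))\<^sup>2) summable_on UNIV},
                    ip = (\<lambda>f g. \<Sum>\<^sub>\<infinity>x. cnj (f x) * g x) \<rparr>"

lemma ell2_ip_summable:
  assumes "f \<in> vecs (ell2 X)" "g \<in> vecs (ell2 X)"
  shows "(\<lambda>x. cnj (f x) * g x) summable_on UNIV"
proof -
  have s: "(\<lambda>x. (cmod (f x))\<^sup>2 + (cmod (g x))\<^sup>2) summable_on UNIV"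
    using assms by (intro summable_on_add) (auto simp: ell2_def)
  have "(\<lambda>x. norm (cnj (f x) * g x)) summable_on UNIV"
  proof (rule summable_on_comparison_test[OF s])
    fix x
    have "0 \<le> (cmod (f x) - cmod (g x))\<^sup>2" by simp
    moreover have "0 \<le> cmod (f x) * cmod (g x)" by simp
    ultimately show "norm (cnj (f x) * g x) \<le> (cmod (f x))\<^sup>2 + (cmod (g x))\<^sup>2"
      unfolding norm_mult complex_mod_cnj power2_diff by linarith
  qed simp
  then show ?thesis by (rule abs_summable_summable)
qed

lemma ell2_closed:
  assumes "f \<in> vecs (ell2 X)" "g \<in> vecs (ell2 X)"
  shows "c \<cdot>\<^sub>v f + g \<in> vecs (ell2 X)"
proof -
  have s: "(\<lambda>x. 2 * (cmod c)\<^sup>2 * (cmod (f x))\<^sup>2 + 2 * (cmod (g x))\<^sup>2) summable_on UNIV"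
    using assms by (intro summable_on_add summable_on_cmult_right) (auto simp: ell2_def)
  have "(\<lambda>x. (cmod (c * f x + g x))\<^sup>2) summable_on UNIV"
  proof (rule summable_on_comparison_test[OF s])
    fix x
    have "cmod (c * f x + g x) \<le> cmod c * cmod (f x) + cmod (g x)"
      by (metis norm_mult norm_triangle_ineq)
    then have "(cmod (c * f x + g x))\<^sup>2 \<le> (cmod c * cmod (f x) + cmod (g x))\<^sup>2"
      by (intro power_mono) auto
    also have "\<dots> \<le> 2 * (cmod c * cmod (f x))\<^sup>2 + 2 * (cmod (g x))\<^sup>2"
      using sum_squares_bound[of "cmod c * cmod (f x)" "cmod (g x)"] by (simp add: power2_sum)
    finally show "(cmod (c * f x + g x))\<^sup>2 \<le> 2 * (cmod c)\<^sup>2 * (cmod (f x))\<^sup>2 + 2 * (cmod (g x))\<^sup>2"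
      by (simp add: power_mult_distrib)
  qed simp
  then show ?thesis using assms by (auto simp: ell2_def scale_def)
qed

lemma ell2_diff:
  assumes "f \<in> vecs (ell2 X)" "g \<in> vecs (ell2 X)"
  shows "f - g \<in> vecs (ell2 X)"
  using ell2_closed[OF assms(2,1), of "-1"] by (simp add: scale_def plus_fun_def fun_diff_def)

lemma ell2_hnorm:
  assumes "f \<in> vecs (ell2 X)"
  shows "(hnorm (ell2 X) f)\<^sup>2 = (\<Sum>\<^sub>\<infinity>x. (cmod (f x))\<^sup>2)" "hnorm (ell2 X) f \<ge> 0"
proof -
  have "Re (ip (ell2 X) f f) = (\<Sum>\<^sub>\<infinity>x. Re (cnj (f x) * f x))"
    using infsum_Re[OF ell2_ip_summable[OF assms assms]] by (simp add: ell2_def)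
  also have "\<dots> = (\<Sum>\<^sub>\<infinity>x. (cmod (f x))\<^sup>2)"
    by (simp add: cmod_power2 flip: power2_eq_square)
  finally have *: "Re (ip (ell2 X) f f) = (\<Sum>\<^sub>\<infinity>x. (cmod (f x))\<^sup>2)" .
  have "(\<Sum>\<^sub>\<infinity>x. (cmod (f x))\<^sup>2) \<ge> 0" by (intro infsum_nonneg) simp
  then show "(hnorm (ell2 X) f)\<^sup>2 = (\<Sum>\<^sub>\<infinity>x. (cmod (f x))\<^sup>2)" "hnorm (ell2 X) f \<ge> 0"
    by (simp_all add: hnorm_def *)
qed

lemma ell2_finite_sum_le:
  assumes "f \<in> vecs (ell2 X)" "finite S"
  shows "(\<Sum>x\<in>S. (cmod (f x))\<^sup>2) \<le> (hnorm (ell2 X) f)\<^sup>2"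
  using assms by (subst ell2_hnorm[OF assms(1)])
    (intro finite_sum_le_infsum, auto simp: ell2_def)

lemma ell2_bounded:
  assumes "\<And>x. x \<notin> X \<Longrightarrow> f x = 0" "\<And>S. finite S \<Longrightarrow> (\<Sum>x\<in>S. (cmod (f x))\<^sup>2) \<le> C\<^sup>2" "C \<ge> 0"
  shows "f \<in> vecs (ell2 X)" "hnorm (ell2 X) f \<le> C"
proof -
  have s: "(\<lambda>x. (cmod (f x))\<^sup>2) summable_on UNIV"
    using assms(2) by (intro nonneg_bdd_above_summable_on bdd_aboveI[of _ "C\<^sup>2"]) auto
  then show 1: "f \<in> vecs (ell2 X)" using assms(1) by (simp add: ell2_def)
  have "(hnorm (ell2 X) f)\<^sup>2 \<le> C\<^sup>2"
    using s assms(2) by (subst ell2_hnorm[OF 1]) (intro infsum_le_finite_sums, auto)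
  then show "hnorm (ell2 X) f \<le> C" using assms(3) by (rule power2_le_imp_le)
qed

lemma ell2_complete:
  fixes s :: "nat \<Rightarrow> 'x cvec"
  assumes s: "\<And>n. s n \<in> vecs (ell2 X)"
    and cauchy: "\<forall>\<epsilon>>0. \<exists>n0. \<forall>m\<ge>n0. \<forall>n\<ge>n0. hnorm (ell2 X) (s m - s n) < \<epsilon>"
  shows "\<exists>f\<in>vecs (ell2 X). (\<lambda>n. hnorm (ell2 X) (s n - f)) \<longlonglongrightarrow> 0"
proof -
  have pt: "cmod (s m x - s n x) \<le> hnorm (ell2 X) (s m - s n)" for m n x
    using ell2_finite_sum_le[OF ell2_diff[OF s s], of "{x}" m n]
      ell2_hnorm(2)[OF ell2_diff[OF s s], of m n]
    by (auto intro: power2_le_imp_le)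
  have "Cauchy (\<lambda>n. s n x)" for x
  proof (rule metric_CauchyI)
    fix e :: real assume "e > 0"
    then obtain n0 where "\<forall>m\<ge>n0. \<forall>n\<ge>n0. hnorm (ell2 X) (s m - s n) < e" using cauchy by blast
    then show "\<exists>M. \<forall>m\<ge>M. \<forall>n\<ge>M. dist (s m x) (s n x) < e"
      unfolding dist_norm using le_less_trans[OF pt] by blast
  qed
  then obtain f where f: "\<And>x. (\<lambda>n. s n x) \<longlonglongrightarrow> f x"
    unfolding Cauchy_convergent_iff convergent_def by metis
  have fX: "f x = 0" if "x \<notin> X" for x
    using f[of x] s that by (simp add: ell2_def LIMSEQ_const_iff)
  have bound: "\<exists>n0. \<forall>n\<ge>n0. s n - f \<in> vecs (ell2 X) \<and> hnorm (ell2 X) (s n - f) \<le> e" if "e > 0" for e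
  proof -
    obtain n0 where n0: "\<forall>m\<ge>n0. \<forall>n\<ge>n0. hnorm (ell2 X) (s m - s n) < e"
      using cauchy \<open>e > 0\<close> by blast
    have "s n - f \<in> vecs (ell2 X) \<and> hnorm (ell2 X) (s n - f) \<le> e" if n: "n \<ge> n0" for n
    proof -
      have fin: "(\<Sum>x\<in>S. (cmod ((s n - f) x))\<^sup>2) \<le> e\<^sup>2" if S: "finite S" for S
      proof (rule tendsto_upperbound)
        show "(\<lambda>m. \<Sum>x\<in>S. (cmod (s n x - s m x))\<^sup>2) \<longlonglongrightarrow> (\<Sum>x\<in>S. (cmod ((s n - f) x))\<^sup>2)"
          unfolding fun_diff_def by (intro tendsto_intros f)
        have "(\<Sum>x\<in>S. (cmod (s n x - s m x))\<^sup>2) \<le> e\<^sup>2" if "m \<ge> n0" for m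
        proof -
          have "(\<Sum>x\<in>S. (cmod (s n x - s m x))\<^sup>2) \<le> (hnorm (ell2 X) (s n - s m))\<^sup>2"
            using ell2_finite_sum_le[OF ell2_diff[OF s s] S, of n m] by simp
          also have "\<dots> \<le> e\<^sup>2"
            using n0 n that ell2_hnorm(2)[OF ell2_diff[OF s s], of n m]
            by (intro power_mono) (auto intro: less_imp_le)
          finally show ?thesis .
        qed
        then show "\<forall>\<^sub>F m in sequentially. (\<Sum>x\<in>S. (cmod (s n x - s m x))\<^sup>2) \<le> e\<^sup>2"
          using eventually_sequentially by blast
      qed simp
      have "(s n - f) x = 0" if "x \<notin> X" for x
        using fX[OF that] s[of n] that by (simp add: ell2_def)
      then show ?thesis
        using ell2_bounded[of X "s n - f" e] fin \<open>e > 0\<close> by auto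
    qed
    then show ?thesis by blast
  qed
  obtain n1 where n1: "s n1 - f \<in> vecs (ell2 X)" using bound[of 1] by auto
  have "s n1 - (s n1 - f) \<in> vecs (ell2 X)" by (rule ell2_diff[OF s n1])
  then have fv: "f \<in> vecs (ell2 X)" by simp
  have "(\<lambda>n. hnorm (ell2 X) (s n - f)) \<longlonglongrightarrow> 0"
  proof (rule LIMSEQ_I)
    fix r :: real assume "r > 0"
    then obtain n0 where n0: "\<forall>n\<ge>n0. hnorm (ell2 X) (s n - f) \<le> r / 2"
      using bound[of "r/2"] by auto
    show "\<exists>no. \<forall>n\<ge>no. norm (hnorm (ell2 X) (s n - f) - 0) < r"
    proof (intro exI[of _ n0] allI impI)
      fix n assume n: "n \<ge> n0"
      with n0 have "hnorm (ell2 X) (s n - f) \<le> r / 2" by blast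
      moreover have "hnorm (ell2 X) (s n - f) \<ge> 0" by (rule ell2_hnorm(2)[OF ell2_diff[OF s fv]])
      ultimately show "norm (hnorm (ell2 X) (s n - f) - 0) < r" using \<open>r > 0\<close> by simp
    qed
  qed
  with fv show ?thesis by blast
qed

lemma hilbert_space_ell2: "hilbert_space (ell2 X)"
  unfolding hilbert_space_def
proof (intro conjI ballI allI impI)
  show "0 \<in> vecs (ell2 X)" by (simp add: ell2_def)
next
  fix f g c assume "f \<in> vecs (ell2 X)" "g \<in> vecs (ell2 X)"
  then show "c \<cdot>\<^sub>v f + g \<in> vecs (ell2 X)" by (rule ell2_closed)
next
  fix f g h c assume v: "f \<in> vecs (ell2 X)" "g \<in> vecs (ell2 X)" "h \<in> vecs (ell2 X)"
  have "ip (ell2 X) h (c \<cdot>\<^sub>v f + g) = (\<Sum>\<^sub>\<infinity>x. c * (cnj (h x) * f x) + cnj (h x) * g x)"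
    by (simp add: ell2_def scale_def algebra_simps)
  also have "\<dots> = (\<Sum>\<^sub>\<infinity>x. c * (cnj (h x) * f x)) + (\<Sum>\<^sub>\<infinity>x. cnj (h x) * g x)"
    using v by (intro infsum_add summable_on_cmult_right ell2_ip_summable)
  finally show "ip (ell2 X) h (c \<cdot>\<^sub>v f + g) = c * ip (ell2 X) h f + ip (ell2 X) h g"
    by (simp add: infsum_cmult_right') (simp add: ell2_def)
next
  fix f g show "ip (ell2 X) g f = cnj (ip (ell2 X) f g)"
    by (simp add: ell2_def mult.commute flip: infsum_cnj)
next
  fix f assume f: "f \<in> vecs (ell2 X)" "f \<noteq> 0"
  then obtain x where x: "f x \<noteq> 0" by (auto simp: fun_eq_iff)
  then have "0 < (\<Sum>x\<in>{x}. (cmod (f x))\<^sup>2)" by simp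
  also have "\<dots> \<le> (hnorm (ell2 X) f)\<^sup>2" using f(1) by (rule ell2_finite_sum_le) simp
  finally have "sqrt (Re (ip (ell2 X) f f)) > 0"
    using ell2_hnorm(2)[OF f(1)] by (simp add: hnorm_def less_le)
  then show "Re (ip (ell2 X) f f) > 0" by simp
next
  fix s :: "nat \<Rightarrow> 'a cvec"
  assume "(\<forall>n. s n \<in> vecs (ell2 X)) \<and>
    (\<forall>\<epsilon>>0. \<exists>n0. \<forall>m\<ge>n0. \<forall>n\<ge>n0. hnorm (ell2 X) (s m - s n) < \<epsilon>)"
  then show "\<exists>f\<in>vecs (ell2 X). (\<lambda>n. hnorm (ell2 X) (s n - f)) \<longlonglongrightarrow> 0"
    using ell2_complete by blast
qed

lemma ip_L2U: "ip L2U f g = (\<Sum>s\<in>UNIV. cnj (f s) * g s) / of_nat CARD('s)"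
  for f g :: "'s::finite cvec"
  by (simp add: L2_def)

lemma ip_L2U_linear:
  "ip L2U (\<lambda>s. f s - c * f' s) g = ip L2U f g - cnj c * ip L2U f' g"
  "ip L2U f (\<lambda>s. g s - c * g' s) = ip L2U f g - c * ip L2U f g'"
  "ip L2U (\<lambda>s. c * f s) g = cnj c * ip L2U f g"
  "ip L2U f (\<lambda>s. c * g s) = c * ip L2U f g"
  by (simp_all add: ip_L2U sum_subtractf sum_distrib_left algebra_simps diff_divide_distrib)

lemma ip_L2U_cnj: "cnj (ip L2U f g) = ip L2U g f"
  by (simp add: ip_L2U mult.commute)

lemma ip_L2U_zero: "ip L2U f f = 0 \<longleftrightarrow> f = (\<lambda>_. 0)"
proof
  assume "ip L2U f f = 0"
  then have "(\<Sum>s\<in>UNIV. cnj (f s) * f s) = 0" by (simp add: ip_L2U)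
  then have "complex_of_real (\<Sum>s\<in>UNIV. (cmod (f s))\<^sup>2) = 0"
    unfolding of_real_sum complex_norm_square by (simp add: mult.commute)
  then have "(\<Sum>s\<in>UNIV. (cmod (f s))\<^sup>2) = 0" by (simp only: of_real_eq_0_iff)
  then have "(cmod (f s))\<^sup>2 = 0" for s by (subst (asm) sum_nonneg_eq_0_iff) auto
  then show "f = (\<lambda>_. 0)" by auto
qed (simp add: ip_L2U)

lemma ip_L2U_ket:
  fixes f g :: "'s::finite cvec"
  shows "ip L2U (ket a) f = f a / complex_of_real (sqrt CARD('s))"
    and "ip L2U f (ket a) = cnj (f a) / complex_of_real (sqrt CARD('s))"
    and "(\<Sum>a\<in>UNIV. ip L2U f (ket a) * ip L2U (ket a) g) = ip L2U f g"
proof -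
  have r: "complex_of_real (sqrt CARD('s)) * complex_of_real (sqrt CARD('s)) = of_nat CARD('s)"
    by (metis of_real_mult of_real_of_nat_eq of_nat_0_le_iff real_sqrt_mult_self abs_of_nat)
  have 1: "ip L2U (ket a) f = f a / complex_of_real (sqrt CARD('s))" for f :: "'s cvec" and a
  proof -
    have "ip L2U (ket a) f = complex_of_real (sqrt CARD('s)) * f a / of_nat CARD('s)"
      by (simp add: ip_L2U ket_def if_distrib if_distribR sum.If_cases cong: if_cong)
    also have "\<dots> = f a / complex_of_real (sqrt CARD('s))"
      unfolding r[symmetric] by simp
    finally show ?thesis .
  qed
  have 2: "ip L2U f (ket a) = cnj (f a) / complex_of_real (sqrt CARD('s))" for f :: "'s cvec" and a
    using arg_cong[OF 1[of a f], of cnj] by (simp add: ip_L2U_cnj)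
  show "ip L2U (ket a) f = f a / complex_of_real (sqrt CARD('s))"
    "ip L2U f (ket a) = cnj (f a) / complex_of_real (sqrt CARD('s))" by (fact 1, fact 2)
  show "(\<Sum>a\<in>UNIV. ip L2U f (ket a) * ip L2U (ket a) g) = ip L2U f g"
    unfolding 1 2 ip_L2U[of f g] sum_divide_distrib r[symmetric] by simp
qed

lemma onb_through_unit_vector:
  fixes w :: "'g::finite cvec" and g0 :: 'g
  assumes "ip L2U w w = 1"
  obtains u where "u g0 = w" "\<And>a b. ip L2U (u a) (u b) = (if a = b then 1 else 0)"
    "\<And>f g. (\<Sum>a\<in>UNIV. ip L2U f (u a) * ip L2U (u a) g) = ip L2U f g"
proof -
  define e :: "'g cvec" where "e = ket g0"
  have kk: "ip L2U (ket a) (ket b) = (if a = b then 1 else 0)" for a b :: 'g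
    by (simp add: ip_L2U_ket(1)) (auto simp: ket_def)
  define p where "p = (if w g0 = 0 then 1 else sgn (w g0))"
  have pn: "cmod p = 1" by (simp add: p_def norm_sgn)
  have pp: "cnj p * p = 1" "p * cnj p = 1"
    using pn complex_norm_square[of p] by (simp_all add: mult.commute)
  define w' where "w' = (\<lambda>s. cnj p * w s)"
  define r where "r = ip L2U e w'"
  have ww': "ip L2U w' w' = 1" using assms pp by (simp add: w'_def ip_L2U_linear)
  have "cnj p * w g0 = complex_of_real (cmod (w g0))"
    by (simp add: p_def sgn_eq) (metis complex_norm_square mult.commute nonzero_eq_divide_eq
        norm_eq_zero of_real_eq_0_iff power2_eq_square of_real_mult)
  then have rr: "cnj r = r" by (simp add: r_def e_def ip_L2U_ket w'_def)
  have rr': "ip L2U w' e = r" using rr by (simp add: r_def ip_L2U_cnj)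
  define v where "v = (\<lambda>s. w' s - 1 * e s)"
  have ee: "ip L2U e e = 1" by (simp add: e_def kk)
  have vv: "ip L2U v v = 2 - 2 * r"
    unfolding v_def ip_L2U_linear using ww' ee rr' by (simp add: r_def)
  have ve: "ip L2U v e = r - 1" unfolding v_def ip_L2U_linear using ee rr' by simp
  define c where "c = 2 / ip L2U v v"
  have cc: "cnj c = c" using rr by (simp add: c_def vv)
  have cv: "c * c * ip L2U v v = 2 * c" by (simp add: c_def)
  define R where "R = (\<lambda>f s. f s - (c * ip L2U v f) * v s)"
  have Rsa: "ip L2U (R f) g = ip L2U f (R g)" for f g
    unfolding R_def ip_L2U_linear by (simp add: cc ip_L2U_cnj)
  have RR: "ip L2U (R f) (R g) = ip L2U f g" for f g
  proof -
    have "ip L2U (R f) (R g) = ip L2U f g - 2 * c * ip L2U f v * ip L2U v g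
        + (c * c * ip L2U v v) * ip L2U f v * ip L2U v g"
      unfolding R_def ip_L2U_linear by (simp add: cc ip_L2U_cnj algebra_simps)
    then show ?thesis by (simp add: cv)
  qed
  have Re: "R e = w'"
  proof (cases "ip L2U v v = 0")
    case True
    then have "v = (\<lambda>_. 0)" by (simp add: ip_L2U_zero)
    then show ?thesis by (auto simp: R_def v_def fun_eq_iff)
  next
    case False
    have "c * ip L2U v e = (2 * r - 2) / ip L2U v v" by (simp add: c_def ve algebra_simps)
    also have "\<dots> = - ip L2U v v / ip L2U v v" by (simp add: vv)
    also have "\<dots> = -1" using False by simp
    finally have "c * ip L2U v e = -1" .
    then show ?thesis by (auto simp: R_def v_def fun_eq_iff)
  qed
  define d where "d = (\<lambda>a. if a = g0 then p else 1)"
  have dd: "cnj (d a) * d a = 1" "d a * cnj (d a) = 1" for a using pp by (auto simp: d_def)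
  define u where "u = (\<lambda>a s. d a * R (ket a) s)"
  show thesis
  proof
    show "u g0 = w" using Re pp by (simp add: u_def d_def w'_def flip: e_def mult.assoc)
    show "ip L2U (u a) (u b) = (if a = b then 1 else 0)" for a b
      unfolding u_def ip_L2U_linear RR kk using dd by simp
    fix f g
    have "(\<Sum>a\<in>UNIV. ip L2U f (u a) * ip L2U (u a) g)
        = (\<Sum>a\<in>UNIV. (d a * cnj (d a)) * (ip L2U (R f) (ket a) * ip L2U (ket a) (R g)))"
      unfolding u_def ip_L2U_linear Rsa by (simp add: algebra_simps)
    also have "\<dots> = ip L2U (R f) (R g)" by (simp add: dd ip_L2U_ket(3))
    finally show "(\<Sum>a\<in>UNIV. ip L2U f (u a) * ip L2U (u a) g) = ip L2U f g" by (simp add: RR)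
  qed
qed

lemma infinite_tensor_exists:
  fixes w :: "'g::finite cvec"
  assumes "hnorm L2U w = 1"
  shows "\<exists>(K :: (int \<Rightarrow> 'g) hilb) T. infinite_tensor w K T"
proof -
  obtain g0 :: 'g where True by blast
  have im: "Im (ip L2U w w) = 0" using ip_L2U_cnj[of w w] by (simp add: complex_eq_iff)
  have "Re (ip L2U w w) = 1" using assms by (simp add: hnorm_def)
  with im have w1: "ip L2U w w = 1" by (simp add: complex_eq_iff)
  from w1 obtain u where u0: "u g0 = w"
    and uu: "\<And>a b. ip L2U (u a) (u b) = (if a = b then 1 else 0)"
    and pars: "\<And>f g. (\<Sum>a\<in>UNIV. ip L2U f (u a) * ip L2U (u a) g) = ip L2U f g"
    by (rule onb_through_unit_vector[of w g0]) blast
  define X :: "(int \<Rightarrow> 'g) set" where "X = {x. finite {n. x n \<noteq> g0}}"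
  define T :: "(int \<Rightarrow> 'g cvec) \<Rightarrow> (int \<Rightarrow> 'g) cvec"
    where "T = (\<lambda>h x. if x \<in> X then Prod_any (\<lambda>n. ip L2U (u (x n)) (h n)) else 0)"
  have uw: "ip L2U (u a) w = (if a = g0 then 1 else 0)" for a using uu[of a g0] u0 by simp
  have T_eq: "T h x = (if \<forall>n. n \<notin> D \<longrightarrow> x n = g0 then \<Prod>n\<in>D. ip L2U (u (x n)) (h n) else 0)"
    if D: "finite D" "{n. h n \<noteq> w} \<subseteq> D" for h x D
  proof (cases "\<forall>n. n \<notin> D \<longrightarrow> x n = g0")
    case True
    then have "{n. x n \<noteq> g0} \<subseteq> D" by auto
    then have xX: "x \<in> X" using D finite_subset by (auto simp: X_def)
    have "Prod_any (\<lambda>n. ip L2U (u (x n)) (h n)) = (\<Prod>n\<in>D. ip L2U (u (x n)) (h n))"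
    proof (rule Prod_any.expand_superset[OF D(1)])
      show "{n. ip L2U (u (x n)) (h n) \<noteq> 1} \<subseteq> D"
        using D(2) True w1 u0 by force
    qed
    then show ?thesis using True xX by (simp add: T_def)
  next
    case False
    then obtain m where m: "m \<notin> D" "x m \<noteq> g0" by auto
    show ?thesis
    proof (cases "x \<in> X")
      case xX: True
      have fin: "finite (D \<union> {n. x n \<noteq> g0})" using xX D(1) by (simp add: X_def)
      have "Prod_any (\<lambda>n. ip L2U (u (x n)) (h n))
          = (\<Prod>n\<in>D \<union> {n. x n \<noteq> g0}. ip L2U (u (x n)) (h n))"
      proof (rule Prod_any.expand_superset[OF fin])
        show "{n. ip L2U (u (x n)) (h n) \<noteq> 1} \<subseteq> D \<union> {n. x n \<noteq> g0}"
          using D(2) w1 u0 by force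
      qed
      also have "\<dots> = 0"
      proof (rule prod_zero[OF fin], rule bexI[of _ m])
        have "h m = w" using m D(2) by auto
        then show "ip L2U (u (x m)) (h m) = 0" using m uw by simp
      qed (use m in auto)
      finally show ?thesis using False by (auto simp: T_def)
    qed (use False in \<open>auto simp: T_def\<close>)
  qed
  define ext where "ext = (\<lambda>D (y :: int \<Rightarrow> 'g) n. if n \<in> D then y n else g0)"
  have supp: "T h x = 0" if "finite D" "{n. h n \<noteq> w} \<subseteq> D" "x \<notin> ext D ` (PiE D (\<lambda>_. UNIV))"
    for h x D
  proof -
    have "\<not> (\<forall>n. n \<notin> D \<longrightarrow> x n = g0)"
    proof
      assume "\<forall>n. n \<notin> D \<longrightarrow> x n = g0"
      then have "x = ext D (restrict x D)" by (auto simp: ext_def fun_eq_iff)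
      moreover have "restrict x D \<in> PiE D (\<lambda>_. UNIV)" by simp
      ultimately show False using that(3) by (metis image_eqI)
    qed
    then show ?thesis using T_eq[OF that(1,2), of x] by auto
  qed
  have extfin: "finite (ext D ` (PiE D (\<lambda>_. UNIV)))" if "finite D" for D
    using that by (intro finite_imageI finite_PiE) auto
  have Tv: "T h \<in> vecs (ell2 X)" if h: "h \<in> stab w" for h
  proof -
    have D: "finite {n. h n \<noteq> w}" using h by (simp add: stab_def)
    have "(\<lambda>x. (cmod (T h x))\<^sup>2) summable_on UNIV"
      by (rule finite_nonzero_values_imp_summable_on,
          rule finite_subset[OF _ extfin[OF D]]) (use supp[OF D order_refl] in auto)
    then show ?thesis by (simp add: ell2_def T_def)
  qed
  have Tip: "ip (ell2 X) (T h) (T h') = Prod_any (\<lambda>n. ip L2U (h n) (h' n))"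
    if h: "h \<in> stab w" "h' \<in> stab w" for h h'
  proof -
    define D where "D = {n. h n \<noteq> w} \<union> {n. h' n \<noteq> w}"
    have D: "finite D" "{n. h n \<noteq> w} \<subseteq> D" "{n. h' n \<noteq> w} \<subseteq> D"
      using h by (auto simp: stab_def D_def)
    let ?P = "PiE D (\<lambda>_. UNIV :: 'g set)"
    have inj: "inj_on (ext D) ?P"
    proof (rule inj_onI)
      fix y z assume yz: "y \<in> ?P" "z \<in> ?P" "ext D y = ext D z"
      show "y = z"
      proof (rule PiE_ext[OF yz(1,2)])
        fix n assume "n \<in> D"
        then show "y n = z n" using fun_cong[OF yz(3), of n] by (simp add: ext_def)
      qed
    qed
    have "ip (ell2 X) (T h) (T h') = (\<Sum>\<^sub>\<infinity>x\<in>ext D ` ?P. cnj (T h x) * T h' x)"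
      unfolding ell2_def using supp[OF D(1,2)]
      by (simp, intro infsum_cong_neutral) auto
    also have "\<dots> = (\<Sum>x\<in>ext D ` ?P. cnj (T h x) * T h' x)" using extfin[OF D(1)] by simp
    also have "\<dots> = (\<Sum>y\<in>?P. cnj (T h (ext D y)) * T h' (ext D y))"
      by (simp add: sum.reindex[OF inj])
    also have "\<dots> = (\<Sum>y\<in>?P. \<Prod>n\<in>D. ip L2U (h n) (u (y n)) * ip L2U (u (y n)) (h' n))"
    proof (rule sum.cong)
      fix y assume "y \<in> ?P"
      have e: "\<forall>n. n \<notin> D \<longrightarrow> ext D y n = g0" by (simp add: ext_def)
      have "T h (ext D y) = (\<Prod>n\<in>D. ip L2U (u (y n)) (h n))"
        "T h' (ext D y) = (\<Prod>n\<in>D. ip L2U (u (y n)) (h' n))"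
        using T_eq[OF D(1,2), of "ext D y"] T_eq[OF D(1,3), of "ext D y"] e
        by (simp_all add: ext_def)
      then show "cnj (T h (ext D y)) * T h' (ext D y) =
          (\<Prod>n\<in>D. ip L2U (h n) (u (y n)) * ip L2U (u (y n)) (h' n))"
        by (simp add: prod.distrib ip_L2U_cnj)
    qed simp
    also have "\<dots> = (\<Prod>n\<in>D. \<Sum>a\<in>UNIV. ip L2U (h n) (u a) * ip L2U (u a) (h' n))"
      using D(1) by (subst prod_sum_PiE) auto
    also have "\<dots> = (\<Prod>n\<in>D. ip L2U (h n) (h' n))" by (simp only: pars)
    also have "\<dots> = Prod_any (\<lambda>n. ip L2U (h n) (h' n))"
    proof (rule Prod_any.expand_superset[symmetric, OF D(1)])
      show "{n. ip L2U (h n) (h' n) \<noteq> 1} \<subseteq> D" using w1 by (force simp: D_def)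
    qed
    finally show ?thesis .
  qed
  have Tdelta: "T (\<lambda>n. u (x n)) = (\<lambda>y. if y = x then 1 else 0)" "(\<lambda>n. u (x n)) \<in> stab w"
    if x: "x \<in> X" for x
  proof -
    have uinj: "u a = w \<longleftrightarrow> a = g0" for a using uw[of a] u0 w1 by (metis zero_neq_one)
    show s: "(\<lambda>n. u (x n)) \<in> stab w" using x by (simp add: stab_def X_def uinj)
    have D: "finite {n. x n \<noteq> g0}" "{n. u (x n) \<noteq> w} \<subseteq> {n. x n \<noteq> g0}"
      using x by (auto simp: X_def uinj)
    show "T (\<lambda>n. u (x n)) = (\<lambda>y. if y = x then 1 else 0)"
    proof
      fix y
      show "T (\<lambda>n. u (x n)) y = (if y = x then 1 else 0)"
      proof (cases "y = x")
        case True
        then show ?thesis by (subst T_eq[OF D]) (simp add: uu)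
      next
        case False
        then obtain m where m: "y m \<noteq> x m" by auto
        show ?thesis
        proof (cases "x m = g0")
          case True
          then have "\<not> (\<forall>n. n \<notin> {n. x n \<noteq> g0} \<longrightarrow> y n = g0)" using m by auto
          then show ?thesis by (subst T_eq[OF D], subst if_not_P) (use False in auto)
        next
          case f: False
          then have "(\<Prod>n\<in>{n. x n \<noteq> g0}. ip L2U (u (y n)) (u (x n))) = 0"
            using m by (intro prod_zero[OF D(1)] bexI[of _ m]) (auto simp: uu)
          then show ?thesis using T_eq[OF D, of y] False by simp
        qed
      qed
    qed
  qed
  have tot: "total_set (ell2 X) (T ` stab w)"
    unfolding total_set_def
  proof (intro conjI ballI allI impI)
    show "T ` stab w \<subseteq> vecs (ell2 X)" using Tv by auto
    fix f and \<epsilon> :: real assume f: "f \<in> vecs (ell2 X)" and eps: "\<epsilon> > 0"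
    have fs: "(\<lambda>x. (cmod (f x))\<^sup>2) summable_on UNIV" using f by (simp add: ell2_def)
    obtain S where S: "finite S" "dist (\<Sum>x\<in>S. (cmod (f x))\<^sup>2) (\<Sum>\<^sub>\<infinity>x. (cmod (f x))\<^sup>2) \<le> (\<epsilon>/2)\<^sup>2"
      using infsum_finite_approximation[OF fs, of "(\<epsilon>/2)\<^sup>2"] eps by auto
    define \<delta> :: "(int \<Rightarrow> 'g) \<Rightarrow> (int \<Rightarrow> 'g) cvec" where "\<delta> = (\<lambda>x y. if y = x then 1 else 0)"
    have inj: "inj \<delta>" by (rule injI) (metis \<delta>_def zero_neq_one)
    define c where "c = (\<lambda>b. f (inv \<delta> b))"
    have ci: "c (\<delta> x) = f x" for x using inj by (simp add: c_def)
    have sub: "\<delta> ` (S \<inter> X) \<subseteq> T ` stab w"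
    proof
      fix b assume "b \<in> \<delta> ` (S \<inter> X)"
      then obtain x where x: "x \<in> X" "b = \<delta> x" by auto
      then have "b = T (\<lambda>n. u (x n))" using Tdelta(1)[OF x(1)] by (simp add: \<delta>_def)
      then show "b \<in> T ` stab w" using Tdelta(2)[OF x(1)] by blast
    qed
    have sumap: "(\<Sum>x\<in>A. F x) z = (\<Sum>x\<in>A. F x z)"
      for A :: "(int \<Rightarrow> 'g) set" and F :: "(int \<Rightarrow> 'g) \<Rightarrow> (int \<Rightarrow> 'g) cvec" and z
      by (induction A rule: infinite_finite_induct) auto
    define g where "g = f - (\<Sum>b\<in>\<delta> ` (S \<inter> X). c b \<cdot>\<^sub>v b)"
    have g: "g z = (if z \<in> S then 0 else f z)" for z
    proof -
      have "(\<Sum>b\<in>\<delta> ` (S \<inter> X). c b \<cdot>\<^sub>v b) z = (\<Sum>x\<in>S \<inter> X. f x * \<delta> x z)"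
        by (subst sum.reindex[OF inj_on_subset[OF inj]]) (simp_all add: sumap ci scale_def)
      also have "\<dots> = (\<Sum>x\<in>S \<inter> X. if z = x then f x else 0)"
        by (intro sum.cong) (auto simp: \<delta>_def)
      also have "\<dots> = (if z \<in> S \<inter> X then f z else 0)" using S(1) by simp
      finally show ?thesis using f by (auto simp: g_def ell2_def)
    qed
    have "hnorm (ell2 X) g \<le> \<epsilon> / 2"
    proof (rule ell2_bounded(2))
      show "g x = 0" if "x \<notin> X" for x using f that by (simp add: g ell2_def)
      show "(\<Sum>x\<in>S'. (cmod (g x))\<^sup>2) \<le> (\<epsilon>/2)\<^sup>2" if S': "finite S'" for S'
      proof -
        have "(\<Sum>x\<in>S'. (cmod (g x))\<^sup>2) = (\<Sum>x\<in>S' - S. (cmod (f x))\<^sup>2)"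
          using S' by (intro sum.mono_neutral_cong_right) (auto simp: g)
        also have "\<dots> = (\<Sum>x\<in>S' \<union> S. (cmod (f x))\<^sup>2) - (\<Sum>x\<in>S. (cmod (f x))\<^sup>2)"
          using S' S(1) sum.subset_diff[of S "S' \<union> S" "\<lambda>x. (cmod (f x))\<^sup>2"]
          by (simp add: Un_Diff)
        also have "\<dots> \<le> (\<Sum>\<^sub>\<infinity>x. (cmod (f x))\<^sup>2) - (\<Sum>x\<in>S. (cmod (f x))\<^sup>2)"
          using S' S(1) fs by (intro diff_right_mono finite_sum_le_infsum) auto
        also have "\<dots> \<le> (\<epsilon>/2)\<^sup>2" using S(2) by (simp add: dist_real_def)
        finally show ?thesis .
      qed
    qed (use eps in simp)
    then have "hnorm (ell2 X) (f - (\<Sum>b\<in>\<delta> ` (S \<inter> X). c b \<cdot>\<^sub>v b)) < \<epsilon>"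
      using eps by (simp add: g_def)
    then show "\<exists>D c. finite D \<and> D \<subseteq> T ` stab w \<and> hnorm (ell2 X) (f - (\<Sum>b\<in>D. c b \<cdot>\<^sub>v b)) < \<epsilon>"
      using sub S(1) by (intro exI[of _ "\<delta> ` (S \<inter> X)"] exI[of _ c]) auto
  qed
  have "infinite_tensor w (ell2 X) T"
    unfolding infinite_tensor_def using assms hilbert_space_ell2 Tip tot by auto
  then show ?thesis by blast
qed

end

theory Submission
  imports Defs
begin

text \<open>
  The isometry \<open>U = \<Theta> V\<^sub>1\<close> permutes the elementary vectors \<open>|i\<rangle> \<otimes> \<Otimes>\<^sub>n h\<^sub>n\<close> with \<open>h\<^sub>1\<close> a basis
  vector in the way \<open>\<alpha>\<close> moves points, so conjugation by \<open>U\<close> composes multiplication by cylinder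
  functions with \<open>\<alpha>\<close>; continuous functions are uniform limits of cylinder functions. The squared
  moduli of the coefficients of \<open>\<upsilon>\<close> are the weights of \<open>q\<close>, which gives the expectations of
  cylinder functions. The functional calculus is unique because a representation of the continuous
  functions on \<open>\<complex>\<^sup>n\<close> sees only a compact polydisc, where polynomials are dense. For the dilation
  property, one step of either flow compresses \<open>V\<^sup>* (a \<otimes> 1) V\<close> by \<open>\<upsilon>\<close>, which is \<open>T a\<close>.
\<close>

text \<open>Adjoints, traces, site operators, shifts, multiplication operators and the functional
  calculus all enter as definite descriptions, so nothing is known about them until existence and
  uniqueness are proved; this shapes most of the work. Apart from adjoints and traces, uniqueness is
  density: of elementary tensors among vectors, of generators in the local algebra, of cylinder
  functions or polynomials among continuous functions. Existence is harder. Elementary tensors are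
  total but linearly dependent, so prescribed values need not extend linearly. Values with the same
  Gram matrix do extend, to an isometry, and site and multiplication operators are then built from
  isometries by algebra and limits. A second obstacle is that \<upsilon> is in general not a
  canonical basis vector, so only finitely many sites can carry basis vectors at once. Hence
  diagonal operators are described on finite windows, and the dilation induction keeps arbitrary
  entries at the remaining sites. Norm estimates for representations use that c^2 - |f|^2 is the
  square of a continuous function, which avoids spectral theory.\<close>

lemma scale_apply: "(c \<cdot>\<^sub>v f) x = c * f x"
  by (simp add: scale_def)

lemma scale_op_apply: "(c \<cdot>\<^sub>o A) f = c \<cdot>\<^sub>v A f"
  by (simp add: scale_op_def)

text \<open>
  Unification produces eta-expanded vectors, which the default rules for pointwise operations
  would expand to abstractions.
\<close>

lemmas pointwise = plus_fun_apply zero_fun_apply minus_apply uminus_apply scale_apply scale_op_apply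
declare plus_fun_apply [simp del] zero_fun_apply [simp del] minus_apply [simp del] uminus_apply [simp del]

lemma scale_simps [simp]:
  "0 \<cdot>\<^sub>v f = 0" "1 \<cdot>\<^sub>v f = f" "c \<cdot>\<^sub>v 0 = 0" "a \<cdot>\<^sub>v b \<cdot>\<^sub>v f = (a * b) \<cdot>\<^sub>v f" "(-1) \<cdot>\<^sub>v f = - f"
  by (auto simp: fun_eq_iff pointwise)

lemma scale_distrib:
  "c \<cdot>\<^sub>v (f + g) = c \<cdot>\<^sub>v f + c \<cdot>\<^sub>v g" "c \<cdot>\<^sub>v (f - g) = c \<cdot>\<^sub>v f - c \<cdot>\<^sub>v g"
  "(a + b) \<cdot>\<^sub>v f = a \<cdot>\<^sub>v f + b \<cdot>\<^sub>v f" "(a - b) \<cdot>\<^sub>v f = a \<cdot>\<^sub>v f - b \<cdot>\<^sub>v f"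
  by (auto simp: fun_eq_iff algebra_simps pointwise)

lemma sum_fun_apply: "(\<Sum>a\<in>A. f a) x = (\<Sum>a\<in>A. f a x)" for f :: "'a \<Rightarrow> 'b \<Rightarrow> 'c::comm_monoid_add"
  by (induction A rule: infinite_finite_induct) (auto simp: pointwise)

lemma scale_sum: "c \<cdot>\<^sub>v (\<Sum>a\<in>A. f a) = (\<Sum>a\<in>A. c \<cdot>\<^sub>v f a)"
  by (auto simp: fun_eq_iff sum_fun_apply sum_distrib_left pointwise)

section \<open>Hilbert spaces\<close>

locale hilbert =
  fixes K :: "'x hilb"
  assumes hilbert: "hilbert_space K"
begin

lemma zero_vecs [simp, intro]: "0 \<in> vecs K"
  using hilbert unfolding hilbert_space_def by metis

lemma lin_vecs: "f \<in> vecs K \<Longrightarrow> g \<in> vecs K \<Longrightarrow> c \<cdot>\<^sub>v f + g \<in> vecs K"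
  using hilbert unfolding hilbert_space_def by metis

lemma scale_vecs [simp, intro]: "f \<in> vecs K \<Longrightarrow> c \<cdot>\<^sub>v f \<in> vecs K"
  using lin_vecs[of f 0 c] by simp

lemma add_vecs [simp, intro]: "f \<in> vecs K \<Longrightarrow> g \<in> vecs K \<Longrightarrow> f + g \<in> vecs K"
  using lin_vecs[of f g 1] by simp

lemma uminus_vecs [simp, intro]: "f \<in> vecs K \<Longrightarrow> - f \<in> vecs K"
  using scale_vecs[of f "-1"] by simp

lemma diff_vecs [simp, intro]: "f \<in> vecs K \<Longrightarrow> g \<in> vecs K \<Longrightarrow> f - g \<in> vecs K"
  using add_vecs[of f "-g"] by simp

lemma sum_vecs [simp, intro]: "(\<And>a. a \<in> A \<Longrightarrow> f a \<in> vecs K) \<Longrightarrow> (\<Sum>a\<in>A. f a) \<in> vecs K"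
  by (induction A rule: infinite_finite_induct) auto

lemma ip_lin_right: "f \<in> vecs K \<Longrightarrow> g \<in> vecs K \<Longrightarrow> h \<in> vecs K \<Longrightarrow>
    ip K h (c \<cdot>\<^sub>v f + g) = c * ip K h f + ip K h g"
  using hilbert unfolding hilbert_space_def by metis

lemma ip_cnj: "f \<in> vecs K \<Longrightarrow> g \<in> vecs K \<Longrightarrow> cnj (ip K f g) = ip K g f"
  using hilbert unfolding hilbert_space_def by metis

lemma ip_add_right: "f \<in> vecs K \<Longrightarrow> g \<in> vecs K \<Longrightarrow> h \<in> vecs K \<Longrightarrow>
    ip K h (f + g) = ip K h f + ip K h g"
  using ip_lin_right[of f g h 1] by simp

lemma ip_zero_right [simp]: "h \<in> vecs K \<Longrightarrow> ip K h 0 = 0"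
  using ip_add_right[of 0 0 h] by simp

lemma ip_scale_right: "f \<in> vecs K \<Longrightarrow> h \<in> vecs K \<Longrightarrow> ip K h (c \<cdot>\<^sub>v f) = c * ip K h f"
  using ip_lin_right[of f 0 h c] by simp

lemma ip_diff_right: "f \<in> vecs K \<Longrightarrow> g \<in> vecs K \<Longrightarrow> h \<in> vecs K \<Longrightarrow>
    ip K h (f - g) = ip K h f - ip K h g"
  using ip_lin_right[of g f h "-1"] by simp

lemma ip_sum_right: "(\<And>a. a \<in> A \<Longrightarrow> f a \<in> vecs K) \<Longrightarrow> h \<in> vecs K \<Longrightarrow>
    ip K h (\<Sum>a\<in>A. f a) = (\<Sum>a\<in>A. ip K h (f a))"
  by (induction A rule: infinite_finite_induct) (auto simp: ip_add_right)

lemma ip_add_left: "f \<in> vecs K \<Longrightarrow> g \<in> vecs K \<Longrightarrow> h \<in> vecs K \<Longrightarrow>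
    ip K (f + g) h = ip K f h + ip K g h"
  using ip_cnj[of h "f + g"] ip_cnj[of h f] ip_cnj[of h g] by (auto simp: ip_add_right)

lemma ip_scale_left: "f \<in> vecs K \<Longrightarrow> h \<in> vecs K \<Longrightarrow> ip K (c \<cdot>\<^sub>v f) h = cnj c * ip K f h"
  using ip_cnj[of h "c \<cdot>\<^sub>v f"] ip_cnj[of h f] by (auto simp: ip_scale_right)

lemma ip_zero_left [simp]: "h \<in> vecs K \<Longrightarrow> ip K 0 h = 0"
  using ip_scale_left[of 0 h 0] by simp

lemma ip_diff_left: "f \<in> vecs K \<Longrightarrow> g \<in> vecs K \<Longrightarrow> h \<in> vecs K \<Longrightarrow>
    ip K (f - g) h = ip K f h - ip K g h"
  using ip_cnj[of h "f - g"] ip_cnj[of h f] ip_cnj[of h g] by (auto simp: ip_diff_right)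

lemma ip_sum_left: "(\<And>a. a \<in> A \<Longrightarrow> f a \<in> vecs K) \<Longrightarrow> h \<in> vecs K \<Longrightarrow>
    ip K (\<Sum>a\<in>A. f a) h = (\<Sum>a\<in>A. ip K (f a) h)"
  by (induction A rule: infinite_finite_induct) (auto simp: ip_add_left)

lemmas ip_simps = ip_add_right ip_add_left ip_diff_right ip_diff_left ip_scale_right ip_scale_left

lemma ip_pos: "f \<in> vecs K \<Longrightarrow> f \<noteq> 0 \<Longrightarrow> Re (ip K f f) > 0"
  using hilbert unfolding hilbert_space_def by metis

lemma ip_nonneg: "f \<in> vecs K \<Longrightarrow> Re (ip K f f) \<ge> 0"
  using ip_pos[of f] by (cases "f = 0") auto

lemma hnorm_nonneg [simp]: "f \<in> vecs K \<Longrightarrow> hnorm K f \<ge> 0"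
  by (simp add: hnorm_def ip_nonneg)

lemma hnorm_power2: "f \<in> vecs K \<Longrightarrow> (hnorm K f)\<^sup>2 = Re (ip K f f)"
  by (simp add: hnorm_def ip_nonneg)

lemma ip_self: "f \<in> vecs K \<Longrightarrow> ip K f f = complex_of_real ((hnorm K f)\<^sup>2)"
  using ip_cnj[of f f] by (simp add: hnorm_power2 complex_eq_iff)

lemma hnorm_zero [simp]: "hnorm K 0 = 0"
  by (simp add: hnorm_def)

lemma hnorm_eq_0 [simp]: "f \<in> vecs K \<Longrightarrow> hnorm K f = 0 \<longleftrightarrow> f = 0"
  using ip_pos[of f] unfolding hnorm_def by (cases "f = 0") force+

lemma hnorm_scale: "f \<in> vecs K \<Longrightarrow> hnorm K (c \<cdot>\<^sub>v f) = cmod c * hnorm K f"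
proof -
  assume f: "f \<in> vecs K"
  have "ip K (c \<cdot>\<^sub>v f) (c \<cdot>\<^sub>v f) = c * (cnj c * ip K f f)"
    unfolding ip_scale_right[OF f scale_vecs[OF f]] ip_scale_left[OF f f] ..
  also have "\<dots> = complex_of_real ((cmod c)\<^sup>2) * ip K f f"
    by (simp only: complex_norm_square mult.assoc)
  also have "\<dots> = complex_of_real ((cmod c)\<^sup>2 * (hnorm K f)\<^sup>2)"
    by (simp only: ip_self[OF f] of_real_mult)
  finally have "(hnorm K (c \<cdot>\<^sub>v f))\<^sup>2 = (cmod c * hnorm K f)\<^sup>2"
    unfolding ip_self[OF scale_vecs[OF f]] of_real_eq_iff power_mult_distrib .
  then show ?thesis by (rule power2_eq_imp_eq) (use f in auto)
qed

lemma hnorm_minus: "f \<in> vecs K \<Longrightarrow> hnorm K (- f) = hnorm K f"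
  using hnorm_scale[of f "-1"] by simp

lemma hnorm_minus_commute: "f \<in> vecs K \<Longrightarrow> g \<in> vecs K \<Longrightarrow> hnorm K (f - g) = hnorm K (g - f)"
  using hnorm_minus[of "g - f"] by simp

lemma Cauchy_Schwarz:
  assumes "f \<in> vecs K" "g \<in> vecs K"
  shows "cmod (ip K f g) \<le> hnorm K f * hnorm K g"
proof (cases "g = 0")
  case False
  define N where "N = (hnorm K g)\<^sup>2"
  have N: "N > 0" using False assms by (simp add: N_def)
  \<comment> \<open>c is the coefficient of the projection of f onto g; the inequality is the
    nonnegativity of the squared norm of the orthogonal remainder z.\<close>
  define c where "c = ip K g f / of_real N"
  have gg: "ip K g g = of_real N" using assms by (simp add: ip_self N_def)
  have fg: "ip K f g = cnj (ip K g f)" using assms by (simp add: ip_cnj)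
  define z where "z = f - c \<cdot>\<^sub>v g"
  have "ip K z z = ip K f f - c * cnj (ip K g f) - cnj c * ip K g f + cnj c * c * of_real N"
    unfolding z_def using assms by (simp add: ip_simps gg fg algebra_simps)
  also have "cnj c * c * of_real N = cnj c * ip K g f" using N by (simp add: c_def)
  finally have "ip K z z = ip K f f - ip K g f * cnj (ip K g f) / of_real N"
    by (simp add: c_def)
  also have "\<dots> = of_real ((hnorm K f)\<^sup>2 - (cmod (ip K g f))\<^sup>2 / N)"
    unfolding complex_norm_square[symmetric] using assms by (simp add: ip_self)
  finally have "(hnorm K f)\<^sup>2 - (cmod (ip K g f))\<^sup>2 / N \<ge> 0"
    using ip_nonneg[of z] assms by (simp add: z_def)
  then have "(cmod (ip K g f))\<^sup>2 \<le> (hnorm K f * hnorm K g)\<^sup>2"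
    using N by (simp add: field_simps N_def)
  then have "cmod (ip K g f) \<le> hnorm K f * hnorm K g"
    by (rule power2_le_imp_le) (use assms in auto)
  then show ?thesis by (simp add: fg)
qed (use assms in auto)

lemma hnorm_triangle:
  assumes "f \<in> vecs K" "g \<in> vecs K"
  shows "hnorm K (f + g) \<le> hnorm K f + hnorm K g"
proof (rule power2_le_imp_le)
  have "(hnorm K (f + g))\<^sup>2 = (hnorm K f)\<^sup>2 + Re (ip K f g + cnj (ip K f g)) + (hnorm K g)\<^sup>2"
    using assms by (simp add: hnorm_power2 ip_add_left ip_add_right ip_cnj)
  also have "Re (ip K f g + cnj (ip K f g)) \<le> 2 * (hnorm K f * hnorm K g)"
    using complex_Re_le_cmod[of "ip K f g"] Cauchy_Schwarz[OF assms] by simp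
  finally show "(hnorm K (f + g))\<^sup>2 \<le> (hnorm K f + hnorm K g)\<^sup>2"
    by (simp add: power2_sum)
qed (use assms in auto)

lemma hnorm_triangle_diff:
  assumes "f \<in> vecs K" "g \<in> vecs K" "h \<in> vecs K"
  shows "hnorm K (f - h) \<le> hnorm K (f - g) + hnorm K (g - h)"
  using hnorm_triangle[of "f - g" "g - h"] assms by simp

text \<open>The closing step of approximation arguments: the factor C absorbs norms of fixed
  vectors, and C = 0 covers estimates that already give norm zero.\<close>

lemma vec_eqI_small:
  assumes "f \<in> vecs K" "g \<in> vecs K" "\<And>\<epsilon>. \<epsilon> > 0 \<Longrightarrow> hnorm K (f - g) \<le> C * \<epsilon>" "C \<ge> 0"
  shows "f = g"
proof -
  have "hnorm K (f - g) \<le> 0"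
  proof (rule field_le_epsilon)
    fix e :: real assume "e > 0"
    \<comment> \<open>Dividing by C + 1 instead of C keeps the choice valid for C = 0.\<close>
    then have "hnorm K (f - g) \<le> C * (e / (C + 1))" using assms(4) by (intro assms(3)) auto
    also have "\<dots> \<le> e" using \<open>e > 0\<close> assms(4) by (simp add: field_simps)
    finally show "hnorm K (f - g) \<le> 0 + e" by simp
  qed
  then have "hnorm K (f - g) = 0" using hnorm_nonneg[of "f - g"] assms(1,2) by (intro antisym) auto
  then show ?thesis using assms by simp
qed

subsection \<open>Limits of vectors\<close>

text \<open>Membership is part of the notion because \<open>hnorm\<close> has no meaning outside the
  carrier.\<close>

definition lims :: "(nat \<Rightarrow> 'x cvec) \<Rightarrow> 'x cvec \<Rightarrow> bool"
  where "lims s f \<longleftrightarrow> (\<forall>n. s n \<in> vecs K) \<and> f \<in> vecs K \<and> (\<lambda>n. hnorm K (s n - f)) \<longlonglongrightarrow> 0"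

lemma lims_vecs: "lims s f \<Longrightarrow> s n \<in> vecs K" "lims s f \<Longrightarrow> f \<in> vecs K"
  by (auto simp: lims_def)

lemma lims_bound:
  assumes "\<And>n. s n \<in> vecs K" "f \<in> vecs K" "\<And>n. hnorm K (s n - f) \<le> b n" "b \<longlonglongrightarrow> 0"
  shows "lims s f"
  unfolding lims_def using assms
  by (auto intro: tendsto_sandwich[of "\<lambda>_. 0" "\<lambda>n. hnorm K (s n - f)" sequentially b 0])

lemma lims_add:
  assumes "lims s f" "lims t g"
  shows "lims (\<lambda>n. s n + t n) (f + g)"
proof (rule lims_bound)
  note v = lims_vecs[OF assms(1)] lims_vecs[OF assms(2)]
  show "s n + t n \<in> vecs K" for n using v by auto
  show "f + g \<in> vecs K" using v by auto
  show "hnorm K (s n + t n - (f + g)) \<le> hnorm K (s n - f) + hnorm K (t n - g)" for n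
    using hnorm_triangle[of "s n - f" "t n - g"] v by (simp add: algebra_simps)
  show "(\<lambda>n. hnorm K (s n - f) + hnorm K (t n - g)) \<longlonglongrightarrow> 0"
    using tendsto_add[of _ 0 _ _ 0] assms by (force simp: lims_def)
qed

lemma lims_scale:
  assumes "lims s f"
  shows "lims (\<lambda>n. c \<cdot>\<^sub>v s n) (c \<cdot>\<^sub>v f)"
proof (rule lims_bound)
  note v = lims_vecs[OF assms(1)]
  show "c \<cdot>\<^sub>v s n \<in> vecs K" for n using v by auto
  show "c \<cdot>\<^sub>v f \<in> vecs K" using v by auto
  show "hnorm K (c \<cdot>\<^sub>v s n - c \<cdot>\<^sub>v f) \<le> cmod c * hnorm K (s n - f)" for n
    using hnorm_scale[of "s n - f" c] v by (simp add: scale_distrib)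
  show "(\<lambda>n. cmod c * hnorm K (s n - f)) \<longlonglongrightarrow> 0"
    using tendsto_mult_right_zero assms by (force simp: lims_def)
qed

lemma lims_ip_right:
  assumes "lims s f" "g \<in> vecs K"
  shows "(\<lambda>n. ip K g (s n)) \<longlonglongrightarrow> ip K g f"
proof -
  note v = lims_vecs[OF assms(1)]
  have "(\<lambda>n. ip K g (s n) - ip K g f) \<longlonglongrightarrow> 0"
  proof (rule Lim_null_comparison)
    show "\<forall>\<^sub>F n in sequentially. norm (ip K g (s n) - ip K g f) \<le> hnorm K g * hnorm K (s n - f)"
      using Cauchy_Schwarz[of g "s _ - f"] v assms(2) by (simp add: ip_diff_right)
    show "(\<lambda>n. hnorm K g * hnorm K (s n - f)) \<longlonglongrightarrow> 0"
      using tendsto_mult_right_zero assms by (force simp: lims_def)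
  qed
  then show ?thesis by (rule LIM_zero_cancel)
qed

lemma lims_ip_left:
  assumes "lims s f" "g \<in> vecs K"
  shows "(\<lambda>n. ip K (s n) g) \<longlonglongrightarrow> ip K f g"
  using tendsto_cnj[OF lims_ip_right[OF assms]] lims_vecs[OF assms(1)] assms(2) by (simp add: ip_cnj)

lemma lims_hnorm_le:
  assumes "lims s f" "\<And>n. hnorm K (s n - g) \<le> b" "g \<in> vecs K"
  shows "hnorm K (f - g) \<le> b"
proof (rule field_le_epsilon)
  fix e :: real assume "e > 0"
  note v = lims_vecs[OF assms(1)]
  have "(\<lambda>n. hnorm K (s n - f)) \<longlonglongrightarrow> 0" using assms(1) by (simp add: lims_def)
  then have "\<forall>\<^sub>F n in sequentially. hnorm K (s n - f) < e" using \<open>e > 0\<close> by (rule order_tendstoD)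
  then obtain n where n: "hnorm K (s n - f) < e" by (auto simp: eventually_sequentially)
  then show "hnorm K (f - g) \<le> b + e"
    using hnorm_triangle_diff[of f "s n" g] assms(2)[of n] v assms(3) hnorm_minus_commute[of f "s n"] by auto
qed

lemma lims_unique:
  assumes "lims s f" "lims s g"
  shows "f = g"
proof -
  note v = lims_vecs[OF assms(1)] lims_vecs[OF assms(2)]
  have "(\<lambda>n. ip K (f - g) (s n)) \<longlonglongrightarrow> ip K (f - g) f" "(\<lambda>n. ip K (f - g) (s n)) \<longlonglongrightarrow> ip K (f - g) g"
    using assms v by (auto intro: lims_ip_right)
  then have "ip K (f - g) f = ip K (f - g) g" by (rule LIMSEQ_unique)
  then have "ip K (f - g) (f - g) = 0" using v by (simp add: ip_diff_right)
  then have "hnorm K (f - g) = 0" by (simp add: hnorm_def)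
  then show ?thesis using v by simp
qed

text \<open>Completeness in the form in which it is used: both the minimising sequence in
  \<open>riesz\<close> and the approximants in \<open>isometry_extension\<close> come with an
  explicit null sequence that controls the distances.\<close>

lemma complete:
  assumes "\<And>n. s n \<in> vecs K" "\<And>m n. hnorm K (s m - s n) \<le> b m + b n" "b \<longlonglongrightarrow> (0::real)"
  obtains f where "lims s f"
proof -
  have "\<exists>n0. \<forall>m\<ge>n0. \<forall>n\<ge>n0. hnorm K (s m - s n) < \<epsilon>" if "\<epsilon> > 0" for \<epsilon>
  proof -
    have "\<forall>\<^sub>F n in sequentially. b n < \<epsilon> / 2" using assms(3) that by (intro order_tendstoD) auto
    then obtain n0 where n0: "\<And>n. n \<ge> n0 \<Longrightarrow> b n < \<epsilon> / 2" by (auto simp: eventually_sequentially)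
    then have "hnorm K (s m - s n) < \<epsilon>" if "m \<ge> n0" "n \<ge> n0" for m n
      using assms(2)[of m n] n0[OF that(1)] n0[OF that(2)] by linarith
    then show ?thesis by blast
  qed
  moreover have "\<And>s. (\<forall>n. s n \<in> vecs K) \<and>
      (\<forall>\<epsilon>>0. \<exists>n0. \<forall>m\<ge>n0. \<forall>n\<ge>n0. hnorm K (s m - s n) < \<epsilon>) \<Longrightarrow>
      \<exists>f\<in>vecs K. (\<lambda>n. hnorm K (s n - f)) \<longlonglongrightarrow> 0"
    using hilbert unfolding hilbert_space_def by blast
  ultimately have "\<exists>f\<in>vecs K. (\<lambda>n. hnorm K (s n - f)) \<longlonglongrightarrow> 0" using assms(1) by blast
  then show thesis using that assms(1) by (auto simp: lims_def)
qed

subsection \<open>Spans and total sets\<close>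

text \<open>An inductive span allows proofs that add one vector at a time; \<open>vspan_iff\<close>
  recovers the finite sums that occur in \<open>total_set\<close>.\<close>

inductive in_span :: "'x cvec set \<Rightarrow> 'x cvec \<Rightarrow> bool" for S where
  "in_span S 0"
| "b \<in> S \<Longrightarrow> in_span S f \<Longrightarrow> in_span S (c \<cdot>\<^sub>v b + f)"

definition vspan :: "'x cvec set \<Rightarrow> 'x cvec set"
  where "vspan S = {f. in_span S f}"

lemma vspan_zero: "0 \<in> vspan S"
  and vspan_step: "b \<in> S \<Longrightarrow> f \<in> vspan S \<Longrightarrow> c \<cdot>\<^sub>v b + f \<in> vspan S"
  by (auto simp: vspan_def intro: in_span.intros)

lemma vspan_induct [consumes 1, case_names zero step]:
  assumes "f \<in> vspan S" "P 0"
    "\<And>b f c. b \<in> S \<Longrightarrow> f \<in> vspan S \<Longrightarrow> P f \<Longrightarrow> P (c \<cdot>\<^sub>v b + f)"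
  shows "P f"
  using assms(1) unfolding vspan_def mem_Collect_eq
  by (induction rule: in_span.induct) (auto intro!: assms(2,3) simp: vspan_def)

lemma vspan_base: "b \<in> S \<Longrightarrow> b \<in> vspan S"
  using vspan_step[OF _ vspan_zero, of b S 1] by simp

lemma vspan_add: "f \<in> vspan S \<Longrightarrow> g \<in> vspan S \<Longrightarrow> f + g \<in> vspan S"
  by (induction rule: vspan_induct) (auto simp: add.assoc intro: vspan_zero vspan_step)

lemma vspan_scale: "f \<in> vspan S \<Longrightarrow> c \<cdot>\<^sub>v f \<in> vspan S"
  by (induction rule: vspan_induct) (auto simp: scale_distrib intro: vspan_zero vspan_step)

lemma vspan_sum: "(\<And>a. a \<in> A \<Longrightarrow> f a \<in> vspan S) \<Longrightarrow> (\<Sum>a\<in>A. f a) \<in> vspan S"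
  by (induction A rule: infinite_finite_induct) (auto intro: vspan_add vspan_zero)

lemma vspan_least: "S \<subseteq> vspan S' \<Longrightarrow> vspan S \<subseteq> vspan S'"
proof
  fix f assume "S \<subseteq> vspan S'" "f \<in> vspan S"
  from this(2,1) show "f \<in> vspan S'"
    by (induction rule: vspan_induct) (auto intro: vspan_zero vspan_add vspan_scale)
qed

lemma vspan_vecs: "f \<in> vspan S \<Longrightarrow> S \<subseteq> vecs K \<Longrightarrow> f \<in> vecs K"
  by (induction rule: vspan_induct) auto

lemma vspan_iff: "f \<in> vspan S \<longleftrightarrow> (\<exists>D c. finite D \<and> D \<subseteq> S \<and> f = (\<Sum>b\<in>D. c b \<cdot>\<^sub>v b))"
proof
  assume "f \<in> vspan S"
  then show "\<exists>D c. finite D \<and> D \<subseteq> S \<and> f = (\<Sum>b\<in>D. c b \<cdot>\<^sub>v b)"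
  proof (induction rule: vspan_induct)
    case zero
    show ?case by (rule exI[of _ "{}"]) simp
  next
    case (step b f c)
    then obtain D d where D: "finite D" "D \<subseteq> S" "f = (\<Sum>b\<in>D. d b \<cdot>\<^sub>v b)" by blast
    \<comment> \<open>The new vector b may already occur in D, in which case its coefficients have
      to be added.\<close>
    define d' where "d' = (\<lambda>a. (if a \<in> D then d a else 0) + (if a = b then c else 0))"
    have "(\<Sum>a\<in>insert b D. d' a \<cdot>\<^sub>v a) =
        (\<Sum>a\<in>insert b D. (if a \<in> D then d a else 0) \<cdot>\<^sub>v a) + (\<Sum>a\<in>insert b D. (if a = b then c else 0) \<cdot>\<^sub>v a)"
      by (simp add: d'_def scale_distrib sum.distrib del: sum.insert)
    also have "(\<Sum>a\<in>insert b D. (if a \<in> D then d a else 0) \<cdot>\<^sub>v a) = f"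
      unfolding D(3) using D(1) by (intro sum.mono_neutral_cong_right) auto
    also have "(\<Sum>a\<in>insert b D. (if a = b then c else 0) \<cdot>\<^sub>v a) = (\<Sum>a\<in>{b}. c \<cdot>\<^sub>v a)"
      using D(1) by (intro sum.mono_neutral_cong_right) auto
    also have "(\<Sum>a\<in>{b}. c \<cdot>\<^sub>v a) = c \<cdot>\<^sub>v b" by simp
    finally have "c \<cdot>\<^sub>v b + f = (\<Sum>a\<in>insert b D. d' a \<cdot>\<^sub>v a)" by (simp only: add.commute)
    then show ?case using D step by blast
  qed
next
  assume "\<exists>D c. finite D \<and> D \<subseteq> S \<and> f = (\<Sum>b\<in>D. c b \<cdot>\<^sub>v b)"
  then show "f \<in> vspan S" by (auto intro!: vspan_sum intro: vspan_scale vspan_base)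
qed

lemma total_set_iff: "total_set K S \<longleftrightarrow>
    S \<subseteq> vecs K \<and> (\<forall>f\<in>vecs K. \<forall>\<epsilon>>0. \<exists>g\<in>vspan S. hnorm K (f - g) < \<epsilon>)"
  unfolding total_set_def Bex_def vspan_iff by blast

lemma total_setD:
  assumes "total_set K S"
  shows "S \<subseteq> vecs K" "f \<in> vecs K \<Longrightarrow> \<epsilon> > 0 \<Longrightarrow> \<exists>g\<in>vspan S. hnorm K (f - g) < \<epsilon>"
  using assms by (auto simp: total_set_iff)

text \<open>Passage to a smaller total set, for instance from all elementary tensors to those with
  basis vectors at chosen sites.\<close>

lemma total_set_vspan:
  assumes "total_set K S" "S \<subseteq> vspan S'" "S' \<subseteq> vecs K"
  shows "total_set K S'"
  using assms vspan_least[OF assms(2)] unfolding total_set_iff by blast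

lemma LIMSEQ_const_over_Suc: "(\<lambda>n. C / real (Suc n)) \<longlonglongrightarrow> 0"
  using tendsto_mult_right_zero[OF LIMSEQ_inverse_real_of_nat, of C] by (simp add: divide_inverse)

text \<open>The density argument packaged as an induction rule: a property closed under linear
  combinations and norm limits needs checking only on a total set.\<close>

lemma total_induct:
  assumes "total_set K S" "f \<in> vecs K" "\<And>b. b \<in> S \<Longrightarrow> P b" "P 0"
    and lin: "\<And>c f g. f \<in> vecs K \<Longrightarrow> g \<in> vecs K \<Longrightarrow> P f \<Longrightarrow> P g \<Longrightarrow> P (c \<cdot>\<^sub>v f + g)"
    and lim: "\<And>s f. (\<And>n. P (s n)) \<Longrightarrow> lims s f \<Longrightarrow> P f"
  shows "P f"
proof -
  note S = total_setD(1)[OF assms(1)]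
  have sp: "P g" if "g \<in> vspan S" for g
    using that
  proof (induction rule: vspan_induct)
    case (step b f c)
    then show ?case using S vspan_vecs[of f S] assms(3)[of b] by (intro lin) auto
  qed (rule assms(4))
  have "\<exists>g\<in>vspan S. hnorm K (f - g) < 1 / Suc n" for n
    by (rule total_setD(2)[OF assms(1,2)]) simp
  then obtain s where s: "\<And>n. s n \<in> vspan S" "\<And>n. hnorm K (f - s n) < 1 / Suc n" by metis
  have v: "s n \<in> vecs K" for n using vspan_vecs[OF s(1) S] .
  have "lims s f"
  proof (rule lims_bound[OF v assms(2)])
    show "hnorm K (s n - f) \<le> 1 / Suc n" for n
      using s(2)[of n] hnorm_minus_commute[OF assms(2) v[of n]] by simp
    show "(\<lambda>n. 1 / real (Suc n)) \<longlonglongrightarrow> 0" by (rule LIMSEQ_const_over_Suc)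
  qed
  then show ?thesis using lim[of s f] sp[OF s(1)] by blast
qed

lemma vec_eqI_total:
  assumes "total_set K S" "f \<in> vecs K" "g \<in> vecs K" "\<And>b. b \<in> S \<Longrightarrow> ip K b f = ip K b g"
  shows "f = g"
proof -
  note S = total_setD(1)[OF assms(1)]
  have "ip K h f = ip K h g" if "h \<in> vecs K" for h
    using assms(1) that
  proof (rule total_induct)
    fix s h assume s: "\<And>n. ip K (s n) f = ip K (s n) g" "lims s h"
    have "(\<lambda>n. ip K (s n) f) \<longlonglongrightarrow> ip K h f" "(\<lambda>n. ip K (s n) g) \<longlonglongrightarrow> ip K h g"
      using s(2) assms by (auto intro: lims_ip_left)
    then show "ip K h f = ip K h g" using s(1) by (auto intro: LIMSEQ_unique)
  qed (use assms in \<open>auto simp: ip_simps\<close>)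
  from this[of "f - g"] have "ip K (f - g) (f - g) = 0" using assms by (simp add: ip_diff_right)
  then have "hnorm K (f - g) = 0" by (simp add: hnorm_def)
  then show ?thesis using assms by simp
qed

subsection \<open>Bounded operators\<close>

lemma bop_vecs [simp, intro]: "A \<in> bop K \<Longrightarrow> f \<in> vecs K \<Longrightarrow> A f \<in> vecs K"
  unfolding bop_def by blast

lemma bop_outside: "A \<in> bop K \<Longrightarrow> f \<notin> vecs K \<Longrightarrow> A f = 0"
  unfolding bop_def by blast

lemma bop_lin: "A \<in> bop K \<Longrightarrow> f \<in> vecs K \<Longrightarrow> g \<in> vecs K \<Longrightarrow> A (c \<cdot>\<^sub>v f + g) = c \<cdot>\<^sub>v A f + A g"
  unfolding bop_def by blast

lemma bop_add: "A \<in> bop K \<Longrightarrow> f \<in> vecs K \<Longrightarrow> g \<in> vecs K \<Longrightarrow> A (f + g) = A f + A g"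
  using bop_lin[of A f g 1] by simp

lemma bop_zero [simp]: "A \<in> bop K \<Longrightarrow> A 0 = 0"
  using bop_add[of A 0 0] by simp

lemma bop_scale: "A \<in> bop K \<Longrightarrow> f \<in> vecs K \<Longrightarrow> A (c \<cdot>\<^sub>v f) = c \<cdot>\<^sub>v A f"
  using bop_lin[of A f 0 c] by simp

lemma bop_diff: "A \<in> bop K \<Longrightarrow> f \<in> vecs K \<Longrightarrow> g \<in> vecs K \<Longrightarrow> A (f - g) = A f - A g"
  using bop_lin[of A g f "-1"] by simp

lemma bop_sum: "A \<in> bop K \<Longrightarrow> (\<And>a. a \<in> I \<Longrightarrow> f a \<in> vecs K) \<Longrightarrow> A (\<Sum>a\<in>I. f a) = (\<Sum>a\<in>I. A (f a))"
  by (induction I rule: infinite_finite_induct) (auto simp: bop_add)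

lemma bop_bound:
  assumes "A \<in> bop K"
  obtains C where "C \<ge> 0" "\<And>f. f \<in> vecs K \<Longrightarrow> hnorm K (A f) \<le> C * hnorm K f"
proof -
  obtain C where C: "\<And>f. f \<in> vecs K \<Longrightarrow> hnorm K (A f) \<le> C * hnorm K f"
    using assms unfolding bop_def by blast
  have "hnorm K (A f) \<le> max C 0 * hnorm K f" if "f \<in> vecs K" for f
    using C[OF that] mult_right_mono[OF max.cobounded1[of C 0] hnorm_nonneg[OF that]] by linarith
  then show thesis using that[of "max C 0"] by simp
qed

lemma bopI:
  assumes "\<And>f. f \<in> vecs K \<Longrightarrow> A f \<in> vecs K" "\<And>f. f \<notin> vecs K \<Longrightarrow> A f = 0"
    "\<And>f g c. f \<in> vecs K \<Longrightarrow> g \<in> vecs K \<Longrightarrow> A (c \<cdot>\<^sub>v f + g) = c \<cdot>\<^sub>v A f + A g"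
    "\<And>f. f \<in> vecs K \<Longrightarrow> hnorm K (A f) \<le> C * hnorm K f"
  shows "A \<in> bop K"
  unfolding bop_def using assms by blast

lemma bop_ext: "A \<in> bop K \<Longrightarrow> B \<in> bop K \<Longrightarrow> (\<And>f. f \<in> vecs K \<Longrightarrow> A f = B f) \<Longrightarrow> A = B"
  using bop_outside by (metis ext)

lemma bop_plus [simp, intro]:
  assumes "A \<in> bop K" "B \<in> bop K"
  shows "A + B \<in> bop K"
proof -
  obtain C D where C: "\<And>f. f \<in> vecs K \<Longrightarrow> hnorm K (A f) \<le> C * hnorm K f"
    and D: "\<And>f. f \<in> vecs K \<Longrightarrow> hnorm K (B f) \<le> D * hnorm K f"
    using bop_bound[OF assms(1)] bop_bound[OF assms(2)] by metis
  show ?thesis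
  proof (rule bopI[where C = "C + D"])
    fix f assume f: "f \<in> vecs K"
    have "hnorm K (A f + B f) \<le> hnorm K (A f) + hnorm K (B f)"
      using assms f by (intro hnorm_triangle) auto
    then show "hnorm K ((A + B) f) \<le> (C + D) * hnorm K f"
      using C[OF f] D[OF f] by (simp add: plus_fun_apply algebra_simps)
  next
    fix f g c assume "f \<in> vecs K" "g \<in> vecs K"
    then show "(A + B) (c \<cdot>\<^sub>v f + g) = c \<cdot>\<^sub>v (A + B) f + (A + B) g"
      by (simp add: plus_fun_apply[of A B] bop_lin assms scale_distrib)
  qed (use assms in \<open>auto simp: plus_fun_apply bop_outside\<close>)
qed

lemma bop_scale_op [simp, intro]:
  assumes "A \<in> bop K"
  shows "c \<cdot>\<^sub>o A \<in> bop K"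
proof -
  obtain C where C: "\<And>f. f \<in> vecs K \<Longrightarrow> hnorm K (A f) \<le> C * hnorm K f"
    using bop_bound[OF assms(1)] by metis
  show ?thesis
  proof (rule bopI[where C = "cmod c * C"])
    fix f assume f: "f \<in> vecs K"
    then show "hnorm K ((c \<cdot>\<^sub>o A) f) \<le> cmod c * C * hnorm K f"
      using C[OF f] assms by (simp add: scale_op_apply hnorm_scale mult.assoc mult_left_mono)
  qed (use assms in \<open>auto simp: scale_op_apply bop_outside bop_lin scale_distrib mult.commute\<close>)
qed

lemma scale_op_minus_one: "(-1) \<cdot>\<^sub>o A = - A"
  by (simp add: fun_eq_iff pointwise)

lemma bop_minus [simp, intro]: "A \<in> bop K \<Longrightarrow> B \<in> bop K \<Longrightarrow> A - B \<in> bop K"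
  using bop_plus[of A "(-1) \<cdot>\<^sub>o B"] bop_scale_op[of B "-1"] by (simp add: scale_op_minus_one)

lemma bop_zero_op [simp, intro]: "0 \<in> bop K"
  by (rule bopI[where C = 0]) (auto simp: zero_fun_apply)

lemma bop_sum_op [simp, intro]: "(\<And>a. a \<in> I \<Longrightarrow> A a \<in> bop K) \<Longrightarrow> (\<Sum>a\<in>I. A a) \<in> bop K"
  by (induction I rule: infinite_finite_induct) auto

lemma bop_comp [simp, intro]:
  assumes "A \<in> bop K" "B \<in> bop K"
  shows "A \<circ> B \<in> bop K"
proof -
  obtain C D where C: "\<And>f. f \<in> vecs K \<Longrightarrow> hnorm K (A f) \<le> C * hnorm K f" "C \<ge> 0"
    and D: "\<And>f. f \<in> vecs K \<Longrightarrow> hnorm K (B f) \<le> D * hnorm K f"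
    using bop_bound[OF assms(1)] bop_bound[OF assms(2)] by metis
  show ?thesis
  proof (rule bopI[where C = "C * D"])
    fix f assume f: "f \<in> vecs K"
    have "hnorm K (A (B f)) \<le> C * hnorm K (B f)" using C(1) f assms by auto
    also have "\<dots> \<le> C * (D * hnorm K f)" using D[OF f] C(2) by (rule mult_left_mono)
    finally show "hnorm K ((A \<circ> B) f) \<le> C * D * hnorm K f" by (simp add: mult.assoc)
  qed (use assms in \<open>auto simp: bop_outside bop_lin\<close>)
qed

lemma id_bop [simp, intro]: "id_op K \<in> bop K"
  by (rule bopI[where C = 1]) (auto simp: id_op_def)

lemma id_op_apply [simp]: "f \<in> vecs K \<Longrightarrow> id_op K f = f"
  by (simp add: id_op_def)

lemma id_comp [simp]: "A \<in> bop K \<Longrightarrow> id_op K \<circ> A = A" "A \<in> bop K \<Longrightarrow> A \<circ> id_op K = A"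
  by (auto intro!: bop_ext)

lemma bop_lims: "A \<in> bop K \<Longrightarrow> lims s f \<Longrightarrow> lims (\<lambda>n. A (s n)) (A f)"
proof -
  assume A: "A \<in> bop K" "lims s f"
  note v = lims_vecs[OF A(2)]
  obtain C where C: "\<And>f. f \<in> vecs K \<Longrightarrow> hnorm K (A f) \<le> C * hnorm K f"
    using bop_bound[OF A(1)] by metis
  show "lims (\<lambda>n. A (s n)) (A f)"
  proof (rule lims_bound)
    show "hnorm K (A (s n) - A f) \<le> C * hnorm K (s n - f)" for n
      using C[of "s n - f"] v A by (simp add: bop_diff)
    show "(\<lambda>n. C * hnorm K (s n - f)) \<longlonglongrightarrow> 0"
      using tendsto_mult_right_zero A(2) by (force simp: lims_def)
  qed (use v A in auto)
qed

text \<open>The vectors on which two bounded operators agree form a closed subspace. This is the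
  source of uniqueness for \<open>site_op\<close>, \<open>left_shift_op\<close> and
  \<open>mult_cyl\<close>.\<close>

lemma bop_eqI_total:
  assumes "total_set K S" "A \<in> bop K" "B \<in> bop K" "\<And>b. b \<in> S \<Longrightarrow> A b = B b"
  shows "A = B"
proof (rule bop_ext[OF assms(2,3)])
  fix f assume "f \<in> vecs K"
  with assms(1) show "A f = B f"
  proof (rule total_induct)
    fix s f assume s: "\<And>n. A (s n) = B (s n)" "lims s f"
    show "A f = B f"
      using bop_lims[OF assms(2) s(2)] bop_lims[OF assms(3) s(2)] s(1) by (auto intro: lims_unique)
  qed (use assms in \<open>auto simp: bop_lin\<close>)
qed

lemma opnorm_bound:
  assumes "A \<in> bop K" "f \<in> vecs K"
  shows "hnorm K (A f) \<le> opnorm K A * hnorm K f"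
proof (cases "f = 0")
  case False
  obtain C where C: "\<And>f. f \<in> vecs K \<Longrightarrow> hnorm K (A f) \<le> C * hnorm K f" "C \<ge> 0"
    using bop_bound[OF assms(1)] by metis
  have bdd: "bdd_above ((\<lambda>f. hnorm K (A f)) ` {f \<in> vecs K. hnorm K f \<le> 1})"
  proof (rule bdd_aboveI2)
    fix f assume "f \<in> {f \<in> vecs K. hnorm K f \<le> 1}"
    then show "hnorm K (A f) \<le> C" using C(1)[of f] mult_left_mono[of "hnorm K f" 1 C] C(2) by auto
  qed
  have n: "hnorm K f > 0" using False assms hnorm_nonneg[of f] by (simp add: less_le)
  define u where "u = complex_of_real (1 / hnorm K f) \<cdot>\<^sub>v f"
  have u: "u \<in> vecs K" "hnorm K u = 1" using n assms by (auto simp: u_def hnorm_scale norm_divide)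
  have "hnorm K (A u) \<le> opnorm K A"
    unfolding opnorm_def by (rule cSUP_upper[OF _ bdd]) (use u in auto)
  moreover have "A u = complex_of_real (1 / hnorm K f) \<cdot>\<^sub>v A f"
    using assms by (simp add: u_def bop_scale)
  ultimately show ?thesis using n assms by (simp add: hnorm_scale norm_divide field_simps)
qed (use assms in simp)

lemma opnorm_le:
  assumes "C \<ge> 0" "\<And>f. f \<in> vecs K \<Longrightarrow> hnorm K (A f) \<le> C * hnorm K f"
  shows "opnorm K A \<le> C"
  unfolding opnorm_def
proof (rule cSUP_least)
  fix f assume "f \<in> {f \<in> vecs K. hnorm K f \<le> 1}"
  then show "hnorm K (A f) \<le> C" using assms(2)[of f] mult_left_mono[of "hnorm K f" 1 C] assms(1) by auto
qed (auto intro!: exI[of _ 0])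

lemma opnorm_nonneg:
  assumes "A \<in> bop K"
  shows "opnorm K A \<ge> 0"
proof -
  obtain C where C: "\<And>f. f \<in> vecs K \<Longrightarrow> hnorm K (A f) \<le> C * hnorm K f" "C \<ge> 0"
    using bop_bound[OF assms(1)] by metis
  have bdd: "bdd_above ((\<lambda>f. hnorm K (A f)) ` {f \<in> vecs K. hnorm K f \<le> 1})"
  proof (rule bdd_aboveI2)
    fix f assume "f \<in> {f \<in> vecs K. hnorm K f \<le> 1}"
    then show "hnorm K (A f) \<le> C" using C(1)[of f] mult_left_mono[of "hnorm K f" 1 C] C(2) by auto
  qed
  have "hnorm K (A 0) \<le> opnorm K A"
    unfolding opnorm_def by (rule cSUP_upper[OF _ bdd]) auto
  then show ?thesis using assms by simp
qed

text \<open>The common bound M survives the pointwise limit. In the application it is the supremum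
  bound of the function that is being approximated.\<close>

lemma bop_limit:
  assumes C: "\<And>n. C n \<in> bop K" "\<And>n f. f \<in> vecs K \<Longrightarrow> hnorm K (C n f) \<le> M * hnorm K f"
    and conv: "\<And>f. f \<in> vecs K \<Longrightarrow> \<exists>g. lims (\<lambda>n. C n f) g"
  obtains D where "D \<in> bop K" "\<And>f. f \<in> vecs K \<Longrightarrow> lims (\<lambda>n. C n f) (D f)"
proof -
  define D where "D f = (if f \<in> vecs K then SOME g. lims (\<lambda>n. C n f) g else 0)" for f
  have D: "lims (\<lambda>n. C n f) (D f)" if "f \<in> vecs K" for f
    using someI_ex[OF conv[OF that]] that by (simp add: D_def)
  have "D \<in> bop K"
  proof (rule bopI[where C = M])
    fix f assume f: "f \<in> vecs K"
    show "D f \<in> vecs K" using D[OF f] by (rule lims_vecs)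
    show "hnorm K (D f) \<le> M * hnorm K f"
      using lims_hnorm_le[OF D[OF f], of 0] C f by simp
    fix g c assume g: "g \<in> vecs K"
    have "lims (\<lambda>n. C n (c \<cdot>\<^sub>v f + g)) (c \<cdot>\<^sub>v D f + D g)"
      using lims_add[OF lims_scale[OF D[OF f], of c] D[OF g]] by (simp add: bop_lin[OF C(1) f g])
    then show "D (c \<cdot>\<^sub>v f + g) = c \<cdot>\<^sub>v D f + D g"
      using D[of "c \<cdot>\<^sub>v f + g"] f g by (auto intro: lims_unique)
  qed (simp add: D_def)
  then show thesis using that D by blast
qed

subsection \<open>Adjoints\<close>

text \<open>Adjointness as a relation: it can be composed and summed directly, whereas
  \<open>adj\<close> says nothing before existence and uniqueness are settled.\<close>

definition adjp :: "'x operator \<Rightarrow> 'x operator \<Rightarrow> bool"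
  where "adjp A B \<longleftrightarrow> A \<in> bop K \<and> B \<in> bop K \<and>
    (\<forall>f\<in>vecs K. \<forall>g\<in>vecs K. ip K f (A g) = ip K (B f) g)"

lemma adjpD:
  assumes "adjp A B"
  shows "A \<in> bop K" "B \<in> bop K" "f \<in> vecs K \<Longrightarrow> g \<in> vecs K \<Longrightarrow> ip K f (A g) = ip K (B f) g"
  using assms by (auto simp: adjp_def)

lemma vec_eqI_ip:
  assumes "f \<in> vecs K" "g \<in> vecs K" "\<And>h. h \<in> vecs K \<Longrightarrow> ip K f h = ip K g h"
  shows "f = g"
proof -
  have "ip K (f - g) (f - g) = 0" using assms by (simp add: ip_diff_left)
  then have "hnorm K (f - g) = 0" by (simp add: hnorm_def)
  then show ?thesis using assms by simp
qed

lemma adjp_unique: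
  assumes "adjp A B" "adjp A B'"
  shows "B = B'"
proof (rule bop_ext)
  fix f assume f: "f \<in> vecs K"
  show "B f = B' f"
    using assms f by (intro vec_eqI_ip) (auto simp: adjp_def)
qed (use assms in \<open>auto simp: adjp_def\<close>)

lemma adj_eq:
  assumes "adjp A B"
  shows "adj K A = B"
  unfolding adj_def
proof (rule the_equality)
  show "B \<in> bop K \<and> (\<forall>f\<in>vecs K. \<forall>g\<in>vecs K. ip K f (A g) = ip K (B f) g)"
    using assms by (simp add: adjp_def)
  fix B' assume "B' \<in> bop K \<and> (\<forall>f\<in>vecs K. \<forall>g\<in>vecs K. ip K f (A g) = ip K (B' f) g)"
  then have "adjp A B'" using assms by (simp add: adjp_def)
  then show "B' = B" using adjp_unique assms by blast
qed

lemma adjp_sym: "adjp A B \<Longrightarrow> adjp B A"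
  unfolding adjp_def by (metis ip_cnj bop_vecs)

lemma adjp_comp: "adjp A A' \<Longrightarrow> adjp B B' \<Longrightarrow> adjp (A \<circ> B) (B' \<circ> A')"
  unfolding adjp_def by (auto)

lemma adjp_plus: "adjp A A' \<Longrightarrow> adjp B B' \<Longrightarrow> adjp (A + B) (A' + B')"
  unfolding adjp_def by (auto simp: plus_fun_apply ip_simps)

lemma adjp_scale: "adjp A A' \<Longrightarrow> adjp (c \<cdot>\<^sub>o A) (cnj c \<cdot>\<^sub>o A')"
  unfolding adjp_def by (auto simp: scale_op_apply ip_simps)

lemma adjp_zero: "adjp 0 0"
  unfolding adjp_def by (auto simp: zero_fun_apply)

lemma adjp_sum: "(\<And>a. a \<in> I \<Longrightarrow> adjp (A a) (B a)) \<Longrightarrow> adjp (\<Sum>a\<in>I. A a) (\<Sum>a\<in>I. B a)"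
  by (induction I rule: infinite_finite_induct) (auto intro: adjp_zero adjp_plus)

text \<open>Two density arguments in turn: first the left vector is freed with the right one still
  in S, then the right vector.\<close>

lemma adjp_total:
  assumes "total_set K S" "A \<in> bop K" "B \<in> bop K"
    "\<And>a b. a \<in> S \<Longrightarrow> b \<in> S \<Longrightarrow> ip K a (A b) = ip K (B a) b"
  shows "adjp A B"
proof -
  note S = total_setD(1)[OF assms(1)]
  have 1: "ip K f (A b) = ip K (B f) b" if b: "b \<in> S" and "f \<in> vecs K" for f b
    using assms(1) that(2)
  proof (rule total_induct)
    fix s f assume s: "\<And>n. ip K (s n) (A b) = ip K (B (s n)) b" "lims s f"
    have "(\<lambda>n. ip K (s n) (A b)) \<longlonglongrightarrow> ip K f (A b)" "(\<lambda>n. ip K (B (s n)) b) \<longlonglongrightarrow> ip K (B f) b"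
      using S b assms(2) by (auto intro!: lims_ip_left s(2) bop_lims[OF assms(3) s(2)])
    then show "ip K f (A b) = ip K (B f) b" using s(1) by (auto intro: LIMSEQ_unique)
  qed (use assms S b in \<open>auto simp: ip_simps bop_lin subset_iff\<close>)
  have "ip K f (A g) = ip K (B f) g" if f: "f \<in> vecs K" and "g \<in> vecs K" for f g
    using assms(1) that(2)
  proof (rule total_induct)
    fix s g assume s: "\<And>n. ip K f (A (s n)) = ip K (B f) (s n)" "lims s g"
    have "(\<lambda>n. ip K f (A (s n))) \<longlonglongrightarrow> ip K f (A g)" "(\<lambda>n. ip K (B f) (s n)) \<longlonglongrightarrow> ip K (B f) g"
      using f assms(3) by (auto intro!: lims_ip_right s(2) bop_lims[OF assms(2) s(2)])
    then show "ip K f (A g) = ip K (B f) g" using s(1) by (auto intro: LIMSEQ_unique)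
  qed (use assms f 1 in \<open>auto simp: ip_simps bop_lin\<close>)
  then show ?thesis using assms by (auto simp: adjp_def)
qed

lemma hnorm_plus_power2:
  assumes "f \<in> vecs K" "g \<in> vecs K"
  shows "(hnorm K (f + g))\<^sup>2 = (hnorm K f)\<^sup>2 + 2 * Re (ip K f g) + (hnorm K g)\<^sup>2"
proof -
  have "Re (ip K g f) = Re (ip K f g)" using ip_cnj[OF assms] by (metis cnj.sel(1))
  then show ?thesis using assms by (simp add: hnorm_power2 ip_add_left ip_add_right)
qed

text \<open>Supplies the existence of adjoints of arbitrary bounded operators.\<close>

lemma riesz:
  assumes lin: "\<And>f g c. f \<in> vecs K \<Longrightarrow> g \<in> vecs K \<Longrightarrow> \<phi> (c \<cdot>\<^sub>v f + g) = c * \<phi> f + \<phi> g"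
    and bound: "\<And>f. f \<in> vecs K \<Longrightarrow> cmod (\<phi> f) \<le> C * hnorm K f"
  shows "\<exists>f\<in>vecs K. \<forall>g\<in>vecs K. ip K f g = \<phi> g"
proof -
  text \<open>The representing vector minimises the quadratic functional \<open>J\<close>.\<close>
  define J where "J f = (hnorm K f)\<^sup>2 - 2 * Re (\<phi> f)" for f
  have \<phi>0: "\<phi> 0 = 0" using lin[of 0 0 1] by simp
  have \<phi>c: "\<phi> (c \<cdot>\<^sub>v f) = c * \<phi> f" if "f \<in> vecs K" for c f using lin[of f 0 c] that \<phi>0 by simp
  have \<phi>a: "\<phi> (f + g) = \<phi> f + \<phi> g" if "f \<in> vecs K" "g \<in> vecs K" for f g using lin[of f g 1] that by simp
  \<comment> \<open>Completing the square: J f is at least (|f| - C)^2 - C^2, with |f| the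
    norm.\<close>
  have low: "J f \<ge> - C\<^sup>2" if f: "f \<in> vecs K" for f
  proof -
    have "Re (\<phi> f) \<le> C * hnorm K f" using bound[OF f] complex_Re_le_cmod[of "\<phi> f"] by linarith
    moreover have "0 \<le> (hnorm K f - C)\<^sup>2" by simp
    ultimately show ?thesis by (simp add: J_def power2_diff algebra_simps)
  qed
  have bdd: "bdd_below (J ` vecs K)" by (rule bdd_belowI2[OF low])
  define m where "m = (INF f\<in>vecs K. J f)"
  have m: "m \<le> J f" if "f \<in> vecs K" for f unfolding m_def using bdd that by (rule cINF_lower)
  have "\<exists>f\<in>vecs K. J f < m + 1 / Suc n" for n
  proof -
    have "m < m + 1 / Suc n" by simp
    then show ?thesis unfolding m_def by (subst (asm) cINF_less_iff[OF _ bdd]) auto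
  qed
  then obtain s where s: "\<And>n. s n \<in> vecs K" "\<And>n. J (s n) < m + 1 / Suc n" by metis
  \<comment> \<open>The parallelogram law applied to the midpoint h: since J h cannot fall below m,
    near-minimisers are close to each other, so a minimising sequence is Cauchy.\<close>
  have par: "(hnorm K (a - b))\<^sup>2 \<le> 2 * (J a - m) + 2 * (J b - m)" if ab: "a \<in> vecs K" "b \<in> vecs K" for a b
  proof -
    define h where "h = (1/2) \<cdot>\<^sub>v (a + b)"
    have h: "h \<in> vecs K" using ab by (simp add: h_def)
    have "4 * (hnorm K h)\<^sup>2 = (hnorm K (a + b))\<^sup>2"
      using ab by (simp add: h_def hnorm_scale power_divide)
    moreover have "(hnorm K (a + b))\<^sup>2 + (hnorm K (a - b))\<^sup>2 = 2 * (hnorm K a)\<^sup>2 + 2 * (hnorm K b)\<^sup>2"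
      using ab by (simp add: hnorm_power2 ip_simps)
    moreover have "2 * Re (\<phi> h) = Re (\<phi> a) + Re (\<phi> b)"
      using ab by (simp add: h_def \<phi>c \<phi>a)
    ultimately have "(hnorm K (a - b))\<^sup>2 = 2 * J a + 2 * J b - 4 * J h"
      by (simp add: J_def)
    then show ?thesis using m[OF h] by simp
  qed
  \<comment> \<open>Each s n misses the infimum by less than 1 / Suc n, and the previous estimate
    doubles this.\<close>
  define b where "b n = sqrt (2 / Suc n)" for n
  obtain f where f: "lims s f"
  proof (rule complete[OF s(1)])
    fix i j
    have "(hnorm K (s i - s j))\<^sup>2 \<le> 2 / Suc i + 2 / Suc j"
      using par[OF s(1) s(1), of i j] s(2)[of i] s(2)[of j] by simp
    then have "hnorm K (s i - s j) \<le> sqrt (2 / Suc i + 2 / Suc j)"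
      by (rule real_le_rsqrt)
    also have "\<dots> \<le> b i + b j" unfolding b_def by (rule sqrt_add_le_add_sqrt) auto
    finally show "hnorm K (s i - s j) \<le> b i + b j" .
  next
    show "b \<longlonglongrightarrow> 0" unfolding b_def using tendsto_real_sqrt[OF LIMSEQ_const_over_Suc[of 2]] by simp
  qed blast
  note v = lims_vecs[OF f]
  have "(\<lambda>n. ip K (s n) (s n) - ip K f f) \<longlonglongrightarrow> 0"
  proof (rule Lim_null_comparison)
    have l: "(\<lambda>n. hnorm K (s n - f)) \<longlonglongrightarrow> 0" using f by (simp add: lims_def)
    show "(\<lambda>n. hnorm K (s n - f) * hnorm K (s n - f) + 2 * hnorm K f * hnorm K (s n - f)) \<longlonglongrightarrow> 0"
      using tendsto_add[OF tendsto_mult[OF l l] tendsto_mult[OF tendsto_const[of "2 * hnorm K f"] l]] by simp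
    have "norm (ip K (s n) (s n) - ip K f f) \<le> hnorm K (s n - f) * hnorm K (s n - f) + 2 * hnorm K f * hnorm K (s n - f)" for n
    proof -
      have "ip K (s n) (s n) - ip K f f = ip K (s n - f) (s n - f) + (ip K f (s n - f) + ip K (s n - f) f)"
        using v by (simp add: ip_simps)
      then have "norm (ip K (s n) (s n) - ip K f f) \<le> norm (ip K (s n - f) (s n - f)) + (norm (ip K f (s n - f)) + norm (ip K (s n - f) f))"
        using norm_triangle_ineq[of "ip K (s n - f) (s n - f)" "ip K f (s n - f) + ip K (s n - f) f"]
          norm_triangle_ineq[of "ip K f (s n - f)" "ip K (s n - f) f"] by simp
      moreover have d: "s n - f \<in> vecs K" by (rule diff_vecs[OF v])
      ultimately show ?thesis
        using Cauchy_Schwarz[OF d d] Cauchy_Schwarz[OF v(2) d] Cauchy_Schwarz[OF d v(2)]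
          mult.commute[of "hnorm K f" "hnorm K (s n - f)"] by linarith
    qed
    then show "\<forall>\<^sub>F n in sequentially. norm (ip K (s n) (s n) - ip K f f) \<le> hnorm K (s n - f) * hnorm K (s n - f) + 2 * hnorm K f * hnorm K (s n - f)"
      by simp
  qed
  then have "(\<lambda>n. Re (ip K (s n) (s n))) \<longlonglongrightarrow> Re (ip K f f)"
    by (rule tendsto_Re[OF LIM_zero_cancel])
  moreover have "(\<lambda>n. \<phi> (s n) - \<phi> f) \<longlonglongrightarrow> 0"
  proof (rule Lim_null_comparison)
    have "\<phi> (s n) - \<phi> f = \<phi> (s n - f)" for n using lin[of f "s n" "-1"] v by simp
    then show "\<forall>\<^sub>F n in sequentially. norm (\<phi> (s n) - \<phi> f) \<le> C * hnorm K (s n - f)"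
      using bound[of "s _ - f"] v by simp
    show "(\<lambda>n. C * hnorm K (s n - f)) \<longlonglongrightarrow> 0"
      using f tendsto_mult_right_zero by (force simp: lims_def)
  qed
  then have "(\<lambda>n. Re (\<phi> (s n))) \<longlonglongrightarrow> Re (\<phi> f)"
    by (rule tendsto_Re[OF LIM_zero_cancel])
  ultimately have "(\<lambda>n. J (s n)) \<longlonglongrightarrow> J f"
    unfolding J_def by (simp only: hnorm_power2 v) (intro tendsto_diff tendsto_mult tendsto_const)
  moreover have "(\<lambda>n. m + 1 / Suc n) \<longlonglongrightarrow> m + 0"
    by (intro tendsto_add tendsto_const LIMSEQ_const_over_Suc)
  ultimately have Jf: "J f \<le> m" using s(2) by (intro LIMSEQ_le) (auto intro!: exI less_imp_le)
  have "ip K f g = \<phi> g" if g: "g \<in> vecs K" for g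
  proof (rule ccontr)
    assume ne: "ip K f g \<noteq> \<phi> g"
    \<comment> \<open>If f failed to represent \<phi> at g, moving along t g would lower J: the
      linear term changes J by -2 \<epsilon> |d|^2, and \<epsilon> is chosen so small that the
      quadratic term cannot compensate.\<close>
    define d where "d = ip K f g - \<phi> g"
    define \<epsilon> where "\<epsilon> = 1 / (1 + (hnorm K g)\<^sup>2)"
    define t where "t = - complex_of_real \<epsilon> * cnj d"
    have pos: "1 + (hnorm K g)\<^sup>2 > 0" by (rule add_pos_nonneg) auto
    have \<epsilon>: "\<epsilon> > 0" using pos by (simp add: \<epsilon>_def)
    have "ip K (t \<cdot>\<^sub>v g) f = cnj (t * ip K f g)" using g v by (simp add: ip_scale_left ip_cnj)
    then have "(hnorm K (t \<cdot>\<^sub>v g + f))\<^sup>2 = (cmod t)\<^sup>2 * (hnorm K g)\<^sup>2 + 2 * Re (t * ip K f g) + (hnorm K f)\<^sup>2"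
      using hnorm_plus_power2[of "t \<cdot>\<^sub>v g" f] g v by (simp add: hnorm_scale power_mult_distrib)
    then have "J (t \<cdot>\<^sub>v g + f) = J f + 2 * Re (t * d) + (cmod t)\<^sup>2 * (hnorm K g)\<^sup>2"
      using lin[OF g v(2), of t] by (simp add: J_def d_def algebra_simps)
    moreover have "Re (t * d) = - \<epsilon> * (cmod d)\<^sup>2"
      unfolding cmod_power2 t_def by (simp add: power2_eq_square algebra_simps)
    moreover have "(cmod t)\<^sup>2 = \<epsilon> * \<epsilon> * (cmod d)\<^sup>2"
      using \<epsilon> by (simp add: t_def norm_mult power_mult_distrib power2_eq_square)
    ultimately have "J (t \<cdot>\<^sub>v g + f) = J f + \<epsilon> * (cmod d)\<^sup>2 * (\<epsilon> * (hnorm K g)\<^sup>2 - 2)"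
      by (simp add: algebra_simps)
    moreover have "\<epsilon> * (hnorm K g)\<^sup>2 < 2" using pos by (simp add: \<epsilon>_def field_simps)
    moreover have "\<epsilon> * (cmod d)\<^sup>2 > 0" using ne \<epsilon> by (simp add: d_def)
    ultimately have "J (t \<cdot>\<^sub>v g + f) < J f" by (simp add: mult_pos_neg)
    then show False using m[of "t \<cdot>\<^sub>v g + f"] Jf g v by auto
  qed
  then show ?thesis using v by blast
qed

text \<open>For each f the functional sending g to the scalar product of f with A g is bounded, so
  Riesz gives the value of the adjoint at f.\<close>

lemma adjp_adj:
  assumes A: "A \<in> bop K"
  shows "adjp A (adj K A)"
proof -
  obtain C where C: "\<And>f. f \<in> vecs K \<Longrightarrow> hnorm K (A f) \<le> C * hnorm K f" "C \<ge> 0"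
    using bop_bound[OF A] by metis
  have "\<exists>h\<in>vecs K. \<forall>g\<in>vecs K. ip K h g = ip K f (A g)" if f: "f \<in> vecs K" for f
  proof (rule riesz)
    show "cmod (ip K f (A g)) \<le> (hnorm K f * C) * hnorm K g" if g: "g \<in> vecs K" for g
    proof -
      have "cmod (ip K f (A g)) \<le> hnorm K f * hnorm K (A g)" using A f g by (intro Cauchy_Schwarz) auto
      also have "\<dots> \<le> hnorm K f * (C * hnorm K g)" using C(1)[OF g] f by (intro mult_left_mono) auto
      finally show ?thesis by (simp add: mult.assoc)
    qed
  qed (use A f in \<open>auto simp: bop_lin ip_simps\<close>)
  then obtain B0 where B0: "\<And>f. f \<in> vecs K \<Longrightarrow> B0 f \<in> vecs K"
    "\<And>f g. f \<in> vecs K \<Longrightarrow> g \<in> vecs K \<Longrightarrow> ip K (B0 f) g = ip K f (A g)" by metis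
  define B where "B f = (if f \<in> vecs K then B0 f else 0)" for f
  have B: "B f \<in> vecs K" "f \<in> vecs K \<Longrightarrow> g \<in> vecs K \<Longrightarrow> ip K (B f) g = ip K f (A g)" for f g
    using B0 by (auto simp: B_def)
  have "B \<in> bop K"
  proof (rule bopI[where C = C])
    show "B (c \<cdot>\<^sub>v f + g) = c \<cdot>\<^sub>v B f + B g" if "f \<in> vecs K" "g \<in> vecs K" for f g c
      using that A B by (intro vec_eqI_ip) (auto simp: ip_simps)
    fix f assume f: "f \<in> vecs K"
    \<comment> \<open>Moving one B f back to A bounds its squared norm by C times the norms of f and
      B f; one factor is then cancelled.\<close>
    have "hnorm K (B f) * hnorm K (B f) = cmod (ip K (B f) (B f))"
      using B(1) by (simp add: ip_self norm_mult power2_eq_square)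
    also have "\<dots> = cmod (ip K f (A (B f)))" using B f by simp
    also have "\<dots> \<le> hnorm K f * hnorm K (A (B f))" using A B(1) f by (intro Cauchy_Schwarz) auto
    also have "\<dots> \<le> hnorm K f * (C * hnorm K (B f))" using C(1)[OF B(1)] f by (intro mult_left_mono) auto
    finally have *: "hnorm K (B f) * hnorm K (B f) \<le> (C * hnorm K f) * hnorm K (B f)" by (simp add: mult_ac)
    show "hnorm K (B f) \<le> C * hnorm K f"
    proof (cases "hnorm K (B f) = 0")
      case False
      then have "hnorm K (B f) > 0" using hnorm_nonneg[OF B(1)] by (simp add: less_le)
      with * show ?thesis by simp
    qed (use C(2) f in simp)
  qed (auto simp: B_def B0)
  then have "adjp A B" using A B by (simp add: adjp_def)
  then show ?thesis using adj_eq by blast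
qed

lemma adj_bop [simp, intro]: "A \<in> bop K \<Longrightarrow> adj K A \<in> bop K"
  using adjp_adj adjpD by blast

lemma ip_adj: "A \<in> bop K \<Longrightarrow> f \<in> vecs K \<Longrightarrow> g \<in> vecs K \<Longrightarrow> ip K (adj K A f) g = ip K f (A g)"
  using adjpD(3)[OF adjp_adj] by simp

lemma adj_comp: "A \<in> bop K \<Longrightarrow> B \<in> bop K \<Longrightarrow> adj K (A \<circ> B) = adj K B \<circ> adj K A"
  by (intro adj_eq adjp_comp adjp_adj)

lemma adj_adj: "A \<in> bop K \<Longrightarrow> adj K (adj K A) = A"
  by (rule adj_eq[OF adjp_sym[OF adjp_adj]])

lemma cstar_subalgebra_bop: "cstar_subalgebra K (bop K)"
  by (auto simp: cstar_subalgebra_def)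

subsection \<open>Orthonormal bases and traces\<close>

text \<open>Stated as an unordered sum over an arbitrary orthonormal basis, because
  \<open>htrace\<close> quantifies over all of them.\<close>

lemma parseval:
  assumes S: "onb K S" and v: "f \<in> vecs K" "g \<in> vecs K"
  shows "((\<lambda>b. ip K f b * ip K b g) has_sum ip K f g) S"
proof -
  have tot: "total_set K S" and on: "\<And>b b'. b \<in> S \<Longrightarrow> b' \<in> S \<Longrightarrow> ip K b b' = (if b = b' then 1 else 0)"
    using S by (auto simp: onb_def)
  note Sv = total_setD(1)[OF tot]
  have "\<exists>X. finite X \<and> X \<subseteq> S \<and> (\<forall>Y. finite Y \<and> X \<subseteq> Y \<and> Y \<subseteq> S \<longrightarrow>
      dist (\<Sum>b\<in>Y. ip K f b * ip K b g) (ip K f g) < \<epsilon>)" if "\<epsilon> > 0" for \<epsilon>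
  proof -
    \<comment> \<open>Adding 1 avoids division by zero when g = 0.\<close>
    define \<delta> where "\<delta> = \<epsilon> / (hnorm K g + 1)"
    have g1: "hnorm K g + 1 > 0" using hnorm_nonneg[OF v(2)] by linarith
    have "\<delta> > 0" using that g1 by (simp add: \<delta>_def)
    then obtain q where q: "q \<in> vspan S" "hnorm K (f - q) < \<delta>"
      using total_setD(2)[OF tot v(1)] by blast
    from q(1) obtain D c where D: "finite D" "D \<subseteq> S" "q = (\<Sum>b\<in>D. c b \<cdot>\<^sub>v b)"
      unfolding vspan_iff by blast
    have "dist (\<Sum>b\<in>Y. ip K f b * ip K b g) (ip K f g) < \<epsilon>"
      if Y: "finite Y" "D \<subseteq> Y" "Y \<subseteq> S" for Y
    proof -
      have Yv: "b \<in> vecs K" if "b \<in> Y" for b using that Y(3) Sv by blast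
      \<comment> \<open>p is the orthogonal projection of f onto the span of Y. As q lies in that
        span, Pythagoras shows that p approximates f at least as well as q does.\<close>
      define p where "p = (\<Sum>b\<in>Y. ip K b f \<cdot>\<^sub>v b)"
      have p: "p \<in> vecs K" unfolding p_def by (rule sum_vecs) (use Yv in blast)
      have qv: "q \<in> vecs K" using q(1) Sv by (rule vspan_vecs)
      have orth: "ip K (f - p) b = 0" if b: "b \<in> Y" for b
      proof -
        have "ip K b p = (\<Sum>a\<in>Y. ip K a f * ip K b a)"
          unfolding p_def using Yv b by (simp add: ip_sum_right ip_scale_right)
        also have "\<dots> = (\<Sum>a\<in>Y. if a = b then ip K b f else 0)"
        proof (rule sum.cong)
          fix a assume a: "a \<in> Y"
          then show "ip K a f * ip K b a = (if a = b then ip K b f else 0)"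
            using on[OF subsetD[OF Y(3) b] subsetD[OF Y(3) a]] by auto
        qed simp
        finally have "ip K b (f - p) = 0" using Y(1) b Yv v p by (simp add: ip_diff_right)
        then have "cnj (ip K (f - p) b) = 0" using ip_cnj[of "f - p" b] v p Yv[OF b] by simp
        then show ?thesis by simp
      qed
      have "ip K (f - p) q = (\<Sum>b\<in>D. c b * ip K (f - p) b)"
        unfolding D(3) using Yv Y(2) v p by (simp add: ip_sum_right ip_scale_right subset_iff)
      also have "\<dots> = 0" using orth Y(2) by (intro sum.neutral) auto
      finally have oq: "ip K (f - p) q = 0" .
      have "ip K (f - p) p = (\<Sum>b\<in>Y. ip K b f * ip K (f - p) b)"
        unfolding p_def[of] using Yv v p[unfolded p_def] by (simp add: ip_sum_right ip_scale_right)
      also have "\<dots> = 0" using orth by (intro sum.neutral) auto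
      finally have op: "ip K (f - p) p = 0" .
      have "(hnorm K (f - p + (p - q)))\<^sup>2 = (hnorm K (f - p))\<^sup>2 + (hnorm K (p - q))\<^sup>2"
        using hnorm_plus_power2[of "f - p" "p - q"] v p qv oq op by (simp add: ip_diff_right)
      then have "(hnorm K (f - p))\<^sup>2 \<le> (hnorm K (f - q))\<^sup>2" by simp
      then have "hnorm K (f - p) \<le> hnorm K (f - q)"
        by (rule power2_le_imp_le) (use v qv in auto)
      then have fp: "hnorm K (f - p) < \<delta>" using q(2) by simp
      have "ip K p g = (\<Sum>b\<in>Y. ip K f b * ip K b g)"
        unfolding p_def using Yv v by (simp add: ip_sum_left ip_scale_left ip_cnj)
      then have "dist (\<Sum>b\<in>Y. ip K f b * ip K b g) (ip K f g) = cmod (ip K (f - p) g)"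
        using v p by (simp add: ip_diff_left dist_norm norm_minus_commute)
      also have "\<dots> \<le> hnorm K (f - p) * hnorm K g" using v p by (intro Cauchy_Schwarz) auto
      also have "\<dots> \<le> hnorm K (f - p) * (hnorm K g + 1)" using v p by (intro mult_left_mono) auto
      also have "\<dots> < \<delta> * (hnorm K g + 1)" using fp g1 by (rule mult_strict_right_mono)
      also have "\<dots> = \<epsilon>" using g1 by (simp add: \<delta>_def)
      finally show ?thesis .
    qed
    then show ?thesis using D(1,2) by blast
  qed
  then show ?thesis
    unfolding has_sum_def tendsto_iff eventually_finite_subsets_at_top by blast
qed

lemma ketbra_apply: "h \<in> vecs K \<Longrightarrow> ketbra K f g h = ip K g h \<cdot>\<^sub>v f"
  by (simp add: ketbra_def)

lemma ketbra_bop [simp, intro]: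
  assumes "f \<in> vecs K" "g \<in> vecs K"
  shows "ketbra K f g \<in> bop K"
proof (rule bopI[where C = "hnorm K f * hnorm K g"])
  fix h assume h: "h \<in> vecs K"
  then show "hnorm K (ketbra K f g h) \<le> hnorm K f * hnorm K g * hnorm K h"
    using Cauchy_Schwarz[of g h] assms mult_left_mono[of _ _ "hnorm K f"]
    by (fastforce simp: ketbra_apply hnorm_scale mult_ac)
qed (use assms in \<open>auto simp: ketbra_def ip_simps scale_distrib mult.commute\<close>)

text \<open>For every basis the trace sum is a Parseval sum. A basis has to exist, since otherwise
  the description in \<open>htrace\<close> would hold for every number. Of A only the carrier and
  scalars are mentioned, which is what \<open>homogeneous\<close> provides for the flow.\<close>

lemma htrace_rank_one:
  assumes "onb K S0" and A: "\<And>f. f \<in> vecs K \<Longrightarrow> A f \<in> vecs K"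
    "\<And>c f. f \<in> vecs K \<Longrightarrow> A (c \<cdot>\<^sub>v f) = c \<cdot>\<^sub>v A f"
    and v: "f \<in> vecs K" "g \<in> vecs K"
  shows "htrace K (A \<circ> ketbra K f g) = ip K g (A f)"
proof -
  have *: "((\<lambda>b. ip K b ((A \<circ> ketbra K f g) b)) has_sum ip K g (A f)) S" if S: "onb K S" for S
  proof -
    have "S \<subseteq> vecs K" using S total_setD(1) by (auto simp: onb_def)
    then have eq: "ip K b ((A \<circ> ketbra K f g) b) = ip K g b * ip K b (A f)" if "b \<in> S" for b
      using that A v by (auto simp: ketbra_apply ip_scale_right subset_iff)
    show ?thesis using parseval[OF S v(2) A(1)[OF v(1)]] by (subst has_sum_cong[OF eq])
  qed
  show ?thesis unfolding htrace_def
    by (rule the_equality) (use * assms(1) has_sum_unique in blast)+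
qed

lemma finite_onb_expand:
  assumes S: "onb K S" "finite S" and f: "f \<in> vecs K"
  shows "f = (\<Sum>b\<in>S. ip K b f \<cdot>\<^sub>v b)"
proof -
  have tot: "total_set K S" and on: "\<And>b b'. b \<in> S \<Longrightarrow> b' \<in> S \<Longrightarrow> ip K b b' = (if b = b' then 1 else 0)"
    using S by (auto simp: onb_def)
  note Sv = total_setD(1)[OF tot]
  show ?thesis
  proof (rule vec_eqI_total[OF tot f])
    show "(\<Sum>b\<in>S. ip K b f \<cdot>\<^sub>v b) \<in> vecs K" using Sv by (intro sum_vecs) auto
    fix a assume a: "a \<in> S"
    have "ip K a (\<Sum>b\<in>S. ip K b f \<cdot>\<^sub>v b) = (\<Sum>b\<in>S. ip K b f * ip K a b)"
      using Sv a by (subst ip_sum_right) (auto simp: ip_scale_right subset_iff)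
    also have "\<dots> = (\<Sum>b\<in>S. if b = a then ip K a f else 0)"
    proof (rule sum.cong)
      fix b assume "b \<in> S"
      then show "ip K b f * ip K a b = (if b = a then ip K a f else 0)" using on[of a b] a by auto
    qed simp
    finally show "ip K a f = ip K a (\<Sum>b\<in>S. ip K b f \<cdot>\<^sub>v b)" using S(2) a by simp
  qed
qed

text \<open>Expanding each b in S0 turns the sum over any other basis into finitely many Parseval
  sums, whence basis independence.\<close>

lemma htrace_finite:
  assumes S0: "onb K S0" "finite S0" and A: "A \<in> bop K"
  shows "htrace K A = (\<Sum>b\<in>S0. ip K b (A b))"
proof -
  have S0v: "S0 \<subseteq> vecs K" using S0 total_setD(1) by (auto simp: onb_def)
  have *: "((\<lambda>b. ip K b (A b)) has_sum (\<Sum>e\<in>S0. ip K e (A e))) S" if S: "onb K S" for S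
  proof -
    have Sv: "S \<subseteq> vecs K" using S total_setD(1) by (auto simp: onb_def)
    have eq: "ip K b (A b) = (\<Sum>e\<in>S0. ip K e b * ip K b (A e))" if b: "b \<in> S" for b
    proof -
      have bv: "b \<in> vecs K" using b Sv by blast
      have "A b = (\<Sum>e\<in>S0. ip K e b \<cdot>\<^sub>v A e)"
        by (subst finite_onb_expand[OF S0 bv], subst bop_sum[OF A])
          (use S0v A in \<open>auto simp: bop_scale subset_iff intro!: sum.cong\<close>)
      then show ?thesis using S0v A bv by (simp add: ip_sum_right ip_scale_right subset_iff)
    qed
    have "((\<lambda>b. \<Sum>e\<in>S0. ip K e b * ip K b (A e)) has_sum (\<Sum>e\<in>S0. ip K e (A e))) S"
    proof -
      have "((\<lambda>b. ip K e b * ip K b (A e)) has_sum ip K e (A e)) S" if "e \<in> S0" for e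
        using S0v A that by (intro parseval[OF S]) auto
      with S0(2) show ?thesis by (induction S0) (auto intro: has_sum_add)
    qed
    then show ?thesis by (subst has_sum_cong[OF eq])
  qed
  show ?thesis unfolding htrace_def
    by (rule the_equality) (use * S0(1) has_sum_unique in blast)+
qed

subsection \<open>Isometries and unitary operators\<close>

text \<open>The graph of the would-be linear map sending each s a to w a. It is a relation because
  the s a may be linearly dependent; single-valuedness is proved afterwards from the scalar
  products.\<close>

inductive pair_span :: "('i \<Rightarrow> 'x cvec) \<Rightarrow> ('i \<Rightarrow> 'x cvec) \<Rightarrow> 'i set \<Rightarrow> 'x cvec \<Rightarrow> 'x cvec \<Rightarrow> bool"
  for s w I where
  zero: "pair_span s w I 0 0"
| step: "a \<in> I \<Longrightarrow> pair_span s w I f g \<Longrightarrow> pair_span s w I (c \<cdot>\<^sub>v s a + f) (c \<cdot>\<^sub>v w a + g)"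

lemma pair_span_add:
  "pair_span s w I f g \<Longrightarrow> pair_span s w I f' g' \<Longrightarrow> pair_span s w I (f + f') (g + g')"
  by (induction rule: pair_span.induct) (auto simp: add.assoc intro: pair_span.intros)

lemma pair_span_scale: "pair_span s w I f g \<Longrightarrow> pair_span s w I (c \<cdot>\<^sub>v f) (c \<cdot>\<^sub>v g)"
  by (induction rule: pair_span.induct) (auto simp: scale_distrib intro: pair_span.intros)

lemma pair_span_vspan: "f \<in> vspan (s ` I) \<Longrightarrow> \<exists>g. pair_span s w I f g"
proof (induction rule: vspan_induct)
  case zero
  show ?case using pair_span.zero by blast
next
  case (step b f c)
  from step(1) obtain a where a: "b = s a" "a \<in> I" by auto
  from step(3) obtain g where g: "pair_span s w I f g" by auto
  show ?case unfolding a(1) using pair_span.step[OF a(2) g, of c] by auto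
qed

text \<open>Equal Gram matrices mean that every linear relation among the s a also holds among the w
  a. All operators prescribed on elementary tensors are obtained through this lemma.\<close>

lemma isometry_extension:
  fixes s w :: "'i \<Rightarrow> 'x cvec"
  assumes s: "\<And>a. a \<in> I \<Longrightarrow> s a \<in> vecs K" and w: "\<And>a. a \<in> I \<Longrightarrow> w a \<in> vecs K"
    and iso: "\<And>a b. a \<in> I \<Longrightarrow> b \<in> I \<Longrightarrow> ip K (w a) (w b) = ip K (s a) (s b)"
    and tot: "total_set K (s ` I)"
  obtains W where "W \<in> bop K" "\<And>a. a \<in> I \<Longrightarrow> W (s a) = w a"
proof -
  let ?P = "pair_span s w I"
  have Pv: "f \<in> vecs K \<and> g \<in> vecs K" if "?P f g" for f g
    using that by (induction rule: pair_span.induct) (auto intro: s w)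
  have 1: "ip K (w a) g = ip K (s a) f" if "?P f g" "a \<in> I" for f g a
    using that
  proof (induction rule: pair_span.induct)
    case (step b f g c)
    then show ?case using Pv[of f g] s w by (simp add: ip_simps iso)
  qed (use s w in auto)
  have 2: "ip K g g' = ip K f f'" if "?P f g" "?P f' g'" for f g f' g'
    using that(1)
  proof (induction rule: pair_span.induct)
    case (step b f g c)
    then show ?case using Pv[of f g] Pv[OF that(2)] s w 1[OF that(2)] by (simp add: ip_simps)
  qed (use Pv[OF that(2)] in auto)
  have nrm: "hnorm K g = hnorm K f" if "?P f g" for f g
    using 2[OF that that] by (simp add: hnorm_def)
  have diff: "?P (f - f') (g - g')" if "?P f g" "?P f' g'" for f g f' g'
    using pair_span_add[OF that(1) pair_span_scale[OF that(2), of "-1"]] by simp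
  \<comment> \<open>The image of f is pinned down by its distances to all pairs of the graph. This
    formulation determines g and makes no reference to the approximating sequence.\<close>
  have "\<exists>g\<in>vecs K. \<forall>f' g'. ?P f' g' \<longrightarrow> hnorm K (g - g') \<le> hnorm K (f - f')" if f: "f \<in> vecs K" for f
  proof -
    have "\<exists>f' g'. ?P f' g' \<and> hnorm K (f - f') < 1 / Suc n" for n
    proof -
      obtain f' where "f' \<in> vspan (s ` I)" "hnorm K (f - f') < 1 / Suc n"
        using total_setD(2)[OF tot f, of "1 / Suc n"] by auto
      then show ?thesis using pair_span_vspan by blast
    qed
    then obtain fn gn where n: "\<And>n. ?P (fn n) (gn n)" "\<And>n. hnorm K (f - fn n) < 1 / Suc n" by metis
    have v: "fn n \<in> vecs K" "gn n \<in> vecs K" for n using Pv[OF n(1)] by auto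
    have nm: "hnorm K (fn n - f) \<le> 1 / Suc n" for n
      using n(2)[of n] hnorm_minus_commute[OF f v(1)[of n]] by simp
    obtain g where g: "lims gn g"
    proof (rule complete[OF v(2)])
      fix i j
      have "hnorm K (gn i - gn j) = hnorm K (fn i - fn j)" using nrm[OF diff[OF n(1) n(1)]] .
      also have "\<dots> \<le> hnorm K (fn i - f) + hnorm K (f - fn j)" using v f by (intro hnorm_triangle_diff) auto
      finally show "hnorm K (gn i - gn j) \<le> 1 / Suc i + 1 / Suc j" using nm[of i] n(2)[of j] by linarith
    next
      show "(\<lambda>n. 1 / real (Suc n)) \<longlonglongrightarrow> 0" by (rule LIMSEQ_const_over_Suc)
    qed blast
    have "hnorm K (g - g') \<le> hnorm K (f - f')" if p: "?P f' g'" for f' g'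
    proof (rule field_le_epsilon)
      fix e :: real assume "e > 0"
      then obtain N where N: "1 / Suc N < e" using nat_approx_posE by blast
      note v' = Pv[OF p] lims_vecs(2)[OF g]
      have sh: "lims (\<lambda>n. gn (n + N)) g"
        using g unfolding lims_def by (auto intro: LIMSEQ_ignore_initial_segment)
      show "hnorm K (g - g') \<le> hnorm K (f - f') + e"
      proof (rule lims_hnorm_le[OF sh])
        fix n
        have "hnorm K (gn (n + N) - g') = hnorm K (fn (n + N) - f')" using nrm[OF diff[OF n(1) p]] .
        also have "\<dots> \<le> hnorm K (fn (n + N) - f) + hnorm K (f - f')"
          using v f v' by (intro hnorm_triangle_diff) auto
        also have "hnorm K (fn (n + N) - f) \<le> 1 / Suc (n + N)" by (rule nm)
        also have "\<dots> \<le> 1 / Suc N" by (rule divide_left_mono) auto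
        finally show "hnorm K (gn (n + N) - g') \<le> hnorm K (f - f') + e" using N by linarith
      qed (use v' in blast)
    qed
    then show ?thesis using lims_vecs(2)[OF g] by blast
  qed
  then obtain W0 where W0: "\<And>f. f \<in> vecs K \<Longrightarrow> W0 f \<in> vecs K"
    "\<And>f f' g'. f \<in> vecs K \<Longrightarrow> ?P f' g' \<Longrightarrow> hnorm K (W0 f - g') \<le> hnorm K (f - f')" by metis
  define W where "W f = (if f \<in> vecs K then W0 f else 0)" for f
  have W: "W f \<in> vecs K" "f \<in> vecs K \<Longrightarrow> ?P f' g' \<Longrightarrow> hnorm K (W f - g') \<le> hnorm K (f - f')" for f f' g'
    using W0 by (auto simp: W_def)
  have WP: "W f = g" if "?P f g" for f g
  proof -
    have "hnorm K (W f - g) \<le> 0" using W(2)[OF _ that, of f] Pv[OF that] by simp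
    then have "hnorm K (W f - g) = 0" using hnorm_nonneg[of "W f - g"] W(1)[of f] Pv[OF that] by (intro antisym) auto
    then show ?thesis using W(1)[of f] Pv[OF that] by simp
  qed
  have appr: "\<exists>f' g'. ?P f' g' \<and> hnorm K (f - f') < \<epsilon>" if "f \<in> vecs K" "\<epsilon> > 0" for f \<epsilon>
    using total_setD(2)[OF tot that] pair_span_vspan by blast
  have "W \<in> bop K"
  proof (rule bopI[where C = 1])
    fix f assume f: "f \<in> vecs K"
    show "hnorm K (W f) \<le> 1 * hnorm K f" using W(2)[OF f pair_span.zero] by simp
    fix g c assume g: "g \<in> vecs K"
    show "W (c \<cdot>\<^sub>v f + g) = c \<cdot>\<^sub>v W f + W g"
    proof (rule vec_eqI_small)
      \<comment> \<open>Both sides are compared with c g1 + g2, and each comparison costs (|c| + 1)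
        \<epsilon>.\<close>
      show "2 * cmod c + 2 \<ge> 0" by simp
      fix \<epsilon> :: real assume "\<epsilon> > 0"
      obtain f1 g1 where 1: "?P f1 g1" "hnorm K (f - f1) < \<epsilon>" using appr[OF f \<open>\<epsilon> > 0\<close>] by blast
      obtain f2 g2 where 2: "?P f2 g2" "hnorm K (g - f2) < \<epsilon>" using appr[OF g \<open>\<epsilon> > 0\<close>] by blast
      note v = Pv[OF 1(1)] Pv[OF 2(1)] f g W(1)[of f] W(1)[of g] W(1)[of "c \<cdot>\<^sub>v f + g"]
      have P: "?P (c \<cdot>\<^sub>v f1 + f2) (c \<cdot>\<^sub>v g1 + g2)" using 1 2 by (intro pair_span_add pair_span_scale)
      have b: "hnorm K (c \<cdot>\<^sub>v x + y) \<le> (cmod c + 1) * \<epsilon>"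
        if "x \<in> vecs K" "y \<in> vecs K" "hnorm K x < \<epsilon>" "hnorm K y < \<epsilon>" for x y
        using hnorm_triangle[of "c \<cdot>\<^sub>v x" y] that mult_left_mono[of "hnorm K x" \<epsilon> "cmod c"]
        by (simp add: hnorm_scale algebra_simps)
      have "hnorm K (W (c \<cdot>\<^sub>v f + g) - (c \<cdot>\<^sub>v g1 + g2)) \<le> hnorm K (c \<cdot>\<^sub>v f + g - (c \<cdot>\<^sub>v f1 + f2))"
        using v by (intro W(2)[OF _ P]) auto
      also have "c \<cdot>\<^sub>v f + g - (c \<cdot>\<^sub>v f1 + f2) = c \<cdot>\<^sub>v (f - f1) + (g - f2)" by (simp add: scale_distrib)
      also have "hnorm K \<dots> \<le> (cmod c + 1) * \<epsilon>" using 1 2 v by (intro b) auto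
      finally have A: "hnorm K (W (c \<cdot>\<^sub>v f + g) - (c \<cdot>\<^sub>v g1 + g2)) \<le> (cmod c + 1) * \<epsilon>" .
      have "hnorm K (g1 - W f) < \<epsilon>" "hnorm K (g2 - W g) < \<epsilon>"
        using W(2)[OF f 1(1)] W(2)[OF g 2(1)] 1(2) 2(2) v
        by (simp_all add: hnorm_minus_commute[of g1 "W f"] hnorm_minus_commute[of g2 "W g"])
      then have "hnorm K (c \<cdot>\<^sub>v (g1 - W f) + (g2 - W g)) \<le> (cmod c + 1) * \<epsilon>" using v by (intro b) auto
      also have "c \<cdot>\<^sub>v (g1 - W f) + (g2 - W g) = c \<cdot>\<^sub>v g1 + g2 - (c \<cdot>\<^sub>v W f + W g)" by (simp add: scale_distrib)
      finally have B: "hnorm K (c \<cdot>\<^sub>v g1 + g2 - (c \<cdot>\<^sub>v W f + W g)) \<le> (cmod c + 1) * \<epsilon>" .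
      have "hnorm K (W (c \<cdot>\<^sub>v f + g) - (c \<cdot>\<^sub>v W f + W g)) \<le>
          hnorm K (W (c \<cdot>\<^sub>v f + g) - (c \<cdot>\<^sub>v g1 + g2)) + hnorm K (c \<cdot>\<^sub>v g1 + g2 - (c \<cdot>\<^sub>v W f + W g))"
        using v by (intro hnorm_triangle_diff) auto
      then show "hnorm K (W (c \<cdot>\<^sub>v f + g) - (c \<cdot>\<^sub>v W f + W g)) \<le> (2 * cmod c + 2) * \<epsilon>"
        using A B by (simp add: algebra_simps)
    qed (use f g W(1) in auto)
  qed (auto simp: W_def W0)
  moreover have "W (s a) = w a" if "a \<in> I" for a
    using WP[of "s a" "w a"] pair_span.step[OF that pair_span.zero, of s w 1] by simp
  ultimately show thesis using that by blast
qed

lemma unitary_bop: "unitary_op K W \<Longrightarrow> W \<in> bop K"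
  by (simp add: unitary_op_def)

lemma unitary_simps:
  assumes "unitary_op K W" "f \<in> vecs K"
  shows "adj K W (W f) = f" "W (adj K W f) = f"
proof -
  have "(adj K W \<circ> W) f = f" "(W \<circ> adj K W) f = f" using assms by (simp_all add: unitary_op_def)
  then show "adj K W (W f) = f" "W (adj K W f) = f" by simp_all
qed

lemma unitary_ip:
  assumes "unitary_op K W" "f \<in> vecs K" "g \<in> vecs K"
  shows "ip K (W f) (W g) = ip K f g"
  using ip_adj[of W "W f" g] unitary_simps(1)[OF assms(1,2)] unitary_bop[OF assms(1)] assms(2,3) by simp

lemma unitary_adj: "unitary_op K W \<Longrightarrow> unitary_op K (adj K W)"
  by (auto simp: unitary_op_def adj_adj)

lemma unitary_comp:
  assumes "unitary_op K V" "unitary_op K W"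
  shows "unitary_op K (V \<circ> W)"
proof -
  note b = unitary_bop[OF assms(1)] unitary_bop[OF assms(2)]
  show ?thesis
    unfolding unitary_op_def adj_comp[OF b]
    using b assms by (auto intro!: bop_ext simp: unitary_simps)
qed

text \<open>Isometry on a total set gives the left inverse, and W' gives the right inverse; this
  avoids having to discuss the range of W.\<close>

lemma unitary_op_total:
  assumes tot: "total_set K S" and W: "W \<in> bop K" "W' \<in> bop K"
    and iso: "\<And>a b. a \<in> S \<Longrightarrow> b \<in> S \<Longrightarrow> ip K (W a) (W b) = ip K a b"
    and inv: "\<And>a. a \<in> S \<Longrightarrow> W (W' a) = a"
  shows "unitary_op K W" "adj K W = W'"
proof -
  note Sv = total_setD(1)[OF tot]
  have "adj K W \<circ> W = id_op K"
  proof (rule bop_eqI_total[OF tot])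
    fix b assume b: "b \<in> S"
    have "adj K W (W b) = b"
    proof (rule vec_eqI_total[OF tot])
      fix a assume a: "a \<in> S"
      have "ip K a (adj K W (W b)) = cnj (ip K (adj K W (W b)) a)" using a b Sv W by (simp add: ip_cnj subset_iff)
      also have "\<dots> = cnj (ip K (W b) (W a))" using a b Sv W by (simp add: ip_adj subset_iff)
      also have "\<dots> = ip K a b" using a b Sv by (simp add: iso ip_cnj subset_iff)
      finally show "ip K a (adj K W (W b)) = ip K a b" .
    qed (use b Sv W in auto)
    then show "(adj K W \<circ> W) b = id_op K b" using b Sv by auto
  qed (use W in auto)
  moreover have WW': "W \<circ> W' = id_op K"
    by (rule bop_eqI_total[OF tot]) (use W inv Sv in auto)
  ultimately show a: "adj K W = W'"
    \<comment> \<open>The adjoint of W, composed with W W' = 1, collapses to W'.\<close>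
    using W by (metis adj_bop comp_assoc id_comp)
  show "unitary_op K W" unfolding unitary_op_def a using W WW' \<open>adj K W \<circ> W = id_op K\<close> a by simp
qed

definition conj_by :: "'x operator \<Rightarrow> 'x operator \<Rightarrow> 'x operator"
  where "conj_by W A = adj K W \<circ> A \<circ> W"

lemma conj_by_bop [simp, intro]: "W \<in> bop K \<Longrightarrow> A \<in> bop K \<Longrightarrow> conj_by W A \<in> bop K"
  by (simp add: conj_by_def)

lemma conj_by_simps:
  assumes "unitary_op K W"
  shows "A \<in> bop K \<Longrightarrow> B \<in> bop K \<Longrightarrow> conj_by W (A + B) = conj_by W A + conj_by W B"
    "A \<in> bop K \<Longrightarrow> B \<in> bop K \<Longrightarrow> conj_by W (A - B) = conj_by W A - conj_by W B"
    "A \<in> bop K \<Longrightarrow> conj_by W (c \<cdot>\<^sub>o A) = c \<cdot>\<^sub>o conj_by W A"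
    "A \<in> bop K \<Longrightarrow> B \<in> bop K \<Longrightarrow> conj_by W (A \<circ> B) = conj_by W A \<circ> conj_by W B"
    "A \<in> bop K \<Longrightarrow> conj_by W (adj K A) = adj K (conj_by W A)"
    "conj_by W (id_op K) = id_op K"
    "A \<in> bop K \<Longrightarrow> conj_by (adj K W) (conj_by W A) = A"
    "A \<in> bop K \<Longrightarrow> conj_by W (conj_by (adj K W) A) = A"
proof -
  note b = unitary_bop[OF assms(1)]
  show "conj_by W (A + B) = conj_by W A + conj_by W B" if "A \<in> bop K" "B \<in> bop K"
    using b assms that by (auto intro!: bop_ext simp: conj_by_def bop_add plus_fun_apply[of A B]
        plus_fun_apply[of "adj K W \<circ> A \<circ> W" "adj K W \<circ> B \<circ> W"])
  show "conj_by W (A - B) = conj_by W A - conj_by W B" if "A \<in> bop K" "B \<in> bop K"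
    using b assms that by (auto intro!: bop_ext simp: conj_by_def bop_diff minus_apply[of A B]
        minus_apply[of "adj K W \<circ> A \<circ> W" "adj K W \<circ> B \<circ> W"])
  show "conj_by W (c \<cdot>\<^sub>o A) = c \<cdot>\<^sub>o conj_by W A" if "A \<in> bop K"
    using b assms that by (auto intro!: bop_ext simp: conj_by_def bop_scale scale_op_apply)
  show "conj_by W (A \<circ> B) = conj_by W A \<circ> conj_by W B" if "A \<in> bop K" "B \<in> bop K"
    using b assms that by (auto intro!: bop_ext simp: conj_by_def unitary_simps)
  show "conj_by W (adj K A) = adj K (conj_by W A)" if "A \<in> bop K"
    using b assms that by (simp add: conj_by_def adj_comp adj_adj comp_assoc)
  show "conj_by W (id_op K) = id_op K"
    using b assms by (auto intro!: bop_ext simp: conj_by_def unitary_simps)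
  show "conj_by (adj K W) (conj_by W A) = A" "conj_by W (conj_by (adj K W) A) = A" if "A \<in> bop K"
    using b assms that by (auto intro!: bop_ext simp: conj_by_def unitary_simps adj_adj)
qed

lemma conj_by_comp:
  assumes "V \<in> bop K" "W \<in> bop K"
  shows "conj_by (V \<circ> W) A = conj_by W (conj_by V A)"
  using assms by (simp add: conj_by_def adj_comp comp_assoc)

text \<open>Conjugation by a unitary does not increase the norm, and neither does its
  inverse.\<close>

lemma opnorm_conj_by:
  assumes "unitary_op K W" "A \<in> bop K"
  shows "opnorm K (conj_by W A) = opnorm K A"
proof -
  have nrm: "hnorm K (V f) = hnorm K f" if "unitary_op K V" "f \<in> vecs K" for V f
    using unitary_ip[OF that(1) that(2) that(2)] by (simp add: hnorm_def)
  have le: "opnorm K (conj_by V B) \<le> opnorm K B" if V: "unitary_op K V" and B: "B \<in> bop K" for V B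
  proof (rule opnorm_le)
    show "opnorm K B \<ge> 0" using B by (rule opnorm_nonneg)
    fix f assume f: "f \<in> vecs K"
    note b = unitary_bop[OF V]
    have "hnorm K (conj_by V B f) = hnorm K (B (V f))"
      using nrm[OF unitary_adj[OF V], of "B (V f)"] b B f by (simp add: conj_by_def)
    also have "\<dots> \<le> opnorm K B * hnorm K (V f)" using b B f by (intro opnorm_bound) auto
    finally show "hnorm K (conj_by V B f) \<le> opnorm K B * hnorm K f" by (simp add: nrm[OF V f])
  qed
  have "opnorm K A = opnorm K (conj_by (adj K W) (conj_by W A))" using assms by (simp add: conj_by_simps)
  also have "\<dots> \<le> opnorm K (conj_by W A)"
    using assms unitary_bop by (intro le unitary_adj) auto
  finally show ?thesis using le[OF assms] by simp
qed

subsection \<open>C*-algebras generated by operators\<close>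

definition cstar_gen :: "'x operator set \<Rightarrow> 'x operator set"
  where "cstar_gen G = \<Inter>{\<BB>. cstar_subalgebra K \<BB> \<and> G \<subseteq> \<BB>}"

lemma cstar_subalgebraD:
  assumes "cstar_subalgebra K \<BB>"
  shows "A \<in> \<BB> \<Longrightarrow> A \<in> bop K" "id_op K \<in> \<BB>" "A \<in> \<BB> \<Longrightarrow> B \<in> \<BB> \<Longrightarrow> A + B \<in> \<BB>"
    "A \<in> \<BB> \<Longrightarrow> B \<in> \<BB> \<Longrightarrow> A \<circ> B \<in> \<BB>" "A \<in> \<BB> \<Longrightarrow> c \<cdot>\<^sub>o A \<in> \<BB>" "A \<in> \<BB> \<Longrightarrow> adj K A \<in> \<BB>"
    "A \<in> bop K \<Longrightarrow> (\<And>\<epsilon>. \<epsilon> > 0 \<Longrightarrow> \<exists>B\<in>\<BB>. opnorm K (A - B) < \<epsilon>) \<Longrightarrow> A \<in> \<BB>"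
  using assms by (auto simp: cstar_subalgebra_def)

lemma cstar_gen_least: "cstar_subalgebra K \<BB> \<Longrightarrow> G \<subseteq> \<BB> \<Longrightarrow> cstar_gen G \<subseteq> \<BB>"
  by (auto simp: cstar_gen_def)

lemma cstar_gen_base: "A \<in> G \<Longrightarrow> A \<in> cstar_gen G"
  by (auto simp: cstar_gen_def)

lemma cstar_subalgebra_gen:
  assumes "G \<subseteq> bop K"
  shows "cstar_subalgebra K (cstar_gen G)"
  unfolding cstar_subalgebra_def[of _ "cstar_gen G"]
proof (intro conjI ballI allI impI)
  show "cstar_gen G \<subseteq> bop K" using cstar_gen_least[OF cstar_subalgebra_bop assms] .
  show "id_op K \<in> cstar_gen G" by (auto simp: cstar_gen_def dest: cstar_subalgebraD)
  show "A + B \<in> cstar_gen G" "A \<circ> B \<in> cstar_gen G" if "A \<in> cstar_gen G" "B \<in> cstar_gen G" for A B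
    using that by (auto simp: cstar_gen_def intro: cstar_subalgebraD(3,4))
  show "c \<cdot>\<^sub>o A \<in> cstar_gen G" if "A \<in> cstar_gen G" for A c
    using that by (auto simp: cstar_gen_def intro: cstar_subalgebraD(5))
  show "adj K A \<in> cstar_gen G" if "A \<in> cstar_gen G" for A
    using that by (auto simp: cstar_gen_def intro: cstar_subalgebraD(6))
  fix A assume A: "A \<in> bop K" "\<forall>\<epsilon>>0. \<exists>B\<in>cstar_gen G. opnorm K (A - B) < \<epsilon>"
  show "A \<in> cstar_gen G"
    unfolding cstar_gen_def
  proof (rule InterI)
    fix \<BB> assume B: "\<BB> \<in> {\<BB>. cstar_subalgebra K \<BB> \<and> G \<subseteq> \<BB>}"
    then show "A \<in> \<BB>"
      using A cstar_gen_least[of \<BB> G] by (intro cstar_subalgebraD(7)[of \<BB>]) blast+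
  qed
qed

lemma cstar_sum:
  assumes "cstar_subalgebra K \<BB>" "\<And>a. a \<in> I \<Longrightarrow> A a \<in> \<BB>"
  shows "(\<Sum>a\<in>I. A a) \<in> \<BB>"
proof -
  have "0 \<cdot>\<^sub>o id_op K \<in> \<BB>" using assms(1) cstar_subalgebraD by blast
  moreover have "0 \<cdot>\<^sub>o id_op K = 0" by (simp add: fun_eq_iff pointwise)
  ultimately have "0 \<in> \<BB>" by simp
  then show ?thesis using assms(2)
    by (induction I rule: infinite_finite_induct) (auto intro: cstar_subalgebraD(3)[OF assms(1)])
qed

lemma cstar_minus:
  assumes "cstar_subalgebra K \<BB>" "A \<in> \<BB>" "B \<in> \<BB>"
  shows "A - B \<in> \<BB>"
  using cstar_subalgebraD(3)[OF assms(1,2) cstar_subalgebraD(5)[OF assms(1,3), of "-1"]]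
  by (simp add: scale_op_minus_one)

text \<open>The operators whose conjugates lie in the generated algebra form a C*-algebra, so it
  suffices to look at generators.\<close>

lemma conj_by_gen:
  assumes G: "G \<subseteq> bop K" and W: "unitary_op K W"
    and conj: "\<And>A. A \<in> G \<Longrightarrow> conj_by W A \<in> cstar_gen G" and A: "A \<in> cstar_gen G"
  shows "conj_by W A \<in> cstar_gen G"
proof -
  note C = cstar_subalgebraD[OF cstar_subalgebra_gen[OF G]]
  define \<BB> where "\<BB> = {A \<in> bop K. conj_by W A \<in> cstar_gen G}"
  have "cstar_subalgebra K \<BB>"
    unfolding cstar_subalgebra_def
  proof (intro conjI ballI allI impI)
    show "\<BB> \<subseteq> bop K" by (auto simp: \<BB>_def)
    show "id_op K \<in> \<BB>" using W C(2) conj_by_simps(6)[OF W] by (simp add: \<BB>_def)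
    fix A assume A: "A \<in> \<BB>"
    show "c \<cdot>\<^sub>o A \<in> \<BB>" for c using A W C(5) by (auto simp: \<BB>_def conj_by_simps)
    show "adj K A \<in> \<BB>" using A W C(6) by (auto simp: \<BB>_def conj_by_simps)
    fix B assume B: "B \<in> \<BB>"
    show "A + B \<in> \<BB>" using A B W C(3) by (auto simp: \<BB>_def conj_by_simps)
    show "A \<circ> B \<in> \<BB>" using A B W C(4) by (auto simp: \<BB>_def conj_by_simps)
  next
    fix A assume A: "A \<in> bop K" "\<forall>\<epsilon>>0. \<exists>B\<in>\<BB>. opnorm K (A - B) < \<epsilon>"
    have "conj_by W A \<in> cstar_gen G"
    proof (rule C(7))
      show "conj_by W A \<in> bop K" using A W unitary_bop by auto
      fix \<epsilon> :: real assume "\<epsilon> > 0"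
      then obtain B where B: "B \<in> \<BB>" "opnorm K (A - B) < \<epsilon>" using A(2) by blast
      then have "opnorm K (conj_by W A - conj_by W B) < \<epsilon>"
        using A(1) W by (simp add: \<BB>_def opnorm_conj_by flip: conj_by_simps)
      then show "\<exists>B\<in>cstar_gen G. opnorm K (conj_by W A - B) < \<epsilon>" using B(1) by (auto simp: \<BB>_def)
    qed
    then show "A \<in> \<BB>" using A(1) by (simp add: \<BB>_def)
  qed
  moreover have "G \<subseteq> \<BB>" using G conj by (auto simp: \<BB>_def)
  ultimately show ?thesis using cstar_gen_least A by (auto simp: \<BB>_def)
qed

lemma star_automorphism_conj_by:
  assumes \<BB>: "cstar_subalgebra K \<BB>" and W: "unitary_op K W"
    and "\<And>A. A \<in> \<BB> \<Longrightarrow> conj_by W A \<in> \<BB>" "\<And>A. A \<in> \<BB> \<Longrightarrow> conj_by (adj K W) A \<in> \<BB>"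
  shows "star_automorphism K \<BB> (conj_by W)"
proof -
  note C = cstar_subalgebraD[OF \<BB>]
  have "bij_betw (conj_by W) \<BB> \<BB>"
    by (rule bij_betwI[where g = "conj_by (adj K W)"])
      (use assms C(1) in \<open>auto simp: conj_by_simps\<close>)
  then show ?thesis
    unfolding star_automorphism_def using W C(1) by (simp add: conj_by_simps opnorm_conj_by)
qed

lemma star_automorphism_cong:
  assumes \<BB>: "cstar_subalgebra K \<BB>" and \<theta>: "star_automorphism K \<BB> \<theta>"
    and eq: "\<And>A. A \<in> \<BB> \<Longrightarrow> \<theta>' A = \<theta> A"
  shows "star_automorphism K \<BB> \<theta>'"
proof -
  note C = cstar_subalgebraD[OF \<BB>]
  have "bij_betw \<theta>' \<BB> \<BB>" using \<theta> eq bij_betw_cong[of \<BB> \<theta>' \<theta>] by (simp add: star_automorphism_def)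
  then show ?thesis using \<theta> eq C unfolding star_automorphism_def by simp
qed

text \<open>The operators on which both automorphisms agree form a C*-algebra containing the
  generators. Closedness comes from the preservation of norms in
  \<open>star_automorphism\<close>.\<close>

lemma star_automorphism_unique:
  assumes G: "G \<subseteq> bop K"
    and \<theta>: "star_automorphism K (cstar_gen G) \<theta>" "star_automorphism K (cstar_gen G) \<theta>'"
    and eq: "\<And>A. A \<in> G \<Longrightarrow> \<theta> A = \<theta>' A" and A: "A \<in> cstar_gen G"
  shows "\<theta> A = \<theta>' A"
proof -
  note C = cstar_subalgebraD[OF cstar_subalgebra_gen[OF G]]
  have props: "bij_betw \<eta> (cstar_gen G) (cstar_gen G)" "\<And>A. A \<in> cstar_gen G \<Longrightarrow> \<eta> A \<in> cstar_gen G"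
    "\<And>A B. A \<in> cstar_gen G \<Longrightarrow> B \<in> cstar_gen G \<Longrightarrow> \<eta> (A + B) = \<eta> A + \<eta> B"
    "\<And>A B. A \<in> cstar_gen G \<Longrightarrow> B \<in> cstar_gen G \<Longrightarrow> \<eta> (A \<circ> B) = \<eta> A \<circ> \<eta> B"
    "\<And>A c. A \<in> cstar_gen G \<Longrightarrow> \<eta> (c \<cdot>\<^sub>o A) = c \<cdot>\<^sub>o \<eta> A"
    "\<And>A. A \<in> cstar_gen G \<Longrightarrow> \<eta> (adj K A) = adj K (\<eta> A)"
    "\<And>A. A \<in> cstar_gen G \<Longrightarrow> opnorm K (\<eta> A) = opnorm K A"
    if "star_automorphism K (cstar_gen G) \<eta>" for \<eta>
    using that bij_betwE unfolding star_automorphism_def by blast+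
  note p = props[OF \<theta>(1)] and p' = props[OF \<theta>(2)]
  \<comment> \<open>The unit is preserved because it has a preimage B: multiplying by the image of
    the unit must leave the image of B fixed.\<close>
  have ide: "\<eta> (id_op K) = id_op K" if "star_automorphism K (cstar_gen G) \<eta>" for \<eta>
  proof -
    note q = props[OF that]
    obtain B where B: "B \<in> cstar_gen G" "\<eta> B = id_op K"
      using q(1) C(2) by (metis bij_betw_imp_surj_on imageE)
    have "id_op K = \<eta> (id_op K \<circ> B)" using B C(1) by simp
    also have "\<dots> = \<eta> (id_op K) \<circ> id_op K" using q(4)[OF C(2) B(1)] B(2) by simp
    also have "\<dots> = \<eta> (id_op K)" using q(2)[OF C(2)] C(1) by simp
    finally show ?thesis ..
  qed
  have minus: "\<eta> (A - B) = \<eta> A - \<eta> B"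
    if "star_automorphism K (cstar_gen G) \<eta>" "A \<in> cstar_gen G" "B \<in> cstar_gen G" for \<eta> A B
    using props(3)[OF that(1,2) C(5)[OF that(3), of "-1"]] props(5)[OF that(1,3), of "-1"]
    by (simp add: scale_op_minus_one)
  define \<BB> where "\<BB> = {A \<in> cstar_gen G. \<theta> A = \<theta>' A}"
  have "cstar_subalgebra K \<BB>"
    unfolding cstar_subalgebra_def
  proof (intro conjI ballI allI impI)
    show "\<BB> \<subseteq> bop K" using C(1) by (auto simp: \<BB>_def)
    show "id_op K \<in> \<BB>" using ide \<theta> C(2) by (simp add: \<BB>_def)
    fix A assume A: "A \<in> \<BB>"
    show "c \<cdot>\<^sub>o A \<in> \<BB>" for c using A C(5) p(5) p'(5) by (auto simp: \<BB>_def)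
    show "adj K A \<in> \<BB>" using A C(6) p(6) p'(6) by (auto simp: \<BB>_def)
    fix B assume B: "B \<in> \<BB>"
    show "A + B \<in> \<BB>" using A B C(3) p(3) p'(3) by (auto simp: \<BB>_def)
    show "A \<circ> B \<in> \<BB>" using A B C(4) p(4) p'(4) by (auto simp: \<BB>_def)
  next
    fix A assume A: "A \<in> bop K" "\<forall>\<epsilon>>0. \<exists>B\<in>\<BB>. opnorm K (A - B) < \<epsilon>"
    have AG: "A \<in> cstar_gen G" using A by (intro C(7)) (auto simp: \<BB>_def)
    note t = p(2)[OF AG] p'(2)[OF AG]
    have "\<theta> A = \<theta>' A"
    proof (rule bop_ext)
      fix f assume f: "f \<in> vecs K"
      show "\<theta> A f = \<theta>' A f"
      proof (rule vec_eqI_small)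
        show "2 * hnorm K f \<ge> 0" using f by simp
        fix \<epsilon> :: real assume "\<epsilon> > 0"
        then obtain B where B: "B \<in> \<BB>" "opnorm K (A - B) < \<epsilon>" using A(2) by blast
        have BG: "B \<in> cstar_gen G" using B by (simp add: \<BB>_def)
        have AB: "A - B \<in> cstar_gen G" using cstar_minus[OF cstar_subalgebra_gen[OF G] AG BG] .
        have est: "hnorm K (\<eta> A f - \<eta> B f) \<le> \<epsilon> * hnorm K f"
          if \<eta>: "star_automorphism K (cstar_gen G) \<eta>" for \<eta>
        proof -
          have "hnorm K (\<eta> (A - B) f) \<le> opnorm K (\<eta> (A - B)) * hnorm K f"
            using f by (intro opnorm_bound C(1) props(2)[OF \<eta>] AB)
          also have "\<dots> \<le> \<epsilon> * hnorm K f"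
            using B(2) f props(7)[OF \<eta> AB] by (intro mult_right_mono) auto
          finally show ?thesis by (simp add: minus[OF \<eta> AG BG] minus_apply)
        qed
        have e: "\<theta> B = \<theta>' B" using B by (simp add: \<BB>_def)
        note v = bop_vecs[OF C(1)[OF t(1)] f] bop_vecs[OF C(1)[OF t(2)] f] bop_vecs[OF C(1)[OF p(2)[OF BG]] f]
        have "hnorm K (\<theta> A f - \<theta>' A f) \<le> hnorm K (\<theta> A f - \<theta> B f) + hnorm K (\<theta> B f - \<theta>' A f)"
          using v by (intro hnorm_triangle_diff)
        also have "hnorm K (\<theta> B f - \<theta>' A f) = hnorm K (\<theta>' A f - \<theta>' B f)"
          using v hnorm_minus_commute unfolding e by blast
        finally show "hnorm K (\<theta> A f - \<theta>' A f) \<le> 2 * hnorm K f * \<epsilon>"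
          using est[OF \<theta>(1)] est[OF \<theta>(2)] by (simp add: algebra_simps)
      qed (use C(1) t f in auto)
    qed (use C(1) t in auto)
    then show "A \<in> \<BB>" using AG by (simp add: \<BB>_def)
  qed
  moreover have "G \<subseteq> \<BB>" using cstar_gen_base eq by (auto simp: \<BB>_def)
  ultimately show ?thesis using cstar_gen_least A by (auto simp: \<BB>_def)
qed

subsection \<open>Representations of continuous functions\<close>

lemma cont_star_homD:
  assumes "cont_star_hom X K \<pi>"
  shows "f \<in> cont_funs X \<Longrightarrow> \<pi> f \<in> bop K" "\<pi> (\<lambda>_. 1) = id_op K"
    "f \<in> cont_funs X \<Longrightarrow> g \<in> cont_funs X \<Longrightarrow> \<pi> (\<lambda>x. f x + g x) = \<pi> f + \<pi> g"
    "f \<in> cont_funs X \<Longrightarrow> g \<in> cont_funs X \<Longrightarrow> \<pi> (\<lambda>x. f x * g x) = \<pi> f \<circ> \<pi> g"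
    "f \<in> cont_funs X \<Longrightarrow> \<pi> (\<lambda>x. c * f x) = c \<cdot>\<^sub>o \<pi> f"
    "f \<in> cont_funs X \<Longrightarrow> \<pi> (\<lambda>x. cnj (f x)) = adj K (\<pi> f)"
  using assms by (auto simp: cont_star_hom_def)

lemma cont_star_hom_diff:
  assumes "cont_star_hom X K \<pi>" "f \<in> cont_funs X" "g \<in> cont_funs X"
  shows "\<pi> (\<lambda>x. f x - g x) = \<pi> f - \<pi> g"
proof -
  have "(\<lambda>x. - 1 * g x) \<in> cont_funs X"
    using assms(3) unfolding cont_funs_def by (auto intro: continuous_intros)
  then have "\<pi> (\<lambda>x. f x + - 1 * g x) = \<pi> f + \<pi> (\<lambda>x. - 1 * g x)"
    by (rule cont_star_homD(3)[OF assms(1,2)])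
  also have "\<pi> (\<lambda>x. - 1 * g x) = - 1 \<cdot>\<^sub>o \<pi> g" by (rule cont_star_homD(5)[OF assms(1,3)])
  finally show ?thesis by (simp add: scale_op_minus_one)
qed

text \<open>With \<open>g = sqrt (c\<^sup>2 - |f|\<^sup>2)\<close> we have \<open>\<parallel>\<pi> f v\<parallel>\<^sup>2 + \<parallel>\<pi> g v\<parallel>\<^sup>2 = c\<^sup>2 \<parallel>v\<parallel>\<^sup>2\<close>.\<close>

lemma contraction_of_complement:
  assumes A: "A \<in> bop K" and B: "B \<in> bop K"
    and eq: "(adj K A \<circ> A) + (adj K B \<circ> B) = complex_of_real (c\<^sup>2) \<cdot>\<^sub>o id_op K"
    and v: "v \<in> vecs K" and c: "c \<ge> 0"
  shows "hnorm K (A v) \<le> c * hnorm K v"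
proof (rule power2_le_imp_le)
  have "ip K (((adj K A \<circ> A) + (adj K B \<circ> B)) v) v = ip K (A v) (A v) + ip K (B v) (B v)"
    using A B v by (simp add: plus_fun_apply ip_add_left ip_adj)
  then have "of_real (c\<^sup>2) * ip K v v = ip K (A v) (A v) + ip K (B v) (B v)"
    unfolding eq using v by (simp add: scale_op_apply ip_scale_left)
  then have "Re (of_real (c\<^sup>2) * ip K v v) = (hnorm K (A v))\<^sup>2 + (hnorm K (B v))\<^sup>2"
    using A B v by (simp add: hnorm_power2)
  then show "(hnorm K (A v))\<^sup>2 \<le> (c * hnorm K v)\<^sup>2"
    using v by (simp add: hnorm_power2 power_mult_distrib)
qed (use v c in simp)

lemma sqrt_complement:
  assumes "cmod z \<le> c"
  shows "cnj z * z + cnj (of_real (sqrt (c\<^sup>2 - (cmod z)\<^sup>2))) * of_real (sqrt (c\<^sup>2 - (cmod z)\<^sup>2)) = of_real (c\<^sup>2) * 1"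
proof -
  have "(cmod z)\<^sup>2 \<le> c\<^sup>2" using assms by (rule power_mono) simp
  then have "sqrt (c\<^sup>2 - (cmod z)\<^sup>2) * sqrt (c\<^sup>2 - (cmod z)\<^sup>2) = c\<^sup>2 - (cmod z)\<^sup>2" by simp
  moreover have "cnj z * z = of_real ((cmod z)\<^sup>2)" by (simp only: complex_norm_square mult.commute)
  ultimately show ?thesis by (simp flip: of_real_mult of_real_add del: of_real_power)
qed

text \<open>The space X need not be compact: for X the whole of the vector space over the complex
  numbers, the lemma applies to the bounded functions among the continuous ones.\<close>

lemma cont_star_hom_contractive:
  assumes \<pi>: "cont_star_hom X K \<pi>" and f: "f \<in> cont_funs X" "\<And>x. cmod (f x) \<le> c" and v: "v \<in> vecs K"
  shows "hnorm K (\<pi> f v) \<le> c * hnorm K v"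
proof -
  define g where "g x = complex_of_real (sqrt (c\<^sup>2 - (cmod (f x))\<^sup>2))" for x
  have cf: "continuous_map X euclidean f" using f by (simp add: cont_funs_def)
  have "continuous_map X euclidean ((\<lambda>z. complex_of_real (sqrt (c\<^sup>2 - (cmod z)\<^sup>2))) \<circ> f)"
    by (rule continuous_map_compose[OF cf]) (auto intro!: continuous_intros simp: continuous_map_iff_continuous2)
  then have g: "g \<in> cont_funs X" by (simp add: cont_funs_def g_def[abs_def] o_def)
  have cn: "(\<lambda>x. cnj (h x)) \<in> cont_funs X" "(\<lambda>x. cnj (h x) * h x) \<in> cont_funs X" if "h \<in> cont_funs X" for h
  proof -
    have "continuous_map X euclidean h" using that by (simp add: cont_funs_def)
    moreover have "continuous_map euclidean euclidean cnj"
      "continuous_map euclidean euclidean (\<lambda>z :: complex. cnj z * z)"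
      unfolding continuous_map_iff_continuous2 by (intro continuous_intros)+
    ultimately have "continuous_map X euclidean (cnj \<circ> h)" "continuous_map X euclidean ((\<lambda>z. cnj z * z) \<circ> h)"
      by (auto intro: continuous_map_compose)
    then show "(\<lambda>x. cnj (h x)) \<in> cont_funs X" "(\<lambda>x. cnj (h x) * h x) \<in> cont_funs X"
      by (simp_all add: cont_funs_def o_def)
  qed
  have one: "(\<lambda>_. 1) \<in> cont_funs X" by (simp add: cont_funs_def)
  have "\<pi> (\<lambda>x. cnj (f x) * f x + cnj (g x) * g x) = (adj K (\<pi> f) \<circ> \<pi> f) + (adj K (\<pi> g) \<circ> \<pi> g)"
    using f(1) g cn by (simp add: cont_star_homD[OF \<pi>])
  also have "(\<lambda>x. cnj (f x) * f x + cnj (g x) * g x) = (\<lambda>x. of_real (c\<^sup>2) * 1)"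
    unfolding g_def using sqrt_complement[OF f(2)] by blast
  also have "\<pi> (\<lambda>x. of_real (c\<^sup>2) * 1) = of_real (c\<^sup>2) \<cdot>\<^sub>o id_op K"
    using cont_star_homD(5)[OF \<pi> one] cont_star_homD(2)[OF \<pi>] by metis
  finally have "(adj K (\<pi> f) \<circ> \<pi> f) + (adj K (\<pi> g) \<circ> \<pi> g) = of_real (c\<^sup>2) \<cdot>\<^sub>o id_op K" by (rule sym)
  \<comment> \<open>Types are nonempty, so evaluating the bound at any point shows that c is
    nonnegative.\<close>
  moreover have "c \<ge> 0" using f(2)[of undefined] norm_ge_zero order_trans by blast
  ultimately show ?thesis
    using cont_star_homD(1)[OF \<pi>] f(1) g v by (intro contraction_of_complement) auto
qed

end

section \<open>Tensor products with a finite-dimensional space\<close>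

definition slice :: "('e \<times> 'x) cvec \<Rightarrow> 'e \<Rightarrow> 'x cvec"
  where "slice \<Phi> i = (\<lambda>x. \<Phi> (i, x))"

lemma slice_simps [simp]:
  "slice 0 i = 0" "slice (\<Phi> + \<Psi>) i = slice \<Phi> i + slice \<Psi> i" "slice (\<Phi> - \<Psi>) i = slice \<Phi> i - slice \<Psi> i"
  "slice (c \<cdot>\<^sub>v \<Phi>) i = c \<cdot>\<^sub>v slice \<Phi> i" "slice (\<lambda>(i, x). F i x) i = F i"
  by (auto simp: slice_def fun_eq_iff pointwise)

lemma slice_sum [simp]: "slice (\<Sum>a\<in>A. F a) i = (\<Sum>a\<in>A. slice (F a) i)"
  by (simp add: slice_def fun_eq_iff sum_fun_apply)

lemma slice_ext: "(\<And>i. slice \<Phi> i = slice \<Psi> i) \<Longrightarrow> \<Phi> = \<Psi>"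
  by (auto simp: slice_def fun_eq_iff)

lemma vecs_Htens: "\<Phi> \<in> vecs (Htens K) \<longleftrightarrow> (\<forall>i. slice \<Phi> i \<in> vecs K)"
  by (simp add: Htens_def slice_def)

lemma ip_Htens: "ip (Htens K) \<Phi> \<Psi> = (\<Sum>i\<in>UNIV. ip K (slice \<Phi> i) (slice \<Psi> i)) / of_nat CARD('e)"
  for \<Phi> :: "('e::finite \<times> 'x) cvec"
  by (simp add: Htens_def slice_def)

lemma slice_vtens [simp]: "slice (f \<otimes>\<^sub>v \<kappa>) i = f i \<cdot>\<^sub>v \<kappa>"
  by (simp add: slice_def vtens_def fun_eq_iff scale_apply)

lemma vtens_simps:
  "f \<otimes>\<^sub>v (c \<cdot>\<^sub>v \<kappa>) = c \<cdot>\<^sub>v (f \<otimes>\<^sub>v \<kappa>)" "f \<otimes>\<^sub>v (\<kappa> + \<kappa>') = f \<otimes>\<^sub>v \<kappa> + f \<otimes>\<^sub>v \<kappa>'" "f \<otimes>\<^sub>v 0 = 0"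
  "(c \<cdot>\<^sub>v f) \<otimes>\<^sub>v \<kappa> = c \<cdot>\<^sub>v (f \<otimes>\<^sub>v \<kappa>)" "(f + f') \<otimes>\<^sub>v \<kappa> = f \<otimes>\<^sub>v \<kappa> + f' \<otimes>\<^sub>v \<kappa>" "0 \<otimes>\<^sub>v \<kappa> = 0"
  by (auto simp: vtens_def fun_eq_iff algebra_simps pointwise)

lemma vtens_sum: "f \<otimes>\<^sub>v (\<Sum>a\<in>A. \<kappa> a) = (\<Sum>a\<in>A. f \<otimes>\<^sub>v \<kappa> a)" "(\<Sum>a\<in>A. F a) \<otimes>\<^sub>v \<kappa>' = (\<Sum>a\<in>A. F a \<otimes>\<^sub>v \<kappa>')"
  by (induction A rule: infinite_finite_induct) (auto simp: vtens_simps)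

lemma ket_apply: "ket s x = (if x = s then complex_of_real (sqrt CARD('s)) else 0)" for s :: "'s::finite"
  by (simp add: ket_def)

lemma sqrt_card_nonzero [simp]: "complex_of_real (sqrt (real CARD('s::finite))) \<noteq> 0"
  by simp

context hilbert
begin

lemma cauchy_limit:
  assumes "\<And>n. s n \<in> vecs K" "\<And>\<epsilon>. \<epsilon> > 0 \<Longrightarrow> \<exists>n0. \<forall>m\<ge>n0. \<forall>n\<ge>n0. hnorm K (s m - s n) < \<epsilon>"
  shows "\<exists>f\<in>vecs K. (\<lambda>n. hnorm K (s n - f)) \<longlonglongrightarrow> 0"
proof -
  have "(\<forall>n. s n \<in> vecs K) \<and> (\<forall>\<epsilon>>0. \<exists>n0. \<forall>m\<ge>n0. \<forall>n\<ge>n0. hnorm K (s m - s n) < \<epsilon>) \<Longrightarrow> ?thesis"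
    using hilbert unfolding hilbert_space_def by blast
  then show ?thesis using assms by blast
qed

lemma hnorm_Htens:
  fixes \<Phi> :: "('e::finite \<times> 'x) cvec"
  assumes "\<Phi> \<in> vecs (Htens K)"
  shows "hnorm (Htens K) \<Phi> = sqrt ((\<Sum>i\<in>UNIV. (hnorm K (slice \<Phi> i))\<^sup>2) / CARD('e))"
proof -
  have "ip (Htens K) \<Phi> \<Phi> = complex_of_real ((\<Sum>i\<in>UNIV. (hnorm K (slice \<Phi> i))\<^sup>2) / CARD('e))"
    using assms by (simp add: ip_Htens vecs_Htens ip_self)
  then show ?thesis by (simp add: hnorm_def)
qed

lemma hnorm_slice_le:
  fixes \<Phi> :: "('e::finite \<times> 'x) cvec"
  assumes "\<Phi> \<in> vecs (Htens K)"
  shows "hnorm K (slice \<Phi> i) \<le> sqrt CARD('e) * hnorm (Htens K) \<Phi>"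
proof -
  have "(hnorm K (slice \<Phi> i))\<^sup>2 \<le> (\<Sum>i\<in>UNIV. (hnorm K (slice \<Phi> i))\<^sup>2)"
    by (rule member_le_sum) auto
  then have "hnorm K (slice \<Phi> i) \<le> sqrt (\<Sum>i\<in>UNIV. (hnorm K (slice \<Phi> i))\<^sup>2)"
    by (rule real_le_rsqrt)
  also have "\<dots> = sqrt CARD('e) * hnorm (Htens K) \<Phi>"
    unfolding hnorm_Htens[OF assms] real_sqrt_mult[symmetric] by simp
  finally show ?thesis .
qed

lemma hilbert_space_Htens: "hilbert_space (Htens K :: ('e::finite \<times> 'x) hilb)"
  unfolding hilbert_space_def
proof (intro conjI ballI allI impI)
  let ?H = "Htens K :: ('e \<times> 'x) hilb"
  show "0 \<in> vecs ?H" by (simp add: vecs_Htens)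
  fix f g assume v: "f \<in> vecs ?H" "g \<in> vecs ?H"
  show "c \<cdot>\<^sub>v f + g \<in> vecs ?H" for c using v by (simp add: vecs_Htens)
  show "ip ?H h (c \<cdot>\<^sub>v f + g) = c * ip ?H h f + ip ?H h g" if "h \<in> vecs ?H" for h c
    using v that by (simp add: vecs_Htens ip_Htens ip_simps sum.distrib sum_distrib_left add_divide_distrib)
  show "ip ?H g f = cnj (ip ?H f g)"
    using v by (simp add: vecs_Htens ip_Htens ip_cnj)
next
  let ?H = "Htens K :: ('e \<times> 'x) hilb"
  fix f assume f: "f \<in> vecs ?H" "f \<noteq> 0"
  obtain i where i: "slice f i \<noteq> 0" using f(2) slice_ext[of f 0] by auto
  have "0 < (\<Sum>i\<in>UNIV. Re (ip K (slice f i) (slice f i)))"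
    using i f(1) by (intro sum_pos2[of _ i] ip_pos ip_nonneg) (auto simp: vecs_Htens)
  then show "Re (ip ?H f f) > 0"
    by (simp add: ip_Htens Re_divide_of_nat)
next
  let ?H = "Htens K :: ('e \<times> 'x) hilb"
  fix s :: "nat \<Rightarrow> ('e \<times> 'x) cvec"
  assume "(\<forall>n. s n \<in> vecs ?H) \<and> (\<forall>\<epsilon>>0. \<exists>n0. \<forall>m\<ge>n0. \<forall>n\<ge>n0. hnorm ?H (s m - s n) < \<epsilon>)"
  then have s: "\<And>n. s n \<in> vecs ?H" and c: "\<And>\<epsilon>. \<epsilon> > 0 \<Longrightarrow> \<exists>n0. \<forall>m\<ge>n0. \<forall>n\<ge>n0. hnorm ?H (s m - s n) < \<epsilon>"
    by auto
  have sl: "slice (s n) i \<in> vecs K" for n i using s[of n] by (simp add: vecs_Htens)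
  have "\<exists>f\<in>vecs K. (\<lambda>n. hnorm K (slice (s n) i - f)) \<longlonglongrightarrow> 0" for i
  proof -
    have "\<exists>n0. \<forall>m\<ge>n0. \<forall>n\<ge>n0. hnorm K (slice (s m) i - slice (s n) i) < \<epsilon>" if \<epsilon>: "\<epsilon> > 0" for \<epsilon>
    proof -
      have p: "sqrt CARD('e) > 0" by simp
      obtain n0 where n0: "\<And>m n. m \<ge> n0 \<Longrightarrow> n \<ge> n0 \<Longrightarrow> hnorm ?H (s m - s n) < \<epsilon> / sqrt CARD('e)"
        using c[of "\<epsilon> / sqrt CARD('e)"] \<epsilon> p by auto
      have "hnorm K (slice (s m) i - slice (s n) i) < \<epsilon>" if "m \<ge> n0" "n \<ge> n0" for m n
      proof -
        have "s m - s n \<in> vecs ?H" using sl by (simp add: vecs_Htens)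
        then have "hnorm K (slice (s m) i - slice (s n) i) \<le> sqrt CARD('e) * hnorm ?H (s m - s n)"
          using hnorm_slice_le[of "s m - s n" i] by simp
        also have "\<dots> < \<epsilon>" using n0[OF that] p by (simp add: field_simps)
        finally show ?thesis .
      qed
      then show ?thesis by blast
    qed
    then show ?thesis using sl by (intro cauchy_limit) auto
  qed
  then obtain F where F: "\<And>i. F i \<in> vecs K" "\<And>i. (\<lambda>n. hnorm K (slice (s n) i - F i)) \<longlonglongrightarrow> 0" by metis
  define f where "f = (\<lambda>(i, x). F i x)"
  have fs: "slice f i = F i" for i by (simp add: f_def)
  have fv: "f \<in> vecs ?H" using F(1) by (simp add: vecs_Htens fs)
  have "hnorm ?H (s n - f) = sqrt ((\<Sum>i\<in>UNIV. (hnorm K (slice (s n) i - F i))\<^sup>2) / CARD('e))" for n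
  proof -
    have "s n - f \<in> vecs ?H" using sl F(1) by (simp add: vecs_Htens fs)
    then show ?thesis by (simp add: hnorm_Htens fs)
  qed
  moreover have "(\<lambda>n. sqrt ((\<Sum>i\<in>UNIV. (hnorm K (slice (s n) i - F i))\<^sup>2) / CARD('e))) \<longlonglongrightarrow> sqrt ((\<Sum>i\<in>(UNIV::'e set). 0\<^sup>2) / CARD('e))"
    by (intro tendsto_real_sqrt tendsto_divide tendsto_sum tendsto_power F(2) tendsto_const) auto
  ultimately show "\<exists>f\<in>vecs ?H. (\<lambda>n. hnorm ?H (s n - f)) \<longlonglongrightarrow> 0"
    using fv by (intro bexI[of _ f]) simp_all
qed

lemma hilbert_Htens: "hilbert (Htens K :: ('e::finite \<times> 'x) hilb)"
  by (rule hilbert.intro[OF hilbert_space_Htens])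

lemma vtens_vecs [simp, intro]: "\<kappa> \<in> vecs K \<Longrightarrow> f \<otimes>\<^sub>v \<kappa> \<in> vecs (Htens K)"
  by (simp add: vecs_Htens)

lemma ip_vtens:
  fixes f f' :: "'e::finite cvec"
  assumes "\<kappa> \<in> vecs K" "\<kappa>' \<in> vecs K"
  shows "ip (Htens K) (f \<otimes>\<^sub>v \<kappa>) (f' \<otimes>\<^sub>v \<kappa>') = ip L2U f f' * ip K \<kappa> \<kappa>'"
  using assms by (simp add: ip_Htens ip_L2U ip_simps sum_distrib_left sum_distrib_right sum_divide_distrib mult_ac)

text \<open>The factor appears because \<mu>_E is a probability: the normalised indicator
  \<open>ket i\<close> takes the value sqrt N at i.\<close>

lemma vtens_expand: "\<Phi> = (\<Sum>i\<in>UNIV. ket i \<otimes>\<^sub>v ((1 / complex_of_real (sqrt CARD('e))) \<cdot>\<^sub>v slice \<Phi> i))"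
  for \<Phi> :: "('e::finite \<times> 'x) cvec"
proof (rule slice_ext)
  fix j
  have "(\<Sum>i\<in>UNIV. ket i j \<cdot>\<^sub>v (1 / complex_of_real (sqrt CARD('e))) \<cdot>\<^sub>v slice \<Phi> i) =
      (\<Sum>i\<in>UNIV. if i = j then slice \<Phi> j else 0)"
    by (intro sum.cong) (auto simp: ket_apply)
  then show "slice \<Phi> j = slice (\<Sum>i\<in>UNIV. ket i \<otimes>\<^sub>v ((1 / complex_of_real (sqrt CARD('e))) \<cdot>\<^sub>v slice \<Phi> i)) j"
    by simp
qed

text \<open>E is finite, so the slices can be approximated separately and the errors
  averaged.\<close>

lemma total_Htens:
  assumes tot: "total_set K S"
  shows "total_set (Htens K) {ket (i::'e::finite) \<otimes>\<^sub>v b | i b. b \<in> S}"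
proof -
  interpret H: hilbert "Htens K :: ('e \<times> 'x) hilb" by (rule hilbert_Htens)
  note Sv = total_setD(1)[OF tot]
  let ?S = "{ket (i::'e) \<otimes>\<^sub>v b | i b. b \<in> S}"
  have sp: "ket i \<otimes>\<^sub>v g \<in> H.vspan ?S" if "g \<in> vspan S" for g i
    using that
  proof (induction rule: vspan_induct)
    case zero
    show ?case by (simp add: vtens_simps H.vspan_zero)
  next
    case (step b f c)
    then show ?case unfolding vtens_simps by (intro H.vspan_step) auto
  qed
  show ?thesis
    unfolding H.total_set_iff
  proof (intro conjI ballI allI impI)
    show "?S \<subseteq> vecs (Htens K)" using Sv by auto
    fix \<Phi> :: "('e \<times> 'x) cvec" and \<epsilon> :: real assume \<Phi>: "\<Phi> \<in> vecs (Htens K)" "\<epsilon> > 0"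
    have "\<exists>g\<in>vspan S. hnorm K (slice \<Phi> i - g) < \<epsilon>" for i
      using \<Phi> by (intro total_setD(2)[OF tot]) (auto simp: vecs_Htens)
    then obtain G where G: "\<And>i. G i \<in> vspan S" "\<And>i. hnorm K (slice \<Phi> i - G i) < \<epsilon>" by metis
    have Gv: "G i \<in> vecs K" for i using vspan_vecs[OF G(1) Sv] .
    define \<Psi> where "\<Psi> = (\<lambda>(i, x). G i x)"
    have sl: "slice \<Psi> i = G i" for i by (simp add: \<Psi>_def)
    have "\<Psi> = (\<Sum>i\<in>UNIV. ket i \<otimes>\<^sub>v ((1 / complex_of_real (sqrt CARD('e))) \<cdot>\<^sub>v G i))"
      using vtens_expand[of \<Psi>] by (simp add: sl)
    moreover have "\<dots> \<in> H.vspan ?S" by (intro H.vspan_sum sp vspan_scale G)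
    moreover have "hnorm (Htens K) (\<Phi> - \<Psi>) < \<epsilon>"
    proof -
      have d: "\<Phi> - \<Psi> \<in> vecs (Htens K)" using \<Phi> Gv by (simp add: vecs_Htens sl)
      have "(\<Sum>i\<in>UNIV. (hnorm K (slice \<Phi> i - G i))\<^sup>2) < (\<Sum>i\<in>(UNIV::'e set). \<epsilon>\<^sup>2)"
        using G(2) Gv \<Phi> by (intro sum_strict_mono power_strict_mono) (auto simp: vecs_Htens)
      then have "(\<Sum>i\<in>UNIV. (hnorm K (slice \<Phi> i - G i))\<^sup>2) / CARD('e) < \<epsilon>\<^sup>2"
        by (simp add: field_simps)
      then have "sqrt ((\<Sum>i\<in>UNIV. (hnorm K (slice \<Phi> i - G i))\<^sup>2) / CARD('e)) < sqrt (\<epsilon>\<^sup>2)"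
        by (rule real_sqrt_less_mono)
      then show ?thesis using \<Phi>(2) by (simp add: hnorm_Htens[OF d] sl)
    qed
    ultimately show "\<exists>g\<in>H.vspan ?S. hnorm (Htens K) (\<Phi> - g) < \<epsilon>" by auto
  qed
qed

lemma onb_Htens:
  assumes "onb K S"
  shows "onb (Htens K) {ket (i::'e::finite) \<otimes>\<^sub>v b | i b. b \<in> S}"
  unfolding onb_def
proof (intro conjI ballI)
  have tot: "total_set K S" and on: "\<And>b b'. b \<in> S \<Longrightarrow> b' \<in> S \<Longrightarrow> ip K b b' = (if b = b' then 1 else 0)"
    using assms by (auto simp: onb_def)
  note Sv = total_setD(1)[OF tot]
  show "total_set (Htens K) {ket (i::'e) \<otimes>\<^sub>v b | i b. b \<in> S}" by (rule total_Htens[OF tot])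
  fix x y assume "x \<in> {ket (i::'e) \<otimes>\<^sub>v b | i b. b \<in> S}" "y \<in> {ket (i::'e) \<otimes>\<^sub>v b | i b. b \<in> S}"
  then obtain i b j b' where xy: "x = ket i \<otimes>\<^sub>v b" "y = ket j \<otimes>\<^sub>v b'" "b \<in> S" "b' \<in> S" by blast
  have k: "ip L2U (ket i) (ket j) = (if i = j then 1 else 0)" for i j :: 'e
    by (simp add: ip_L2U_ket(1)) (auto simp: ket_apply)
  have e: "ip (Htens K) x y = (if i = j \<and> b = b' then 1 else 0)"
    using xy Sv on by (simp add: ip_vtens k subset_iff)
  have e': "ip (Htens K) x x = 1" using xy Sv on by (simp add: ip_vtens k subset_iff)
  show "ip (Htens K) x y = (if x = y then 1 else 0)"
  proof (cases "i = j \<and> b = b'")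
    case True
    then have "x = y" by (simp only: xy(1,2))
    then show ?thesis using e' by simp
  next
    case False
    \<comment> \<open>Orthogonality itself shows that distinct index pairs give distinct
      vectors.\<close>
    then have "x \<noteq> y" using e e' by auto
    then show ?thesis using e False by simp
  qed
qed

end

text \<open>On a finite set this is \<open>ell2 S\<close> with the scalar product divided by the
  cardinality, so completeness carries over.\<close>

lemma hilbert_space_L2:
  assumes "finite S" "S \<noteq> {}"
  shows "hilbert_space (L2 S)"
proof -
  have n: "real (card S) > 0" using assms by (simp add: card_gt_0_iff)
  have v: "vecs (L2 S) = vecs (ell2 S)"
  proof -
    have "(\<lambda>x. (cmod (f x))\<^sup>2) summable_on UNIV" if "\<forall>s. s \<notin> S \<longrightarrow> f s = 0" for f :: "'a cvec"
      by (rule finite_nonzero_values_imp_summable_on, rule finite_subset[OF _ assms(1)]) (use that in auto)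
    then show ?thesis by (auto simp: L2_def ell2_def)
  qed
  have i: "ip (L2 S) f g = ip (ell2 S) f g / of_nat (card S)" if "f \<in> vecs (ell2 S)" for f g
  proof -
    have "(\<Sum>\<^sub>\<infinity>x. cnj (f x) * g x) = (\<Sum>\<^sub>\<infinity>x\<in>S. cnj (f x) * g x)"
      using that by (intro infsum_cong_neutral) (auto simp: ell2_def)
    then show ?thesis using assms by (simp add: L2_def ell2_def)
  qed
  have nrm: "hnorm (L2 S) f = hnorm (ell2 S) f / sqrt (card S)" if "f \<in> vecs (ell2 S)" for f
    using i[OF that] by (simp add: hnorm_def Re_divide_of_nat real_sqrt_divide)
  interpret E: hilbert "ell2 S" by (rule hilbert.intro[OF hilbert_space_ell2])
  show ?thesis
    unfolding hilbert_space_def v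
  proof (intro conjI ballI allI impI)
    fix f g assume fg: "f \<in> vecs (ell2 S)" "g \<in> vecs (ell2 S)"
    show "ip (L2 S) h (c \<cdot>\<^sub>v f + g) = c * ip (L2 S) h f + ip (L2 S) h g" if "h \<in> vecs (ell2 S)" for h c
      using fg that by (simp add: i E.ip_simps add_divide_distrib)
    show "ip (L2 S) g f = cnj (ip (L2 S) f g)" using fg by (simp add: i E.ip_cnj)
  next
    fix f assume "f \<in> vecs (ell2 S)" "f \<noteq> 0"
    then show "Re (ip (L2 S) f f) > 0" using E.ip_pos[of f] n by (simp add: i Re_divide_of_nat)
  next
    fix s :: "nat \<Rightarrow> 'a cvec"
    assume "(\<forall>n. s n \<in> vecs (ell2 S)) \<and> (\<forall>\<epsilon>>0. \<exists>n0. \<forall>m\<ge>n0. \<forall>n\<ge>n0. hnorm (L2 S) (s m - s n) < \<epsilon>)"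
    then have s: "\<And>n. s n \<in> vecs (ell2 S)"
      and c: "\<And>\<epsilon>. \<epsilon> > 0 \<Longrightarrow> \<exists>n0. \<forall>m\<ge>n0. \<forall>n\<ge>n0. hnorm (ell2 S) (s m - s n) / sqrt (card S) < \<epsilon>"
      by (auto simp: nrm)
    have "\<exists>n0. \<forall>m\<ge>n0. \<forall>n\<ge>n0. hnorm (ell2 S) (s m - s n) < \<epsilon>" if "\<epsilon> > 0" for \<epsilon>
      using c[of "\<epsilon> / sqrt (card S)"] n that by (simp add: divide_less_cancel)
    then have "\<exists>f\<in>vecs (ell2 S). (\<lambda>n. hnorm (ell2 S) (s n - f)) \<longlonglongrightarrow> 0"
      using s by (intro E.cauchy_limit) auto
    then obtain f where f: "f \<in> vecs (ell2 S)" "(\<lambda>n. hnorm (ell2 S) (s n - f)) \<longlonglongrightarrow> 0" by blast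
    have "(\<lambda>n. hnorm (ell2 S) (s n - f) / sqrt (card S)) \<longlonglongrightarrow> 0"
      using tendsto_divide[OF f(2) tendsto_const[of "sqrt (card S)"]] n by simp
    then show "\<exists>f\<in>vecs (ell2 S). (\<lambda>n. hnorm (L2 S) (s n - f)) \<longlonglongrightarrow> 0"
      using f(1) s by (intro bexI[of _ f]) (simp_all add: nrm)
  qed (auto intro: E.lin_vecs)
qed

text \<open>The version of \<open>ket\<close> for a finite subset of a possibly infinite type, as
  needed for words of fixed length among all lists.\<close>

definition point :: "'s set \<Rightarrow> 's \<Rightarrow> 's cvec"
  where "point S s = (\<lambda>x. if x = s then complex_of_real (sqrt (real (card S))) else 0)"

lemma point_UNIV: "point UNIV = (ket :: 's::finite \<Rightarrow> _)"
  by (simp add: point_def ket_def fun_eq_iff)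

lemma onb_L2:
  assumes "finite S" "S \<noteq> {}"
  shows "onb (L2 S) (point S ` S)"
proof -
  interpret L: hilbert "L2 S" by (rule hilbert.intro[OF hilbert_space_L2[OF assms]])
  define r where "r = complex_of_real (sqrt (real (card S)))"
  have r: "r * r = of_nat (card S)" "r \<noteq> 0" "cnj r = r"
    using assms by (simp_all add: r_def flip: of_real_mult)
  have vec: "f \<in> vecs (L2 S) \<longleftrightarrow> (\<forall>s. s \<notin> S \<longrightarrow> f s = 0)" for f :: "'a cvec" by (simp add: L2_def)
  have pv: "point S s \<in> vecs (L2 S)" if "s \<in> S" for s using that by (auto simp: vec point_def)
  have ipp: "ip (L2 S) (point S s) f = f s / r" if "s \<in> S" for s f
  proof -
    have "(\<Sum>x\<in>S. cnj (point S s x) * f x) = (\<Sum>x\<in>S. if x = s then r * f s else 0)"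
      by (intro sum.cong) (auto simp: point_def r_def)
    also have "\<dots> = r * f s" using assms(1) that by simp
    finally have "(\<Sum>x\<in>S. cnj (point S s x) * f x) = r * f s" .
    then have "ip (L2 S) (point S s) f = (r * f s) / (r * r)" unfolding r(1) by (simp add: L2_def)
    then show ?thesis using r(2) by simp
  qed
  have inj: "inj_on (point S) S"
  proof (rule inj_onI)
    fix s t assume "s \<in> S" "t \<in> S" "point S s = point S t"
    then have "point S s s = point S t s" by simp
    then show "s = t" using r(2) by (auto simp: point_def r_def split: if_splits)
  qed
  have "total_set (L2 S) (point S ` S)"
    unfolding L.total_set_iff
  proof (intro conjI ballI allI impI)
    show "point S ` S \<subseteq> vecs (L2 S)" using pv by auto
    fix f \<epsilon> assume f: "f \<in> vecs (L2 S)" and "(\<epsilon>::real) > 0"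
    have "f = (\<Sum>s\<in>S. (f s / r) \<cdot>\<^sub>v point S s)"
    proof
      fix x
      have "(\<Sum>s\<in>S. (f s / r) * point S s x) = (\<Sum>s\<in>S. if s = x then f x else 0)"
        using r(2) by (intro sum.cong) (auto simp: point_def r_def)
      then show "f x = (\<Sum>s\<in>S. (f s / r) \<cdot>\<^sub>v point S s) x"
        using f assms(1) by (simp add: sum_fun_apply scale_apply vec)
    qed
    moreover have "(\<Sum>s\<in>S. (f s / r) \<cdot>\<^sub>v point S s) \<in> L.vspan (point S ` S)"
      by (intro L.vspan_sum L.vspan_scale L.vspan_base) auto
    ultimately show "\<exists>g\<in>L.vspan (point S ` S). hnorm (L2 S) (f - g) < \<epsilon>"
      using \<open>\<epsilon> > 0\<close> by (intro bexI[of _ f]) auto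
  qed
  moreover have "ip (L2 S) (point S s) (point S t) = (if point S s = point S t then 1 else 0)"
    if "s \<in> S" "t \<in> S" for s t
    using ipp[OF that(1), of "point S t"] r(2) inj_onD[OF inj _ that] by (auto simp: point_def r_def)
  ultimately show ?thesis unfolding onb_def by blast
qed

interpretation L2U: hilbert "L2U :: 's::finite hilb"
  by (rule hilbert.intro[OF hilbert_space_L2]) auto

lemma vecs_L2U [simp]: "f \<in> vecs L2U"
  by (simp add: L2_def)

lemma onb_ket: "onb L2U (range (ket :: 's::finite \<Rightarrow> _))"
  using onb_L2[of "UNIV :: 's set"] by (simp add: point_UNIV)

lemma total_ket: "total_set L2U (range ket)"
  using onb_ket unfolding onb_def by blast

lemma ip_ket [simp]: "ip L2U (ket i) (ket j) = (if i = j then 1 else 0)"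
  by (simp add: ip_L2U_ket(1)) (auto simp: ket_apply)

lemma ket_inj [simp]: "ket i = ket j \<longleftrightarrow> i = j"
  using ip_ket[of i j] ip_ket[of j j] by (metis zero_neq_one)

lemma ket_expand: "f = (\<Sum>i\<in>UNIV. ip L2U (ket i) f \<cdot>\<^sub>v ket i)"
proof -
  have "(\<Sum>b\<in>range ket. ip L2U b f \<cdot>\<^sub>v b) = (\<Sum>i\<in>UNIV. ip L2U (ket i) f \<cdot>\<^sub>v ket i)"
    by (rule sum.reindex_cong[of ket]) (auto simp: inj_on_def)
  then show ?thesis using L2U.finite_onb_expand[OF onb_ket, of f] by simp
qed

subsection \<open>Matrix elements\<close>

definition mel :: "'s::finite operator \<Rightarrow> 's \<Rightarrow> 's \<Rightarrow> complex"
  where "mel A i j = ip L2U (ket i) (A (ket j))"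

lemma mel_ext: "A \<in> bop L2U \<Longrightarrow> B \<in> bop L2U \<Longrightarrow> (\<And>i j. mel A i j = mel B i j) \<Longrightarrow> A = B"
proof (rule L2U.bop_eqI_total[OF total_ket])
  fix b :: "'a cvec" assume "\<And>i j. mel A i j = mel B i j" "b \<in> range ket"
  then show "A b = B b" using ket_expand[of "A b"] ket_expand[of "B b"] by (auto simp: mel_def)
qed

lemma mel_sum_ketbra:
  "(\<Sum>i\<in>UNIV. \<Sum>j\<in>UNIV. c i j \<cdot>\<^sub>o ketbra L2U (ket i) (ket j)) \<in> bop L2U"
  "mel (\<Sum>i\<in>UNIV. \<Sum>j\<in>UNIV. c i j \<cdot>\<^sub>o ketbra L2U (ket i) (ket j)) k l = c k l"
  "(\<Sum>i\<in>UNIV. \<Sum>j\<in>UNIV. c i j \<cdot>\<^sub>o ketbra L2U (ket i) (ket j)) (ket l) = (\<Sum>i\<in>UNIV. c i l \<cdot>\<^sub>v ket i)"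
proof -
  show "(\<Sum>i\<in>UNIV. \<Sum>j\<in>UNIV. c i j \<cdot>\<^sub>o ketbra L2U (ket i) (ket j)) \<in> bop L2U"
    by (intro L2U.bop_sum_op L2U.bop_scale_op L2U.ketbra_bop) auto
  have "(\<Sum>j\<in>UNIV. c i j \<cdot>\<^sub>v ip L2U (ket j) (ket l) \<cdot>\<^sub>v ket i) = (\<Sum>j\<in>UNIV. if j = l then c i l \<cdot>\<^sub>v ket i else 0)" for i
    by (intro sum.cong) auto
  then show *: "(\<Sum>i\<in>UNIV. \<Sum>j\<in>UNIV. c i j \<cdot>\<^sub>o ketbra L2U (ket i) (ket j)) (ket l) = (\<Sum>i\<in>UNIV. c i l \<cdot>\<^sub>v ket i)"
    by (simp add: sum_fun_apply scale_op_apply L2U.ketbra_apply del: ip_ket scale_simps(4))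
  have "(\<Sum>i\<in>UNIV. c i l * ip L2U (ket k) (ket i)) = (\<Sum>i\<in>UNIV. if i = k then c k l else 0)"
    by (intro sum.cong) auto
  then show "mel (\<Sum>i\<in>UNIV. \<Sum>j\<in>UNIV. c i j \<cdot>\<^sub>o ketbra L2U (ket i) (ket j)) k l = c k l"
    unfolding mel_def * by (simp add: L2U.ip_sum_right L2U.ip_scale_right del: ip_ket)
qed

lemma mel_plus: "mel (A + B) i j = mel A i j + mel B i j"
  by (simp add: mel_def plus_fun_apply[of A B] L2U.ip_add_right)

lemma mel_scale: "mel (c \<cdot>\<^sub>o A) i j = c * mel A i j"
  by (simp add: mel_def scale_op_apply L2U.ip_scale_right)

lemma mel_sum: "mel (\<Sum>a\<in>I. A a) i j = (\<Sum>a\<in>I. mel (A a) i j)"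
  by (simp add: mel_def sum_fun_apply[of A] L2U.ip_sum_right)

lemma mel_id: "mel (id_op L2U) i j = (if i = j then 1 else 0)"
  by (simp add: mel_def)

lemma bop_ket: "A \<in> bop L2U \<Longrightarrow> A (ket j) = (\<Sum>i\<in>UNIV. mel A i j \<cdot>\<^sub>v ket i)"
  unfolding mel_def by (rule ket_expand)

lemma mel_apply:
  assumes "A \<in> bop L2U"
  shows "A f i = (\<Sum>j\<in>UNIV. mel A i j * f j)"
proof -
  have "A f = A (\<Sum>j\<in>UNIV. ip L2U (ket j) f \<cdot>\<^sub>v ket j)" by (subst ket_expand[of f]) simp
  also have "\<dots> = (\<Sum>j\<in>UNIV. ip L2U (ket j) f \<cdot>\<^sub>v A (ket j))"
    using assms by (simp add: L2U.bop_sum L2U.bop_scale)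
  finally have "A f i = (\<Sum>j\<in>UNIV. ip L2U (ket j) f * A (ket j) i)"
    by (simp add: sum_fun_apply scale_apply)
  also have "\<dots> = (\<Sum>j\<in>UNIV. mel A i j * f j)"
    by (intro sum.cong) (simp_all add: mel_def ip_L2U_ket(1))
  finally show ?thesis .
qed

lemma htrace_L2U: "A \<in> bop L2U \<Longrightarrow> htrace L2U A = (\<Sum>i\<in>UNIV. mel A i i)"
  using L2U.htrace_finite[OF onb_ket, of A] by (simp add: mel_def sum.reindex inj_on_def)

lemma mel_comp:
  assumes "A \<in> bop L2U" "B \<in> bop L2U"
  shows "mel (A \<circ> B) i j = (\<Sum>k\<in>UNIV. mel A i k * mel B k j)"
proof -
  have "A (B (ket j)) = (\<Sum>k\<in>UNIV. mel B k j \<cdot>\<^sub>v A (ket k))"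
    using assms by (subst bop_ket) (simp_all add: L2U.bop_sum L2U.bop_scale)
  then show ?thesis by (simp add: mel_def L2U.ip_sum_right L2U.ip_scale_right mult.commute)
qed

lemma htrace_comm:
  assumes "A \<in> bop L2U" "B \<in> bop L2U"
  shows "htrace L2U (A \<circ> B) = htrace L2U (B \<circ> A)"
proof -
  have "htrace L2U (A \<circ> B) = (\<Sum>i\<in>UNIV. \<Sum>k\<in>UNIV. mel A i k * mel B k i)"
    using assms by (simp add: htrace_L2U L2U.bop_comp mel_comp)
  also have "\<dots> = (\<Sum>k\<in>UNIV. \<Sum>i\<in>UNIV. mel B k i * mel A i k)"
    by (subst sum.swap) (simp add: mult.commute)
  also have "\<dots> = htrace L2U (B \<circ> A)"
    using assms by (simp add: htrace_L2U L2U.bop_comp mel_comp)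
  finally show ?thesis .
qed

subsection \<open>Conditional expectations and ampliations\<close>

text \<open>Every trace in \<open>cond_exp_def\<close> has rank one and collapses to a scalar
  product; S is there only to make these traces meaningful.\<close>

lemma (in hilbert) cond_exp:
  fixes A :: "('e::finite \<times> 'x) operator"
  assumes S: "onb K S" and A: "\<And>\<Phi>. \<Phi> \<in> vecs (Htens K) \<Longrightarrow> A \<Phi> \<in> vecs (Htens K)"
    "\<And>c \<Phi>. \<Phi> \<in> vecs (Htens K) \<Longrightarrow> A (c \<cdot>\<^sub>v \<Phi>) = c \<cdot>\<^sub>v A \<Phi>"
    and \<kappa>: "\<kappa> \<in> vecs K" "\<kappa>' \<in> vecs K"
  shows "cond_exp K \<kappa> \<kappa>' A \<in> bop L2U"
    "mel (cond_exp K \<kappa> \<kappa>' A) i j = ip (Htens K) (ket i \<otimes>\<^sub>v \<kappa>') (A (ket j \<otimes>\<^sub>v \<kappa>))"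
proof -
  interpret H: hilbert "Htens K :: ('e \<times> 'x) hilb" by (rule hilbert_Htens)
  have "htrace (Htens K) (A \<circ> ketbra (Htens K) (ket j \<otimes>\<^sub>v \<kappa>) (ket i \<otimes>\<^sub>v \<kappa>')) =
      ip (Htens K) (ket i \<otimes>\<^sub>v \<kappa>') (A (ket j \<otimes>\<^sub>v \<kappa>))" for i j
    using \<kappa> by (intro H.htrace_rank_one[OF onb_Htens[OF S]] A) auto
  then show "cond_exp K \<kappa> \<kappa>' A \<in> bop L2U"
    "mel (cond_exp K \<kappa> \<kappa>' A) i j = ip (Htens K) (ket i \<otimes>\<^sub>v \<kappa>') (A (ket j \<otimes>\<^sub>v \<kappa>))"
    unfolding cond_exp_def by (simp_all add: mel_sum_ketbra)
qed

lemma (in hilbert) amp_slice: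
  assumes "a \<in> bop L2U" "\<Phi> \<in> vecs (Htens K)"
  shows "slice (amp K a \<Phi>) i = (\<Sum>j\<in>UNIV. mel a i j \<cdot>\<^sub>v slice \<Phi> j)"
proof
  fix x
  have "a (\<lambda>j. \<Phi> (j, x)) i = (\<Sum>j\<in>UNIV. mel a i j * \<Phi> (j, x))" by (rule mel_apply[OF assms(1)])
  then show "slice (amp K a \<Phi>) i x = (\<Sum>j\<in>UNIV. mel a i j \<cdot>\<^sub>v slice \<Phi> j) x"
    using assms by (simp add: amp_def slice_def sum_fun_apply scale_apply)
qed

lemma (in hilbert) hnorm_sum:
  assumes "\<And>a. a \<in> A \<Longrightarrow> f a \<in> vecs K"
  shows "hnorm K (\<Sum>a\<in>A. f a) \<le> (\<Sum>a\<in>A. hnorm K (f a))"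
  using assms
proof (induction A rule: infinite_finite_induct)
  case (insert x A)
  have "hnorm K (f x + (\<Sum>a\<in>A. f a)) \<le> hnorm K (f x) + hnorm K (\<Sum>a\<in>A. f a)"
    using insert by (intro hnorm_triangle) auto
  moreover have "hnorm K (\<Sum>a\<in>A. f a) \<le> (\<Sum>a\<in>A. hnorm K (f a))" using insert by auto
  ultimately show ?case using insert by simp
qed auto

lemma (in hilbert) amp_bop:
  fixes a :: "'e::finite operator"
  assumes a: "a \<in> bop L2U"
  shows "amp K a \<in> bop (Htens K)"
proof -
  interpret H: hilbert "Htens K :: ('e \<times> 'x) hilb" by (rule hilbert_Htens)
  \<comment> \<open>A crude bound is enough: M dominates every entry, each slice is at most sqrt N
    times the full norm, and N slices are added.\<close>
  define M where "M = (\<Sum>i\<in>UNIV. \<Sum>j\<in>UNIV. cmod (mel a i j))"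
  have Mij: "cmod (mel a i j) \<le> M" for i j
  proof -
    have "cmod (mel a i j) \<le> (\<Sum>j\<in>UNIV. cmod (mel a i j))" by (rule member_le_sum) auto
    also have "\<dots> \<le> M" unfolding M_def by (rule member_le_sum) (auto intro: sum_nonneg)
    finally show ?thesis .
  qed
  have M0: "M \<ge> 0" unfolding M_def by (intro sum_nonneg) auto
  show ?thesis
  proof (rule H.bopI[where C = "CARD('e) * (M * sqrt CARD('e))"])
    fix \<Phi> :: "('e \<times> 'x) cvec" assume \<Phi>: "\<Phi> \<in> vecs (Htens K)"
    then have sl: "slice \<Phi> i \<in> vecs K" for i by (simp add: vecs_Htens)
    show v: "amp K a \<Phi> \<in> vecs (Htens K)"
      using sl by (simp add: vecs_Htens[of "amp K a \<Phi>"] amp_slice[OF a \<Phi>])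
    have B: "hnorm K (slice (amp K a \<Phi>) i) \<le> CARD('e) * (M * sqrt CARD('e)) * hnorm (Htens K) \<Phi>" for i
    proof -
      have "hnorm K (slice (amp K a \<Phi>) i) \<le> (\<Sum>j\<in>UNIV. hnorm K (mel a i j \<cdot>\<^sub>v slice \<Phi> j))"
        unfolding amp_slice[OF a \<Phi>] using sl by (intro hnorm_sum) auto
      also have "\<dots> \<le> (\<Sum>j\<in>(UNIV::'e set). M * (sqrt CARD('e) * hnorm (Htens K) \<Phi>))"
        using sl M0 by (intro sum_mono) (auto simp: hnorm_scale intro!: mult_mono Mij hnorm_slice_le[OF \<Phi>])
      finally show ?thesis by (simp add: mult_ac)
    qed
    define R where "R = CARD('e) * (M * sqrt CARD('e)) * hnorm (Htens K) \<Phi>"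
    have R: "R \<ge> 0" using M0 \<Phi> H.hnorm_nonneg[OF \<Phi>] by (simp add: R_def)
    have "(\<Sum>i\<in>UNIV. (hnorm K (slice (amp K a \<Phi>) i))\<^sup>2) \<le> (\<Sum>i\<in>(UNIV::'e set). R\<^sup>2)"
      using B v by (intro sum_mono power_mono) (auto simp: R_def vecs_Htens)
    then have "(\<Sum>i\<in>UNIV. (hnorm K (slice (amp K a \<Phi>) i))\<^sup>2) / CARD('e) \<le> R\<^sup>2" by (simp add: field_simps)
    then have "hnorm (Htens K) (amp K a \<Phi>) \<le> R"
      unfolding hnorm_Htens[OF v] by (rule real_le_lsqrt[OF R])
    then show "hnorm (Htens K) (amp K a \<Phi>) \<le> CARD('e) * (M * sqrt CARD('e)) * hnorm (Htens K) \<Phi>"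
      by (simp only: R_def)
  next
    fix \<Phi> \<Psi> :: "('e \<times> 'x) cvec" and c assume v: "\<Phi> \<in> vecs (Htens K)" "\<Psi> \<in> vecs (Htens K)"
    have cv: "c \<cdot>\<^sub>v \<Phi> + \<Psi> \<in> vecs (Htens K)" using v by auto
    show "amp K a (c \<cdot>\<^sub>v \<Phi> + \<Psi>) = c \<cdot>\<^sub>v amp K a \<Phi> + amp K a \<Psi>"
    proof (rule slice_ext)
      fix i
      show "slice (amp K a (c \<cdot>\<^sub>v \<Phi> + \<Psi>)) i = slice (c \<cdot>\<^sub>v amp K a \<Phi> + amp K a \<Psi>) i"
        using amp_slice[OF a v(1)] amp_slice[OF a v(2)] amp_slice[OF a cv]
        by (simp add: scale_distrib scale_sum sum.distrib mult.commute)
    qed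
  qed (simp add: amp_def)
qed

lemma (in hilbert) amp_vtens:
  assumes a: "a \<in> bop L2U" and \<kappa>: "\<kappa> \<in> vecs K"
  shows "amp K a (f \<otimes>\<^sub>v \<kappa>) = a f \<otimes>\<^sub>v \<kappa>"
proof (rule slice_ext)
  fix i
  have "slice (amp K a (f \<otimes>\<^sub>v \<kappa>)) i = (\<Sum>j\<in>UNIV. (mel a i j * f j) \<cdot>\<^sub>v \<kappa>)"
    using amp_slice[OF a vtens_vecs[OF \<kappa>]] by simp
  also have "\<dots> = (\<Sum>j\<in>UNIV. mel a i j * f j) \<cdot>\<^sub>v \<kappa>"
    by (simp add: fun_eq_iff sum_fun_apply scale_apply sum_distrib_right)
  finally show "slice (amp K a (f \<otimes>\<^sub>v \<kappa>)) i = slice (a f \<otimes>\<^sub>v \<kappa>) i" by (simp add: mel_apply[OF a])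
qed

lemma (in hilbert) ip_adj_right: "A \<in> bop K \<Longrightarrow> f \<in> vecs K \<Longrightarrow> g \<in> vecs K \<Longrightarrow> ip K f (adj K A g) = ip K (A f) g"
  using adjpD(3)[OF adjp_sym[OF adjp_adj]] .

section \<open>The unitary of the dilation\<close>

interpretation HL: hilbert "Htens L2U :: ('e::finite \<times> 'g::finite) hilb"
  by (rule L2U.hilbert_Htens)

lemma vecs_HL [simp]: "\<Phi> \<in> vecs (Htens L2U)"
  by (simp add: vecs_Htens)

definition pket :: "'e::finite \<times> 'g::finite \<Rightarrow> ('e \<times> 'g) cvec"
  where "pket p = ket (fst p) \<otimes>\<^sub>v ket (snd p)"

lemma ip_pket [simp]: "ip (Htens L2U) (pket p) (pket p') = (if p = p' then 1 else 0)"
  by (auto simp: pket_def L2U.ip_vtens prod_eq_iff)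

lemma onb_pket: "onb (Htens L2U) (range (pket :: 'e::finite \<times> 'g::finite \<Rightarrow> _))"
proof -
  have "{ket (i::'e) \<otimes>\<^sub>v b | i b. b \<in> range (ket :: 'g \<Rightarrow> _)} = range pket"
    by (auto simp: pket_def image_iff; blast)
  moreover have "onb (Htens L2U) {ket (i::'e) \<otimes>\<^sub>v b | i b. b \<in> range (ket :: 'g \<Rightarrow> _)}"
    by (rule L2U.onb_Htens[OF onb_ket])
  ultimately show ?thesis by (simp only:)
qed

lemma total_pket: "total_set (Htens L2U) (range pket)"
  using onb_pket unfolding onb_def by blast

lemma dil_V_eq: "dil_V \<phi> = (\<Sum>p\<in>UNIV. ketbra (Htens L2U) (pket (\<phi> p)) (pket p))"
  unfolding dil_V_def pket_def
  by (simp add: sum.cartesian_product case_prod_unfold)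

lemma dil_V_bop [simp, intro]: "dil_V \<phi> \<in> bop (Htens L2U)"
  unfolding dil_V_eq by (intro HL.bop_sum_op HL.ketbra_bop) auto

lemma dil_V_pket: "dil_V \<phi> (pket p) = pket (\<phi> p)"
proof -
  have "dil_V \<phi> (pket p) = (\<Sum>p'\<in>UNIV. ip (Htens L2U) (pket p') (pket p) \<cdot>\<^sub>v pket (\<phi> p'))"
    by (simp add: dil_V_eq sum_fun_apply[of "\<lambda>p. ketbra _ (pket (\<phi> p)) (pket p)"] HL.ketbra_apply del: ip_pket)
  also have "\<dots> = (\<Sum>p'\<in>UNIV. if p' = p then pket (\<phi> p) else 0)"
    by (intro sum.cong) auto
  finally show ?thesis by simp
qed

text \<open>The matrix of a permutation is unitary, with the matrix of the inverse permutation as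
  its adjoint.\<close>

lemma dil_V_unitary:
  assumes "bij \<phi>"
  shows "unitary_op (Htens L2U) (dil_V \<phi>)" "adj (Htens L2U) (dil_V \<phi>) = dil_V (inv \<phi>)"
proof -
  have i: "\<phi> (inv \<phi> p) = p" "\<phi> p = \<phi> p' \<longleftrightarrow> p = p'" for p p'
    using surj_f_inv_f[OF bij_is_surj[OF assms]] inj_eq[OF bij_is_inj[OF assms]] by auto
  show "unitary_op (Htens L2U) (dil_V \<phi>)"
    by (rule HL.unitary_op_total(1)[OF total_pket dil_V_bop dil_V_bop[of "inv \<phi>"]]) (auto simp: dil_V_pket i)
  show "adj (Htens L2U) (dil_V \<phi>) = dil_V (inv \<phi>)"
    by (rule HL.unitary_op_total(2)[OF total_pket dil_V_bop dil_V_bop]) (auto simp: dil_V_pket i)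
qed

lemma block_bop [simp, intro]: "block V g g' \<in> bop L2U"
  unfolding block_def by (rule mel_sum_ketbra)

lemma block_dil_V: "block (dil_V \<phi>) g g' (ket j) = (if snd (\<phi> (j, g')) = g then ket (fst (\<phi> (j, g'))) else 0)"
proof -
  have "block (dil_V \<phi>) g g' (ket j) = (\<Sum>i\<in>UNIV. ip (Htens L2U) (pket (i, g)) (dil_V \<phi> (pket (j, g'))) \<cdot>\<^sub>v ket i)"
    unfolding block_def mel_sum_ketbra by (simp add: pket_def)
  also have "\<dots> = (\<Sum>i\<in>UNIV. if i = fst (\<phi> (j, g')) then (if snd (\<phi> (j, g')) = g then ket (fst (\<phi> (j, g'))) else 0) else 0)"
    by (intro sum.cong) (auto simp: dil_V_pket prod_eq_iff)
  finally show ?thesis by simp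
qed

text \<open>The Kraus operators of T: the partial matrix elements of V between |g> and
  \<upsilon>.\<close>

definition kraus :: "('e::finite \<times> 'g::finite \<Rightarrow> 'e \<times> 'g) \<Rightarrow> 'g pmf \<Rightarrow> 'g \<Rightarrow> 'e operator"
  where "kraus \<phi> q g = (\<Sum>g'\<in>UNIV. complex_of_real (sqrt (pmf q g')) \<cdot>\<^sub>o block (dil_V \<phi>) g g')"

lemma kraus_bop [simp, intro]: "kraus \<phi> q g \<in> bop L2U"
  unfolding kraus_def by (intro L2U.bop_sum_op L2U.bop_scale_op) auto

lemma kraus_ket: "kraus \<phi> q g (ket j) = (\<Sum>h\<in>UNIV. complex_of_real (sqrt (pmf q h)) \<cdot>\<^sub>v
    (if snd (\<phi> (j, h)) = g then ket (fst (\<phi> (j, h))) else 0))"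
  by (simp only: kraus_def sum_fun_apply scale_op_apply block_dil_V)

text \<open>\<open>dil_T\<close> lists the adjoints of the blocks one by one. The weights are real,
  so these sums are the adjoints of the Kraus operators.\<close>

lemma dil_T_eq: "dil_T \<phi> q a = (\<Sum>g\<in>UNIV. adj L2U (kraus \<phi> q g) \<circ> a \<circ> kraus \<phi> q g)"
proof -
  have "L2U.adjp (kraus \<phi> q g) (\<Sum>g'\<in>UNIV. complex_of_real (sqrt (pmf q g')) \<cdot>\<^sub>o adj L2U (block (dil_V \<phi>) g g'))" for g
    unfolding kraus_def
  proof (rule L2U.adjp_sum)
    fix g'
    show "L2U.adjp (complex_of_real (sqrt (pmf q g')) \<cdot>\<^sub>o block (dil_V \<phi>) g g')
        (complex_of_real (sqrt (pmf q g')) \<cdot>\<^sub>o adj L2U (block (dil_V \<phi>) g g'))"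
      using L2U.adjp_scale[OF L2U.adjp_adj[OF block_bop], where c = "complex_of_real (sqrt (pmf q g'))"] by simp
  qed
  then have "adj L2U (kraus \<phi> q g) = (\<Sum>g'\<in>UNIV. complex_of_real (sqrt (pmf q g')) \<cdot>\<^sub>o adj L2U (block (dil_V \<phi>) g g'))" for g
    by (rule L2U.adj_eq)
  then show ?thesis unfolding dil_T_def kraus_def[symmetric] by simp
qed

lemma dil_T_bop [simp, intro]: "a \<in> bop L2U \<Longrightarrow> dil_T \<phi> q a \<in> bop L2U"
  unfolding dil_T_eq by (intro L2U.bop_sum_op L2U.bop_comp L2U.adj_bop) auto

lemma dil_T_apply: "dil_T \<phi> q a f = (\<Sum>g\<in>UNIV. adj L2U (kraus \<phi> q g) (a (kraus \<phi> q g f)))"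
  by (simp add: dil_T_eq sum_fun_apply[of "\<lambda>g. adj L2U (kraus \<phi> q g) \<circ> a \<circ> kraus \<phi> q g"])

lemma ip_dil_T:
  assumes "a \<in> bop L2U"
  shows "ip L2U f (dil_T \<phi> q a f') = (\<Sum>g\<in>UNIV. ip L2U (kraus \<phi> q g f) (a (kraus \<phi> q g f')))"
  by (simp add: dil_T_apply L2U.ip_sum_right L2U.ip_adj_right)

text \<open>The sum over the output g collapses and leaves pairs of inputs h, h' whose images have
  the same component in G. The dilation computations below arrive at exactly this double
  sum.\<close>

lemma mel_dil_T:
  assumes a: "a \<in> bop L2U"
  shows "mel (dil_T \<phi> q a) i j = (\<Sum>h\<in>UNIV. \<Sum>h'\<in>UNIV. complex_of_real (sqrt (pmf q h)) * complex_of_real (sqrt (pmf q h')) *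
    (if snd (\<phi> (i, h)) = snd (\<phi> (j, h')) then mel a (fst (\<phi> (i, h))) (fst (\<phi> (j, h'))) else 0))"
proof -
  let ?r = "\<lambda>h. complex_of_real (sqrt (pmf q h))"
  let ?k = "\<lambda>j h g. if snd (\<phi> (j, h)) = g then ket (fst (\<phi> (j, h))) else 0"
  have "ip L2U (kraus \<phi> q g (ket i)) (a (kraus \<phi> q g (ket j))) =
      (\<Sum>h\<in>UNIV. \<Sum>h'\<in>UNIV. ?r h * ?r h' * ip L2U (?k i h g) (a (?k j h' g)))" for g
    unfolding kraus_ket using a
    by (simp add: L2U.bop_sum L2U.bop_scale L2U.ip_sum_left L2U.ip_sum_right L2U.ip_scale_left
        L2U.ip_scale_right sum_distrib_left mult_ac) (subst sum.swap, simp add: mult_ac)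
  then have "mel (dil_T \<phi> q a) i j = (\<Sum>g\<in>UNIV. \<Sum>h\<in>UNIV. \<Sum>h'\<in>UNIV. ?r h * ?r h' * ip L2U (?k i h g) (a (?k j h' g)))"
    using a by (simp add: mel_def ip_dil_T)
  also have "\<dots> = (\<Sum>h\<in>UNIV. \<Sum>h'\<in>UNIV. \<Sum>g\<in>UNIV. ?r h * ?r h' * ip L2U (?k i h g) (a (?k j h' g)))"
    by (rule trans[OF sum.swap], rule sum.cong[OF refl], rule sum.swap)
  also have "\<dots> = (\<Sum>h\<in>UNIV. \<Sum>h'\<in>UNIV. \<Sum>g\<in>UNIV. if g = snd (\<phi> (j, h')) then
      ?r h * ?r h' * (if snd (\<phi> (i, h)) = snd (\<phi> (j, h')) then mel a (fst (\<phi> (i, h))) (fst (\<phi> (j, h'))) else 0) else 0)"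
    using a by (intro sum.cong) (auto simp: mel_def)
  finally show ?thesis by simp
qed

lemma ip_pket_amp:
  assumes "a \<in> bop L2U"
  shows "ip (Htens L2U) (pket p) (amp L2U a (pket p')) = (if snd p = snd p' then mel a (fst p) (fst p') else 0)"
  using assms by (simp add: pket_def L2U.amp_vtens L2U.ip_vtens mel_def)

lemma dil_V_dil_vec: "dil_V \<phi> (ket i \<otimes>\<^sub>v dil_vec q) = (\<Sum>h\<in>UNIV. complex_of_real (sqrt (pmf q h)) \<cdot>\<^sub>v pket (\<phi> (i, h)))"
proof -
  have "ket i \<otimes>\<^sub>v dil_vec q = (\<Sum>h\<in>UNIV. complex_of_real (sqrt (pmf q h)) \<cdot>\<^sub>v pket (i, h))"
    by (simp add: dil_vec_def vtens_sum vtens_simps pket_def)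
  then show ?thesis by (simp add: HL.bop_sum[OF dil_V_bop] HL.bop_scale[OF dil_V_bop] dil_V_pket)
qed

text \<open>Expanding \<upsilon> on both sides gives the double sum of \<open>mel_dil_T\<close>: the
  ampliation of a is diagonal in G, which forces equal second components.\<close>

lemma dil_T_compression:
  assumes a: "a \<in> bop L2U"
  shows "ip (Htens L2U) (dil_V \<phi> (ket i \<otimes>\<^sub>v dil_vec q)) (amp L2U a (dil_V \<phi> (ket j \<otimes>\<^sub>v dil_vec q))) = mel (dil_T \<phi> q a) i j"
proof -
  note b = L2U.amp_bop[OF a]
  show ?thesis unfolding dil_V_dil_vec mel_dil_T[OF a]
    by (simp add: HL.bop_sum[OF b] HL.bop_scale[OF b] HL.ip_sum_left HL.ip_sum_right HL.ip_scale_left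
        HL.ip_scale_right ip_pket_amp[OF a] sum_distrib_left mult_ac)
      (subst sum.swap, simp add: mult_ac)
qed

lemma ket_dil_vec: "ip L2U (ket g) (dil_vec q) = complex_of_real (sqrt (pmf q g))"
proof -
  have "ip L2U (ket g) (dil_vec q) = (\<Sum>h\<in>UNIV. complex_of_real (sqrt (pmf q h)) * ip L2U (ket g) (ket h))"
    by (simp add: dil_vec_def L2U.ip_sum_right L2U.ip_scale_right del: ip_ket)
  also have "\<dots> = (\<Sum>h\<in>UNIV. if h = g then complex_of_real (sqrt (pmf q g)) else 0)"
    by (intro sum.cong) auto
  finally show ?thesis by simp
qed

lemma sum_pmf_finite: "(\<Sum>g\<in>UNIV. pmf q g) = 1" for q :: "'g::finite pmf"
  by (rule sum_pmf_eq_1) auto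

lemma of_real_sqrt_pmf: "complex_of_real (sqrt (pmf q g)) * complex_of_real (sqrt (pmf q g)) = complex_of_real (pmf q g)"
  by (simp flip: of_real_mult)

lemma ip_dil_vec: "ip L2U (dil_vec q) (dil_vec q) = 1"
proof -
  have "ip L2U (dil_vec q) (dil_vec q) = (\<Sum>g\<in>UNIV. ip L2U (dil_vec q) (ket g) * ip L2U (ket g) (dil_vec q))"
    by (rule ip_L2U_ket(3)[symmetric])
  also have "\<dots> = (\<Sum>g\<in>UNIV. complex_of_real (pmf q g))"
  proof (rule sum.cong)
    fix g
    have "ip L2U (dil_vec q) (ket g) = cnj (ip L2U (ket g) (dil_vec q))" by (simp add: ip_L2U_cnj)
    then show "ip L2U (dil_vec q) (ket g) * ip L2U (ket g) (dil_vec q) = complex_of_real (pmf q g)"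
      by (simp add: ket_dil_vec of_real_sqrt_pmf)
  qed simp
  also have "\<dots> = of_real (\<Sum>g\<in>UNIV. pmf q g)" by simp
  finally show ?thesis by (simp only: sum_pmf_finite of_real_1)
qed

lemma hnorm_dil_vec: "hnorm L2U (dil_vec q) = 1"
  by (simp add: hnorm_def ip_dil_vec)

subsection \<open>The quantum dynamical semigroup\<close>

lemma dil_T_linear:
  assumes "a \<in> bop L2U" "b \<in> bop L2U"
  shows "dil_T \<phi> q (c \<cdot>\<^sub>o a + b) = c \<cdot>\<^sub>o dil_T \<phi> q a + dil_T \<phi> q b"
proof (rule mel_ext)
  fix i j
  show "mel (dil_T \<phi> q (c \<cdot>\<^sub>o a + b)) i j = mel (c \<cdot>\<^sub>o dil_T \<phi> q a + dil_T \<phi> q b) i j"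
    unfolding mel_dil_T[OF L2U.bop_plus[OF L2U.bop_scale_op[OF assms(1), of c] assms(2)]] mel_plus mel_scale
      mel_dil_T[OF assms(1)] mel_dil_T[OF assms(2)] sum_distrib_left sum.distrib[symmetric]
    by (intro sum.cong refl) (simp add: algebra_simps)
qed (use assms in auto)

text \<open>Here bijectivity of \<phi> enters: equal images force i = j and h = h', so the cross
  terms vanish and the weights of q add up to 1.\<close>

lemma dil_T_id: 
  assumes "bij \<phi>"
  shows "dil_T \<phi> q (id_op L2U) = id_op L2U"
proof (rule mel_ext)
  fix i j
  let ?r = "\<lambda>h. complex_of_real (sqrt (pmf q h))"
  have inj: "\<phi> p = \<phi> p' \<longleftrightarrow> p = p'" for p p' by (rule inj_eq[OF bij_is_inj[OF assms]])
  have "mel (dil_T \<phi> q (id_op L2U)) i j = (\<Sum>h\<in>UNIV. \<Sum>h'\<in>UNIV. if h' = h then (if i = j then ?r h * ?r h else 0) else 0)"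
    unfolding mel_dil_T[OF L2U.id_bop] mel_id
  proof (intro sum.cong refl)
    fix h h'
    have "snd (\<phi> (i, h)) = snd (\<phi> (j, h')) \<and> fst (\<phi> (i, h)) = fst (\<phi> (j, h')) \<longleftrightarrow> i = j \<and> h = h'"
      using inj[of "(i, h)" "(j, h')"] by (auto simp: prod_eq_iff)
    then show "?r h * ?r h' * (if snd (\<phi> (i, h)) = snd (\<phi> (j, h')) then if fst (\<phi> (i, h)) = fst (\<phi> (j, h')) then 1 else 0 else 0) =
        (if h' = h then if i = j then ?r h * ?r h else 0 else 0)" by auto
  qed
  also have "\<dots> = (if i = j then of_real (\<Sum>h\<in>UNIV. pmf q h) else 0)"
    by (simp add: of_real_sqrt_pmf)
  finally show "mel (dil_T \<phi> q (id_op L2U)) i j = mel (id_op L2U) i j"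
    by (simp add: mel_id sum_pmf_finite)
qed auto

lemma sum_comp: "(\<Sum>a\<in>I. A a) \<circ> B = (\<Sum>a\<in>I. A a \<circ> B)" for A :: "'a \<Rightarrow> 'x operator"
  by (simp add: fun_eq_iff sum_fun_apply)

lemma comp_sum: "B \<in> bop L2U \<Longrightarrow> B \<circ> (\<Sum>a\<in>I. A a) = (\<Sum>a\<in>I. B \<circ> A a)"
  by (rule ext) (simp add: sum_fun_apply[of A] sum_fun_apply[of "\<lambda>a. B \<circ> A a"] L2U.bop_sum)

lemma htrace_sum: "(\<And>a. a \<in> I \<Longrightarrow> A a \<in> bop L2U) \<Longrightarrow> htrace L2U (\<Sum>a\<in>I. A a) = (\<Sum>a\<in>I. htrace L2U (A a))"
  by (simp add: htrace_L2U L2U.bop_sum_op mel_sum sum.swap[of _ UNIV])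

lemma nonneg_Reals_sum: "(\<And>a. a \<in> A \<Longrightarrow> f a \<in> \<real>\<^sub>\<ge>\<^sub>0) \<Longrightarrow> (\<Sum>a\<in>A. f a) \<in> \<real>\<^sub>\<ge>\<^sub>0"
  for f :: "'a \<Rightarrow> complex"
  by (induction A rule: infinite_finite_induct) (auto intro: nonneg_Reals_add_I)

lemma qds_generator_dil_T:
  fixes \<phi> :: "'e::finite \<times> 'g::finite \<Rightarrow> 'e \<times> 'g"
  assumes "bij \<phi>"
  shows "qds_generator (dil_T \<phi> q)"
  unfolding qds_generator_def
proof (intro conjI ballI allI)
  let ?W = "kraus \<phi> q"
  show "dil_T \<phi> q a \<in> bop L2U" if "a \<in> bop L2U" for a using that by auto
  show "dil_T \<phi> q (c \<cdot>\<^sub>o a + b) = c \<cdot>\<^sub>o dil_T \<phi> q a + dil_T \<phi> q b" if "a \<in> bop L2U" "b \<in> bop L2U" for a b c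
    using that by (rule dil_T_linear)
  show "dil_T \<phi> q (id_op L2U) = id_op L2U" using assms by (rule dil_T_id)
  define C where "C = (\<Sum>g\<in>UNIV. opnorm L2U (adj L2U (?W g)) * opnorm L2U (?W g))"
  show "\<exists>C. \<forall>a\<in>bop L2U. opnorm L2U (dil_T \<phi> q a) \<le> C * opnorm L2U a"
  proof (intro exI[of _ C] ballI)
    fix a :: "'e operator" assume a: "a \<in> bop L2U"
    show "opnorm L2U (dil_T \<phi> q a) \<le> C * opnorm L2U a"
    proof (rule L2U.opnorm_le)
      show "C * opnorm L2U a \<ge> 0"
        unfolding C_def using a by (intro mult_nonneg_nonneg sum_nonneg L2U.opnorm_nonneg L2U.adj_bop kraus_bop)
      fix f
      have "hnorm L2U (adj L2U (?W g) (a (?W g f))) \<le> opnorm L2U (adj L2U (?W g)) * (opnorm L2U a * (opnorm L2U (?W g) * hnorm L2U f))" for g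
      proof -
        have "hnorm L2U (adj L2U (?W g) (a (?W g f))) \<le> opnorm L2U (adj L2U (?W g)) * hnorm L2U (a (?W g f))"
          by (rule L2U.opnorm_bound) auto
        also have "\<dots> \<le> opnorm L2U (adj L2U (?W g)) * (opnorm L2U a * hnorm L2U (?W g f))"
          using a by (intro mult_left_mono L2U.opnorm_bound L2U.opnorm_nonneg) auto
        also have "\<dots> \<le> opnorm L2U (adj L2U (?W g)) * (opnorm L2U a * (opnorm L2U (?W g) * hnorm L2U f))"
          using a by (intro mult_left_mono L2U.opnorm_bound L2U.opnorm_nonneg) auto
        finally show ?thesis .
      qed
      then have "hnorm L2U (dil_T \<phi> q a f) \<le> (\<Sum>g\<in>UNIV. opnorm L2U (adj L2U (?W g)) * (opnorm L2U a * (opnorm L2U (?W g) * hnorm L2U f)))"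
        unfolding dil_T_apply by (intro order_trans[OF L2U.hnorm_sum] sum_mono) auto
      then show "hnorm L2U (dil_T \<phi> q a f) \<le> C * opnorm L2U a * hnorm L2U f"
        by (simp add: C_def sum_distrib_left sum_distrib_right mult_ac)
    qed
  qed
  \<comment> \<open>For each g the assumed positivity is applied to the vectors obtained from the f
    k by the Kraus operator of g.\<close>
  show "completely_positive L2U (dil_T \<phi> q)"
    unfolding completely_positive_def positive_matrix_def
  proof (intro allI impI)
    fix n :: nat and A :: "nat \<Rightarrow> nat \<Rightarrow> 'e operator" and f :: "nat \<Rightarrow> 'e cvec"
    assume A: "\<forall>k<n. \<forall>l<n. A k l \<in> bop L2U"
      and pos: "\<forall>f. (\<forall>k<n. f k \<in> vecs L2U) \<longrightarrow> (\<Sum>k<n. \<Sum>l<n. ip L2U (f k) (A k l (f l))) \<in> \<real>\<^sub>\<ge>\<^sub>0"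
    have "(\<Sum>k<n. \<Sum>l<n. ip L2U (f k) (dil_T \<phi> q (A k l) (f l))) =
        (\<Sum>k<n. \<Sum>l<n. \<Sum>g\<in>UNIV. ip L2U (?W g (f k)) (A k l (?W g (f l))))"
      using A by (intro sum.cong refl ip_dil_T) auto
    also have "\<dots> = (\<Sum>k<n. \<Sum>g\<in>UNIV. \<Sum>l<n. ip L2U (?W g (f k)) (A k l (?W g (f l))))"
      by (intro sum.cong refl sum.swap)
    also have "\<dots> = (\<Sum>g\<in>UNIV. \<Sum>k<n. \<Sum>l<n. ip L2U (?W g (f k)) (A k l (?W g (f l))))"
      by (rule sum.swap)
    also have "\<dots> \<in> \<real>\<^sub>\<ge>\<^sub>0"
    proof -
      have "(\<Sum>k<n. \<Sum>l<n. ip L2U (?W g (f k)) (A k l (?W g (f l)))) \<in> \<real>\<^sub>\<ge>\<^sub>0" for g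
        using pos[rule_format, of "\<lambda>k. ?W g (f k)"] by simp
      then show ?thesis by (rule nonneg_Reals_sum)
    qed
    finally show "(\<Sum>k<n. \<Sum>l<n. ip L2U (f k) (dil_T \<phi> q (A k l) (f l))) \<in> \<real>\<^sub>\<ge>\<^sub>0" .
  qed
  \<comment> \<open>Cyclicity of the trace moves the left factor to the right, so the predual map is
    \<tau> to the sum over g of K_g \<tau> K_g^*.\<close>
  show "normal_map (dil_T \<phi> q)"
    unfolding normal_map_def
  proof (intro ballI bexI)
    fix \<tau> a :: "'e operator" assume \<tau>: "\<tau> \<in> bop L2U" and a: "a \<in> bop L2U"
    have "htrace L2U (dil_T \<phi> q a \<circ> \<tau>) = (\<Sum>g\<in>UNIV. htrace L2U (adj L2U (?W g) \<circ> a \<circ> ?W g \<circ> \<tau>))"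
      unfolding dil_T_eq sum_comp using a \<tau> by (intro htrace_sum) auto
    also have "\<dots> = (\<Sum>g\<in>UNIV. htrace L2U (a \<circ> (?W g \<circ> \<tau> \<circ> adj L2U (?W g))))"
    proof (intro sum.cong refl)
      fix g
      have "htrace L2U (adj L2U (?W g) \<circ> (a \<circ> ?W g \<circ> \<tau>)) = htrace L2U ((a \<circ> ?W g \<circ> \<tau>) \<circ> adj L2U (?W g))"
        using a \<tau> by (intro htrace_comm) auto
      then show "htrace L2U (adj L2U (?W g) \<circ> a \<circ> ?W g \<circ> \<tau>) = htrace L2U (a \<circ> (?W g \<circ> \<tau> \<circ> adj L2U (?W g)))"
        by (simp add: comp_assoc)
    qed
    also have "\<dots> = htrace L2U (a \<circ> (\<Sum>g\<in>UNIV. ?W g \<circ> \<tau> \<circ> adj L2U (?W g)))"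
      unfolding comp_sum[OF a] using a \<tau> by (intro htrace_sum[symmetric]) auto
    finally show "htrace L2U (dil_T \<phi> q a \<circ> \<tau>) = htrace L2U (a \<circ> (\<Sum>g\<in>UNIV. ?W g \<circ> \<tau> \<circ> adj L2U (?W g)))" .
  next
    fix \<tau> :: "'e operator" assume \<tau>: "\<tau> \<in> bop L2U"
    show "(\<Sum>g\<in>UNIV. ?W g \<circ> \<tau> \<circ> adj L2U (?W g)) \<in> bop L2U"
      using \<tau> by (intro L2U.bop_sum_op L2U.bop_comp L2U.adj_bop) auto
  qed
qed

subsection \<open>The path measure\<close>

text \<open>A point mass in the first factor makes the measure the image of the product measure
  under x to (k, x); integrals are thereby reduced to one factor.\<close>

lemma path_measure_distr:
  "path_measure q k = distr (\<Pi>\<^sub>M n\<in>(UNIV::int set). measure_pmf q) (path_measure q k) (Pair k)"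
proof -
  let ?P = "\<Pi>\<^sub>M n\<in>(UNIV::int set). measure_pmf q"
  interpret P: product_prob_space "\<lambda>_. measure_pmf q" "UNIV :: int set" ..
  interpret R: prob_space "measure_pmf (return_pmf k)" by (rule measure_pmf.prob_space_axioms)
  have [measurable]: "Pair k \<in> measurable ?P (measure_pmf (return_pmf k) \<Otimes>\<^sub>M ?P)" by simp
  have "measure_pmf (return_pmf k) \<Otimes>\<^sub>M ?P = distr ?P (measure_pmf (return_pmf k) \<Otimes>\<^sub>M ?P) (Pair k)"
  proof (rule pair_measure_eqI)
    show "sigma_finite_measure (measure_pmf (return_pmf k))" "sigma_finite_measure ?P" by unfold_locales
    fix A B assume AB: "A \<in> sets (measure_pmf (return_pmf k))" "B \<in> sets ?P"
    have "emeasure (distr ?P (measure_pmf (return_pmf k) \<Otimes>\<^sub>M ?P) (Pair k)) (A \<times> B) = emeasure ?P (Pair k -` (A \<times> B) \<inter> space ?P)"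
      using AB by (intro emeasure_distr) auto
    also have "Pair k -` (A \<times> B) \<inter> space ?P = (if k \<in> A then B else {})"
      using sets.sets_into_space[OF AB(2)] by auto
    finally show "emeasure (measure_pmf (return_pmf k)) A * emeasure ?P B =
        emeasure (distr ?P (measure_pmf (return_pmf k) \<Otimes>\<^sub>M ?P) (Pair k)) (A \<times> B)"
      by (auto simp: emeasure_return_pmf)
  qed simp
  then show ?thesis by (simp add: path_measure_def)
qed

lemma path_measure_Pair [measurable]: "Pair k \<in> measurable (\<Pi>\<^sub>M n\<in>(UNIV::int set). measure_pmf q) (path_measure q k')"
  unfolding path_measure_def by simp

lemma prob_space_path_measure: "prob_space (path_measure q k)"
proof -
  interpret P: product_prob_space "\<lambda>_. measure_pmf q" "UNIV :: int set" ..
  show ?thesis by (subst path_measure_distr, rule P.P.prob_space_distr) simp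
qed

lemma space_path_measure [simp]: "space (path_measure q k) = UNIV"
  by (simp add: path_measure_def space_pair_measure space_PiM)

lemma cylinder_set_measurable:
  fixes y :: "int \<Rightarrow> 'g" and i :: 'e
  assumes "finite J"
  shows "{\<omega>. fst \<omega> = i \<and> (\<forall>n\<in>J. snd \<omega> n = y n)} \<in> sets (path_measure q k)"
proof -
  let ?M = "path_measure q k :: ('e, 'g) path measure"
  have 1: "fst \<in> measurable ?M (count_space UNIV)" unfolding path_measure_def
    using measurable_fst[of "measure_pmf (return_pmf k)"] by (simp add: measurable_def)
  have 2: "(\<lambda>\<omega>. snd \<omega> n) \<in> measurable ?M (count_space UNIV)" for n
  proof -
    have "(\<lambda>\<omega>. snd \<omega> n) \<in> measurable ?M (measure_pmf q)" unfolding path_measure_def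
      by (rule measurable_compose[OF measurable_snd measurable_component_singleton]) simp
    then show ?thesis by (simp add: measurable_def)
  qed
  have "{\<omega> \<in> space ?M. \<forall>n\<in>J. snd \<omega> n = y n} \<in> sets ?M"
  proof (rule sets.sets_Collect_finite_All[OF _ assms])
    fix n
    have "{\<omega> \<in> space ?M. snd \<omega> n = y n} = (\<lambda>\<omega>. snd \<omega> n) -` {y n} \<inter> space ?M" by auto
    then show "{\<omega> \<in> space ?M. snd \<omega> n = y n} \<in> sets ?M" using measurable_sets[OF 2, of "{y n}" n] by simp
  qed
  moreover have "fst -` {i} \<inter> space ?M \<in> sets ?M" by (rule measurable_sets[OF 1]) simp
  ultimately have "(fst -` {i} \<inter> space ?M) \<inter> {\<omega> \<in> space ?M. \<forall>n\<in>J. snd \<omega> n = y n} \<in> sets ?M"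
    by (rule sets.Int[rotated])
  moreover have "{\<omega>. fst \<omega> = i \<and> (\<forall>n\<in>J. snd \<omega> n = y n)} =
      (fst -` {i} \<inter> space ?M) \<inter> {\<omega> \<in> space ?M. \<forall>n\<in>J. snd \<omega> n = y n}" by auto
  ultimately show ?thesis by (simp only:)
qed

lemma cylinderD: "cylinder t F \<Longrightarrow> (\<And>n. \<bar>n\<bar> \<le> int t \<Longrightarrow> x n = y n) \<Longrightarrow> F (i, x) = F (i, y)"
  by (simp add: cylinder_def)

text \<open>A window has finitely many configurations. The extensional functions pick one
  representative of each, with \<open>undefined\<close> outside the window, where F does not
  look.\<close>

lemma cylinder_expand:
  fixes F :: "('e::finite, 'g::finite) path \<Rightarrow> complex"
  assumes "cylinder t F"
  shows "F \<omega> = (\<Sum>i\<in>UNIV. \<Sum>y\<in>PiE {-int t..int t} (\<lambda>_. UNIV).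
    F (i, y) * indicator {\<omega>. fst \<omega> = i \<and> (\<forall>n\<in>{-int t..int t}. snd \<omega> n = y n)} \<omega>)"
proof -
  let ?J = "{-int t..int t}"
  let ?y = "restrict (snd \<omega>) ?J"
  have fin: "finite (PiE ?J (\<lambda>_. UNIV :: 'g set))" by (intro finite_PiE) auto
  have y: "?y \<in> PiE ?J (\<lambda>_. UNIV)" by simp
  have "(\<Sum>y\<in>PiE ?J (\<lambda>_. UNIV). F (i, y) * indicator {\<omega>. fst \<omega> = i \<and> (\<forall>n\<in>?J. snd \<omega> n = y n)} \<omega>) =
      (if i = fst \<omega> then F \<omega> else 0)" for i
  proof -
    have "F (i, y) * indicator {\<omega>. fst \<omega> = i \<and> (\<forall>n\<in>?J. snd \<omega> n = y n)} \<omega> =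
        (if y = ?y then (if i = fst \<omega> then F \<omega> else 0) else 0)" if "y \<in> PiE ?J (\<lambda>_. UNIV)" for y
    proof (cases "\<forall>n\<in>?J. snd \<omega> n = y n")
      case True
      have "y = ?y" by (rule PiE_ext[OF that y]) (use True in auto)
      moreover have "F (fst \<omega>, ?y) = F (fst \<omega>, snd \<omega>)"
        by (rule cylinderD[OF assms]) (auto simp: restrict_def)
      ultimately show ?thesis using True by (auto simp: indicator_def)
    next
      case False
      then have "y \<noteq> ?y" by auto
      then show ?thesis using False by (simp add: indicator_def)
    qed
    then have "(\<Sum>y\<in>PiE ?J (\<lambda>_. UNIV). F (i, y) * indicator {\<omega>. fst \<omega> = i \<and> (\<forall>n\<in>?J. snd \<omega> n = y n)} \<omega>) =
        (\<Sum>y\<in>PiE ?J (\<lambda>_. UNIV). if y = ?y then (if i = fst \<omega> then F \<omega> else 0) else 0)"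
      by (intro sum.cong refl)
    also have "\<dots> = (if i = fst \<omega> then F \<omega> else 0)"
      unfolding sum.delta[OF fin] using y by simp
    finally show ?thesis .
  qed
  then show ?thesis by simp
qed

lemma cylinder_measurable:
  fixes F :: "('e::finite, 'g::finite) path \<Rightarrow> complex"
  assumes "cylinder t F"
  shows "F \<in> borel_measurable (path_measure q k)"
proof -
  have "(\<lambda>\<omega>. \<Sum>i\<in>UNIV. \<Sum>y\<in>PiE {-int t..int t} (\<lambda>_. UNIV). F (i, y) *
      indicator {\<omega>. fst \<omega> = i \<and> (\<forall>n\<in>{-int t..int t}. snd \<omega> n = y n)} \<omega>) \<in> borel_measurable (path_measure q k)"
    by (intro borel_measurable_sum borel_measurable_times borel_measurable_const borel_measurable_indicator
        cylinder_set_measurable) auto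
  then show ?thesis by (subst measurable_cong[OF cylinder_expand[OF assms]])
qed

lemma path_integral_Pair:
  fixes F :: "('e, 'g) path \<Rightarrow> complex"
  assumes "F \<in> borel_measurable (path_measure q k)"
  shows "(\<integral>\<omega>. F \<omega> \<partial>path_measure q k) = (\<integral>x. F (k, x) \<partial>(\<Pi>\<^sub>M n\<in>(UNIV::int set). measure_pmf q))"
  by (subst path_measure_distr) (rule integral_distr[OF path_measure_Pair assms])

text \<open>Each configuration of the window is a finite-dimensional event whose probability is the
  product of the weights.\<close>

lemma path_integral_cylinder:
  fixes F :: "('e::finite, 'g::finite) path \<Rightarrow> complex"
  assumes "cylinder t F"
  shows "(\<integral>\<omega>. F \<omega> \<partial>path_measure q k) = (\<Sum>y\<in>PiE {-int t..int t} (\<lambda>_. UNIV).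
    F (k, y) * (\<Prod>n\<in>{-int t..int t}. complex_of_real (pmf q (y n))))"
proof -
  let ?J = "{-int t..int t}"
  let ?P = "\<Pi>\<^sub>M n\<in>(UNIV::int set). measure_pmf q"
  interpret P: product_prob_space "\<lambda>_. measure_pmf q" "UNIV :: int set" ..
  define S where "S y = {x. \<forall>n\<in>?J. x n = y n}" for y :: "int \<Rightarrow> 'g"
  have S: "S y = prod_emb UNIV (\<lambda>_. measure_pmf q) ?J (PiE ?J (\<lambda>n. {y n}))" for y
    by (auto simp: S_def prod_emb_def PiE_iff space_PiM)
  have Sm: "S y \<in> sets ?P" for y unfolding S by (rule sets_PiM_I) auto
  have Sp: "measure ?P (S y) = (\<Prod>n\<in>?J. pmf q (y n))" for y
    unfolding S by (subst P.measure_PiM_emb) (auto simp: measure_pmf_single)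
  have eq: "F (k, x) = (\<Sum>y\<in>PiE ?J (\<lambda>_. UNIV). indicator (S y) x *\<^sub>R F (k, y))" for x
  proof -
    have "(\<Sum>y\<in>PiE ?J (\<lambda>_. UNIV). F (i, y) * indicator {\<omega>. fst \<omega> = i \<and> (\<forall>n\<in>?J. snd \<omega> n = y n)} (k, x)) =
        (if i = k then (\<Sum>y\<in>PiE ?J (\<lambda>_. UNIV). indicator (S y) x *\<^sub>R F (k, y)) else 0)" for i
      by (auto simp: S_def indicator_def intro!: sum.cong sum.neutral)
    then show ?thesis by (subst cylinder_expand[OF assms]) simp
  qed
  have "(\<integral>\<omega>. F \<omega> \<partial>path_measure q k) = (\<integral>x. (\<Sum>y\<in>PiE ?J (\<lambda>_. UNIV). indicator (S y) x *\<^sub>R F (k, y)) \<partial>?P)"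
    unfolding path_integral_Pair[OF cylinder_measurable[OF assms]]
    by (rule Bochner_Integration.integral_cong[OF refl eq])
  also have "\<dots> = (\<Sum>y\<in>PiE ?J (\<lambda>_. UNIV). measure ?P (S y) *\<^sub>R F (k, y))"
    by (intro has_bochner_integral_integral_eq has_bochner_integral_sum has_bochner_integral_indicator Sm)
      (simp add: P.P.emeasure_eq_measure)
  also have "\<dots> = (\<Sum>y\<in>PiE ?J (\<lambda>_. UNIV). F (k, y) * (\<Prod>n\<in>?J. complex_of_real (pmf q (y n))))"
    by (intro sum.cong) (auto simp: Sp scaleR_conv_of_real)
  finally show ?thesis .
qed

text \<open>The Markov property at time \<open>0\<close> identifies the law of one step.\<close>

lemma standard_dilation_step:
  fixes P :: "'e::finite \<Rightarrow> 'e \<Rightarrow> real" and \<phi> :: "'e \<times> 'g::finite \<Rightarrow> 'e \<times> 'g"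
  assumes "standard_dilation P \<phi> q"
  shows "(\<Sum>g\<in>UNIV. if fst (\<phi> (k, g)) = j then pmf q g else 0) = P k j"
proof -
  let ?M = "path_measure q k :: ('e, 'g) path measure"
  let ?P = "\<Pi>\<^sub>M n\<in>(UNIV::int set). measure_pmf q"
  let ?F = "vimage_algebra UNIV (chain \<phi> 0) (count_space UNIV) :: ('e, 'g) path measure"
  let ?A = "{\<omega>. chain \<phi> (Suc 0) \<omega> = j}"
  interpret M: prob_space ?M by (rule prob_space_path_measure)
  interpret P: product_prob_space "\<lambda>_. measure_pmf q" "UNIV :: int set" ..
  have c0: "chain \<phi> 0 = fst" by (auto simp: chain_def fun_eq_iff)
  have c1: "chain \<phi> (Suc 0) \<omega> = fst (\<phi> (fst \<omega>, snd \<omega> 1))" for \<omega>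
    by (auto simp: chain_def alpha_def path_shift_def act1_def split: prod.split)
  have cyl: "cylinder 1 (\<lambda>\<omega>. f (fst \<omega>) (snd \<omega> 1) :: complex)" for f :: "'e \<Rightarrow> 'g \<Rightarrow> complex"
    unfolding cylinder_def by simp
  have meas: "(\<lambda>\<omega>. f (fst \<omega>) (snd \<omega> 1)) \<in> borel_measurable ?M" for f :: "'e \<Rightarrow> 'g \<Rightarrow> real"
    using measurable_compose[OF cylinder_measurable[OF cyl[of "\<lambda>i g. complex_of_real (f i g)"]] borel_measurable_Re] by simp
  have indA: "indicator ?A = (\<lambda>\<omega>. (if fst (\<phi> (fst \<omega>, snd \<omega> 1)) = j then 1 else 0 :: real))"
    by (auto simp: c1 indicator_def fun_eq_iff)
  have Am: "(indicator ?A :: _ \<Rightarrow> real) \<in> borel_measurable ?M"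
    unfolding indA by (rule meas[of "\<lambda>i g. if fst (\<phi> (i, g)) = j then 1 else 0"])
  have fm: "fst -` B \<in> sets ?M" for B :: "'e set"
  proof -
    have "(\<lambda>\<omega>. indicator B (fst \<omega>) :: real) \<in> borel_measurable ?M" by (rule meas[of "\<lambda>i g. indicator B i"])
    then have "(\<lambda>\<omega>. indicator B (fst \<omega>) :: real) -` {1} \<inter> space ?M \<in> sets ?M" by (rule measurable_sets) simp
    moreover have "(\<lambda>\<omega>. indicator B (fst \<omega>) :: real) -` {1} \<inter> space ?M = fst -` B"
      by (auto simp: indicator_def split: if_splits)
    ultimately show ?thesis by (simp only:)
  qed
  have "sigma_sets (space ?M) {B. \<exists>A. B = fst -` A} \<subseteq> sets ?M"
    by (rule sets.sigma_sets_subset) (use fm in auto)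
  \<comment> \<open>At time 0 the conditioning \<sigma>-algebra is the one generated by the initial
    state.\<close>
  then have sub: "subalgebra ?M ?F"
    unfolding subalgebra_def by (simp add: sets_vimage_algebra c0)
  interpret S: finite_measure_subalgebra ?M ?F by unfold_locales (rule sub)
  have intA: "integrable ?M (indicator ?A :: _ \<Rightarrow> real)"
    by (rule M.integrable_const_bound[of _ 1]) (use Am in \<open>auto simp: indicator_def\<close>)
  have "AE \<omega> in ?M. real_cond_exp ?M ?F (indicator ?A) \<omega> = P (chain \<phi> 0 \<omega>) j"
    using assms unfolding standard_dilation_def by blast
  \<comment> \<open>Integrating the almost sure identity removes the conditional expectation. Under
    the point mass at k the right side is the constant P k j.\<close>
  then have "(\<integral>\<omega>. real_cond_exp ?M ?F (indicator ?A) \<omega> \<partial>?M) = (\<integral>\<omega>. P (fst \<omega>) j \<partial>?M)"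
    unfolding c0 by (intro integral_cong_AE meas[of "\<lambda>i g. P i j"] borel_measurable_cond_exp2) auto
  then have "(\<integral>\<omega>. indicator ?A \<omega> \<partial>?M) = (\<integral>\<omega>. P (fst \<omega>) j \<partial>?M)"
    using S.real_cond_exp_int(2)[OF intA] by simp
  also have "\<dots> = (\<integral>x. P k j \<partial>?P)"
    by (subst path_measure_distr, subst integral_distr[OF path_measure_Pair meas[of "\<lambda>i g. P i j"]]) simp
  also have "\<dots> = P k j" by (simp add: P.P.prob_space)
  also have "(\<integral>\<omega>. indicator ?A \<omega> \<partial>?M) = (\<integral>x. (if fst (\<phi> (k, x 1)) = j then 1 else 0 :: real) \<partial>?P)"
    unfolding indA
    by (subst path_measure_distr, subst integral_distr[OF path_measure_Pair
          meas[of "\<lambda>i g. if fst (\<phi> (i, g)) = j then 1 else 0"]]) simp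
  also have "\<dots> = (\<integral>g. (if fst (\<phi> (k, g)) = j then 1 else 0 :: real) \<partial>distr ?P (measure_pmf q) (\<lambda>x. x 1))"
    by (subst integral_distr) auto
  \<comment> \<open>The event depends on the noise at site 1 only, whose law is q.\<close>
  also have "distr ?P (measure_pmf q) (\<lambda>x. x 1) = measure_pmf q" by (rule P.PiM_component) simp
  also have "(\<integral>g. (if fst (\<phi> (k, g)) = j then 1 else 0 :: real) \<partial>measure_pmf q) = (\<Sum>g\<in>UNIV. if fst (\<phi> (k, g)) = j then pmf q g else 0)"
    by (subst integral_measure_pmf_real[of UNIV]) (auto intro: sum.cong)
  finally show ?thesis .
qed

text \<open>For diagonal a, equality of the second components is joined by equality of the first
  ones, so injectivity of \<phi> removes all cross terms. What remains is an average over q, which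
  the law of one step turns into P.\<close>

lemma dil_T_mult_fun:
  fixes P :: "'e::finite \<Rightarrow> 'e \<Rightarrow> real" and \<phi> :: "'e \<times> 'g::finite \<Rightarrow> 'e \<times> 'g"
  assumes "standard_dilation P \<phi> q"
  shows "dil_T \<phi> q (mult_fun f) = mult_fun (markov_op P f)"
proof (rule mel_ext)
  have inj: "\<phi> p = \<phi> p' \<longleftrightarrow> p = p'" for p p'
    using assms by (intro inj_eq bij_is_inj) (simp add: standard_dilation_def)
  have bop: "mult_fun h \<in> bop L2U" for h :: "'e \<Rightarrow> complex"
  proof -
    have "mult_fun h = (\<Sum>i\<in>UNIV. h i \<cdot>\<^sub>o ketbra L2U (ket i) (ket i))"
    proof
      fix u
      have "(\<Sum>i\<in>UNIV. h i * (ip L2U (ket i) u * ket i x)) = (\<Sum>i\<in>UNIV. if i = x then h x * u x else 0)" for x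
        by (intro sum.cong) (auto simp: ket_apply ip_L2U_ket(1))
      then show "mult_fun h u = (\<Sum>i\<in>UNIV. h i \<cdot>\<^sub>o ketbra L2U (ket i) (ket i)) u"
        by (simp add: fun_eq_iff mult_fun_def sum_fun_apply scale_op_apply scale_apply L2U.ketbra_apply mult.assoc)
    qed
    then show ?thesis by (simp add: L2U.bop_sum_op L2U.bop_scale_op L2U.ketbra_bop)
  qed
  show "dil_T \<phi> q (mult_fun f) \<in> bop L2U" "mult_fun (markov_op P f) \<in> bop L2U" using bop by auto
  fix i j
  have mm: "mel (mult_fun h) i j = (if i = j then h i else 0)" for h :: "'e \<Rightarrow> complex" and i j
    by (simp add: mel_def ip_L2U_ket(1) mult_fun_def ket_apply)
  let ?r = "\<lambda>h. complex_of_real (sqrt (pmf q h))"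
  have "mel (dil_T \<phi> q (mult_fun f)) i j = (\<Sum>h\<in>UNIV. \<Sum>h'\<in>UNIV. if h' = h then (if i = j then ?r h * ?r h * f (fst (\<phi> (i, h))) else 0) else 0)"
    unfolding mel_dil_T[OF bop] mm
  proof (intro sum.cong refl)
    fix h h'
    have "snd (\<phi> (i, h)) = snd (\<phi> (j, h')) \<and> fst (\<phi> (i, h)) = fst (\<phi> (j, h')) \<longleftrightarrow> i = j \<and> h = h'"
      using inj[of "(i, h)" "(j, h')"] by (auto simp: prod_eq_iff)
    note e = this
    show "?r h * ?r h' * (if snd (\<phi> (i, h)) = snd (\<phi> (j, h')) then if fst (\<phi> (i, h)) = fst (\<phi> (j, h')) then f (fst (\<phi> (i, h))) else 0 else 0) =
        (if h' = h then if i = j then ?r h * ?r h * f (fst (\<phi> (i, h))) else 0 else 0)"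
    proof (cases "i = j \<and> h = h'")
      case False
      then have "(if snd (\<phi> (i, h)) = snd (\<phi> (j, h')) then if fst (\<phi> (i, h)) = fst (\<phi> (j, h')) then f (fst (\<phi> (i, h))) else 0 else 0) = 0"
        using e by argo
      then show ?thesis using False by (simp only: mult_zero_right) auto
    qed simp
  qed
  also have "\<dots> = (if i = j then (\<Sum>h\<in>UNIV. complex_of_real (pmf q h) * f (fst (\<phi> (i, h)))) else 0)"
    by (simp add: of_real_sqrt_pmf)
  \<comment> \<open>The noise values are grouped by the state l that they lead to.\<close>
  also have "(\<Sum>h\<in>UNIV. complex_of_real (pmf q h) * f (fst (\<phi> (i, h)))) =
      (\<Sum>h\<in>UNIV. \<Sum>l\<in>UNIV. if l = fst (\<phi> (i, h)) then complex_of_real (pmf q h) * f l else 0)"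
    by simp
  also have "\<dots> = (\<Sum>l\<in>UNIV. \<Sum>h\<in>UNIV. complex_of_real (if fst (\<phi> (i, h)) = l then pmf q h else 0) * f l)"
    by (subst sum.swap, intro sum.cong refl) auto
  also have "\<dots> = markov_op P f i"
    unfolding markov_op_def
    by (simp only: sum_distrib_right[symmetric] of_real_sum[symmetric] standard_dilation_step[OF assms])
  finally show "mel (dil_T \<phi> q (mult_fun f)) i j = mel (mult_fun (markov_op P f)) i j" by (simp add: mm)
qed

section \<open>Infinite tensor products\<close>

text \<open>Finiteness matters: a product with infinitely many factors different from 1 has the
  default value 1.\<close>

lemma Prod_any_eq_0:
  fixes f :: "int \<Rightarrow> complex"
  assumes "finite {n. f n \<noteq> 1}" "f m = 0"
  shows "Prod_any f = 0"
proof -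
  have "Prod_any f = (\<Prod>n\<in>{n. f n \<noteq> 1}. f n)" by (rule Prod_any.expand_superset[OF assms(1)]) auto
  also have "\<dots> = 0" by (rule prod_zero[OF assms(1)], rule bexI[of _ m]) (use assms(2) in auto)
  finally show ?thesis .
qed

text \<open>The last parameter only fixes the type of the index set \<open>E\<close>.\<close>

locale itensor =
  fixes \<psi> :: "'g::finite cvec" and K :: "'x hilb" and T :: "(int \<Rightarrow> 'g cvec) \<Rightarrow> 'x cvec"
    and E :: "'e::finite itself"
  assumes tensor: "infinite_tensor \<psi> K T"

sublocale itensor \<subseteq> hilbert K
  using tensor by unfold_locales (simp add: infinite_tensor_def)

sublocale itensor \<subseteq> H: hilbert "Htens K :: ('e \<times> 'x) hilb"
  by (rule hilbert_Htens)

context itensor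
begin

abbreviation HK :: "('e \<times> 'x) hilb" where "HK \<equiv> Htens K"

lemma ip_stable [simp]: "ip L2U \<psi> \<psi> = 1"
proof -
  have "hnorm L2U \<psi> = 1" using tensor by (simp add: infinite_tensor_def)
  then show ?thesis using L2U.ip_self[of \<psi>] by simp
qed

lemma ip_T: "h \<in> stab \<psi> \<Longrightarrow> h' \<in> stab \<psi> \<Longrightarrow> ip K (T h) (T h') = Prod_any (\<lambda>n. ip L2U (h n) (h' n))"
  using tensor by (simp add: infinite_tensor_def)

lemma total_T: "total_set K (T ` stab \<psi>)"
  using tensor by (simp add: infinite_tensor_def)

lemma T_vecs [simp, intro]: "h \<in> stab \<psi> \<Longrightarrow> T h \<in> vecs K"
  using total_setD(1)[OF total_T] by auto

lemma stab_const [simp, intro]: "(\<lambda>_. \<psi>) \<in> stab \<psi>"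
  by (simp add: stab_def)

lemma stab_update [simp, intro]: "h \<in> stab \<psi> \<Longrightarrow> h(n := v) \<in> stab \<psi>"
  unfolding stab_def by (simp, rule finite_subset[of _ "insert n {n. h n \<noteq> \<psi>}"]) auto

lemma stab_shift [simp, intro]: "h \<in> stab \<psi> \<Longrightarrow> (\<lambda>n. h (n + k)) \<in> stab \<psi>"
proof -
  assume "h \<in> stab \<psi>"
  then have "finite ((\<lambda>n. n - k) ` {n. h n \<noteq> \<psi>})" by (simp add: stab_def)
  moreover have "{n. h (n + k) \<noteq> \<psi>} \<subseteq> (\<lambda>n. n - k) ` {n. h n \<noteq> \<psi>}"
  proof
    fix n assume "n \<in> {n. h (n + k) \<noteq> \<psi>}"
    then show "n \<in> (\<lambda>n. n - k) ` {n. h n \<noteq> \<psi>}" by (intro image_eqI[of _ _ "n + k"]) auto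
  qed
  ultimately show "(\<lambda>n. h (n + k)) \<in> stab \<psi>" unfolding stab_def using finite_subset by blast
qed

lemma finite_support:
  assumes "h \<in> stab \<psi>" "h' \<in> stab \<psi>"
  shows "finite {n. ip L2U (h n) (h' n) \<noteq> 1}"
proof (rule finite_subset)
  show "finite ({n. h n \<noteq> \<psi>} \<union> {n. h' n \<noteq> \<psi>})" using assms by (simp add: stab_def)
  have "ip L2U (h n) (h' n) = 1" if "h n = \<psi>" "h' n = \<psi>" for n unfolding that by (rule ip_stable)
  then show "{n. ip L2U (h n) (h' n) \<noteq> 1} \<subseteq> {n. h n \<noteq> \<psi>} \<union> {n. h' n \<noteq> \<psi>}" by blast
qed

text \<open>The scalar product of two elementary tensors with the factor of site n removed; it does
  not depend on the entries there.\<close>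

definition rest :: "int \<Rightarrow> (int \<Rightarrow> 'g cvec) \<Rightarrow> (int \<Rightarrow> 'g cvec) \<Rightarrow> complex"
  where "rest n h h' = Prod_any (\<lambda>m. if m = n then 1 else ip L2U (h m) (h' m))"

lemma ip_T_update:
  assumes "h \<in> stab \<psi>" "h' \<in> stab \<psi>"
  shows "ip K (T (h(n := a))) (T (h'(n := b))) = ip L2U a b * rest n h h'"
proof -
  let ?g = "\<lambda>m. if m = n then 1 else ip L2U (h m) (h' m)"
  have "finite {m. ?g m \<noteq> 1}"
    by (rule finite_subset[OF _ finite_support[OF assms]]) auto
  then have "Prod_any (?g(n := ip L2U a b)) = ip L2U a b * Prod_any ?g"
    by (rule Prod_any.update) simp
  moreover have "(\<lambda>m. ip L2U ((h(n := a)) m) ((h'(n := b)) m)) = ?g(n := ip L2U a b)" by auto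
  moreover have "ip K (T (h(n := a))) (T (h'(n := b))) = Prod_any (\<lambda>m. ip L2U ((h(n := a)) m) ((h'(n := b)) m))"
    using assms by (intro ip_T stab_update)
  ultimately show ?thesis by (simp only: rest_def)
qed

text \<open>\<open>infinite_tensor\<close> does not state linearity of T in each entry; it follows
  from the scalar products with the total set. The Parseval identity is a hypothesis so that the
  canonical basis and a basis through the stabilising vector are both covered.\<close>

lemma T_expand:
  assumes h: "h \<in> stab \<psi>" and u: "\<And>f g. (\<Sum>a\<in>(UNIV::'b::finite set). ip L2U f (u a) * ip L2U (u a) g) = ip L2U f g"
  shows "T h = (\<Sum>a\<in>UNIV. ip L2U (u a) (h n) \<cdot>\<^sub>v T (h(n := u a)))"
proof (rule vec_eqI_total[OF total_T])
  show "T h \<in> vecs K" "(\<Sum>a\<in>UNIV. ip L2U (u a) (h n) \<cdot>\<^sub>v T (h(n := u a))) \<in> vecs K" using h by auto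
  fix b assume "b \<in> T ` stab \<psi>"
  then obtain h' where h': "h' \<in> stab \<psi>" "b = T h'" by auto
  have 1: "ip K (T h') (T (h(n := v))) = ip L2U (h' n) v * rest n h' h" for v
    using ip_T_update[OF h'(1) h, of n "h' n" v] by simp
  have "ip K b (T h) = ip L2U (h' n) (h n) * rest n h' h"
    using 1[of "h n"] h' by simp
  also have "\<dots> = (\<Sum>a\<in>UNIV. ip L2U (h' n) (u a) * ip L2U (u a) (h n)) * rest n h' h" by (simp only: u)
  also have "\<dots> = (\<Sum>a\<in>UNIV. ip L2U (u a) (h n) * ip K b (T (h(n := u a))))"
    unfolding h'(2) 1 by (simp add: sum_distrib_left sum_distrib_right mult_ac)
  finally show "ip K b (T h) = ip K b (\<Sum>a\<in>UNIV. ip L2U (u a) (h n) \<cdot>\<^sub>v T (h(n := u a)))"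
    using h h' by (simp add: ip_sum_right ip_scale_right)
qed

text \<open>Induction on the set of sites, expanding one further entry at a time.\<close>

lemma T_span:
  assumes u: "\<And>f g. (\<Sum>a\<in>(UNIV::'b::finite set). ip L2U f (u a) * ip L2U (u a) g) = ip L2U f g"
    and N: "finite N" and h: "h \<in> stab \<psi>"
  shows "T h \<in> vspan (T ` {h' \<in> stab \<psi>. (\<forall>n\<in>N. h' n \<in> range u) \<and> (\<forall>n. n \<notin> N \<longrightarrow> h' n = h n)})"
  using N
proof (induction N)
  case empty
  then show ?case using h by (intro vspan_base) auto
next
  case (insert m N)
  let ?A = "\<lambda>N. {h' \<in> stab \<psi>. (\<forall>n\<in>N. h' n \<in> range u) \<and> (\<forall>n. n \<notin> N \<longrightarrow> h' n = h n)}"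
  have "T ` ?A N \<subseteq> vspan (T ` ?A (insert m N))"
  proof
    fix b assume "b \<in> T ` ?A N"
    then obtain h' where h': "h' \<in> ?A N" "b = T h'" by blast
    have "h'(m := u a) \<in> ?A (insert m N)" for a using h'(1) by auto
    then have "T (h'(m := u a)) \<in> vspan (T ` ?A (insert m N))" for a by (intro vspan_base) blast
    then have "(\<Sum>a\<in>UNIV. ip L2U (u a) (h' m) \<cdot>\<^sub>v T (h'(m := u a))) \<in> vspan (T ` ?A (insert m N))"
      by (intro vspan_sum vspan_scale)
    then show "b \<in> vspan (T ` ?A (insert m N))"
      using T_expand[OF _ u, of h' m] h' by auto
  qed
  then show ?case using vspan_least insert.IH by blast
qed

text \<open>The set N has to be finite: almost all entries must equal \<psi>, which is in general
  not in the canonical basis.\<close>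

lemma total_T_ket:
  assumes "finite N"
  shows "total_set K (T ` {h \<in> stab \<psi>. \<forall>n\<in>N. h n \<in> range ket})"
proof (rule total_set_vspan[OF total_T])
  show "T ` stab \<psi> \<subseteq> vspan (T ` {h \<in> stab \<psi>. \<forall>n\<in>N. h n \<in> range ket})"
  proof
    fix b assume "b \<in> T ` stab \<psi>"
    then obtain h where h: "h \<in> stab \<psi>" "b = T h" by blast
    let ?A = "{h' \<in> stab \<psi>. (\<forall>n\<in>N. h' n \<in> range ket) \<and> (\<forall>n. n \<notin> N \<longrightarrow> h' n = h n)}"
    have "T h \<in> vspan (T ` ?A)" by (rule T_span[OF ip_L2U_ket(3) assms h(1)])
    moreover have "T ` ?A \<subseteq> vspan (T ` {h \<in> stab \<psi>. \<forall>n\<in>N. h n \<in> range ket})"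
      by (auto intro!: vspan_base)
    ultimately show "b \<in> vspan (T ` {h \<in> stab \<psi>. \<forall>n\<in>N. h n \<in> range ket})" using vspan_least h(2) by blast
  qed
qed auto

text \<open>Needed for traces to be meaningful. With a basis of the one-site space that contains the
  stabilising vector, the tensors of basis vectors that are eventually that vector are orthonormal
  and total.\<close>

lemma onb_exists: "\<exists>S. onb K S"
proof -
  obtain g0 :: 'g where True by blast
  obtain u where u0: "u g0 = \<psi>"
    and uu: "\<And>a b. ip L2U (u a) (u b) = (if a = b then 1 else 0)"
    and pars: "\<And>f g. (\<Sum>a\<in>UNIV. ip L2U f (u a) * ip L2U (u a) g) = ip L2U f g"
    by (rule onb_through_unit_vector[OF ip_stable, of g0]) blast
  let ?A = "{h \<in> stab \<psi>. \<forall>n. h n \<in> range u}"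
  have "total_set K (T ` ?A)"
  proof (rule total_set_vspan[OF total_T])
    show "T ` stab \<psi> \<subseteq> vspan (T ` ?A)"
    proof
      fix b assume "b \<in> T ` stab \<psi>"
      then obtain h where h: "h \<in> stab \<psi>" "b = T h" by blast
      let ?N = "{n. h n \<noteq> \<psi>}"
      let ?B = "{h' \<in> stab \<psi>. (\<forall>n\<in>?N. h' n \<in> range u) \<and> (\<forall>n. n \<notin> ?N \<longrightarrow> h' n = h n)}"
      have "T h \<in> vspan (T ` ?B)"
        by (rule T_span[OF pars _ h(1)]) (use h in \<open>simp add: stab_def\<close>)
      moreover have "?B \<subseteq> ?A"
      proof
        fix h' assume h': "h' \<in> ?B"
        have "h' n \<in> range u" for n
        proof (cases "n \<in> ?N")
          case False
          then have "h' n = u g0" using h' u0 by simp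
          then show ?thesis by simp
        qed (use h' in simp)
        then show "h' \<in> ?A" using h' by simp
      qed
      then have "T ` ?B \<subseteq> vspan (T ` ?A)" by (auto intro!: vspan_base)
      ultimately show "b \<in> vspan (T ` ?A)" using vspan_least h(2) by blast
    qed
  qed auto
  moreover have ipA: "ip K (T h) (T h') = (if h = h' then 1 else 0)" if "h \<in> ?A" "h' \<in> ?A" for h h'
  proof (cases "h = h'")
    case True
    have "ip L2U (h n) (h' n) = 1" for n
    proof -
      have "h n \<in> range u" using that by simp
      then show ?thesis using True uu by auto
    qed
    then show ?thesis using True that by (simp add: ip_T)
  next
    case False
    then obtain n where "h n \<noteq> h' n" by auto
    moreover have "h n \<in> range u" "h' n \<in> range u" using that by simp_all
    ultimately have "ip L2U (h n) (h' n) = 0" using uu by auto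
    then have "Prod_any (\<lambda>n. ip L2U (h n) (h' n)) = 0"
      using that by (intro Prod_any_eq_0[of _ n] finite_support) auto
    then show ?thesis using False that by (simp add: ip_T)
  qed
  moreover have "ip K b b' = (if b = b' then 1 else 0)" if bb: "b \<in> T ` ?A" "b' \<in> T ` ?A" for b b'
  proof -
    obtain h h' where h: "h \<in> ?A" "b = T h" "h' \<in> ?A" "b' = T h'" using bb by blast
    have "h = h'" if "b = b'" using ipA[OF h(1,3)] ipA[OF h(3,3)] h that by (auto split: if_splits)
    then show ?thesis using ipA[OF h(1,3)] h by auto
  qed
  ultimately have "onb K (T ` ?A)" unfolding onb_def by blast
  then show ?thesis ..
qed

lemma onb_HK_exists: "\<exists>S. onb HK S"
  using onb_exists onb_Htens by blast

subsection \<open>Elementary vectors\<close>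

definition tvec :: "'e \<Rightarrow> (int \<Rightarrow> 'g cvec) \<Rightarrow> ('e \<times> 'x) cvec"
  where "tvec i h = ket i \<otimes>\<^sub>v T h"

text \<open>The entry of h at site n is overwritten, so the vector splits into a basis vector p of
  the system and site n and a remaining part. An operator at site n acts on p alone.\<close>

definition es :: "int \<Rightarrow> 'e \<times> 'g \<Rightarrow> (int \<Rightarrow> 'g cvec) \<Rightarrow> ('e \<times> 'x) cvec"
  where "es n p h = tvec (fst p) (h(n := ket (snd p)))"

lemma tvec_vecs [simp, intro]: "h \<in> stab \<psi> \<Longrightarrow> tvec i h \<in> vecs HK"
  by (simp add: tvec_def)

lemma es_vecs [simp, intro]: "h \<in> stab \<psi> \<Longrightarrow> es n p h \<in> vecs HK"
  by (simp add: es_def)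

lemma ip_tvec: "h \<in> stab \<psi> \<Longrightarrow> h' \<in> stab \<psi> \<Longrightarrow>
    ip HK (tvec i h) (tvec j h') = (if i = j then Prod_any (\<lambda>n. ip L2U (h n) (h' n)) else 0)"
  by (simp add: tvec_def ip_vtens ip_T)

lemma ip_es:
  assumes "h \<in> stab \<psi>" "h' \<in> stab \<psi>"
  shows "ip HK (es n p h) (es n p' h') = (if p = p' then rest n h h' else 0)"
proof -
  have "ip HK (es n p h) (es n p' h') = ip L2U (ket (fst p)) (ket (fst p')) * ip K (T (h(n := ket (snd p)))) (T (h'(n := ket (snd p'))))"
    unfolding es_def tvec_def using assms by (intro ip_vtens) auto
  then show ?thesis using assms by (auto simp: ip_T_update prod_eq_iff)
qed

lemma total_tvec_ket:
  assumes "finite N"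
  shows "total_set HK ((\<lambda>(i, h). tvec i h) ` (UNIV \<times> {h \<in> stab \<psi>. \<forall>n\<in>N. h n \<in> range ket}))"
proof -
  have "{ket (i::'e) \<otimes>\<^sub>v b | i b. b \<in> T ` {h \<in> stab \<psi>. \<forall>n\<in>N. h n \<in> range ket}} =
      (\<lambda>(i, h). tvec i h) ` (UNIV \<times> {h \<in> stab \<psi>. \<forall>n\<in>N. h n \<in> range ket})"
    by (auto simp: tvec_def)
  then show ?thesis using total_Htens[OF total_T_ket[OF assms], where 'e = 'e] by simp
qed

lemma total_tvec: "total_set HK ((\<lambda>(i, h). tvec i h) ` (UNIV \<times> stab \<psi>))"
  using total_tvec_ket[of "{}"] by simp

lemma total_es: "total_set HK ((\<lambda>(p, h). es n p h) ` (UNIV \<times> stab \<psi>))"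
proof -
  have "(\<lambda>(i, h). tvec i h) ` (UNIV \<times> {h \<in> stab \<psi>. \<forall>m\<in>{n}. h m \<in> range ket}) \<subseteq> (\<lambda>(p, h). es n p h) ` (UNIV \<times> stab \<psi>)"
  proof
    fix b assume "b \<in> (\<lambda>(i, h). tvec i h) ` (UNIV \<times> {h \<in> stab \<psi>. \<forall>m\<in>{n}. h m \<in> range ket})"
    then obtain i h g where "b = tvec i h" "h \<in> stab \<psi>" "h n = ket g" by auto
    moreover from this have "h(n := ket g) = h" by auto
    ultimately show "b \<in> (\<lambda>(p, h). es n p h) ` (UNIV \<times> stab \<psi>)"
      by (intro image_eqI[of _ _ "((i, g), h)"]) (auto simp: es_def)
  qed
  then have sub: "(\<lambda>(i, h). tvec i h) ` (UNIV \<times> {h \<in> stab \<psi>. \<forall>m\<in>{n}. h m \<in> range ket}) \<subseteq>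
      H.vspan ((\<lambda>(p, h). es n p h) ` (UNIV \<times> stab \<psi>))"
    by (auto intro!: H.vspan_base)
  have tot: "total_set HK ((\<lambda>(i, h). tvec i h) ` (UNIV \<times> {h \<in> stab \<psi>. \<forall>m\<in>{n}. h m \<in> range ket}))"
    by (rule total_tvec_ket) simp
  show ?thesis by (rule H.total_set_vspan[OF tot sub]) auto
qed

lemma op_eq_ket:
  assumes "finite N" "A \<in> bop HK" "B \<in> bop HK"
    "\<And>i h. h \<in> stab \<psi> \<Longrightarrow> (\<And>n. n \<in> N \<Longrightarrow> h n \<in> range ket) \<Longrightarrow> A (tvec i h) = B (tvec i h)"
  shows "A = B"
  by (rule H.bop_eqI_total[OF total_tvec_ket[OF assms(1)] assms(2,3)]) (auto intro: assms(4))

lemma op_eq_es: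
  assumes "A \<in> bop HK" "B \<in> bop HK" "\<And>p h. h \<in> stab \<psi> \<Longrightarrow> A (es n p h) = B (es n p h)"
  shows "A = B"
  by (rule H.bop_eqI_total[OF total_es assms(1,2)]) (auto intro: assms(3))

lemma tvec_expand:
  assumes "h \<in> stab \<psi>"
  shows "tvec i h = (\<Sum>g\<in>UNIV. ip L2U (ket g) (h n) \<cdot>\<^sub>v es n (i, g) h)"
  unfolding tvec_def es_def by (subst T_expand[OF assms ip_L2U_ket(3), of n]) (simp add: vtens_sum vtens_simps)

subsection \<open>Operators at one site\<close>

text \<open>
  Operators that permute the vectors \<open>es n p h\<close> up to phases are isometric; differences of
  two of them are matrix units, and these span all operators at the site.
\<close>

lemma phase_permutation_exists:
  fixes \<tau> :: "'e \<times> 'g \<Rightarrow> 'e \<times> 'g"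
  assumes "inj \<tau>" "\<And>p. cnj (\<sigma> p) * \<sigma> p = 1"
  obtains W where "W \<in> bop HK" "\<And>p h. h \<in> stab \<psi> \<Longrightarrow> W (es n p h) = \<sigma> p \<cdot>\<^sub>v es n (\<tau> p) h"
proof -
  let ?I = "(UNIV :: ('e \<times> 'g) set) \<times> stab \<psi>"
  obtain W where W: "W \<in> bop HK"
    "\<And>a. a \<in> ?I \<Longrightarrow> W ((\<lambda>(p, h). es n p h) a) = (\<lambda>(p, h). \<sigma> p \<cdot>\<^sub>v es n (\<tau> p) h) a"
  proof (rule H.isometry_extension)
    show "total_set HK ((\<lambda>(p, h). es n p h) ` ?I)" by (rule total_es)
    fix a b assume "a \<in> ?I" "b \<in> ?I"
    then obtain p h p' h' where ab: "a = (p, h)" "b = (p', h')" "h \<in> stab \<psi>" "h' \<in> stab \<psi>" by auto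
    then show "(\<lambda>(p, h). es n p h) a \<in> vecs HK" "(\<lambda>(p, h). \<sigma> p \<cdot>\<^sub>v es n (\<tau> p) h) a \<in> vecs HK" by auto
    show "ip HK ((\<lambda>(p, h). \<sigma> p \<cdot>\<^sub>v es n (\<tau> p) h) a) ((\<lambda>(p, h). \<sigma> p \<cdot>\<^sub>v es n (\<tau> p) h) b) =
        ip HK ((\<lambda>(p, h). es n p h) a) ((\<lambda>(p, h). es n p h) b)"
    proof -
      have "ip HK (\<sigma> p \<cdot>\<^sub>v es n (\<tau> p) h) (\<sigma> p' \<cdot>\<^sub>v es n (\<tau> p') h') =
          cnj (\<sigma> p) * \<sigma> p' * (if \<tau> p = \<tau> p' then rest n h h' else 0)"
        using ab by (simp add: H.ip_scale_left H.ip_scale_right ip_es)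
      also have "\<dots> = (if p = p' then rest n h h' else 0)"
        using assms by (cases "p = p'") (simp_all add: inj_eq)
      also have "\<dots> = ip HK (es n p h) (es n p' h')" using ab by (simp add: ip_es)
      finally show ?thesis unfolding ab(1,2) prod.case .
    qed
  qed blast
  have "W (es n p h) = \<sigma> p \<cdot>\<^sub>v es n (\<tau> p) h" if "h \<in> stab \<psi>" for p h using W(2)[of "(p, h)"] that by simp
  then show thesis using that W(1) by blast
qed

lemma matrix_unit_exists:
  obtains M where "M \<in> bop HK" "\<And>p h. h \<in> stab \<psi> \<Longrightarrow> M (es n p h) = (if p = p1 then es n p0 h else 0)"
proof -
  \<comment> \<open>\<tau> exchanges p0 and p1, and \<sigma> changes the sign at p1 only. Half the
    difference of the two isometries therefore annihilates every p except p1, which goes to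
    p0.\<close>
  define \<tau> where "\<tau> p = (if p = p0 then p1 else if p = p1 then p0 else p)" for p :: "'e \<times> 'g"
  define \<sigma> where "\<sigma> p = (if p = p1 then -1 else 1 :: complex)" for p
  have \<tau>: "inj \<tau>" by (rule injI) (auto simp: \<tau>_def split: if_splits)
  obtain W1 where W1: "W1 \<in> bop HK" "\<And>p h. h \<in> stab \<psi> \<Longrightarrow> W1 (es n p h) = 1 \<cdot>\<^sub>v es n (\<tau> p) h"
    by (rule phase_permutation_exists[OF \<tau>, of "\<lambda>_. 1"]) auto
  obtain W2 where W2: "W2 \<in> bop HK" "\<And>p h. h \<in> stab \<psi> \<Longrightarrow> W2 (es n p h) = \<sigma> p \<cdot>\<^sub>v es n (\<tau> p) h"
    by (rule phase_permutation_exists[OF \<tau>, of \<sigma>]) (auto simp: \<sigma>_def)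
  show thesis
  proof (rule that)
    show "(1/2) \<cdot>\<^sub>o (W1 - W2) \<in> bop HK" using W1 W2 by auto
    fix p h assume h: "h \<in> stab \<psi>"
    have "((1/2) \<cdot>\<^sub>o (W1 - W2)) (es n p h) = ((1 - \<sigma> p) / 2) \<cdot>\<^sub>v es n (\<tau> p) h"
      using h by (simp add: scale_op_apply minus_apply[of W1] W1 W2 scale_distrib[symmetric])
        (simp add: fun_eq_iff pointwise field_simps)
    then show "((1/2) \<cdot>\<^sub>o (W1 - W2)) (es n p h) = (if p = p1 then es n p0 h else 0)"
      by (auto simp: \<sigma>_def \<tau>_def)
  qed
qed

lemma site_exists:
  obtains W where "W \<in> bop HK" "\<And>p h. h \<in> stab \<psi> \<Longrightarrow> W (es n p h) = (\<Sum>p'\<in>UNIV. b p' p \<cdot>\<^sub>v es n p' h)"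
proof -
  have "\<exists>M. M \<in> bop HK \<and> (\<forall>p. \<forall>h\<in>stab \<psi>. M (es n p h) = (if p = p1 then es n p0 h else 0))" for p0 p1
    by (rule matrix_unit_exists[of n p1 p0]) blast
  note ex = this
  define M where "M p0 p1 = (SOME M. M \<in> bop HK \<and> (\<forall>p. \<forall>h\<in>stab \<psi>. M (es n p h) = (if p = p1 then es n p0 h else 0)))" for p0 p1
  have "M p0 p1 \<in> bop HK \<and> (\<forall>p. \<forall>h\<in>stab \<psi>. M p0 p1 (es n p h) = (if p = p1 then es n p0 h else 0))" for p0 p1
    unfolding M_def by (rule someI_ex[OF ex])
  then have M: "M p0 p1 \<in> bop HK" "h \<in> stab \<psi> \<Longrightarrow> M p0 p1 (es n p h) = (if p = p1 then es n p0 h else 0)" for p0 p1 p h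
    by blast+
  define W where "W = (\<Sum>p0\<in>UNIV. \<Sum>p1\<in>UNIV. b p0 p1 \<cdot>\<^sub>o M p0 p1)"
  show thesis
  proof (rule that)
    show "W \<in> bop HK" unfolding W_def using M(1) by (intro H.bop_sum_op H.bop_scale_op)
    fix p h assume h: "h \<in> stab \<psi>"
    have "W (es n p h) = (\<Sum>p0\<in>UNIV. \<Sum>p1\<in>UNIV. b p0 p1 \<cdot>\<^sub>v (if p = p1 then es n p0 h else 0))"
      unfolding W_def sum_fun_apply[of _ _ "es n p h"] scale_op_apply M(2)[OF h] ..
    also have "\<dots> = (\<Sum>p0\<in>UNIV. \<Sum>p1\<in>UNIV. if p1 = p then b p0 p \<cdot>\<^sub>v es n p0 h else 0)"
      by (intro sum.cong) auto
    finally show "W (es n p h) = (\<Sum>p'\<in>UNIV. b p' p \<cdot>\<^sub>v es n p' h)" by simp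
  qed
qed

abbreviation site :: "int \<Rightarrow> ('e \<times> 'g) operator \<Rightarrow> ('e \<times> 'x) operator"
  where "site \<equiv> site_op \<psi> K T"

text \<open>Existence is a linear combination of matrix units, uniqueness is totality; the double
  sum in the description is rewritten as a sum over pairs.\<close>

lemma site_op:
  shows site_bop [simp, intro]: "site n B \<in> bop HK"
    and site_es: "h \<in> stab \<psi> \<Longrightarrow> site n B (es n p h) = (\<Sum>p'\<in>UNIV. ip (Htens L2U) (pket p') (B (pket p)) \<cdot>\<^sub>v es n p' h)"
    and site_eqI: "W \<in> bop HK \<Longrightarrow> (\<And>p h. h \<in> stab \<psi> \<Longrightarrow>
      W (es n p h) = (\<Sum>p'\<in>UNIV. ip (Htens L2U) (pket p') (B (pket p)) \<cdot>\<^sub>v es n p' h)) \<Longrightarrow> site n B = W"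
proof -
  let ?spec = "\<lambda>W. W \<in> bop HK \<and> (\<forall>i g. \<forall>h\<in>stab \<psi>. W (ket i \<otimes>\<^sub>v T (h(n := ket g))) =
      (\<Sum>j\<in>UNIV. \<Sum>g'\<in>UNIV. ip (Htens L2U) (ket j \<otimes>\<^sub>v ket g') (B (ket i \<otimes>\<^sub>v ket g))
          \<cdot>\<^sub>v (ket j \<otimes>\<^sub>v T (h(n := ket g')))))"
  let ?spec' = "\<lambda>W. W \<in> bop HK \<and> (\<forall>p. \<forall>h\<in>stab \<psi>. W (es n p h) = (\<Sum>p'\<in>UNIV. ip (Htens L2U) (pket p') (B (pket p)) \<cdot>\<^sub>v es n p' h))"
  have s: "?spec = ?spec'"
  proof
    fix W
    have "(\<Sum>j\<in>UNIV. \<Sum>g'\<in>UNIV. ip (Htens L2U) (ket j \<otimes>\<^sub>v ket g') (B (ket i \<otimes>\<^sub>v ket g)) \<cdot>\<^sub>v (ket j \<otimes>\<^sub>v T (h(n := ket g')))) =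
        (\<Sum>p'\<in>UNIV. ip (Htens L2U) (pket p') (B (pket (i, g))) \<cdot>\<^sub>v es n p' h)" for i g h
      by (simp add: sum.cartesian_product case_prod_unfold pket_def es_def tvec_def)
    then show "?spec W = ?spec' W" by (simp add: es_def tvec_def)
  qed
  obtain W where W: "?spec' W"
    by (rule site_exists[of n "\<lambda>p' p. ip (Htens L2U) (pket p') (B (pket p))"]) blast
  have uniq: "W' = W''" if "?spec' W'" "?spec' W''" for W' W''
    by (rule op_eq_es[of _ _ n]) (use that in auto)
  have eq: "site n B = (THE W. ?spec' W)" unfolding site_op_def s ..
  have sp: "?spec' (site n B)" unfolding eq by (rule theI'[OF ex1I[of ?spec', OF W uniq]]) (use W in blast)+
  show "site n B \<in> bop HK" using sp by blast
  show "site n B (es n p h) = (\<Sum>p'\<in>UNIV. ip (Htens L2U) (pket p') (B (pket p)) \<cdot>\<^sub>v es n p' h)" if "h \<in> stab \<psi>"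
    using sp that by blast
  show "site n B = W" if "W \<in> bop HK" "\<And>p h. h \<in> stab \<psi> \<Longrightarrow>
      W (es n p h) = (\<Sum>p'\<in>UNIV. ip (Htens L2U) (pket p') (B (pket p)) \<cdot>\<^sub>v es n p' h)" for W
    using uniq[OF sp] that by blast
qed

lemma site_dil_V:
  assumes "h \<in> stab \<psi>"
  shows "site n (dil_V \<phi>) (es n p h) = es n (\<phi> p) h"
proof -
  have "site n (dil_V \<phi>) (es n p h) = (\<Sum>p'\<in>UNIV. if p' = \<phi> p then es n (\<phi> p) h else 0)"
    unfolding site_es[OF assms] dil_V_pket by (intro sum.cong) auto
  then show ?thesis by simp
qed

lemma site_dil_V_unitary:
  assumes "bij \<phi>"
  shows "unitary_op HK (site n (dil_V \<phi>))" "adj HK (site n (dil_V \<phi>)) = site n (dil_V (inv \<phi>))"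
proof -
  have i: "\<phi> (inv \<phi> p) = p" "\<phi> p = \<phi> p' \<longleftrightarrow> p = p'" for p p'
    using surj_f_inv_f[OF bij_is_surj[OF assms]] inj_eq[OF bij_is_inj[OF assms]] by auto
  show "unitary_op HK (site n (dil_V \<phi>))"
    by (rule H.unitary_op_total(1)[OF total_es[of n] site_bop site_bop[of n "dil_V (inv \<phi>)"]])
      (auto simp: site_dil_V ip_es i)
  show "adj HK (site n (dil_V \<phi>)) = site n (dil_V (inv \<phi>))"
    by (rule H.unitary_op_total(2)[OF total_es[of n] site_bop site_bop])
      (auto simp: site_dil_V ip_es i)
qed

subsection \<open>The shift\<close>

text \<open>Reindexing the product leaves scalar products unchanged. Both k = 1 and k = -1 are used,
  the second giving the inverse of the left shift.\<close>

lemma shift_exists: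
  obtains W where "W \<in> bop HK" "\<And>i h. h \<in> stab \<psi> \<Longrightarrow> W (tvec i h) = tvec i (\<lambda>n. h (n + k))"
proof -
  let ?I = "(UNIV :: 'e set) \<times> stab \<psi>"
  obtain W where W: "W \<in> bop HK"
    "\<And>a. a \<in> ?I \<Longrightarrow> W ((\<lambda>(i, h). tvec i h) a) = (\<lambda>(i, h). tvec i (\<lambda>n. h (n + k))) a"
  proof (rule H.isometry_extension)
    show "total_set HK ((\<lambda>(i, h). tvec i h) ` ?I)" by (rule total_tvec)
    fix a b assume "a \<in> ?I" "b \<in> ?I"
    then obtain i h i' h' where ab: "a = (i, h)" "b = (i', h')" "h \<in> stab \<psi>" "h' \<in> stab \<psi>" by auto
    then show "(\<lambda>(i, h). tvec i h) a \<in> vecs HK" "(\<lambda>(i, h). tvec i (\<lambda>n. h (n + k))) a \<in> vecs HK" by auto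
    have "Prod_any (\<lambda>n. ip L2U (h n) (h' n)) = Prod_any (\<lambda>n. ip L2U (h (n + k)) (h' (n + k)))"
      by (rule Prod_any.reindex_cong[of "\<lambda>n. n + k"]) (auto simp: fun_eq_iff intro!: o_bij[of "\<lambda>n. n - k"])
    then show "ip HK ((\<lambda>(i, h). tvec i (\<lambda>n. h (n + k))) a) ((\<lambda>(i, h). tvec i (\<lambda>n. h (n + k))) b) =
        ip HK ((\<lambda>(i, h). tvec i h) a) ((\<lambda>(i, h). tvec i h) b)"
      using ab by (simp add: ip_tvec)
  qed blast
  have "W (tvec i h) = tvec i (\<lambda>n. h (n + k))" if "h \<in> stab \<psi>" for i h using W(2)[of "(i, h)"] that by simp
  then show thesis using that W(1) by blast
qed

abbreviation LS :: "('e \<times> 'x) operator" where "LS \<equiv> left_shift_op \<psi> K T"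

lemma left_shift:
  shows LS_bop [simp, intro]: "LS \<in> bop HK"
    and LS_tvec: "h \<in> stab \<psi> \<Longrightarrow> LS (tvec i h) = tvec i (\<lambda>n. h (n + 1))"
    and LS_unitary: "unitary_op HK LS"
    and adj_LS_tvec: "h \<in> stab \<psi> \<Longrightarrow> adj HK LS (tvec i h) = tvec i (\<lambda>n. h (n - 1))"
proof -
  let ?spec = "\<lambda>W. W \<in> bop HK \<and> (\<forall>f. \<forall>h\<in>stab \<psi>. W (f \<otimes>\<^sub>v T h) = f \<otimes>\<^sub>v T (\<lambda>n. h (n + 1)))"
  obtain W where W: "W \<in> bop HK" "\<And>i h. h \<in> stab \<psi> \<Longrightarrow> W (tvec i h) = tvec i (\<lambda>n. h (n + 1))"
    by (rule shift_exists[of 1]) blast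
  have "W (f \<otimes>\<^sub>v T h) = f \<otimes>\<^sub>v T (\<lambda>n. h (n + 1))" if h: "h \<in> stab \<psi>" for f h
  proof -
    have e: "f \<otimes>\<^sub>v T h = (\<Sum>i\<in>UNIV. ip L2U (ket i) f \<cdot>\<^sub>v tvec i h)" for h
      by (subst ket_expand[of f]) (simp add: vtens_sum vtens_simps tvec_def)
    show ?thesis unfolding e using h W by (simp add: H.bop_sum H.bop_scale)
  qed
  then have spec: "?spec W" using W by blast
  have "LS = W" unfolding left_shift_op_def
  proof (rule the_equality)
    show "?spec W" by (rule spec)
    fix W' assume "?spec W'"
    then show "W' = W" using spec by (intro op_eq_ket[of "{}"]) (auto simp: tvec_def)
  qed
  then have LS: "LS \<in> bop HK" "\<And>i h. h \<in> stab \<psi> \<Longrightarrow> LS (tvec i h) = tvec i (\<lambda>n. h (n + 1))" using W by auto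
  show "LS \<in> bop HK" "h \<in> stab \<psi> \<Longrightarrow> LS (tvec i h) = tvec i (\<lambda>n. h (n + 1))" by (fact LS)+
  obtain W' where W': "W' \<in> bop HK" "\<And>i h. h \<in> stab \<psi> \<Longrightarrow> W' (tvec i h) = tvec i (\<lambda>n. h (n + - 1))"
    by (rule shift_exists[of "-1"]) blast
  have iso: "ip HK (LS a) (LS b) = ip HK a b"
    if ab: "a \<in> (\<lambda>(i, h). tvec i h) ` (UNIV \<times> stab \<psi>)" "b \<in> (\<lambda>(i, h). tvec i h) ` (UNIV \<times> stab \<psi>)" for a b
  proof -
    obtain i h i' h' where e: "a = tvec i h" "b = tvec i' h'" "h \<in> stab \<psi>" "h' \<in> stab \<psi>" using ab by auto
    have "Prod_any (\<lambda>n. ip L2U (h n) (h' n)) = Prod_any (\<lambda>n. ip L2U (h (n + 1)) (h' (n + 1)))"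
      by (rule Prod_any.reindex_cong[of "\<lambda>n. n + 1"]) (auto simp: fun_eq_iff intro!: o_bij[of "\<lambda>n. n - 1"])
    then show ?thesis using e by (simp add: LS ip_tvec)
  qed
  have inv: "LS (W' a) = a" if a: "a \<in> (\<lambda>(i, h). tvec i h) ` (UNIV \<times> stab \<psi>)" for a
  proof -
    obtain i h where e: "a = tvec i h" "h \<in> stab \<psi>" using a by auto
    have st: "(\<lambda>n. h (n + - 1)) \<in> stab \<psi>" using e(2) by (rule stab_shift)
    show ?thesis unfolding e(1) W'(2)[OF e(2)] LS(2)[OF st] by simp
  qed
  show "unitary_op HK LS" by (rule H.unitary_op_total(1)[OF total_tvec LS(1) W'(1) iso inv])
  have "adj HK LS = W'" by (rule H.unitary_op_total(2)[OF total_tvec LS(1) W'(1) iso inv])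
  then show "adj HK LS (tvec i h) = tvec i (\<lambda>n. h (n - 1))" if "h \<in> stab \<psi>"
    using W'(2)[OF that] by simp
qed

lemma stab_shift_minus [simp, intro]: "h \<in> stab \<psi> \<Longrightarrow> (\<lambda>n. h (n - k)) \<in> stab \<psi>"
  using stab_shift[of h "-k"] by simp

lemma LS_es: "h \<in> stab \<psi> \<Longrightarrow> LS (es (n + 1) p h) = es n p (\<lambda>m. h (m + 1))"
proof -
  assume h: "h \<in> stab \<psi>"
  have "(\<lambda>m. (h(n + 1 := ket (snd p))) (m + 1)) = (\<lambda>m. h (m + 1))(n := ket (snd p))" by auto
  then show ?thesis unfolding es_def using h by (simp add: LS_tvec)
qed

lemma adj_LS_es: "h \<in> stab \<psi> \<Longrightarrow> adj HK LS (es n p (\<lambda>m. h (m + 1))) = es (n + 1) p h"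
  using LS_es[of h n p] H.unitary_simps(1)[OF LS_unitary, of "es (n + 1) p h"] by simp

text \<open>The left shift carries site n + 1 to site n, where B acts, and its adjoint carries the
  result back: a left shift of vectors is a right shift of operators.\<close>

lemma conj_LS_site: "H.conj_by LS (site n B) = site (n + 1) B"
proof (rule site_eqI[symmetric])
  show "H.conj_by LS (site n B) \<in> bop HK" by auto
  fix p h assume h: "h \<in> stab \<psi>"
  have "H.conj_by LS (site n B) (es (n + 1) p h) = adj HK LS (site n B (es n p (\<lambda>m. h (m + 1))))"
    using h by (simp add: H.conj_by_def LS_es)
  also have "\<dots> = (\<Sum>p'\<in>UNIV. ip (Htens L2U) (pket p') (B (pket p)) \<cdot>\<^sub>v adj HK LS (es n p' (\<lambda>m. h (m + 1))))"
    using h by (simp add: site_es H.bop_sum H.bop_scale)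
  finally show "H.conj_by LS (site n B) (es (n + 1) p h) =
      (\<Sum>p'\<in>UNIV. ip (Htens L2U) (pket p') (B (pket p)) \<cdot>\<^sub>v es (n + 1) p' h)"
    using h by (simp add: adj_LS_es)
qed

subsection \<open>The local algebra\<close>

abbreviation LA :: "('e \<times> 'x) operator set" where "LA \<equiv> local_algebra \<psi> K T"

definition gens :: "('e \<times> 'x) operator set"
  where "gens = {site n B | n B. B \<in> bop (Htens L2U)}"

lemma gens_bop: "gens \<subseteq> bop HK"
  by (auto simp: gens_def)

lemma local_algebra_eq: "LA = H.cstar_gen gens"
proof -
  have "(\<forall>n. \<forall>B\<in>bop (Htens L2U). site n B \<in> \<BB>) \<longleftrightarrow> gens \<subseteq> \<BB>" for \<BB>
    by (auto simp: gens_def)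
  then show ?thesis unfolding local_algebra_def H.cstar_gen_def by simp
qed

lemma cstar_LA: "cstar_subalgebra HK LA"
  unfolding local_algebra_eq by (rule H.cstar_subalgebra_gen[OF gens_bop])

lemmas LA = H.cstar_subalgebraD[OF cstar_LA]

lemma site_LA: "B \<in> bop (Htens L2U) \<Longrightarrow> site n B \<in> LA"
  unfolding local_algebra_eq by (rule H.cstar_gen_base) (auto simp: gens_def)

lemma conj_LS_LA:
  assumes "A \<in> LA"
  shows "H.conj_by LS A \<in> LA" "H.conj_by (adj HK LS) A \<in> LA"
proof -
  show "H.conj_by LS A \<in> LA"
    unfolding local_algebra_eq
  proof (rule H.conj_by_gen[OF gens_bop LS_unitary])
    fix A assume "A \<in> gens"
    then obtain n B where A: "A = site n B" "B \<in> bop (Htens L2U)" by (auto simp: gens_def)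
    then show "H.conj_by LS A \<in> H.cstar_gen gens"
      unfolding A(1) conj_LS_site local_algebra_eq[symmetric] by (intro site_LA)
  qed (use assms in \<open>simp add: local_algebra_eq\<close>)
  show "H.conj_by (adj HK LS) A \<in> LA"
    unfolding local_algebra_eq
  proof (rule H.conj_by_gen[OF gens_bop H.unitary_adj[OF LS_unitary]])
    fix A assume "A \<in> gens"
    then obtain n B where A: "A = site n B" "B \<in> bop (Htens L2U)" by (auto simp: gens_def)
    have "H.conj_by (adj HK LS) (H.conj_by LS (site (n - 1) B)) = site (n - 1) B"
      by (rule H.conj_by_simps(7)[OF LS_unitary site_bop])
    then have "H.conj_by (adj HK LS) (site n B) = site (n - 1) B" by (simp add: conj_LS_site)
    then show "H.conj_by (adj HK LS) A \<in> H.cstar_gen gens"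
      unfolding A(1) local_algebra_eq[symmetric] using A(2) by (simp add: site_LA)
  qed (use assms in \<open>simp add: local_algebra_eq\<close>)
qed

text \<open>Conjugation by the left shift witnesses existence in the description of the right shift.
  It follows that \<open>local_J\<close> is implemented by the same unitary as
  \<open>global_J\<close>.\<close>

lemma right_shift_eq:
  assumes A: "A \<in> LA"
  shows "right_shift \<psi> K T A = H.conj_by LS A"
  unfolding right_shift_def
proof (rule the_equality)
  have auto: "star_automorphism HK LA (H.conj_by LS)"
    by (rule H.star_automorphism_conj_by[OF cstar_LA LS_unitary]) (auto intro: conj_LS_LA)
  then show "\<exists>\<theta>. star_automorphism HK LA \<theta> \<and> (\<forall>n. \<forall>B\<in>bop (Htens L2U). \<theta> (site n B) = site (n + 1) B) \<and>
      H.conj_by LS A = \<theta> A"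
    by (intro exI[of _ "H.conj_by LS"]) (simp add: conj_LS_site)
  fix A' assume "\<exists>\<theta>. star_automorphism HK LA \<theta> \<and> (\<forall>n. \<forall>B\<in>bop (Htens L2U). \<theta> (site n B) = site (n + 1) B) \<and> A' = \<theta> A"
  then obtain \<theta> where t: "star_automorphism HK LA \<theta> \<and>
    (\<forall>n. \<forall>B\<in>bop (Htens L2U). \<theta> (site n B) = site (n + 1) B) \<and> A' = \<theta> A" ..
  note \<theta> = conjunct1[OF t] conjunct1[OF conjunct2[OF t]] conjunct2[OF conjunct2[OF t]]
  have "\<theta> B = H.conj_by LS B" if B: "B \<in> gens" for B
  proof -
    obtain n B' where "B = site n B'" "B' \<in> bop (Htens L2U)" using B unfolding gens_def by auto
    then show ?thesis using \<theta>(2) by (simp add: conj_LS_site)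
  qed
  then have "\<theta> A = H.conj_by LS A"
    using H.star_automorphism_unique[OF gens_bop \<theta>(1)[unfolded local_algebra_eq] auto[unfolded local_algebra_eq],
        of A] A unfolding local_algebra_eq by metis
  then show "A' = H.conj_by LS A" using \<theta>(3) by simp
qed

text \<open>The unitary \<open>U\<close> that implements the automorphism \<open>J\<close>.\<close>

definition evol :: "('e \<times> 'g \<Rightarrow> 'e \<times> 'g) \<Rightarrow> ('e \<times> 'x) operator"
  where "evol \<phi> = LS \<circ> site 1 (dil_V \<phi>)"

lemma evol_unitary: "bij \<phi> \<Longrightarrow> unitary_op HK (evol \<phi>)"
  unfolding evol_def by (intro H.unitary_comp LS_unitary site_dil_V_unitary)

lemma evol_bop [simp, intro]: "evol \<phi> \<in> bop HK"
  unfolding evol_def by auto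

text \<open>The unitary acts at site 1 first and the shift then carries that site to 0, in the same
  order as in \<open>alpha\<close>.\<close>

lemma evol_es: "h \<in> stab \<psi> \<Longrightarrow> evol \<phi> (es 1 p h) = es 0 (\<phi> p) (\<lambda>n. h (n + 1))"
  using LS_es[of h 0] by (simp add: evol_def site_dil_V)

lemma local_J_eq:
  assumes "A \<in> LA"
  shows "local_J \<psi> K T (dil_V \<phi>) A = H.conj_by (evol \<phi>) A"
  unfolding local_J_def right_shift_eq[OF assms] evol_def
  using H.conj_by_comp[OF LS_bop site_bop] by (simp add: H.conj_by_def)

lemma global_J_eq: "global_J \<psi> K T (dil_V \<phi>) A = H.conj_by (evol \<phi>) A"
  by (simp add: global_J_def evol_def H.conj_by_def Let_def)

text \<open>V at site 1 lies in the local algebra itself, so conjugation by it preserves the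
  algebra; for the shift this is \<open>conj_LS_LA\<close>.\<close>

lemma star_automorphism_local_J:
  assumes "bij \<phi>"
  shows "star_automorphism HK LA (local_J \<psi> K T (dil_V \<phi>))"
proof (rule H.star_automorphism_cong[OF cstar_LA _ local_J_eq])
  let ?V = "site 1 (dil_V \<phi>)"
  note V = site_dil_V_unitary(1)[OF assms]
  have VL: "?V \<in> LA" by (rule site_LA) auto
  show "star_automorphism HK LA (H.conj_by (evol \<phi>))"
  proof (rule H.star_automorphism_conj_by[OF cstar_LA evol_unitary[OF assms]])
    fix A assume A: "A \<in> LA"
    have "H.conj_by (evol \<phi>) A = adj HK ?V \<circ> H.conj_by LS A \<circ> ?V"
      unfolding evol_def H.conj_by_comp[OF LS_bop site_bop] by (simp add: H.conj_by_def)
    then show "H.conj_by (evol \<phi>) A \<in> LA" using A VL conj_LS_LA(1) LA(4,6) by simp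
    have "H.conj_by (adj HK (evol \<phi>)) A = H.conj_by (adj HK LS) (H.conj_by (adj HK ?V) A)"
      unfolding evol_def H.adj_comp[OF LS_bop site_bop]
      by (rule H.conj_by_comp) auto
    moreover have "H.conj_by (adj HK ?V) A \<in> LA"
      unfolding H.conj_by_def using A VL LA(4,6) by simp
    ultimately show "H.conj_by (adj HK (evol \<phi>)) A \<in> LA" using conj_LS_LA(2) by simp
  qed
qed

end

section \<open>Continuous functions on the path space\<close>

abbreviation agree :: "nat \<Rightarrow> (int \<Rightarrow> 'g) \<Rightarrow> (int \<Rightarrow> 'g) \<Rightarrow> bool"
  where "agree t x y \<equiv> (\<forall>n. \<bar>n\<bar> \<le> int t \<longrightarrow> x n = y n)"

text \<open>All factors are discrete, so the paths agreeing with x on a window form a neighbourhood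
  base; continuity becomes a statement about windows.\<close>

lemma openin_path_topology:
  "openin (path_topology :: ('e, 'g) path topology) U \<longleftrightarrow>
    (\<forall>i x. (i, x) \<in> U \<longrightarrow> (\<exists>t. \<forall>y. agree t x y \<longrightarrow> (i, y) \<in> U))"
proof (intro iffI allI impI)
  fix i :: 'e and x :: "int \<Rightarrow> 'g"
  assume U: "openin (path_topology :: ('e, 'g) path topology) U" "(i, x) \<in> U"
  obtain A B where AB: "openin (product_topology (\<lambda>_. discrete_topology (UNIV :: 'g set)) (UNIV :: int set)) B"
    "i \<in> A" "x \<in> B" "A \<times> B \<subseteq> U"
    using U(1)[unfolded path_topology_def openin_prod_topology_alt, rule_format, OF U(2)]
    by (elim exE conjE)
  obtain V where V: "finite {n \<in> UNIV :: int set. V n \<noteq> topspace (discrete_topology (UNIV :: 'g set))}"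
    "x \<in> PiE UNIV V" "PiE UNIV V \<subseteq> B"
    using AB(1)[unfolded openin_product_topology_alt, rule_format, OF AB(3)] by (elim exE conjE)
  \<comment> \<open>The window covers the finitely many coordinates that V restricts; inserting 0
    makes the maximum defined when there are none.\<close>
  define t where "t = nat (Max (insert 0 (abs ` {n. V n \<noteq> UNIV})))"
  have t: "\<bar>n\<bar> \<le> int t" if "V n \<noteq> UNIV" for n
  proof -
    have "\<bar>n\<bar> \<le> Max (insert 0 (abs ` {n. V n \<noteq> UNIV}))" using V(1) that by (intro Max_ge) auto
    then show ?thesis unfolding t_def by linarith
  qed
  have "(i, y) \<in> U" if y: "agree t x y" for y
  proof -
    have "y n \<in> V n" for n
    proof (cases "V n = UNIV")
      case False
      then have "x n = y n" using y t[of n] by simp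
      then show ?thesis using V(2) by (metis PiE_mem UNIV_I)
    qed simp
    then have "y \<in> PiE UNIV V" by (auto simp: PiE_iff)
    then show ?thesis using V(3) AB by auto
  qed
  then show "\<exists>t. \<forall>y. agree t x y \<longrightarrow> (i, y) \<in> U" by blast
next
  assume U: "\<forall>i x. (i, x) \<in> U \<longrightarrow> (\<exists>t. \<forall>y. agree t x y \<longrightarrow> (i, y) \<in> U)"
  show "openin (path_topology :: ('e, 'g) path topology) U"
    unfolding path_topology_def openin_prod_topology_alt
  proof (intro allI impI)
    fix i x assume "(i, x) \<in> U"
    then obtain t where t: "\<And>y. agree t x y \<Longrightarrow> (i, y) \<in> U" using U by blast
    define V where "V n = (if \<bar>n\<bar> \<le> int t then {x n} else UNIV)" for n
    have "{n. V n \<noteq> UNIV} \<subseteq> {- int t..int t}" by (auto simp: V_def split: if_splits)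
    then have "finite {n. V n \<noteq> UNIV}" by (rule finite_subset) simp
    then have "openin (product_topology (\<lambda>_. discrete_topology UNIV) UNIV) (PiE UNIV V)"
      by (intro product_topology_basis) auto
    moreover have "x \<in> PiE UNIV V" by (auto simp: V_def PiE_iff)
    moreover have "{i} \<times> PiE UNIV V \<subseteq> U"
      using t by (auto simp: V_def PiE_iff split: if_splits)
    ultimately show "\<exists>A B. openin (discrete_topology UNIV) A \<and>
        openin (product_topology (\<lambda>_. discrete_topology UNIV) UNIV) B \<and> i \<in> A \<and> x \<in> B \<and> A \<times> B \<subseteq> U"
      by (intro exI[of _ "{i}"] exI[of _ "PiE UNIV V"]) auto
  qed
qed

lemma topspace_path [simp]: "topspace path_topology = UNIV"
  by (simp add: path_topology_def)

lemma compact_path_topology: "compact_space (path_topology :: ('e::finite, 'g::finite) path topology)"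
  unfolding path_topology_def
  by (simp add: compact_space_prod_topology compact_space_product_topology compact_space_discrete_topology)

lemma cont_funs_path_iff:
  "F \<in> cont_funs path_topology \<longleftrightarrow>
    (\<forall>i x. \<forall>\<epsilon>>0. \<exists>t. \<forall>y. agree t x y \<longrightarrow> cmod (F (i, y) - F (i, x)) < \<epsilon>)"
proof (intro iffI allI impI)
  fix i x \<epsilon> assume F: "F \<in> cont_funs path_topology" "(\<epsilon>::real) > 0"
  have "openin path_topology {\<omega> \<in> topspace path_topology. F \<omega> \<in> ball (F (i, x)) \<epsilon>}"
    using F by (intro openin_continuous_map_preimage) (auto simp: cont_funs_def)
  moreover have "(i, x) \<in> {\<omega> \<in> topspace path_topology. F \<omega> \<in> ball (F (i, x)) \<epsilon>}" using F by simp
  ultimately obtain t where "\<And>y. agree t x y \<Longrightarrow> (i, y) \<in> {\<omega> \<in> topspace path_topology. F \<omega> \<in> ball (F (i, x)) \<epsilon>}"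
    unfolding openin_path_topology by blast
  then show "\<exists>t. \<forall>y. agree t x y \<longrightarrow> cmod (F (i, y) - F (i, x)) < \<epsilon>"
    by (intro exI[of _ t]) (auto simp: dist_norm norm_minus_commute)
next
  assume F: "\<forall>i x. \<forall>\<epsilon>>0. \<exists>t. \<forall>y. agree t x y \<longrightarrow> cmod (F (i, y) - F (i, x)) < \<epsilon>"
  have "openin path_topology {\<omega>. F \<omega> \<in> U}" if U: "open U" for U
    unfolding openin_path_topology
  proof (intro allI impI)
    fix i x assume "(i, x) \<in> {\<omega>. F \<omega> \<in> U}"
    then obtain \<epsilon> where \<epsilon>: "\<epsilon> > 0" "ball (F (i, x)) \<epsilon> \<subseteq> U" using U by (auto simp: open_contains_ball)
    then obtain t where "\<And>y. agree t x y \<Longrightarrow> cmod (F (i, y) - F (i, x)) < \<epsilon>" using F by blast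
    then show "\<exists>t. \<forall>y. agree t x y \<longrightarrow> (i, y) \<in> {\<omega>. F \<omega> \<in> U}"
      using \<epsilon>(2) by (intro exI[of _ t]) (auto simp: dist_norm norm_minus_commute subset_iff)
  qed
  then show "F \<in> cont_funs path_topology"
    unfolding cont_funs_def continuous_map_def by (simp add: open_openin[symmetric])
qed

lemma cont_funs_bounded:
  fixes F :: "('e::finite, 'g::finite) path \<Rightarrow> complex"
  assumes "F \<in> cont_funs path_topology"
  obtains M where "\<And>\<omega>. cmod (F \<omega>) \<le> M"
proof -
  have "compactin euclidean (F ` topspace path_topology)"
    using assms compact_path_topology by (intro image_compactin) (auto simp: cont_funs_def compact_space_def)
  then have "compact (range F)" by simp
  then obtain M where "\<forall>z\<in>range F. norm z \<le> M" using compact_imp_bounded bounded_iff by blast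
  then show thesis using that by auto
qed

text \<open>Uniform continuity on the compact path space: one window serves all paths.\<close>

lemma uniformly_cylindrical:
  fixes F :: "('e::finite, 'g::finite) path \<Rightarrow> complex"
  assumes F: "F \<in> cont_funs path_topology" and \<epsilon>: "\<epsilon> > 0"
  obtains t where "\<And>i x y. agree t x y \<Longrightarrow> cmod (F (i, x) - F (i, y)) < \<epsilon>"
proof -
  have "\<exists>t. \<forall>y. agree t (snd \<omega>) y \<longrightarrow> cmod (F (fst \<omega>, y) - F (fst \<omega>, snd \<omega>)) < \<epsilon> / 2" for \<omega>
  proof -
    have "\<forall>i x. \<forall>\<epsilon>>0. \<exists>t. \<forall>y. agree t x y \<longrightarrow> cmod (F (i, y) - F (i, x)) < \<epsilon>"
      using F unfolding cont_funs_path_iff .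
    then show ?thesis using half_gt_zero[OF \<epsilon>] by blast
  qed
  then obtain \<tau> where \<tau>: "\<And>\<omega> y. agree (\<tau> \<omega>) (snd \<omega>) y \<Longrightarrow> cmod (F (fst \<omega>, y) - F (fst \<omega>, snd \<omega>)) < \<epsilon> / 2" by metis
  \<comment> \<open>On each of these open sets F varies by less than \<epsilon> / 2 from its value
    at \<omega>, so two paths in the same set have values within \<epsilon>. A finite subcover
    leaves finitely many windows, and the largest one is taken.\<close>
  define C where "C \<omega> = {(i, y). i = fst \<omega> \<and> agree (\<tau> \<omega>) (snd \<omega>) y}" for \<omega>
  have "openin path_topology (C \<omega>)" for \<omega>
    unfolding openin_path_topology
  proof (intro allI impI)
    fix i x assume "(i, x) \<in> C \<omega>"
    then show "\<exists>t. \<forall>y. agree t x y \<longrightarrow> (i, y) \<in> C \<omega>" by (intro exI[of _ "\<tau> \<omega>"]) (auto simp: C_def)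
  qed
  moreover have "\<omega> \<in> C \<omega>" for \<omega> by (cases \<omega>) (auto simp: C_def)
  ultimately have cov: "\<forall>U\<in>range C. openin path_topology U" "topspace path_topology \<subseteq> \<Union>(range C)" by auto
  obtain \<F> where "finite \<F>" "\<F> \<subseteq> range C" "topspace path_topology \<subseteq> \<Union>\<F>"
    using compact_path_topology cov unfolding compact_space_alt by metis
  then obtain D where D: "finite D" "\<F> = C ` D" "UNIV \<subseteq> \<Union>(C ` D)"
    by (metis finite_subset_image topspace_path)
  define t where "t = Max (insert 0 (\<tau> ` D))"
  have "cmod (F (i, x) - F (i, y)) < \<epsilon>" if xy: "agree t x y" for i x y
  proof -
    obtain \<omega> where \<omega>: "\<omega> \<in> D" "(i, x) \<in> C \<omega>" using D(3) by blast
    have "\<tau> \<omega> \<le> t" unfolding t_def using D(1) \<omega>(1) by (intro Max_ge) auto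
    then have "agree (\<tau> \<omega>) x y" using xy by auto
    moreover have i: "i = fst \<omega>" "agree (\<tau> \<omega>) (snd \<omega>) x" using \<omega>(2) by (auto simp: C_def)
    ultimately have "agree (\<tau> \<omega>) (snd \<omega>) y" by auto
    from \<tau>[OF this] \<tau>[OF i(2)] show ?thesis
      unfolding i(1) using norm_diff_triangle_less[of "F (fst \<omega>, x)" "F (fst \<omega>, snd \<omega>)" "\<epsilon> / 2" "F (fst \<omega>, y)" "\<epsilon> / 2"]
      by (simp add: norm_minus_commute)
  qed
  then show thesis using that by blast
qed

text \<open>Coordinates outside the window are reset to the fixed element \<open>undefined\<close>,
  so composing any function with \<open>trunc t\<close> gives a cylinder function.\<close>

definition trunc :: "nat \<Rightarrow> ('e, 'g) path \<Rightarrow> ('e, 'g) path"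
  where "trunc t \<omega> = (fst \<omega>, \<lambda>n. if \<bar>n\<bar> \<le> int t then snd \<omega> n else undefined)"

lemma cylinder_trunc: "cylinder t (\<lambda>\<omega>. F (trunc t \<omega>))"
  unfolding cylinder_def trunc_def by (auto intro!: arg_cong[of _ _ F])

lemma cylinder_trunc_eq:
  assumes "cylinder t F" "t \<le> s"
  shows "F (trunc s \<omega>) = F \<omega>"
proof -
  have "F (trunc s \<omega>) = F (fst \<omega>, snd \<omega>)"
    unfolding trunc_def by (rule cylinderD[OF assms(1)]) (use assms(2) in auto)
  then show ?thesis by simp
qed

lemma cylinder_mono: "cylinder t F \<Longrightarrow> t \<le> s \<Longrightarrow> cylinder s F"
  unfolding cylinder_def by (metis of_nat_le_iff order_trans)

lemma cylinder_cont: "cylinder t F \<Longrightarrow> F \<in> cont_funs path_topology"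
  unfolding cont_funs_path_iff
proof (intro allI impI)
  fix i x and \<epsilon> :: real assume F: "cylinder t F" and "\<epsilon> > 0"
  have "cmod (F (i, y) - F (i, x)) < \<epsilon>" if y: "agree t x y" for y
  proof -
    have "F (i, y) = F (i, x)" by (rule cylinderD[OF F]) (metis y)
    then show ?thesis using \<open>\<epsilon> > 0\<close> by (metis diff_self norm_zero)
  qed
  then show "\<exists>t. \<forall>y. agree t x y \<longrightarrow> cmod (F (i, y) - F (i, x)) < \<epsilon>" by (intro exI[of _ t] allI impI)
qed

lemma trunc_approx:
  fixes F :: "('e::finite, 'g::finite) path \<Rightarrow> complex"
  assumes "F \<in> cont_funs path_topology" "\<epsilon> > 0"
  obtains t where "\<And>s \<omega>. s \<ge> t \<Longrightarrow> cmod (F (trunc s \<omega>) - F \<omega>) < \<epsilon>"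
proof -
  obtain t where t: "\<And>i x y. agree t x y \<Longrightarrow> cmod (F (i, x) - F (i, y)) < \<epsilon>"
    using uniformly_cylindrical[OF assms] by blast
  have "cmod (F (trunc s \<omega>) - F \<omega>) < \<epsilon>" if "s \<ge> t" for s \<omega>
  proof -
    have "agree t (snd (trunc s \<omega>)) (snd \<omega>)" using that by (auto simp: trunc_def)
    from t[OF this, of "fst \<omega>"] show ?thesis by (simp add: trunc_def)
  qed
  then show thesis using that by blast
qed

lemma alpha_apply: "alpha \<phi> (i, x) = (fst (\<phi> (i, x 1)), \<lambda>n. (x(1 := snd (\<phi> (i, x 1)))) (n + 1))"
  by (simp add: alpha_def path_shift_def act1_def)

text \<open>The coordinate at n after one step is read off at n + 1, hence the window shrinks by
  one.\<close>

lemma alpha_agree: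
  assumes "agree (Suc t) x y"
  shows "fst (alpha \<phi> (i, x)) = fst (alpha \<phi> (i, y))" "agree t (snd (alpha \<phi> (i, x))) (snd (alpha \<phi> (i, y)))"
proof -
  have 1: "x 1 = y 1" using assms by simp
  show "fst (alpha \<phi> (i, x)) = fst (alpha \<phi> (i, y))" by (simp add: alpha_apply 1)
  have "x (n + 1) = y (n + 1)" if "\<bar>n\<bar> \<le> int t" for n using assms that by simp
  then show "agree t (snd (alpha \<phi> (i, x))) (snd (alpha \<phi> (i, y)))" by (simp add: alpha_apply 1)
qed

lemma cylinder_alpha:
  assumes "cylinder t F"
  shows "cylinder (Suc t) (F \<circ> alpha \<phi>)"
  unfolding cylinder_def
proof (intro allI impI)
  fix i and x y :: "int \<Rightarrow> 'b" assume "agree (Suc t) x y"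
  note a = alpha_agree[OF this, of \<phi> i]
  have "F (fst (alpha \<phi> (i, x)), snd (alpha \<phi> (i, x))) = F (fst (alpha \<phi> (i, x)), snd (alpha \<phi> (i, y)))"
    by (rule cylinderD[OF assms]) (use a(2) in blast)
  moreover have "(fst (alpha \<phi> (i, x)), snd (alpha \<phi> (i, y))) = alpha \<phi> (i, y)" using a(1) by (simp add: prod_eq_iff)
  ultimately show "(F \<circ> alpha \<phi>) (i, x) = (F \<circ> alpha \<phi>) (i, y)" by (simp only: prod.collapse o_apply)
qed

lemma cont_alpha:
  assumes "F \<in> cont_funs path_topology"
  shows "F \<circ> alpha \<phi> \<in> cont_funs path_topology"
  unfolding cont_funs_path_iff
proof (intro allI impI)
  fix i x and \<epsilon> :: real assume "\<epsilon> > 0"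
  obtain t where t: "\<And>y. agree t (snd (alpha \<phi> (i, x))) y \<Longrightarrow>
      cmod (F (fst (alpha \<phi> (i, x)), y) - F (fst (alpha \<phi> (i, x)), snd (alpha \<phi> (i, x)))) < \<epsilon>"
    using assms \<open>\<epsilon> > 0\<close> unfolding cont_funs_path_iff by blast
  have "cmod ((F \<circ> alpha \<phi>) (i, y) - (F \<circ> alpha \<phi>) (i, x)) < \<epsilon>" if "agree (Suc t) x y" for y
  proof -
    have "(fst (alpha \<phi> (i, x)), snd (alpha \<phi> (i, y))) = alpha \<phi> (i, y)"
      using alpha_agree(1)[OF that, of \<phi> i] by (simp add: prod_eq_iff)
    then show ?thesis using t[OF alpha_agree(2)[OF that, of \<phi> i]] by (simp only: prod.collapse o_apply)
  qed
  then show "\<exists>t. \<forall>y. agree t x y \<longrightarrow> cmod ((F \<circ> alpha \<phi>) (i, y) - (F \<circ> alpha \<phi>) (i, x)) < \<epsilon>" by blast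
qed

lemma cont_funs_compose:
  assumes "F \<in> cont_funs X" "continuous_on UNIV \<eta>"
  shows "(\<lambda>\<omega>. \<eta> (F \<omega>)) \<in> cont_funs X"
proof -
  have "continuous_map euclidean euclidean \<eta>" using assms(2) by simp
  then have "continuous_map X euclidean (\<eta> \<circ> F)" using assms(1) by (auto simp: cont_funs_def intro: continuous_map_compose)
  then show ?thesis by (simp add: cont_funs_def o_def)
qed

section \<open>Multiplication operators\<close>

context itensor
begin

definition window :: "nat \<Rightarrow> int set" where "window t = {- int t..int t}"

lemma window [simp]: "finite (window t)" "n \<in> window t \<longleftrightarrow> \<bar>n\<bar> \<le> int t"
  by (auto simp: window_def)

definition ovr :: "int set \<Rightarrow> (int \<Rightarrow> 'g) \<Rightarrow> (int \<Rightarrow> 'g cvec) \<Rightarrow> int \<Rightarrow> 'g cvec"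
  where "ovr J y h = (\<lambda>n. if n \<in> J then ket (y n) else h n)"

lemma ovr_stab [simp, intro]: "finite J \<Longrightarrow> h \<in> stab \<psi> \<Longrightarrow> ovr J y h \<in> stab \<psi>"
  unfolding stab_def ovr_def by (simp, rule finite_subset[of _ "J \<union> {n. h n \<noteq> \<psi>}"]) auto

definition diag_site :: "int \<Rightarrow> 'e \<times> 'g \<Rightarrow> ('e \<times> 'x) operator"
  where "diag_site n p = site n (ketbra (Htens L2U) (pket p) (pket p))"

lemma diag_site_LA: "diag_site n p \<in> LA"
  unfolding diag_site_def by (rule site_LA) auto

lemma diag_site_es: "h \<in> stab \<psi> \<Longrightarrow> diag_site n p (es n p' h) = (if p' = p then es n p h else 0)"
proof -
  assume h: "h \<in> stab \<psi>"
  have "diag_site n p (es n p' h) = (\<Sum>r\<in>UNIV. (if p = p' then if r = p then es n p h else 0 else 0))"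
    unfolding diag_site_def site_es[OF h] by (intro sum.cong) (auto simp: HL.ketbra_apply HL.ip_scale_right)
  then show ?thesis by auto
qed

lemma bop_HK_sum: "A \<in> LA \<Longrightarrow> (\<And>a. a \<in> I \<Longrightarrow> f a \<in> vecs HK) \<Longrightarrow> A (\<Sum>a\<in>I. f a) = (\<Sum>a\<in>I. A (f a))"
  by (rule H.bop_sum[OF LA(1)])

lemma diag_site_tvec:
  assumes h: "h \<in> stab \<psi>"
  shows "diag_site n (i, g) (tvec j h) = (if j = i then ip L2U (ket g) (h n) \<cdot>\<^sub>v tvec i (h(n := ket g)) else 0)"
proof -
  have "diag_site n (i, g) (tvec j h) = (\<Sum>g'\<in>UNIV. ip L2U (ket g') (h n) \<cdot>\<^sub>v diag_site n (i, g) (es n (j, g') h))"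
    by (subst tvec_expand[OF h, of j n], subst bop_HK_sum[OF diag_site_LA])
      (use h in \<open>auto intro!: sum.cong H.bop_scale[OF LA(1)[OF diag_site_LA]]\<close>)
  also have "\<dots> = (\<Sum>g'\<in>UNIV. if g' = g then (if j = i then ip L2U (ket g) (h n) \<cdot>\<^sub>v es n (i, g) h else 0) else 0)"
    using h by (intro sum.cong) (auto simp: diag_site_es)
  finally show ?thesis by (simp add: es_def)
qed

text \<open>Multiplication by the indicator of a configuration is a product of one-site projections.
  This puts it into the local algebra.\<close>

lemma point_proj_exists:
  assumes "finite J"
  obtains P where "P \<in> LA" "\<And>i h. h \<in> stab \<psi> \<Longrightarrow> P (tvec i h) =
    (if i = i0 then (\<Prod>n\<in>J. ip L2U (ket (y n)) (h n)) \<cdot>\<^sub>v tvec i (ovr J y h) else 0)"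
proof -
  have "\<exists>P\<in>LA. \<forall>i. \<forall>h\<in>stab \<psi>. P (tvec i h) =
    (if i = i0 then (\<Prod>n\<in>J. ip L2U (ket (y n)) (h n)) \<cdot>\<^sub>v tvec i (ovr J y h) else 0)"
    using assms
  proof (induction J)
    case empty
    \<comment> \<open>The projection onto |i0> in the system alone is obtained by summing over all
      values at some site; site 0 is an arbitrary choice.\<close>
    let ?P = "\<Sum>g\<in>UNIV. diag_site 0 (i0, g)"
    have "?P (tvec i h) = (if i = i0 then tvec i h else 0)" if h: "h \<in> stab \<psi>" for i h
    proof -
      have "?P (tvec i h) = (\<Sum>g\<in>UNIV. if i = i0 then ip L2U (ket g) (h 0) \<cdot>\<^sub>v es 0 (i, g) h else 0)"
        unfolding sum_fun_apply[of _ _ "tvec i h"] using h by (intro sum.cong) (auto simp: diag_site_tvec es_def)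
      then show ?thesis using tvec_expand[OF h, of i 0] by auto
    qed
    moreover have "?P \<in> LA" by (rule H.cstar_sum[OF cstar_LA diag_site_LA])
    ultimately show ?case by (intro bexI[of _ ?P]) (auto simp: ovr_def)
  next
    case (insert m J)
    then obtain P where P: "P \<in> LA" "\<And>i h. h \<in> stab \<psi> \<Longrightarrow> P (tvec i h) =
        (if i = i0 then (\<Prod>n\<in>J. ip L2U (ket (y n)) (h n)) \<cdot>\<^sub>v tvec i (ovr J y h) else 0)" by blast
    note Q = diag_site_LA[of m "(i0, y m)"]
    have "(diag_site m (i0, y m) \<circ> P) (tvec i h) =
        (if i = i0 then (\<Prod>n\<in>insert m J. ip L2U (ket (y n)) (h n)) \<cdot>\<^sub>v tvec i (ovr (insert m J) y h) else 0)"
      if h: "h \<in> stab \<psi>" for i h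
    proof -
      have o: "(ovr J y h)(m := ket (y m)) = ovr (insert m J) y h" by (auto simp: ovr_def)
      have m: "ovr J y h m = h m" using insert.hyps by (simp add: ovr_def)
      show ?thesis
        using h insert.hyps H.bop_scale[OF LA(1)[OF Q]] H.bop_zero[OF LA(1)[OF Q]]
        by (auto simp: P(2) diag_site_tvec o m mult.commute)
    qed
    then show ?case using LA(4)[OF Q P(1)] by blast
  qed
  then show thesis using that by blast
qed

text \<open>The clause that describes \<open>mult_cyl\<close>, separated from it so that the window
  can be enlarged independently of the function.\<close>

definition eig :: "('e \<times> 'x) operator \<Rightarrow> (('e, 'g) path \<Rightarrow> complex) \<Rightarrow> nat \<Rightarrow> bool"
  where "eig W F t \<longleftrightarrow> (\<forall>i x. \<forall>h\<in>stab \<psi>. (\<forall>n. \<bar>n\<bar> \<le> int t \<longrightarrow> h n = ket (x n)) \<longrightarrow>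
    W (tvec i h) = F (i, x) \<cdot>\<^sub>v tvec i h)"

lemma eigD: "eig W F t \<Longrightarrow> h \<in> stab \<psi> \<Longrightarrow> (\<And>n. \<bar>n\<bar> \<le> int t \<Longrightarrow> h n = ket (x n)) \<Longrightarrow> W (tvec i h) = F (i, x) \<cdot>\<^sub>v tvec i h"
  by (simp add: eig_def)

lemma eig_mono: "eig W F t \<Longrightarrow> t \<le> s \<Longrightarrow> eig W F s"
  unfolding eig_def by (meson of_nat_le_iff order_trans)

lemma eig_unique:
  assumes "eig W F t" "eig W' F t" "W \<in> bop HK" "W' \<in> bop HK"
  shows "W = W'"
proof (rule op_eq_ket[of "window t" W W'])
  fix i h assume h: "h \<in> stab \<psi>" "\<And>n. n \<in> window t \<Longrightarrow> h n \<in> range ket"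
  have "\<bar>n\<bar> \<le> int t \<Longrightarrow> h n = ket (inv ket (h n))" for n using h(2)[of n] by (simp add: f_inv_into_f)
  then show "W (tvec i h) = W' (tvec i h)"
    using eigD[OF assms(1) h(1), of "\<lambda>n. inv ket (h n)"] eigD[OF assms(2) h(1), of "\<lambda>n. inv ket (h n)"] by simp
qed (use assms in auto)

abbreviation PE :: "nat \<Rightarrow> (int \<Rightarrow> 'g) set" where "PE t \<equiv> PiE (window t) (\<lambda>_. UNIV)"

text \<open>A sum over the configurations of the window. The formula covers every stabilised h, not
  only basis entries: the expectations need it at the constant sequence \<psi>.\<close>

lemma cylinder_op_exists:
  obtains W where "W \<in> LA" "\<And>i h. h \<in> stab \<psi> \<Longrightarrow> W (tvec i h) =
    (\<Sum>y\<in>PE t. (F (i, y) * (\<Prod>n\<in>window t. ip L2U (ket (y n)) (h n))) \<cdot>\<^sub>v tvec i (ovr (window t) y h))"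
proof -
  have ex: "\<exists>P. P \<in> LA \<and> (\<forall>i. \<forall>h\<in>stab \<psi>. P (tvec i h) =
    (if i = i0 then (\<Prod>n\<in>window t. ip L2U (ket (y n)) (h n)) \<cdot>\<^sub>v tvec i (ovr (window t) y h) else 0))" for i0 y
    by (rule point_proj_exists[of "window t" i0 y]) auto
  define P where "P i0 y = (SOME P. P \<in> LA \<and> (\<forall>i. \<forall>h\<in>stab \<psi>. P (tvec i h) =
    (if i = i0 then (\<Prod>n\<in>window t. ip L2U (ket (y n)) (h n)) \<cdot>\<^sub>v tvec i (ovr (window t) y h) else 0)))" for i0 y
  have "P i0 y \<in> LA \<and> (\<forall>i. \<forall>h\<in>stab \<psi>. P i0 y (tvec i h) =
    (if i = i0 then (\<Prod>n\<in>window t. ip L2U (ket (y n)) (h n)) \<cdot>\<^sub>v tvec i (ovr (window t) y h) else 0))" for i0 y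
    unfolding P_def by (rule someI_ex[OF ex])
  then have P: "P i0 y \<in> LA" "h \<in> stab \<psi> \<Longrightarrow> P i0 y (tvec i h) =
    (if i = i0 then (\<Prod>n\<in>window t. ip L2U (ket (y n)) (h n)) \<cdot>\<^sub>v tvec i (ovr (window t) y h) else 0)" for i0 y i h
    by blast+
  let ?W = "\<Sum>i0\<in>UNIV. \<Sum>y\<in>PE t. F (i0, y) \<cdot>\<^sub>o P i0 y"
  show thesis
  proof (rule that[of ?W])
    show "?W \<in> LA" by (intro H.cstar_sum[OF cstar_LA] LA(5) P(1))
    fix i h assume h: "h \<in> stab \<psi>"
    have "?W (tvec i h) = (\<Sum>i0\<in>UNIV. \<Sum>y\<in>PE t. F (i0, y) \<cdot>\<^sub>v P i0 y (tvec i h))"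
      by (simp only: sum_fun_apply[of _ _ "tvec i h"] scale_op_apply)
    also have "\<dots> = (\<Sum>i0\<in>UNIV. if i0 = i then (\<Sum>y\<in>PE t. (F (i, y) * (\<Prod>n\<in>window t. ip L2U (ket (y n)) (h n))) \<cdot>\<^sub>v tvec i (ovr (window t) y h)) else 0)"
      using h by (intro sum.cong refl) (auto simp: P(2) intro!: sum.cong)
    finally show "?W (tvec i h) = (\<Sum>y\<in>PE t. (F (i, y) * (\<Prod>n\<in>window t. ip L2U (ket (y n)) (h n))) \<cdot>\<^sub>v tvec i (ovr (window t) y h))"
      by simp
  qed
qed

lemma finite_PE [simp]: "finite (PE t)"
  by (intro finite_PiE) auto

text \<open>With basis vectors in the window, a single configuration has a nonzero
  coefficient.\<close>

lemma eig_cylinder_op: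
  assumes F: "cylinder t F" and W: "\<And>i h. h \<in> stab \<psi> \<Longrightarrow> W (tvec i h) =
    (\<Sum>y\<in>PE t. (F (i, y) * (\<Prod>n\<in>window t. ip L2U (ket (y n)) (h n))) \<cdot>\<^sub>v tvec i (ovr (window t) y h))"
  shows "eig W F t"
  unfolding eig_def
proof (intro allI ballI impI)
  fix i x h assume h: "h \<in> stab \<psi>" "agree t h (\<lambda>n. ket (x n))"
  let ?x = "restrict x (window t)"
  have x: "?x \<in> PE t" by simp
  have "(F (i, y) * (\<Prod>n\<in>window t. ip L2U (ket (y n)) (h n))) \<cdot>\<^sub>v tvec i (ovr (window t) y h) =
      (if y = ?x then F (i, x) \<cdot>\<^sub>v tvec i h else 0)" if y: "y \<in> PE t" for y
  proof (cases "\<forall>n\<in>window t. y n = x n")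
    case True
    have "y = ?x" by (rule PiE_ext[OF y x]) (use True in auto)
    moreover have "F (i, y) = F (i, x)" by (rule cylinderD[OF F]) (use True in auto)
    moreover have "(\<Prod>n\<in>window t. ip L2U (ket (y n)) (h n)) = 1"
      using True h by (intro prod.neutral) auto
    moreover have "ovr (window t) y h = h" using True h by (auto simp: ovr_def)
    ultimately show ?thesis by simp
  next
    case False
    then obtain n where n: "n \<in> window t" "y n \<noteq> x n" by blast
    then have p0: "(\<Prod>n\<in>window t. ip L2U (ket (y n)) (h n)) = 0"
      using h by (intro prod_zero bexI[of _ n]) auto
    have "y \<noteq> ?x" using n by auto
    then show ?thesis unfolding p0 by simp
  qed
  then have "W (tvec i h) = (\<Sum>y\<in>PE t. if y = ?x then F (i, x) \<cdot>\<^sub>v tvec i h else 0)"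
    unfolding W[OF h(1)] by (intro sum.cong refl)
  also have "\<dots> = F (i, x) \<cdot>\<^sub>v tvec i h" unfolding sum.delta[OF finite_PE] using x by simp
  finally show "W (tvec i h) = F (i, x) \<cdot>\<^sub>v tvec i h" .
qed

abbreviation mc :: "nat \<Rightarrow> (('e, 'g) path \<Rightarrow> complex) \<Rightarrow> ('e \<times> 'x) operator"
  where "mc \<equiv> mult_cyl \<psi> K T"

text \<open>Comparison on a larger window s is allowed since enlarging the window keeps both
  eigenvalue statements, and the larger window still has a total set of eigenvectors.\<close>

lemma mult_cyl_eqI:
  assumes F: "cylinder t F" and W: "W \<in> bop HK" "eig W F s" "t \<le> s"
  shows "mc t F = W"
proof -
  obtain W0 where W0: "W0 \<in> LA" "\<And>i h. h \<in> stab \<psi> \<Longrightarrow> W0 (tvec i h) =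
    (\<Sum>y\<in>PE t. (F (i, y) * (\<Prod>n\<in>window t. ip L2U (ket (y n)) (h n))) \<cdot>\<^sub>v tvec i (ovr (window t) y h))"
    by (rule cylinder_op_exists[of F t]) blast
  have e: "eig W0 F t" by (rule eig_cylinder_op[OF F W0(2)])
  have spec: "(W' \<in> bop HK \<and> (\<forall>i x. \<forall>h\<in>stab \<psi>. (\<forall>n. \<bar>n\<bar> \<le> int t \<longrightarrow> h n = ket (x n)) \<longrightarrow>
      W' (ket i \<otimes>\<^sub>v T h) = F (i, x) \<cdot>\<^sub>v (ket i \<otimes>\<^sub>v T h))) \<longleftrightarrow> W' \<in> bop HK \<and> eig W' F t" for W'
    by (simp add: eig_def tvec_def)
  have "mc t F = W0" unfolding mult_cyl_def spec
    by (rule the_equality) (use e W0 LA(1) eig_unique in blast)+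
  also have "W0 = W" by (rule eig_unique[OF eig_mono[OF e W(3)] W(2) LA(1)[OF W0(1)] W(1)])
  finally show ?thesis .
qed

lemma mult_cyl:
  assumes F: "cylinder t F"
  shows "mc t F \<in> LA" "eig (mc t F) F t"
    "h \<in> stab \<psi> \<Longrightarrow> mc t F (tvec i h) =
    (\<Sum>y\<in>PE t. (F (i, y) * (\<Prod>n\<in>window t. ip L2U (ket (y n)) (h n))) \<cdot>\<^sub>v tvec i (ovr (window t) y h))"
proof -
  obtain W0 where W0: "W0 \<in> LA" "\<And>i h. h \<in> stab \<psi> \<Longrightarrow> W0 (tvec i h) =
    (\<Sum>y\<in>PE t. (F (i, y) * (\<Prod>n\<in>window t. ip L2U (ket (y n)) (h n))) \<cdot>\<^sub>v tvec i (ovr (window t) y h))"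
    by (rule cylinder_op_exists[of F t]) blast
  have e: "eig W0 F t" by (rule eig_cylinder_op[OF F W0(2)])
  have eq: "mc t F = W0" by (rule mult_cyl_eqI[OF F LA(1)[OF W0(1)] e order_refl])
  show "mc t F \<in> LA" "eig (mc t F) F t" unfolding eq by (fact W0(1), fact e)
  show "mc t F (tvec i h) =
    (\<Sum>y\<in>PE t. (F (i, y) * (\<Prod>n\<in>window t. ip L2U (ket (y n)) (h n))) \<cdot>\<^sub>v tvec i (ovr (window t) y h))" if "h \<in> stab \<psi>"
    unfolding eq by (rule W0(2)[OF that])
qed

lemma mc_bop [simp, intro]: "cylinder t F \<Longrightarrow> mc t F \<in> bop HK"
  using mult_cyl(1) LA(1) by blast

lemma mc_raise: "cylinder t F \<Longrightarrow> t \<le> s \<Longrightarrow> mc s F = mc t F"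
  by (rule mult_cyl_eqI[OF cylinder_mono mc_bop _ order_refl]) (auto intro: eig_mono mult_cyl(2))

lemma cylinder_ops:
  assumes "cylinder t F"
  shows "cylinder t (\<lambda>\<omega>. \<eta> (F \<omega>))" "cylinder t G \<Longrightarrow> cylinder t (\<lambda>\<omega>. \<zeta> (F \<omega>) (G \<omega>))"
  using assms unfolding cylinder_def by metis+

lemma mc_one: "mc t (\<lambda>_. 1) = id_op HK"
  by (rule mult_cyl_eqI[OF _ _ _ order_refl]) (auto simp: cylinder_def eig_def)

lemma mc_add: "cylinder t F \<Longrightarrow> cylinder t G \<Longrightarrow> mc t (\<lambda>\<omega>. F \<omega> + G \<omega>) = mc t F + mc t G"
proof -
  assume c: "cylinder t F" "cylinder t G"
  note e = eigD[OF mult_cyl(2)[OF c(1)]] eigD[OF mult_cyl(2)[OF c(2)]]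
  show ?thesis
  proof (rule mult_cyl_eqI[OF cylinder_ops(2)[OF c] _ _ order_refl])
    show "mc t F + mc t G \<in> bop HK" using c by auto
    show "eig (mc t F + mc t G) (\<lambda>\<omega>. F \<omega> + G \<omega>) t"
      unfolding eig_def by (auto simp: plus_fun_apply[of "mc t F"] e scale_distrib)
  qed
qed

lemma mc_scale: "cylinder t F \<Longrightarrow> mc t (\<lambda>\<omega>. k * F \<omega>) = k \<cdot>\<^sub>o mc t F"
proof -
  assume c: "cylinder t F"
  show ?thesis
  proof (rule mult_cyl_eqI[OF cylinder_ops(1)[OF c] _ _ order_refl])
    show "k \<cdot>\<^sub>o mc t F \<in> bop HK" using c by auto
    show "eig (k \<cdot>\<^sub>o mc t F) (\<lambda>\<omega>. k * F \<omega>) t"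
      unfolding eig_def by (auto simp: scale_op_apply eigD[OF mult_cyl(2)[OF c]])
  qed
qed

lemma mc_mult: "cylinder t F \<Longrightarrow> cylinder t G \<Longrightarrow> mc t (\<lambda>\<omega>. F \<omega> * G \<omega>) = mc t F \<circ> mc t G"
proof -
  assume c: "cylinder t F" "cylinder t G"
  note e = eigD[OF mult_cyl(2)[OF c(1)]] eigD[OF mult_cyl(2)[OF c(2)]]
  show ?thesis
  proof (rule mult_cyl_eqI[OF cylinder_ops(2)[OF c] _ _ order_refl])
    show "mc t F \<circ> mc t G \<in> bop HK" using c by auto
    show "eig (mc t F \<circ> mc t G) (\<lambda>\<omega>. F \<omega> * G \<omega>) t"
      unfolding eig_def by (auto simp: e H.bop_scale[OF mc_bop[OF c(1)]] mult.commute)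
  qed
qed

lemma mc_cnj:
  assumes F: "cylinder t F"
  shows "mc t (\<lambda>\<omega>. cnj (F \<omega>)) = adj HK (mc t F)"
proof -
  have F': "cylinder t (\<lambda>\<omega>. cnj (F \<omega>))" by (rule cylinder_ops(1)[OF F])
  have "H.adjp (mc t F) (mc t (\<lambda>\<omega>. cnj (F \<omega>)))"
  proof (rule H.adjp_total[OF total_tvec_ket[of "window t"] mc_bop[OF F] mc_bop[OF F']])
    fix a b
    assume "a \<in> (\<lambda>(i, h). tvec i h) ` (UNIV \<times> {h \<in> stab \<psi>. \<forall>n\<in>window t. h n \<in> range ket})"
      "b \<in> (\<lambda>(i, h). tvec i h) ` (UNIV \<times> {h \<in> stab \<psi>. \<forall>n\<in>window t. h n \<in> range ket})"
    then obtain i h j h' where ab: "a = tvec i h" "b = tvec j h'" "h \<in> stab \<psi>" "h' \<in> stab \<psi>"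
      "\<And>n. n \<in> window t \<Longrightarrow> h n \<in> range ket" "\<And>n. n \<in> window t \<Longrightarrow> h' n \<in> range ket" by auto
    define x where "x n = inv ket (h n)" for n
    define x' where "x' n = inv ket (h' n)" for n
    have x: "h n = ket (x n)" "h' n = ket (x' n)" if "\<bar>n\<bar> \<le> int t" for n
      using ab(5,6)[of n] that by (simp_all add: x_def x'_def f_inv_into_f)
    have 1: "ip HK a (mc t F b) = F (j, x') * ip HK a b"
      using ab eigD[OF mult_cyl(2)[OF F] ab(4) x(2)] by (simp add: H.ip_scale_right)
    have 2: "ip HK (mc t (\<lambda>\<omega>. cnj (F \<omega>)) a) b = F (i, x) * ip HK a b"
      using ab eigD[OF mult_cyl(2)[OF F'] ab(3) x(1)] by (simp add: H.ip_scale_left)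
    \<comment> \<open>Eigenvectors with different eigenvalues are orthogonal, so real and conjugated
      eigenvalues never have to match across different configurations.\<close>
    have "ip HK a b = 0 \<or> F (i, x) = F (j, x')"
    proof (cases "i = j \<and> agree t x x'")
      case True
      then have "F (i, x) = F (i, x')" by (intro cylinderD[OF F]) auto
      then show ?thesis using True by simp
    next
      case False
      show ?thesis
      proof (cases "i = j")
        case True
        then obtain n where n: "\<bar>n\<bar> \<le> int t" "x n \<noteq> x' n" using False by blast
        then have "ip L2U (h n) (h' n) = 0" using x[OF n(1)] by simp
        then have "Prod_any (\<lambda>n. ip L2U (h n) (h' n)) = 0"
          by (rule Prod_any_eq_0[OF finite_support[OF ab(3,4)]])
        then show ?thesis using ab by (simp add: ip_tvec)
      qed (use ab in \<open>simp add: ip_tvec\<close>)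
    qed
    then show "ip HK a (mc t F b) = ip HK (mc t (\<lambda>\<omega>. cnj (F \<omega>)) a) b" unfolding 1 2 by auto
  qed auto
  then show ?thesis using H.adj_eq by simp
qed

text \<open>The square root complement again: G is a cylinder function on the same window, so the
  argument stays within window t and needs no representation of all continuous functions.\<close>

lemma mc_contractive:
  assumes F: "cylinder t F" "\<And>\<omega>. cmod (F \<omega>) \<le> c" and v: "v \<in> vecs HK"
  shows "hnorm HK (mc t F v) \<le> c * hnorm HK v"
proof -
  define G where "G \<omega> = complex_of_real (sqrt (c\<^sup>2 - (cmod (F \<omega>))\<^sup>2))" for \<omega>
  have G: "cylinder t G" unfolding G_def by (rule cylinder_ops(1)[OF F(1)])
  have sq: "cylinder t (\<lambda>\<omega>. cnj (A \<omega>))" "cylinder t (\<lambda>\<omega>. cnj (A \<omega>) * A \<omega>)" if "cylinder t A" for A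
    using cylinder_ops(1)[OF that] by auto
  have one: "cylinder t (\<lambda>_. 1)" by (simp add: cylinder_def)
  have "mc t (\<lambda>\<omega>. cnj (F \<omega>) * F \<omega> + cnj (G \<omega>) * G \<omega>) = (adj HK (mc t F) \<circ> mc t F) + (adj HK (mc t G) \<circ> mc t G)"
    unfolding mc_add[OF sq(2)[OF F(1)] sq(2)[OF G]] mc_mult[OF sq(1)[OF F(1)] F(1)] mc_mult[OF sq(1)[OF G] G]
      mc_cnj[OF F(1)] mc_cnj[OF G] ..
  also have "(\<lambda>\<omega>. cnj (F \<omega>) * F \<omega> + cnj (G \<omega>) * G \<omega>) = (\<lambda>\<omega>. of_real (c\<^sup>2) * 1)"
    unfolding G_def using H.sqrt_complement[OF F(2)] by blast
  also have "mc t (\<lambda>\<omega>. of_real (c\<^sup>2) * 1) = of_real (c\<^sup>2) \<cdot>\<^sub>o id_op HK"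
    by (simp only: mc_scale[OF one] mc_one)
  finally have "(adj HK (mc t F) \<circ> mc t F) + (adj HK (mc t G) \<circ> mc t G) = of_real (c\<^sup>2) \<cdot>\<^sub>o id_op HK" by (rule sym)
  moreover have "c \<ge> 0" using F(2)[of undefined] norm_ge_zero order_trans by blast
  ultimately show ?thesis using F(1) G v by (intro H.contraction_of_complement) auto
qed

text \<open>Both operators are first moved to a common window, where their difference is a single
  multiplication operator.\<close>

lemma mc_diff:
  assumes F: "cylinder t F" "cylinder s G" "\<And>\<omega>. cmod (F \<omega> - G \<omega>) \<le> c" and v: "v \<in> vecs HK"
  shows "hnorm HK (mc t F v - mc s G v) \<le> c * hnorm HK v"
proof -
  define m where "m = max s t"
  have c: "cylinder m F" "cylinder m G" using cylinder_mono[OF F(1), of m] cylinder_mono[OF F(2), of m] by (simp_all add: m_def)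
  have c': "cylinder m (\<lambda>\<omega>. (-1) * G \<omega>)" by (rule cylinder_ops(1)[OF c(2)])
  have "mc m (\<lambda>\<omega>. F \<omega> + (-1) * G \<omega>) = mc m F + (-1) \<cdot>\<^sub>o mc m G" unfolding mc_add[OF c(1) c'] mc_scale[OF c(2)] ..
  also have "\<dots> = mc t F - mc s G"
    using mc_raise[OF F(1), of m] mc_raise[OF F(2), of m] by (simp add: m_def H.scale_op_minus_one)
  finally have "mc t F v - mc s G v = mc m (\<lambda>\<omega>. F \<omega> + (-1) * G \<omega>) v" by (simp add: minus_apply)
  then show ?thesis
    using mc_contractive[OF cylinder_ops(2)[OF c, of "\<lambda>a b. a + (-1) * b"], of c v] F(3) v by simp
qed

end

section \<open>Limits of uniformly bounded sequences of operators\<close>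

context hilbert
begin

lemma lims_hnorm_le_eventually:
  assumes "lims s f" "\<And>n. n \<ge> N \<Longrightarrow> hnorm K (s n - g) \<le> b" "g \<in> vecs K"
  shows "hnorm K (f - g) \<le> b"
proof (rule lims_hnorm_le)
  show "lims (\<lambda>n. s (n + N)) f"
    using assms(1) unfolding lims_def by (auto intro: LIMSEQ_ignore_initial_segment)
qed (use assms in auto)

text \<open>Operator and vector vary together, as happens for the product of two truncated
  multiplication operators.\<close>

lemma lims_apply:
  assumes C: "\<And>n. C n \<in> bop K" "\<And>n f. f \<in> vecs K \<Longrightarrow> hnorm K (C n f) \<le> M * hnorm K f"
    and u: "lims u w" and Cw: "lims (\<lambda>n. C n w) z"
  shows "lims (\<lambda>n. C n (u n)) z"
proof (rule lims_bound)
  note v = lims_vecs[OF u] lims_vecs(2)[OF Cw]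
  show "C n (u n) \<in> vecs K" for n using C(1) v by auto
  show "z \<in> vecs K" using v by auto
  show "hnorm K (C n (u n) - z) \<le> M * hnorm K (u n - w) + hnorm K (C n w - z)" for n
  proof -
    have "hnorm K (C n (u n) - z) \<le> hnorm K (C n (u n) - C n w) + hnorm K (C n w - z)"
      using C(1) v by (intro hnorm_triangle_diff) auto
    moreover have "C n (u n) - C n w = C n (u n - w)" using C(1)[of n] v by (simp add: bop_diff)
    moreover have "hnorm K (C n (u n - w)) \<le> M * hnorm K (u n - w)" using v by (intro C(2)) auto
    ultimately show ?thesis by simp
  qed
  have "(\<lambda>n. M * hnorm K (u n - w) + hnorm K (C n w - z)) \<longlonglongrightarrow> M * 0 + 0"
    using u Cw unfolding lims_def by (intro tendsto_add tendsto_mult tendsto_const) auto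
  then show "(\<lambda>n. M * hnorm K (u n - w) + hnorm K (C n w - z)) \<longlonglongrightarrow> 0" by simp
qed

end

section \<open>Multiplication by continuous functions\<close>

context itensor
begin

text \<open>Multiplication by a continuous function is the limit of the multiplications by its truncations.\<close>

definition mlim :: "(('e, 'g) path \<Rightarrow> complex) \<Rightarrow> ('e \<times> 'x) operator"
  where "mlim F = (SOME D. D \<in> bop HK \<and> (\<forall>v\<in>vecs HK. H.lims (\<lambda>n. mc n (\<lambda>\<omega>. F (trunc n \<omega>)) v) (D v)))"

lemma mc_trunc_bop [simp, intro]: "mc n (\<lambda>\<omega>. F (trunc n \<omega>)) \<in> bop HK"
  by (rule mc_bop[OF cylinder_trunc])

lemma mc_trunc_bounded:
  assumes "F \<in> cont_funs path_topology"
  obtains M where "\<And>n v. v \<in> vecs HK \<Longrightarrow> hnorm HK (mc n (\<lambda>\<omega>. F (trunc n \<omega>)) v) \<le> M * hnorm HK v"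
proof -
  obtain M where M: "\<And>\<omega>. cmod (F \<omega>) \<le> M" using cont_funs_bounded[OF assms] by blast
  show thesis by (rule that[of M]) (rule mc_contractive[OF cylinder_trunc], rule M)
qed

text \<open>The truncations of F are uniformly Cauchy, hence so are the operators by
  \<open>mc_diff\<close>, and their bounds do not depend on the window.\<close>

lemma mlim:
  assumes F: "F \<in> cont_funs path_topology"
  shows mlim_bop: "mlim F \<in> bop HK"
    and mlim_lims: "v \<in> vecs HK \<Longrightarrow> H.lims (\<lambda>n. mc n (\<lambda>\<omega>. F (trunc n \<omega>)) v) (mlim F v)"
proof -
  let ?C = "\<lambda>n. mc n (\<lambda>\<omega>. F (trunc n \<omega>))"
  obtain M where M: "\<And>n v. v \<in> vecs HK \<Longrightarrow> hnorm HK (?C n v) \<le> M * hnorm HK v"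
    using mc_trunc_bounded[OF F] by blast
  have conv: "\<exists>g. H.lims (\<lambda>n. ?C n v) g" if v: "v \<in> vecs HK" for v
  proof -
    have "\<exists>n0. \<forall>m\<ge>n0. \<forall>n\<ge>n0. hnorm HK (?C m v - ?C n v) < \<epsilon>" if "\<epsilon> > 0" for \<epsilon>
    proof -
      \<comment> \<open>Both truncations may be off by \<delta>, hence the factor 2; the added 1
        covers v = 0.\<close>
      define \<delta> where "\<delta> = \<epsilon> / (2 * (hnorm HK v + 1))"
      have p: "hnorm HK v + 1 > 0" using H.hnorm_nonneg[OF v] by linarith
      have \<delta>: "\<delta> > 0" using that p by (simp add: \<delta>_def)
      obtain t where t: "\<And>s \<omega>. s \<ge> t \<Longrightarrow> cmod (F (trunc s \<omega>) - F \<omega>) < \<delta>" using trunc_approx[OF F \<delta>] by blast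
      have "hnorm HK (?C m v - ?C n v) < \<epsilon>" if mn: "m \<ge> t" "n \<ge> t" for m n
      proof -
        have "cmod (F (trunc m \<omega>) - F (trunc n \<omega>)) \<le> 2 * \<delta>" for \<omega>
          using norm_triangle_ineq4[of "F (trunc m \<omega>) - F \<omega>" "F (trunc n \<omega>) - F \<omega>"] t[OF mn(1), of \<omega>] t[OF mn(2), of \<omega>]
          by simp
        then have "hnorm HK (?C m v - ?C n v) \<le> 2 * \<delta> * hnorm HK v"
          by (intro mc_diff[OF cylinder_trunc cylinder_trunc _ v])
        also have "\<dots> < 2 * \<delta> * (hnorm HK v + 1)" using \<delta> by simp
        also have "\<dots> = \<epsilon>" using p by (simp add: \<delta>_def field_simps)
        finally show ?thesis .
      qed
      then show ?thesis by blast
    qed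
    then obtain f where "f \<in> vecs HK" "(\<lambda>n. hnorm HK (?C n v - f)) \<longlonglongrightarrow> 0"
      using H.cauchy_limit[of "\<lambda>n. ?C n v"] v by auto
    then show ?thesis unfolding H.lims_def using v by auto
  qed
  have "\<exists>D. D \<in> bop HK \<and> (\<forall>v\<in>vecs HK. H.lims (\<lambda>n. ?C n v) (D v))"
  proof (rule H.bop_limit[where C = ?C and M = M, OF mc_trunc_bop M conv])
    fix D assume "D \<in> bop HK" "\<And>v. v \<in> vecs HK \<Longrightarrow> H.lims (\<lambda>n. ?C n v) (D v)"
    then show ?thesis by (intro exI[of _ D] conjI ballI)
  qed
  from someI_ex[OF this] show "mlim F \<in> bop HK"
    "v \<in> vecs HK \<Longrightarrow> H.lims (\<lambda>n. ?C n v) (mlim F v)" unfolding mlim_def by auto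
qed

lemma mlim_eqI:
  assumes F: "F \<in> cont_funs path_topology" and D: "D \<in> bop HK"
    "\<And>v. v \<in> vecs HK \<Longrightarrow> H.lims (\<lambda>n. mc n (\<lambda>\<omega>. F (trunc n \<omega>)) v) (D v)"
  shows "mlim F = D"
  by (rule H.bop_ext[OF mlim_bop[OF F] D(1)]) (rule H.lims_unique[OF mlim_lims[OF F] D(2)])

text \<open>Once the window contains that of G, truncation leaves G unchanged, so the estimate holds
  for the truncations and survives the limit.\<close>

lemma mlim_approx:
  assumes F: "F \<in> cont_funs path_topology" and G: "cylinder t G" "\<And>\<omega>. cmod (F \<omega> - G \<omega>) \<le> c"
    and v: "v \<in> vecs HK"
  shows "hnorm HK (mlim F v - mc t G v) \<le> c * hnorm HK v"
proof (rule H.lims_hnorm_le_eventually[OF mlim_lims[OF F v], of t])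
  show "mc t G v \<in> vecs HK" using mc_bop[OF G(1)] v by auto
  fix n assume n: "n \<ge> t"
  have "cmod (F (trunc n \<omega>) - G \<omega>) \<le> c" for \<omega>
    using G(2)[of "trunc n \<omega>"] cylinder_trunc_eq[OF G(1) n, of \<omega>] by simp
  then show "hnorm HK (mc n (\<lambda>\<omega>. F (trunc n \<omega>)) v - mc t G v) \<le> c * hnorm HK v"
    by (intro mc_diff[OF cylinder_trunc G(1) _ v])
qed

lemma mlim_cylinder:
  assumes G: "cylinder t G"
  shows "mlim G = mc t G"
proof (rule H.bop_ext[OF mlim_bop[OF cylinder_cont[OF G]] mc_bop[OF G]])
  fix v assume v: "v \<in> vecs HK"
  have "hnorm HK (mlim G v - mc t G v) \<le> 0 * hnorm HK v"
    by (rule mlim_approx[OF cylinder_cont[OF G] G _ v]) simp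
  then show "mlim G v = mc t G v"
    using mlim_bop[OF cylinder_cont[OF G]] mc_bop[OF G] v
    by (intro H.vec_eqI_small[of _ _ 0]) auto
qed

lemma cont_path_ops:
  fixes F G :: "('e, 'g) path \<Rightarrow> complex"
  assumes "F \<in> cont_funs path_topology" "G \<in> cont_funs path_topology"
  shows "(\<lambda>\<omega>. F \<omega> + G \<omega>) \<in> cont_funs path_topology" "(\<lambda>\<omega>. F \<omega> * G \<omega>) \<in> cont_funs path_topology"
    "(\<lambda>\<omega>. c * F \<omega>) \<in> cont_funs path_topology" "(\<lambda>\<omega>. cnj (F \<omega>)) \<in> cont_funs path_topology"
proof -
  note c = assms[unfolded cont_funs_def mem_Collect_eq]
  show "(\<lambda>\<omega>. F \<omega> + G \<omega>) \<in> cont_funs path_topology"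
    unfolding cont_funs_def mem_Collect_eq by (rule continuous_map_add[OF c])
  have "continuous_map path_topology euclidean (\<lambda>\<omega>. (F \<omega>, G \<omega>))"
    using continuous_map_pairedI[OF c] by simp
  then have p: "(\<lambda>\<omega>. (F \<omega>, G \<omega>)) \<in> {f. continuous_map path_topology euclidean f}" by simp
  have "continuous_map euclidean euclidean (\<lambda>z. fst z * snd z :: complex)"
    by (simp, intro continuous_intros)
  from continuous_map_compose[OF p[unfolded mem_Collect_eq] this]
  show "(\<lambda>\<omega>. F \<omega> * G \<omega>) \<in> cont_funs path_topology" by (simp add: cont_funs_def o_def)
  show "(\<lambda>\<omega>. c * F \<omega>) \<in> cont_funs path_topology"
    by (rule cont_funs_compose[OF assms(1)]) (intro continuous_intros)
  show "(\<lambda>\<omega>. cnj (F \<omega>)) \<in> cont_funs path_topology"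
    by (rule cont_funs_compose[OF assms(1)]) (intro continuous_intros)
qed

text \<open>Truncation is composition with a map of paths and commutes with all pointwise
  operations, so each identity passes from the cylinder functions to the limit.\<close>

lemma cont_star_hom_mlim: "cont_star_hom path_topology HK mlim"
  unfolding cont_star_hom_def
proof (intro conjI ballI allI)
  show "mlim F \<in> bop HK" if "F \<in> cont_funs path_topology" for F using mlim_bop[OF that] .
  have "cylinder 0 (\<lambda>_ :: ('e, 'g) path. 1 :: complex)" by (simp add: cylinder_def)
  from mlim_cylinder[OF this] show "mlim (\<lambda>_. 1) = id_op HK" by (simp add: mc_one)
  fix F :: "('e, 'g) path \<Rightarrow> complex" assume F: "F \<in> cont_funs path_topology"
  note FF = cont_path_ops[OF F F] and Fb = mlim_bop[OF F] and Fl = mlim_lims[OF F]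
  show "mlim (\<lambda>\<omega>. c * F \<omega>) = c \<cdot>\<^sub>o mlim F" for c
  proof (rule mlim_eqI[OF FF(3)])
    show "c \<cdot>\<^sub>o mlim F \<in> bop HK" using Fb by auto
    fix v assume v: "v \<in> vecs HK"
    show "H.lims (\<lambda>n. mc n (\<lambda>\<omega>. c * F (trunc n \<omega>)) v) ((c \<cdot>\<^sub>o mlim F) v)"
      unfolding mc_scale[OF cylinder_trunc] scale_op_apply by (rule H.lims_scale[OF Fl[OF v]])
  qed
  have "H.adjp (mlim F) (mlim (\<lambda>\<omega>. cnj (F \<omega>)))"
    unfolding H.adjp_def
  proof (intro conjI ballI Fb mlim_bop[OF FF(4)])
    fix f g assume v: "f \<in> vecs HK" "g \<in> vecs HK"
    have "(\<lambda>n. ip HK f (mc n (\<lambda>\<omega>. F (trunc n \<omega>)) g)) \<longlonglongrightarrow> ip HK f (mlim F g)"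
      by (rule H.lims_ip_right[OF Fl[OF v(2)] v(1)])
    moreover have "(\<lambda>n. ip HK (mc n (\<lambda>\<omega>. cnj (F (trunc n \<omega>))) f) g) \<longlonglongrightarrow> ip HK (mlim (\<lambda>\<omega>. cnj (F \<omega>)) f) g"
      by (rule H.lims_ip_left[OF mlim_lims[OF FF(4) v(1)] v(2)])
    moreover have "ip HK (mc n (\<lambda>\<omega>. cnj (F (trunc n \<omega>))) f) g = ip HK f (mc n (\<lambda>\<omega>. F (trunc n \<omega>)) g)" for n
      unfolding mc_cnj[OF cylinder_trunc] by (rule H.ip_adj[OF mc_trunc_bop v])
    ultimately show "ip HK f (mlim F g) = ip HK (mlim (\<lambda>\<omega>. cnj (F \<omega>)) f) g" by (auto intro: LIMSEQ_unique)
  qed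
  then show "mlim (\<lambda>\<omega>. cnj (F \<omega>)) = adj HK (mlim F)" using H.adj_eq by simp
  fix G :: "('e, 'g) path \<Rightarrow> complex" assume G: "G \<in> cont_funs path_topology"
  note FG = cont_path_ops[OF F G] and Gb = mlim_bop[OF G] and Gl = mlim_lims[OF G]
  show "mlim (\<lambda>\<omega>. F \<omega> + G \<omega>) = mlim F + mlim G"
  proof (rule mlim_eqI[OF FG(1)])
    show "mlim F + mlim G \<in> bop HK" using Fb Gb by auto
    fix v assume v: "v \<in> vecs HK"
    show "H.lims (\<lambda>n. mc n (\<lambda>\<omega>. F (trunc n \<omega>) + G (trunc n \<omega>)) v) ((mlim F + mlim G) v)"
      unfolding mc_add[OF cylinder_trunc cylinder_trunc] plus_fun_apply[of _ _ v]
      by (rule H.lims_add[OF Fl[OF v] Gl[OF v]])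
  qed
  show "mlim (\<lambda>\<omega>. F \<omega> * G \<omega>) = mlim F \<circ> mlim G"
  proof (rule mlim_eqI[OF FG(2)])
    show "mlim F \<circ> mlim G \<in> bop HK" using Fb Gb by auto
    fix v assume v: "v \<in> vecs HK"
    obtain M where M: "\<And>n v. v \<in> vecs HK \<Longrightarrow> hnorm HK (mc n (\<lambda>\<omega>. F (trunc n \<omega>)) v) \<le> M * hnorm HK v"
      using mc_trunc_bounded[OF F] by blast
    show "H.lims (\<lambda>n. mc n (\<lambda>\<omega>. F (trunc n \<omega>) * G (trunc n \<omega>)) v) ((mlim F \<circ> mlim G) v)"
      unfolding mc_mult[OF cylinder_trunc cylinder_trunc] o_apply
      by (rule H.lims_apply[OF mc_trunc_bop M Gl[OF v] Fl]) (use Gb v in auto)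
  qed
qed

text \<open>Contractivity makes both homomorphisms continuous in the supremum norm, in which
  cylinder functions are dense.\<close>

lemma cont_star_hom_path_unique:
  assumes \<pi>: "cont_star_hom path_topology HK \<pi>" and cyl: "\<And>t F. cylinder t F \<Longrightarrow> \<pi> F = mc t F"
    and F: "F \<in> cont_funs path_topology"
  shows "\<pi> F = mlim F"
proof (rule H.bop_ext[OF H.cont_star_homD(1)[OF \<pi> F] mlim_bop[OF F]])
  fix v assume v: "v \<in> vecs HK"
  show "\<pi> F v = mlim F v"
  proof (rule H.vec_eqI_small)
    show "\<pi> F v \<in> vecs HK" "mlim F v \<in> vecs HK" using H.cont_star_homD(1)[OF \<pi> F] mlim_bop[OF F] v by auto
    show "2 * hnorm HK v \<ge> 0" using v by simp
    fix \<epsilon> :: real assume "\<epsilon> > 0"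
    obtain t where t: "\<And>s \<omega>. s \<ge> t \<Longrightarrow> cmod (F (trunc s \<omega>) - F \<omega>) < \<epsilon>"
      using trunc_approx[OF F \<open>\<epsilon> > 0\<close>] by blast
    let ?G = "\<lambda>\<omega>. F (trunc t \<omega>)"
    have G: "cylinder t ?G" by (rule cylinder_trunc)
    have b: "cmod (F \<omega> - ?G \<omega>) \<le> \<epsilon>" for \<omega> using t[of t \<omega>] by (simp add: norm_minus_commute less_imp_le)
    have FG: "(\<lambda>\<omega>. F \<omega> - ?G \<omega>) \<in> cont_funs path_topology"
      using cont_path_ops(1)[OF F cont_path_ops(3)[OF cylinder_cont[OF G] F, of "-1"]] by simp
    have "hnorm HK (\<pi> (\<lambda>\<omega>. F \<omega> - ?G \<omega>) v) \<le> \<epsilon> * hnorm HK v"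
      by (rule H.cont_star_hom_contractive[OF \<pi> FG b v])
    then have 1: "hnorm HK (\<pi> F v - mc t ?G v) \<le> \<epsilon> * hnorm HK v"
      unfolding H.cont_star_hom_diff[OF \<pi> F cylinder_cont[OF G]] cyl[OF G] by (simp add: minus_apply)
    have 2: "hnorm HK (mlim F v - mc t ?G v) \<le> \<epsilon> * hnorm HK v" by (rule mlim_approx[OF F G b v])
    have vv: "\<pi> F v \<in> vecs HK" "mlim F v \<in> vecs HK" "mc t ?G v \<in> vecs HK"
      using H.cont_star_homD(1)[OF \<pi> F] mlim_bop[OF F] v by auto
    have "hnorm HK (\<pi> F v - mlim F v) \<le> hnorm HK (\<pi> F v - mc t ?G v) + hnorm HK (mc t ?G v - mlim F v)"
      using vv by (intro H.hnorm_triangle_diff)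
    then show "hnorm HK (\<pi> F v - mlim F v) \<le> 2 * hnorm HK v * \<epsilon>"
      using 1 2 H.hnorm_minus_commute[OF vv(2,3)] by (simp add: mult_ac)
  qed
qed

text \<open>\<open>mlim\<close> is the homomorphism that the description asks for.\<close>

lemma mult_op_eq:
  assumes F: "F \<in> cont_funs path_topology"
  shows "mult_op \<psi> K T F = mlim F"
  unfolding mult_op_def
proof (rule the_equality)
  show "\<exists>\<pi>. cont_star_hom path_topology HK \<pi> \<and> (\<forall>t F'. cylinder t F' \<longrightarrow> \<pi> F' = mc t F') \<and> mlim F = \<pi> F"
    using cont_star_hom_mlim mlim_cylinder by (intro exI[of _ mlim]) simp
  fix A assume "\<exists>\<pi>. cont_star_hom path_topology HK \<pi> \<and> (\<forall>t F'. cylinder t F' \<longrightarrow> \<pi> F' = mc t F') \<and> A = \<pi> F"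
  then obtain \<pi> where \<pi>: "cont_star_hom path_topology HK \<pi> \<and> (\<forall>t F'. cylinder t F' \<longrightarrow> \<pi> F' = mc t F') \<and> A = \<pi> F"
    by (elim exE)
  have "\<pi> F = mlim F"
    by (rule cont_star_hom_path_unique[OF conjunct1[OF \<pi>] _ F]) (use \<pi> in blast)
  then show "A = mlim F" using \<pi> by simp
qed

lemma mlim_LA:
  assumes F: "F \<in> cont_funs path_topology"
  shows "mlim F \<in> LA"
proof (rule LA(7)[OF mlim_bop[OF F]])
  fix \<epsilon> :: real assume "\<epsilon> > 0"
  then have e2: "\<epsilon> / 2 > 0" by simp
  obtain t where t: "\<And>s \<omega>. s \<ge> t \<Longrightarrow> cmod (F (trunc s \<omega>) - F \<omega>) < \<epsilon> / 2"
    using trunc_approx[OF F e2] by blast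
  let ?G = "\<lambda>\<omega>. F (trunc t \<omega>)"
  have G: "cylinder t ?G" by (rule cylinder_trunc)
  have b: "cmod (F \<omega> - ?G \<omega>) \<le> \<epsilon> / 2" for \<omega> using t[of t \<omega>] by (simp add: norm_minus_commute less_imp_le)
  have "opnorm HK (mlim F - mc t ?G) \<le> \<epsilon> / 2"
    by (rule H.opnorm_le) (use e2 mlim_approx[OF F G b] in \<open>auto simp: minus_apply\<close>)
  then have "opnorm HK (mlim F - mc t ?G) < \<epsilon>" using \<open>\<epsilon> > 0\<close> by simp
  then show "\<exists>B\<in>LA. opnorm HK (mlim F - B) < \<epsilon>" using mult_cyl(1)[OF G] by blast
qed

text \<open>Stated for the inverse conjugation because \<open>conj_evol_mlim\<close> needs a
  homomorphism that restricts to \<open>mult_cyl\<close> on cylinder functions.\<close>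

lemma conj_evol_cylinder:
  assumes \<phi>: "bij \<phi>" and F: "cylinder t F"
  shows "H.conj_by (adj HK (evol \<phi>)) (mc (Suc t) (F \<circ> alpha \<phi>)) = mc t F"
proof (rule mult_cyl_eqI[symmetric, OF F])
  let ?U = "evol \<phi>"
  note U = evol_unitary[OF \<phi>]
  have Fa: "cylinder (Suc t) (F \<circ> alpha \<phi>)" by (rule cylinder_alpha[OF F])
  let ?W = "H.conj_by (adj HK ?U) (mc (Suc t) (F \<circ> alpha \<phi>))"
  show "?W \<in> bop HK" using Fa by (intro H.conj_by_bop H.adj_bop) auto
  \<comment> \<open>For |n| at most t + 1 the shifted sequence reads h at n - 1, which may have
    modulus t + 2.\<close>
  show "t \<le> t + 2" by simp
  show "eig ?W F (t + 2)"
    unfolding eig_def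
  proof (intro allI ballI impI)
    fix i x h assume h: "h \<in> stab \<psi>" "agree (t + 2) h (\<lambda>n. ket (x n))"
    \<comment> \<open>Site 0 after the step came from site 1 before it, so p is the pair from which
      \<phi> produced i and the entry at 0.\<close>
    define p where "p = inv \<phi> (i, x 0)"
    have \<phi>p: "\<phi> p = (i, x 0)" unfolding p_def by (rule surj_f_inv_f[OF bij_is_surj[OF \<phi>]])
    define h' where "h' = (\<lambda>n. h (n - 1))"
    have h': "h' \<in> stab \<psi>" unfolding h'_def by (rule stab_shift_minus[OF h(1)])
    \<comment> \<open>The path that one step from the state \<open>fst p\<close> carries to
      x.\<close>
    define x' where "x' = (\<lambda>n. x (n - 1))(1 := snd p)"
    have Ue: "?U (es 1 p h') = tvec i h"
    proof -
      have "?U (es 1 p h') = es 0 (i, x 0) h" unfolding evol_es[OF h'] \<phi>p by (simp add: h'_def)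
      moreover have "h(0 := ket (x 0)) = h" using h(2) by auto
      ultimately show ?thesis by (simp add: es_def)
    qed
    have U': "adj HK ?U (tvec i h) = es 1 p h'"
      unfolding Ue[symmetric] by (rule H.unitary_simps(1)[OF U]) (use h' in auto)
    have "(h'(1 := ket (snd p))) n = ket (x' n)" if "\<bar>n\<bar> \<le> int (Suc t)" for n
      using h(2) that by (auto simp: h'_def x'_def)
    then have "mc (Suc t) (F \<circ> alpha \<phi>) (tvec (fst p) (h'(1 := ket (snd p)))) =
        (F \<circ> alpha \<phi>) (fst p, x') \<cdot>\<^sub>v tvec (fst p) (h'(1 := ket (snd p)))"
      by (intro eigD[OF mult_cyl(2)[OF Fa]] stab_update h')
    moreover have "alpha \<phi> (fst p, x') = (i, x)"
    proof -
      have "\<phi> (fst p, x' 1) = (i, x 0)" using \<phi>p by (simp add: x'_def)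
      then show ?thesis unfolding alpha_apply by (auto simp: x'_def fun_eq_iff)
    qed
    ultimately have M: "mc (Suc t) (F \<circ> alpha \<phi>) (es 1 p h') = F (i, x) \<cdot>\<^sub>v es 1 p h'"
      by (simp add: es_def)
    have "?W (tvec i h) = ?U (mc (Suc t) (F \<circ> alpha \<phi>) (adj HK ?U (tvec i h)))"
      by (simp add: H.conj_by_def H.adj_adj)
    also have "\<dots> = F (i, x) \<cdot>\<^sub>v tvec i h"
      unfolding U' M using h' by (simp add: H.bop_scale[OF evol_bop] Ue)
    finally show "?W (tvec i h) = F (i, x) \<cdot>\<^sub>v tvec i h" .
  qed
qed

text \<open>Undoing the conjugation on the multiplication by F composed with \<open>alpha\<close> is
  itself a homomorphism with the right values on cylinder functions, so uniqueness identifies it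
  with \<open>mlim\<close>.\<close>

lemma conj_evol_mlim:
  assumes \<phi>: "bij \<phi>" and F: "F \<in> cont_funs path_topology"
  shows "H.conj_by (evol \<phi>) (mlim F) = mlim (F \<circ> alpha \<phi>)"
proof -
  note U = evol_unitary[OF \<phi>] and U' = H.unitary_adj[OF evol_unitary[OF \<phi>]]
  note hom = H.cont_star_homD[OF cont_star_hom_mlim]
  define \<pi> where "\<pi> F = H.conj_by (adj HK (evol \<phi>)) (mlim (F \<circ> alpha \<phi>))" for F
  have ca: "F \<circ> alpha \<phi> \<in> cont_funs path_topology" if "F \<in> cont_funs path_topology" for F
    using cont_alpha[OF that] .
  have "cont_star_hom path_topology HK \<pi>"
    unfolding cont_star_hom_def
  proof (intro conjI ballI allI)
    show "\<pi> F \<in> bop HK" if "F \<in> cont_funs path_topology" for F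
      unfolding \<pi>_def using mlim_bop[OF ca[OF that]] by (intro H.conj_by_bop H.adj_bop) auto
    show "\<pi> (\<lambda>_. 1) = id_op HK"
      unfolding \<pi>_def using hom(2) H.conj_by_simps(6)[OF U'] by (simp add: o_def)
    fix F :: "('e, 'g) path \<Rightarrow> complex" assume F: "F \<in> cont_funs path_topology"
    note Fa = ca[OF F] and Fb = mlim_bop[OF ca[OF F]]
    show "\<pi> (\<lambda>\<omega>. c * F \<omega>) = c \<cdot>\<^sub>o \<pi> F" for c
      unfolding \<pi>_def H.conj_by_simps(3)[OF U' Fb, symmetric] hom(5)[OF Fa, symmetric] by (simp add: o_def)
    show "\<pi> (\<lambda>\<omega>. cnj (F \<omega>)) = adj HK (\<pi> F)"
      unfolding \<pi>_def H.conj_by_simps(5)[OF U' Fb, symmetric] hom(6)[OF Fa, symmetric] by (simp add: o_def)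
    fix G :: "('e, 'g) path \<Rightarrow> complex" assume G: "G \<in> cont_funs path_topology"
    note Ga = ca[OF G] and Gb = mlim_bop[OF ca[OF G]]
    show "\<pi> (\<lambda>\<omega>. F \<omega> + G \<omega>) = \<pi> F + \<pi> G"
      unfolding \<pi>_def H.conj_by_simps(1)[OF U' Fb Gb, symmetric] hom(3)[OF Fa Ga, symmetric] by (simp add: o_def)
    show "\<pi> (\<lambda>\<omega>. F \<omega> * G \<omega>) = \<pi> F \<circ> \<pi> G"
      unfolding \<pi>_def H.conj_by_simps(4)[OF U' Fb Gb, symmetric] hom(4)[OF Fa Ga, symmetric] by (simp add: o_def)
  qed
  moreover have "\<pi> G = mc t G" if G: "cylinder t G" for t G
    unfolding \<pi>_def mlim_cylinder[OF cylinder_alpha[OF G]] by (rule conj_evol_cylinder[OF \<phi> G])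
  ultimately have "\<pi> F = mlim F" by (rule cont_star_hom_path_unique[OF _ _ F])
  then have "H.conj_by (evol \<phi>) (\<pi> F) = H.conj_by (evol \<phi>) (mlim F)" by simp
  then show ?thesis unfolding \<pi>_def using H.conj_by_simps(8)[OF U mlim_bop[OF ca[OF F]]] by simp
qed

lemma local_J_mult_op:
  fixes F :: "('e, 'g) path \<Rightarrow> complex"
  assumes "bij \<phi>" "F \<in> cont_funs path_topology"
  shows "local_J \<psi> K T (dil_V \<phi>) (mult_op \<psi> K T F) = mult_op \<psi> K T (F \<circ> alpha \<phi>)"
  using local_J_eq[OF mlim_LA[OF assms(2)]] conj_evol_mlim[OF assms]
  by (simp add: mult_op_eq[OF assms(2)] mult_op_eq[OF cont_alpha[OF assms(2)]])

end

subsection \<open>Joint functional calculus\<close>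

context hilbert
begin

text \<open>A spectral bound without spectra. With u = max 0 (|w|^2 - R^2) and s = sqrt u one has |w
  u|^2 = |s u|^2 + R^2 u^2 pointwise. The bound R on the image of w then leaves no room for s u, so
  its image vanishes.\<close>

lemma cont_star_hom_outside:
  fixes \<pi> :: "('a::topological_space \<Rightarrow> complex) \<Rightarrow> 'x operator" and w :: "'a \<Rightarrow> complex"
  assumes \<pi>: "cont_star_hom euclidean K \<pi>" and w: "continuous_on UNIV w"
    and R: "\<And>v. v \<in> vecs K \<Longrightarrow> hnorm K (\<pi> w v) \<le> R * hnorm K v" "R \<ge> 0"
  shows "\<pi> (\<lambda>z. complex_of_real (max 0 ((cmod (w z))\<^sup>2 - R\<^sup>2))) = 0"
proof -
  define u where "u z = max 0 ((cmod (w z))\<^sup>2 - R\<^sup>2)" for z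
  define s where "s z = complex_of_real (sqrt (u z))" for z
  have u0: "u z \<ge> 0" for z by (simp add: u_def)
  have s2: "s z * s z = complex_of_real (u z)" for z using u0 by (simp add: s_def flip: of_real_mult)
  have cu: "continuous_on UNIV u" unfolding u_def by (intro continuous_intros w)
  have cs: "s \<in> cont_funs euclidean" unfolding s_def cont_funs_def by (simp, intro continuous_intros cu)
  define U where "U z = complex_of_real (u z)" for z
  have cU: "U \<in> cont_funs euclidean" unfolding U_def cont_funs_def by (simp, intro continuous_intros cu)
  have cw: "w \<in> cont_funs euclidean" using w by (simp add: cont_funs_def)
  have cus: "(\<lambda>z. s z * U z) \<in> cont_funs euclidean" and cwu: "(\<lambda>z. w z * U z) \<in> cont_funs euclidean"
    using cs cU cw unfolding cont_funs_def by (simp_all add: continuous_on_mult)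
  note hom = cont_star_homD[OF \<pi>]
  have key: "hnorm K (\<pi> (\<lambda>z. s z * U z) v) \<le> 0" if v: "v \<in> vecs K" for v
  proof -
    have sq: "(hnorm K (\<pi> f v))\<^sup>2 = Re (ip K v (\<pi> (\<lambda>z. cnj (f z) * f z) v))" if f: "f \<in> cont_funs euclidean" for f
    proof -
      have cf: "(\<lambda>z. cnj (f z)) \<in> cont_funs euclidean" using f by (simp add: cont_funs_def continuous_on_cnj)
      have "ip K v (\<pi> (\<lambda>z. cnj (f z) * f z) v) = ip K v (adj K (\<pi> f) (\<pi> f v))"
        unfolding hom(4)[OF cf f] hom(6)[OF f] by simp
      also have "\<dots> = ip K (\<pi> f v) (\<pi> f v)" using hom(1)[OF f] v by (simp add: ip_adj_right)
      finally show ?thesis using hom(1)[OF f] v by (simp add: hnorm_power2)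
    qed
    have pt: "cnj (w z * U z) * (w z * U z) = cnj (s z * U z) * (s z * U z) + of_real (R\<^sup>2) * (cnj (U z) * U z)" for z
    proof -
      have "u z * u z * ((cmod (w z))\<^sup>2 - R\<^sup>2 - u z) = 0" by (simp add: u_def max_def)
      then have "(cmod (w z))\<^sup>2 * (u z * u z) = u z * (u z * u z) + R\<^sup>2 * (u z * u z)" by (simp add: algebra_simps)
      then have "complex_of_real ((cmod (w z))\<^sup>2 * (u z * u z)) = complex_of_real (u z * (u z * u z) + R\<^sup>2 * (u z * u z))" by simp
      moreover have "cnj (w z * U z) * (w z * U z) = complex_of_real ((cmod (w z))\<^sup>2 * (u z * u z))"
        unfolding of_real_mult complex_norm_square U_def by (simp add: mult_ac)
      moreover have "cnj (s z) = s z" by (simp add: s_def)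
      then have "cnj (s z * U z) * (s z * U z) = (s z * s z) * (U z * U z)" by (simp add: U_def mult_ac)
      then have "cnj (s z * U z) * (s z * U z) = complex_of_real (u z * (u z * u z))" by (simp add: s2 U_def)
      ultimately show ?thesis by (auto simp: U_def)
    qed
    have c1: "(\<lambda>z. cnj (s z * U z) * (s z * U z)) \<in> cont_funs euclidean" and c2: "(\<lambda>z. cnj (U z) * U z) \<in> cont_funs euclidean"
      using cus cU unfolding cont_funs_def by (simp_all add: continuous_on_mult continuous_on_cnj del: complex_cnj_mult)
    have c3: "(\<lambda>z. of_real (R\<^sup>2) * (cnj (U z) * U z)) \<in> cont_funs euclidean"
      using c2 unfolding cont_funs_def by (simp add: continuous_on_mult_left del: of_real_power)
    have "\<pi> (\<lambda>z. cnj (w z * U z) * (w z * U z)) = \<pi> (\<lambda>z. cnj (s z * U z) * (s z * U z)) + of_real (R\<^sup>2) \<cdot>\<^sub>o \<pi> (\<lambda>z. cnj (U z) * U z)"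
      unfolding pt hom(3)[OF c1 c3] hom(5)[OF c2] ..
    then have "(hnorm K (\<pi> (\<lambda>z. w z * U z) v))\<^sup>2 = (hnorm K (\<pi> (\<lambda>z. s z * U z) v))\<^sup>2 + R\<^sup>2 * (hnorm K (\<pi> U v))\<^sup>2"
      unfolding sq[OF cwu] sq[OF cus] sq[OF cU] using hom(1)[OF c1] hom(1)[OF c2] v
      by (simp add: plus_fun_apply[of "\<pi> (\<lambda>z. cnj (s z * U z) * (s z * U z))"] scale_op_apply ip_add_right ip_scale_right
          del: complex_cnj_mult of_real_power)
    moreover have "hnorm K (\<pi> (\<lambda>z. w z * U z) v) \<le> R * hnorm K (\<pi> U v)"
      unfolding hom(4)[OF cw cU] using R(1)[of "\<pi> U v"] hom(1)[OF cU] v by simp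
    then have "(hnorm K (\<pi> (\<lambda>z. w z * U z) v))\<^sup>2 \<le> (R * hnorm K (\<pi> U v))\<^sup>2"
      using hom(1)[OF cwu] v by (intro power_mono) auto
    ultimately have "(hnorm K (\<pi> (\<lambda>z. s z * U z) v))\<^sup>2 \<le> 0" by (simp add: power_mult_distrib)
    then show ?thesis by simp
  qed
  have su0: "\<pi> (\<lambda>z. s z * U z) = 0"
  proof (rule bop_ext[OF hom(1)[OF cus] bop_zero_op])
    fix v assume v: "v \<in> vecs K"
    then have "\<pi> (\<lambda>z. s z * U z) v = 0"
      using key[OF v] hom(1)[OF cus] by (intro vec_eqI_small[of _ _ 0]) auto
    then show "\<pi> (\<lambda>z. s z * U z) v = 0 v" by (simp add: zero_fun_apply)
  qed
  have "hnorm K (\<pi> U v) \<le> 0" if v: "v \<in> vecs K" for v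
  proof -
    \<comment> \<open>Multiplying by s once more gives the image of u^2, which is the squared
      modulus of U, so the image of U vanishes too.\<close>
    have "\<pi> (\<lambda>z. s z * (s z * U z)) = \<pi> s \<circ> 0" unfolding hom(4)[OF cs cus] su0 ..
    moreover have "(\<lambda>z. s z * (s z * U z)) = (\<lambda>z. cnj (U z) * U z)"
      by (simp add: fun_eq_iff mult.assoc[symmetric] s2 U_def)
    moreover have "\<pi> (\<lambda>z. cnj (U z) * U z) = adj K (\<pi> U) \<circ> \<pi> U"
    proof -
      have "(\<lambda>z. cnj (U z)) \<in> cont_funs euclidean" using cU by (simp add: cont_funs_def continuous_on_cnj)
      then show ?thesis unfolding hom(4)[OF _ cU] hom(6)[OF cU] by (simp add: hom(4)[OF _ cU] hom(6)[OF cU])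
    qed
    ultimately have "adj K (\<pi> U) (\<pi> U v) = 0" using hom(1)[OF cs] by (metis bop_zero comp_apply zero_fun_apply)
    then have "ip K (\<pi> U v) (\<pi> U v) = 0"
      using ip_adj[of "\<pi> U" "\<pi> U v" v] hom(1)[OF cU] v by simp
    then show ?thesis by (simp add: hnorm_def)
  qed
  then have "\<pi> U = 0"
    using hom(1)[OF cU] by (intro bop_ext[OF hom(1)[OF cU] bop_zero_op])
      (auto simp: zero_fun_apply intro!: vec_eqI_small[of _ _ 0])
  moreover have "U = (\<lambda>z. complex_of_real (max 0 ((cmod (w z))\<^sup>2 - R\<^sup>2)))"
    by (rule ext) (simp only: U_def u_def)
  ultimately show ?thesis by metis
qed

end

lemma cont_euclidean_iff: "f \<in> cont_funs euclidean \<longleftrightarrow> continuous_on UNIV f"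
  by (simp add: cont_funs_def)

context hilbert
begin

text \<open>
  With \<open>u = \<Sum>\<^sub>j (|z\<^sub>j|\<^sup>2 - R\<^sup>2)\<^sub>+\<close> we have \<open>\<pi> u = 0\<close>, and functions that vanish on the
  polydisc are uniform limits of continuous multiples of \<open>u\<close>.
\<close>

lemma cont_star_hom_polydisc:
  fixes \<pi> :: "(complex^'n::finite \<Rightarrow> complex) \<Rightarrow> 'x operator"
  assumes \<pi>: "cont_star_hom euclidean K \<pi>"
    and R: "\<And>j v. v \<in> vecs K \<Longrightarrow> hnorm K (\<pi> (\<lambda>z. z $ j) v) \<le> R * hnorm K v" "R \<ge> 0"
    and f: "continuous_on UNIV f" "\<And>z. (\<And>j. cmod (z $ j) \<le> R) \<Longrightarrow> f z = 0"
  shows "\<pi> f = 0"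
proof -
  note hom = cont_star_homD[OF \<pi>]
  define m where "m j z = max 0 ((cmod (z $ j))\<^sup>2 - R\<^sup>2)" for j and z :: "complex^'n"
  define u where "u z = (\<Sum>j\<in>UNIV. m j z)" for z :: "complex^'n"
  have cm: "continuous_on UNIV (m j)" for j unfolding m_def by (intro continuous_intros)
  have cu: "continuous_on UNIV u" unfolding u_def by (intro continuous_intros cm)
  have m0: "m j z \<ge> 0" for j z by (simp add: m_def)
  have u0: "u z \<ge> 0" for z unfolding u_def by (intro sum_nonneg m0)
  have uf: "f z = 0" if "u z = 0" for z
  proof (rule f(2))
    fix j
    have "m j z = 0" using that m0 by (simp add: u_def sum_nonneg_eq_0_iff)
    then have "(cmod (z $ j))\<^sup>2 \<le> R\<^sup>2" by (simp add: m_def max_def split: if_splits)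
    then show "cmod (z $ j) \<le> R" by (rule power2_le_imp_le) (rule R(2))
  qed
  have cont: "continuous_on UNIV g \<Longrightarrow> (\<lambda>z. complex_of_real (g z)) \<in> cont_funs euclidean" for g :: "complex^'n \<Rightarrow> real"
    unfolding cont_euclidean_iff by (intro continuous_intros)
  have \<pi>0: "\<pi> (\<lambda>_. 0) = 0"
    using hom(5)[of "\<lambda>_. 1" 0] by (simp add: cont_euclidean_iff scale_op_def scale_def fun_eq_iff zero_fun_apply)
  have \<pi>m: "\<pi> (\<lambda>z. complex_of_real (m j z)) = 0" for j
    unfolding m_def by (rule cont_star_hom_outside[OF \<pi> _ R(1) R(2)]) (intro continuous_intros)
  have \<pi>u: "\<pi> (\<lambda>z. complex_of_real (u z)) = 0"
  proof -
    have "\<pi> (\<lambda>z. complex_of_real (\<Sum>j\<in>J. m j z)) = 0" if "finite J" for J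
      using that
    proof (induction J rule: finite_induct)
      case empty
      then show ?case using \<pi>0 by simp
    next
      case (insert j J)
      have c: "continuous_on UNIV (\<lambda>z. \<Sum>j\<in>J. m j z)" by (intro continuous_intros cm)
      have "\<pi> (\<lambda>z. complex_of_real (m j z) + complex_of_real (\<Sum>j\<in>J. m j z)) = 0 + 0"
        unfolding hom(3)[OF cont[OF cm] cont[OF c]] \<pi>m insert.IH ..
      then show ?case using insert.hyps by simp
    qed
    then show ?thesis unfolding u_def by simp
  qed
  have cf: "f \<in> cont_funs euclidean" using f(1) by (simp add: cont_euclidean_iff)
  have small: "hnorm K (\<pi> f v) \<le> \<epsilon> * hnorm K v" if v: "v \<in> vecs K" and \<epsilon>: "\<epsilon> > 0" for v \<epsilon>
  proof -
    \<comment> \<open>r is a cutoff with values in [0, 1) that vanishes where |f| is at most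
      \<epsilon> and changes f by at most \<epsilon>. The quotient k by u exhibits f r as a multiple
      of u.\<close>
    define t where "t z = max 0 (cmod (f z) - \<epsilon>)" for z
    define r where "r z = t z / (t z + \<epsilon>)" for z
    define k where "k z = r z / u z" for z
    have t0: "t z \<ge> 0" for z by (simp add: t_def)
    have tp: "t z + \<epsilon> > 0" for z using t0[of z] \<epsilon> by linarith
    have ct: "continuous_on UNIV t" unfolding t_def by (intro continuous_intros f(1))
    have cr: "continuous_on UNIV r" unfolding r_def
      by (intro continuous_intros ct ballI less_imp_neq[symmetric] tp)
    \<comment> \<open>k could fail to be continuous only at zeros of u. There f = 0, so k vanishes
      on a whole neighbourhood, and two open sets cover the space.\<close>
    have "continuous_on ({z. cmod (f z) < \<epsilon>} \<union> {z. u z > 0}) k"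
    proof (rule continuous_on_open_Un)
      show "open {z. cmod (f z) < \<epsilon>}" by (intro open_Collect_less continuous_intros f(1))
      show "open {z. u z > 0}" by (intro open_Collect_less continuous_intros cu)
      show "continuous_on {z. cmod (f z) < \<epsilon>} k"
      proof (rule continuous_on_eq[OF continuous_on_const[of _ 0]])
        fix z assume "z \<in> {z. cmod (f z) < \<epsilon>}"
        then have "t z = 0" by (simp add: t_def)
        then show "0 = k z" by (simp add: k_def r_def)
      qed
      show "continuous_on {z. u z > 0} k" unfolding k_def
        by (intro continuous_on_divide continuous_on_subset[OF cr] continuous_on_subset[OF cu]) auto
    qed
    moreover have "{z. cmod (f z) < \<epsilon>} \<union> {z. u z > 0} = UNIV"
      using uf u0 \<epsilon> by (auto simp: less_le)
    ultimately have ck: "continuous_on UNIV k" by simp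
    have ku: "k z * u z = r z" for z
    proof (cases "u z = 0")
      case True
      then show ?thesis using uf[OF True] \<epsilon> by (simp add: r_def t_def)
    qed (simp add: k_def)
    have cfk: "(\<lambda>z. f z * complex_of_real (k z)) \<in> cont_funs euclidean"
      unfolding cont_euclidean_iff by (intro continuous_intros f(1) ck)
    have cfr: "(\<lambda>z. f z * complex_of_real (r z)) \<in> cont_funs euclidean"
      unfolding cont_euclidean_iff by (intro continuous_intros f(1) cr)
    have cd: "(\<lambda>z. f z - f z * complex_of_real (r z)) \<in> cont_funs euclidean"
      unfolding cont_euclidean_iff by (intro continuous_intros f(1) cr)
    have "\<pi> (\<lambda>z. (f z * complex_of_real (k z)) * complex_of_real (u z)) = \<pi> (\<lambda>z. f z * complex_of_real (k z)) \<circ> 0"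
      unfolding hom(4)[OF cfk cont[OF cu]] \<pi>u ..
    moreover have "(f z * complex_of_real (k z)) * complex_of_real (u z) = f z * complex_of_real (r z)" for z
      unfolding ku[symmetric] by simp
    ultimately have fr: "\<pi> (\<lambda>z. f z * complex_of_real (r z)) = \<pi> (\<lambda>z. f z * complex_of_real (k z)) \<circ> 0" by simp
    have z: "\<pi> (\<lambda>z. f z * complex_of_real (r z)) v = 0"
      unfolding fr o_apply zero_fun_apply[of v] by (rule bop_zero[OF hom(1)[OF cfk]])
    have b: "cmod (f z - f z * complex_of_real (r z)) \<le> \<epsilon>" for z
    proof -
      have "1 - r z = \<epsilon> / (t z + \<epsilon>)" using tp[of z] by (simp add: r_def field_simps)
      moreover have "f z - f z * complex_of_real (r z) = f z * complex_of_real (1 - r z)" by (simp add: algebra_simps)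
      ultimately have "cmod (f z - f z * complex_of_real (r z)) = cmod (f z) * (\<epsilon> / (t z + \<epsilon>))"
        using \<epsilon> tp[of z] by (simp only: norm_mult norm_of_real) simp
      also have "\<dots> \<le> (t z + \<epsilon>) * (\<epsilon> / (t z + \<epsilon>))"
        using \<epsilon> tp[of z] by (intro mult_right_mono) (auto simp: t_def)
      also have "\<dots> = \<epsilon>" using tp[of z] by simp
      finally show ?thesis .
    qed
    have "hnorm K (\<pi> (\<lambda>z. f z - f z * complex_of_real (r z)) v) \<le> \<epsilon> * hnorm K v"
      by (rule cont_star_hom_contractive[OF \<pi> cd b v])
    then show ?thesis unfolding cont_star_hom_diff[OF \<pi> cf cfr] by (simp add: minus_apply z)
  qed
  show ?thesis
  proof (rule bop_ext[OF hom(1)[OF cf] bop_zero_op])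
    fix v assume v: "v \<in> vecs K"
    have "\<pi> f v = 0"
      by (rule vec_eqI_small[of _ _ "hnorm K v"]) (use small[OF v] hom(1)[OF cf] v in \<open>auto simp: mult.commute\<close>)
    then show "\<pi> f v = 0 v" by (simp add: zero_fun_apply)
  qed
qed

text \<open>Real polynomial functions are generated by real-linear functionals, which this expansion
  writes through real and imaginary parts of the coordinates.\<close>

lemma complex_cart_expand:
  fixes z :: "complex^'n::finite"
  shows "z = (\<Sum>j\<in>UNIV. Re (z $ j) *\<^sub>R axis j 1 + Im (z $ j) *\<^sub>R axis j \<i>)"
proof (simp add: vec_eq_iff, intro allI)
  fix k
  have "(\<Sum>j\<in>UNIV. Re (z $ j) *\<^sub>R (axis j 1 :: complex^'n) $ k + Im (z $ j) *\<^sub>R (axis j \<i> :: complex^'n) $ k) =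
    (\<Sum>j\<in>UNIV. if j = k then z $ k else 0)"
    by (intro sum.cong refl) (auto simp: axis_def complex_eq_iff)
  then show "z $ k = (\<Sum>j\<in>UNIV. Re (z $ j) *\<^sub>R (axis j 1 :: complex^'n) $ k + Im (z $ j) *\<^sub>R (axis j \<i> :: complex^'n) $ k)" by simp
qed

lemma cont_star_hom_euclidean_unique:
  fixes \<pi> \<pi>' :: "(complex^'n::finite \<Rightarrow> complex) \<Rightarrow> 'x operator"
  assumes \<pi>: "cont_star_hom euclidean K \<pi>" and \<pi>': "cont_star_hom euclidean K \<pi>'"
    and eq: "\<And>j. \<pi> (\<lambda>z. z $ j) = \<pi>' (\<lambda>z. z $ j)" and f: "continuous_on UNIV f"
  shows "\<pi> f = \<pi>' f"
proof -
  note hom = cont_star_homD[OF \<pi>] and hom' = cont_star_homD[OF \<pi>']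
  \<comment> \<open>The functions on which both representations agree are closed under sums,
    products, scalars and conjugation; with the coordinates they contain all real
    polynomials.\<close>
  define ag where "ag g \<longleftrightarrow> g \<in> cont_funs euclidean \<and> \<pi> g = \<pi>' g" for g
  have ag_add: "ag (\<lambda>z. g z + h z)" and ag_mult: "ag (\<lambda>z. g z * h z)" if "ag g" "ag h" for g h
    using that hom(3,4)[of g h] hom'(3,4)[of g h] unfolding ag_def
    by (auto simp: cont_euclidean_iff intro!: continuous_intros)
  have ag_scale: "ag (\<lambda>z. c * g z)" and ag_cnj: "ag (\<lambda>z. cnj (g z))" if "ag g" for g c
    using that hom(5,6)[of g] hom'(5,6)[of g] unfolding ag_def
    by (auto simp: cont_euclidean_iff intro!: continuous_intros)
  have one: "ag (\<lambda>_. 1)" using hom(2) hom'(2) by (simp add: ag_def cont_euclidean_iff)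
  have const: "ag (\<lambda>_. c)" for c using ag_scale[OF one, of c] by simp
  have ag_sum: "ag (\<lambda>z. \<Sum>j\<in>J. g j z)" if "finite J" "\<And>j. ag (g j)" for J :: "'n set" and g
    using that(1) by induction (use const ag_add[OF that(2)] in auto)
  have coord: "ag (\<lambda>z. z $ j)" for j unfolding ag_def cont_euclidean_iff using eq by (auto intro!: continuous_intros)
  have re: "ag (\<lambda>z. complex_of_real (Re (z $ j)))" for j
  proof -
    have e: "(\<lambda>z. complex_of_real (Re (z $ j))) = (\<lambda>z. (1/2) * (z $ j + cnj (z $ j)))" by (simp add: fun_eq_iff complex_eq_iff)
    show ?thesis unfolding e by (rule ag_scale[OF ag_add[OF coord ag_cnj[OF coord]]])
  qed
  have im: "ag (\<lambda>z. complex_of_real (Im (z $ j)))" for j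
  proof -
    have e: "(\<lambda>z. complex_of_real (Im (z $ j))) = (\<lambda>z. (- \<i> / 2) * (z $ j + (-1) * cnj (z $ j)))"
      by (simp add: fun_eq_iff complex_eq_iff)
    show ?thesis unfolding e by (rule ag_scale[OF ag_add[OF coord ag_scale[OF ag_cnj[OF coord]]]])
  qed
  have poly: "ag (\<lambda>z. complex_of_real (p z))" if "real_polynomial_function p" for p
    using that
  proof (induction rule: real_polynomial_function.induct)
    case (linear g)
    interpret bounded_linear g by fact
    have "g z = (\<Sum>j\<in>UNIV. Re (z $ j) * g (axis j 1) + Im (z $ j) * g (axis j \<i>))" for z
      by (subst (1) complex_cart_expand) (simp add: sum add scaleR)
    then have "complex_of_real (g z) = complex_of_real (\<Sum>j\<in>UNIV. Re (z $ j) * g (axis j 1) + Im (z $ j) * g (axis j \<i>))" for z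
      by (rule arg_cong)
    moreover have "complex_of_real (\<Sum>j\<in>UNIV. Re (z $ j) * g (axis j 1) + Im (z $ j) * g (axis j \<i>)) =
        (\<Sum>j\<in>UNIV. complex_of_real (g (axis j 1)) * complex_of_real (Re (z $ j)) +
          complex_of_real (g (axis j \<i>)) * complex_of_real (Im (z $ j)))" for z :: "complex^'n"
      by (simp add: mult.commute)
    ultimately have e: "(\<lambda>z. complex_of_real (g z)) = (\<lambda>z. \<Sum>j\<in>UNIV. complex_of_real (g (axis j 1)) * complex_of_real (Re (z $ j)) +
          complex_of_real (g (axis j \<i>)) * complex_of_real (Im (z $ j)))"
      by (intro ext) (rule trans)
    show ?case unfolding e by (intro ag_sum ag_add ag_scale re im) simp
  next
    case (const c)
    then show ?case using \<open>\<And>c. ag (\<lambda>_. c)\<close> by simp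
  next
    case (add g h)
    then show ?case using ag_add by simp
  next
    case (mult g h)
    then show ?case using ag_mult by simp
  qed
  have "\<exists>C. C \<ge> 0 \<and> (\<forall>v\<in>vecs K. hnorm K (\<pi> (\<lambda>z. z $ j) v) \<le> C * hnorm K v)" for j
    using bop_bound[of "\<pi> (\<lambda>z. z $ j)"] coord[of j] hom(1) unfolding ag_def by metis
  then obtain C where C: "\<And>j. C j \<ge> 0" "\<And>j v. v \<in> vecs K \<Longrightarrow> hnorm K (\<pi> (\<lambda>z. z $ j) v) \<le> C j * hnorm K v" by metis
  \<comment> \<open>One radius that works for every coordinate, taken from the operator
    bounds.\<close>
  define R where "R = (\<Sum>j\<in>UNIV. C j)"
  have CR: "C j \<le> R" for j unfolding R_def by (rule member_le_sum) (use C in auto)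
  have R0: "R \<ge> 0" unfolding R_def by (intro sum_nonneg C)
  have R: "hnorm K (\<pi> (\<lambda>z. z $ j) v) \<le> R * hnorm K v" if "v \<in> vecs K" for j v
    using C(2)[OF that, of j] mult_right_mono[OF CR[of j] hnorm_nonneg[OF that]] by linarith
  have R': "hnorm K (\<pi>' (\<lambda>z. z $ j) v) \<le> R * hnorm K v" if "v \<in> vecs K" for j v
    using R[OF that] eq by simp
  define D where "D = {z :: complex^'n. \<forall>j. cmod (z $ j) \<le> R}"
  have "compact D"
  proof -
    have "closed D" unfolding D_def by (intro closed_Collect_all closed_Collect_le continuous_intros)
    moreover have "norm z \<le> (\<Sum>j\<in>(UNIV :: 'n set). R)" if "z \<in> D" for z
      using that L2_set_le_sum[of UNIV "\<lambda>j. cmod (z $ j)"] sum_mono[of "UNIV :: 'n set" "\<lambda>j. cmod (z $ j)" "\<lambda>_. R"]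
      unfolding D_def norm_vec_def by auto
    then have "bounded D" unfolding bounded_iff by blast
    ultimately show ?thesis by (simp add: compact_eq_bounded_closed)
  qed
  have real: "ag (\<lambda>z. complex_of_real (g z))" if g: "continuous_on UNIV g" for g :: "complex^'n \<Rightarrow> real"
    unfolding ag_def
  proof
    have cont: "continuous_on UNIV h \<Longrightarrow> (\<lambda>z. complex_of_real (h z)) \<in> cont_funs euclidean" for h :: "complex^'n \<Rightarrow> real"
      unfolding cont_euclidean_iff by (intro continuous_intros)
    show cg: "(\<lambda>z. complex_of_real (g z)) \<in> cont_funs euclidean" by (rule cont[OF g])
    show "\<pi> (\<lambda>z. complex_of_real (g z)) = \<pi>' (\<lambda>z. complex_of_real (g z))"
    proof (rule bop_ext[OF hom(1)[OF cg] hom'(1)[OF cg]])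
      fix v assume v: "v \<in> vecs K"
      show "\<pi> (\<lambda>z. complex_of_real (g z)) v = \<pi>' (\<lambda>z. complex_of_real (g z)) v"
      proof (rule vec_eqI_small[of _ _ "2 * hnorm K v"])
        fix \<epsilon> :: real assume \<epsilon>: "\<epsilon> > 0"
        obtain p where p: "real_polynomial_function p" "\<And>z. z \<in> D \<Longrightarrow> \<bar>g z - p z\<bar> < \<epsilon>"
          using Stone_Weierstrass_real_polynomial_function[OF \<open>compact D\<close> continuous_on_subset[OF g subset_UNIV] \<epsilon>] by blast
        have cp: "continuous_on UNIV p" using p(1) by (simp add: continuous_on_polymonial_function real_polynomial_function_eq)
        \<comment> \<open>Polynomial approximation holds on D only, so the error g - p is clamped: c
          is small everywhere, and the remainder g - p - c vanishes on D and is annihilated by both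
          representations.\<close>
        define c where "c z = max (- \<epsilon>) (min \<epsilon> (g z - p z))" for z
        have cc: "continuous_on UNIV c" unfolding c_def by (intro continuous_intros g cp)
        have cb: "cmod (complex_of_real (c z)) \<le> \<epsilon>" for z using \<epsilon> by (auto simp: c_def)
        have cd: "continuous_on UNIV (\<lambda>z. g z - p z - c z)" by (intro continuous_intros g cp cc)
        have d0: "complex_of_real (g z - p z - c z) = 0" if "\<And>j. cmod (z $ j) \<le> R" for z
        proof -
          have "z \<in> D" using that by (simp add: D_def)
          from p(2)[OF this] show ?thesis by (simp add: c_def)
        qed
        have ccd: "continuous_on UNIV (\<lambda>z. complex_of_real (g z - p z - c z))"
          using cont[OF cd] by (simp add: cont_euclidean_iff)
        have "\<pi> (\<lambda>z. complex_of_real (g z - p z - c z)) = 0" by (rule cont_star_hom_polydisc[OF \<pi> R R0 ccd d0])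
        moreover have "\<pi>' (\<lambda>z. complex_of_real (g z - p z - c z)) = 0" by (rule cont_star_hom_polydisc[OF \<pi>' R' R0 ccd d0])
        moreover have dec: "(\<lambda>z. complex_of_real (g z)) = (\<lambda>z. (complex_of_real (p z) + complex_of_real (c z)) + complex_of_real (g z - p z - c z))"
          by (simp add: fun_eq_iff)
        have cpc: "(\<lambda>z. complex_of_real (p z) + complex_of_real (c z)) \<in> cont_funs euclidean"
          using cont[OF continuous_on_add[OF cp cc]] by simp
        moreover have "\<pi> (\<lambda>z. complex_of_real (p z)) = \<pi>' (\<lambda>z. complex_of_real (p z))" using poly[OF p(1)] by (simp add: ag_def)
        ultimately have 1: "\<pi> (\<lambda>z. complex_of_real (g z)) = \<pi> (\<lambda>z. complex_of_real (p z)) + \<pi> (\<lambda>z. complex_of_real (c z)) + 0"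
          "\<pi>' (\<lambda>z. complex_of_real (g z)) = \<pi> (\<lambda>z. complex_of_real (p z)) + \<pi>' (\<lambda>z. complex_of_real (c z)) + 0"
          unfolding dec hom(3)[OF cpc cont[OF cd]] hom'(3)[OF cpc cont[OF cd]]
            hom(3)[OF cont[OF cp] cont[OF cc]] hom'(3)[OF cont[OF cp] cont[OF cc]] by simp_all
        define x where "x = \<pi> (\<lambda>z. complex_of_real (c z)) v"
        define y where "y = \<pi>' (\<lambda>z. complex_of_real (c z)) v"
        have xy: "x \<in> vecs K" "y \<in> vecs K" using hom(1)[OF cont[OF cc]] hom'(1)[OF cont[OF cc]] v by (auto simp: x_def y_def)
        have "hnorm K x \<le> \<epsilon> * hnorm K v" unfolding x_def by (rule cont_star_hom_contractive[OF \<pi> cont[OF cc] cb v])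
        moreover have "hnorm K y \<le> \<epsilon> * hnorm K v" unfolding y_def by (rule cont_star_hom_contractive[OF \<pi>' cont[OF cc] cb v])
        moreover have "hnorm K (x - y) \<le> hnorm K x + hnorm K y"
          using hnorm_triangle_diff[of x 0 y] hnorm_minus_commute[of 0 y] xy by simp
        moreover have "\<pi> (\<lambda>z. complex_of_real (g z)) v - \<pi>' (\<lambda>z. complex_of_real (g z)) v = x - y"
          unfolding 1 plus_fun_apply[of _ _ v] x_def y_def by simp
        ultimately show "hnorm K (\<pi> (\<lambda>z. complex_of_real (g z)) v - \<pi>' (\<lambda>z. complex_of_real (g z)) v) \<le> 2 * hnorm K v * \<epsilon>"
          by (simp add: mult_ac)
      qed (use hom(1)[OF cg] hom'(1)[OF cg] v in auto)
    qed
  qed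
  have "ag (\<lambda>z. complex_of_real (Re (f z)) + \<i> * complex_of_real (Im (f z)))"
    by (intro ag_add ag_scale real continuous_intros f)
  moreover have "(\<lambda>z. complex_of_real (Re (f z)) + \<i> * complex_of_real (Im (f z))) = f"
    by (rule ext) (rule complex_eq[symmetric])
  ultimately show ?thesis by (simp add: ag_def)
qed

lemma joint_cfc_eqI:
  fixes \<pi> :: "(complex^'n::finite \<Rightarrow> complex) \<Rightarrow> 'x operator"
  assumes "cont_star_hom euclidean K \<pi>" "\<And>j. \<pi> (\<lambda>z. z $ j) = N j" "continuous_on UNIV \<eta>"
  shows "joint_cfc K N \<eta> = \<pi> \<eta>"
  unfolding joint_cfc_def
proof (rule the_equality)
  show "\<exists>\<pi>'. cont_star_hom euclidean K \<pi>' \<and> (\<forall>j. \<pi>' (\<lambda>z. z $ j) = N j) \<and> \<pi> \<eta> = \<pi>' \<eta>"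
    using assms by (intro exI[of _ \<pi>]) simp
  fix B assume "\<exists>\<pi>'. cont_star_hom euclidean K \<pi>' \<and> (\<forall>j. \<pi>' (\<lambda>z. z $ j) = N j) \<and> B = \<pi>' \<eta>"
  then obtain \<pi>' where \<pi>': "cont_star_hom euclidean K \<pi>' \<and> (\<forall>j. \<pi>' (\<lambda>z. z $ j) = N j) \<and> B = \<pi>' \<eta>" by (elim exE)
  have "\<pi>' \<eta> = \<pi> \<eta>"
    by (rule cont_star_hom_euclidean_unique[OF conjunct1[OF \<pi>'] assms(1) _ assms(3)]) (use \<pi>' assms(2) in simp)
  then show "B = \<pi> \<eta>" using \<pi>' by simp
qed

end

context itensor
begin

lemma cont_vec_compose:
  fixes F :: "'n::finite \<Rightarrow> ('e, 'g) path \<Rightarrow> complex" and \<eta> :: "complex^'n \<Rightarrow> complex"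
  assumes F: "\<And>j. F j \<in> cont_funs path_topology" and \<eta>: "continuous_on UNIV \<eta>"
  shows "(\<lambda>\<omega>. \<eta> (\<chi> j. F j \<omega>)) \<in> cont_funs path_topology"
proof -
  have "limitin euclidean (\<lambda>\<omega>. \<chi> j. F j \<omega>) (\<chi> j. F j \<omega>0) (atin path_topology \<omega>0)" if "\<omega>0 \<in> topspace path_topology" for \<omega>0
    unfolding limitin_canonical_iff
  proof (rule vec_tendstoI)
    fix j
    have "continuous_map path_topology euclidean (F j)" using F by (simp add: cont_funs_def)
    then show "((\<lambda>\<omega>. (\<chi> j. F j \<omega>) $ j) \<longlongrightarrow> (\<chi> j. F j \<omega>0) $ j) (atin path_topology \<omega>0)"
      using that unfolding continuous_map_atin vec_lambda_beta limitin_canonical_iff[symmetric] by blast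
  qed
  then have "continuous_map path_topology euclidean (\<lambda>\<omega>. \<chi> j. F j \<omega>)" by (simp add: continuous_map_atin)
  moreover have "continuous_map euclidean euclidean \<eta>" using \<eta> by simp
  ultimately have "continuous_map path_topology euclidean (\<eta> \<circ> (\<lambda>\<omega>. \<chi> j. F j \<omega>))" by (rule continuous_map_compose)
  then show ?thesis by (simp add: cont_funs_def o_def)
qed

text \<open>Composing with the functions F j and then multiplying is a representation that sends the
  coordinates to the given operators, so it is the functional calculus.\<close>

lemma joint_cfc_mult_op:
  fixes F :: "'n::finite \<Rightarrow> ('e, 'g) path \<Rightarrow> complex" and \<eta> :: "complex^'n \<Rightarrow> complex"
  assumes F: "\<And>j. F j \<in> cont_funs path_topology" and \<eta>: "continuous_on UNIV \<eta>"
  shows "joint_cfc HK (\<lambda>j. mult_op \<psi> K T (F j)) \<eta> = mlim (\<lambda>\<omega>. \<eta> (\<chi> j. F j \<omega>))"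
proof (rule H.joint_cfc_eqI[OF _ _ \<eta>])
  note m = H.cont_star_homD[OF cont_star_hom_mlim]
  have c: "(\<lambda>\<omega>. f (\<chi> j. F j \<omega>)) \<in> cont_funs path_topology" if "f \<in> cont_funs euclidean" for f :: "complex^'n \<Rightarrow> complex"
    using that cont_vec_compose[OF F, of f] by (simp add: cont_euclidean_iff)
  show "cont_star_hom euclidean HK (\<lambda>f. mlim (\<lambda>\<omega>. f (\<chi> j. F j \<omega>)))"
    unfolding cont_star_hom_def using m(1)[OF c] m(2) m(3,4)[OF c c] m(5,6)[OF c] by simp
  show "mlim (\<lambda>\<omega>. (\<chi> j. F j \<omega>) $ j) = mult_op \<psi> K T (F j)" for j
    using mult_op_eq[OF F] by simp
qed

subsection \<open>Expectations\<close>

lemma mc_expectation: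
  assumes \<psi>: "\<psi> = dil_vec q" and F: "cylinder t F"
  shows "ip HK (tvec k (\<lambda>_. \<psi>)) (mc t F (tvec k (\<lambda>_. \<psi>))) = (\<integral>\<omega>. F \<omega> \<partial>path_measure q k)"
proof -
  let ?h = "\<lambda>_. \<psi>"
  have h: "?h \<in> stab \<psi>" by simp
  have p: "ip L2U (ket g) \<psi> = complex_of_real (sqrt (pmf q g))" for g by (simp add: \<psi> ket_dil_vec)
  have p': "ip L2U \<psi> (ket g) = complex_of_real (sqrt (pmf q g))" for g
    using ip_L2U_cnj[of "ket g" \<psi>] p[of g] by simp
  \<comment> \<open>This overlap gives one square root of each weight; the coefficient in the
    expansion of the operator gives the other.\<close>
  have ov: "ip HK (tvec k ?h) (tvec k (ovr (window t) y ?h)) = (\<Prod>n\<in>window t. complex_of_real (sqrt (pmf q (y n))))" for y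
  proof -
    have "Prod_any (\<lambda>n. ip L2U \<psi> (ovr (window t) y ?h n)) = (\<Prod>n\<in>window t. ip L2U \<psi> (ovr (window t) y ?h n))"
    proof (rule Prod_any.expand_superset)
      have "ip L2U \<psi> (ovr (window t) y ?h n) = 1" if "n \<notin> window t" for n
        using that ip_stable unfolding ovr_def by metis
      then show "{n. ip L2U \<psi> (ovr (window t) y ?h n) \<noteq> 1} \<subseteq> window t" by blast
    qed simp
    also have "\<dots> = (\<Prod>n\<in>window t. complex_of_real (sqrt (pmf q (y n))))"
      by (rule prod.cong[OF refl]) (simp only: ovr_def if_True p')
    finally show ?thesis using ip_tvec[OF h ovr_stab[OF _ h]] by simp
  qed
  have "ip HK (tvec k ?h) (mc t F (tvec k ?h)) =
      (\<Sum>y\<in>PE t. F (k, y) * (\<Prod>n\<in>window t. complex_of_real (sqrt (pmf q (y n)))) * (\<Prod>n\<in>window t. complex_of_real (sqrt (pmf q (y n)))))"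
    unfolding mult_cyl(3)[OF F h] p
    by (subst H.ip_sum_right) (auto simp: H.ip_scale_right ov intro!: sum.cong)
  also have "\<dots> = (\<Sum>y\<in>PE t. F (k, y) * (\<Prod>n\<in>window t. complex_of_real (pmf q (y n))))"
    by (rule sum.cong[OF refl]) (simp only: mult.assoc prod.distrib[symmetric] of_real_sqrt_pmf)
  finally show ?thesis unfolding path_integral_cylinder[OF F] window_def .
qed

text \<open>Both sides are limits of the same sequence of truncated expectations, by strong
  convergence of operators and by dominated convergence.\<close>

lemma mlim_expectation:
  fixes F :: "('e, 'g) path \<Rightarrow> complex"
  assumes \<psi>: "\<psi> = dil_vec q" and F: "F \<in> cont_funs path_topology"
  shows "ip HK (tvec k (\<lambda>_. \<psi>)) (mlim F (tvec k (\<lambda>_. \<psi>))) = (\<integral>\<omega>. F \<omega> \<partial>path_measure q k)"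
proof (rule LIMSEQ_unique)
  let ?v = "tvec k (\<lambda>_. \<psi>)" and ?F = "\<lambda>n \<omega>. F (trunc n \<omega>)"
  have v: "?v \<in> vecs HK" by simp
  interpret prob_space "path_measure q k" by (rule prob_space_path_measure)
  have "(\<lambda>n. ip HK ?v (mc n (?F n) ?v)) \<longlonglongrightarrow> ip HK ?v (mlim F ?v)"
    by (rule H.lims_ip_right[OF mlim_lims[OF F v] v])
  then show "(\<lambda>n. \<integral>\<omega>. ?F n \<omega> \<partial>path_measure q k) \<longlonglongrightarrow> ip HK ?v (mlim F ?v)"
    unfolding mc_expectation[OF \<psi> cylinder_trunc] .
  obtain M where M: "\<And>\<omega>. cmod (F \<omega>) \<le> M" using cont_funs_bounded[OF F] by blast
  have conv: "(\<lambda>n. ?F n \<omega>) \<longlonglongrightarrow> F \<omega>" for \<omega>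
  proof (rule LIMSEQ_I)
    fix r :: real assume "r > 0"
    then obtain t where "\<And>s \<omega>. s \<ge> t \<Longrightarrow> cmod (F (trunc s \<omega>) - F \<omega>) < r" using trunc_approx[OF F] by blast
    then show "\<exists>no. \<forall>n\<ge>no. cmod (?F n \<omega> - F \<omega>) < r" by blast
  qed
  have meas: "?F n \<in> borel_measurable (path_measure q k)" for n by (rule cylinder_measurable[OF cylinder_trunc])
  have "F \<in> borel_measurable (path_measure q k)" by (rule borel_measurable_LIMSEQ_metric[OF meas conv])
  then show "(\<lambda>n. \<integral>\<omega>. ?F n \<omega> \<partial>path_measure q k) \<longlonglongrightarrow> (\<integral>\<omega>. F \<omega> \<partial>path_measure q k)"
    by (rule integral_dominated_convergence[where w = "\<lambda>_. M"]) (use meas conv M in auto)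
qed

lemma joint_cfc_expectation:
  fixes F :: "'n::finite \<Rightarrow> ('e, 'g) path \<Rightarrow> complex" and \<eta> :: "complex^'n \<Rightarrow> complex"
  assumes \<psi>: "\<psi> = dil_vec q" and F: "\<And>j. F j \<in> cont_funs path_topology" and \<eta>: "continuous_on UNIV \<eta>"
  shows "(\<integral>\<omega>. \<eta> (\<chi> j. F j \<omega>) \<partial>path_measure q k) =
    htrace HK (joint_cfc HK (\<lambda>j. mult_op \<psi> K T (F j)) \<eta> \<circ>
      ketbra HK (ket k \<otimes>\<^sub>v T (\<lambda>_. \<psi>)) (ket k \<otimes>\<^sub>v T (\<lambda>_. \<psi>)))"
proof -
  note c = cont_vec_compose[OF F \<eta>]
  note b = mlim_bop[OF c]
  obtain S where S: "onb HK S" using onb_HK_exists by blast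
  have v: "tvec k (\<lambda>_. \<psi>) \<in> vecs HK" by simp
  have "htrace HK (mlim (\<lambda>\<omega>. \<eta> (\<chi> j. F j \<omega>)) \<circ> ketbra HK (tvec k (\<lambda>_. \<psi>)) (tvec k (\<lambda>_. \<psi>))) =
      ip HK (tvec k (\<lambda>_. \<psi>)) (mlim (\<lambda>\<omega>. \<eta> (\<chi> j. F j \<omega>)) (tvec k (\<lambda>_. \<psi>)))"
    by (rule H.htrace_rank_one[OF S _ _ v v]) (use b H.bop_scale[OF b] in auto)
  then show ?thesis unfolding joint_cfc_mult_op[OF F \<eta>] tvec_def[symmetric] by (simp only: mlim_expectation[OF \<psi> c])
qed

end

section \<open>The dilation property of the unitary evolution\<close>

lemma dil_T_funpow_bop [simp, intro]: "a \<in> bop L2U \<Longrightarrow> (dil_T \<phi> q ^^ t) a \<in> bop L2U"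
  by (induction t) auto

context itensor
begin

text \<open>The entry at site 1 is the unit vector \<psi> and contributes the factor 1, so after the
  shift site 0 may be disregarded.\<close>

lemma ip_T_shift:
  assumes h: "h \<in> stab \<psi>" "h' \<in> stab \<psi>" "h 1 = \<psi>" "h' 1 = \<psi>"
  shows "ip K (T h) (T h') = rest 0 (\<lambda>n. h (n + 1)) (\<lambda>n. h' (n + 1))"
proof -
  let ?s = "\<lambda>h n :: int. h (n + 1) :: 'g cvec"
  have s: "?s h \<in> stab \<psi>" "?s h' \<in> stab \<psi>" using h by auto
  have "Prod_any (\<lambda>n. ip L2U (h n) (h' n)) = Prod_any (\<lambda>n. ip L2U (h (n + 1)) (h' (n + 1)))"
    by (rule Prod_any.reindex_cong[of "\<lambda>n. n + 1"]) (auto simp: fun_eq_iff intro!: o_bij[of "\<lambda>n. n - 1"])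
  then have "ip K (T h) (T h') = ip K (T (?s h)) (T (?s h'))" using h s by (simp add: ip_T)
  also have "\<dots> = ip K (T ((?s h)(0 := \<psi>))) (T ((?s h')(0 := \<psi>)))"
    using h(3,4) fun_upd_triv[of "?s h" 0] fun_upd_triv[of "?s h'" 0] by simp
  finally show ?thesis unfolding ip_T_update[OF s] by (simp add: ip_stable)
qed

lemma evol_tvec:
  assumes "\<psi> = dil_vec q" "h \<in> stab \<psi>" "h 1 = \<psi>"
  shows "evol \<phi> (tvec i h) = (\<Sum>g\<in>UNIV. complex_of_real (sqrt (pmf q g)) \<cdot>\<^sub>v es 0 (\<phi> (i, g)) (\<lambda>n. h (n + 1)))"
proof -
  have p: "ip L2U (ket g) (h 1) = complex_of_real (sqrt (pmf q g))" for g
    unfolding assms(3) by (simp add: assms(1) ket_dil_vec)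
  show ?thesis
    using assms(2) by (subst tvec_expand[OF assms(2), of i 1])
      (simp add: p H.bop_sum[OF evol_bop] H.bop_scale[OF evol_bop] evol_es)
qed

lemma global_J_funpow_Suc:
  "(global_J \<psi> K T (dil_V \<phi>) ^^ Suc t) A = H.conj_by (evol \<phi>) ((global_J \<psi> K T (dil_V \<phi>) ^^ t) A)"
  by (simp only: funpow.simps o_apply global_J_eq[of \<phi> "(global_J \<psi> K T (dil_V \<phi>) ^^ t) A"])

lemma global_J_funpow_bop:
  fixes \<phi> :: "'e \<times> 'g \<Rightarrow> 'e \<times> 'g"
  assumes "bij \<phi>" "a \<in> bop L2U"
  shows "(global_J \<psi> K T (dil_V \<phi>) ^^ t) (amp K a) \<in> bop HK"
proof (induction t)
  case 0
  show ?case using amp_bop[OF assms(2)] by simp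
next
  case (Suc t)
  then show ?case unfolding global_J_funpow_Suc H.conj_by_def by (intro H.bop_comp H.adj_bop evol_bop)
qed

text \<open>The sequences h and h' are arbitrary except on the sites 1 to t still to be used: one
  step leaves basis vectors at site 0, so a claim about the constant sequence \<psi> alone would not
  be inductive.\<close>

lemma global_J_funpow_tvec:
  fixes \<phi> :: "'e \<times> 'g \<Rightarrow> 'e \<times> 'g"
  assumes \<psi>: "\<psi> = dil_vec q" and \<phi>: "bij \<phi>" and a: "a \<in> bop L2U"
  shows "h \<in> stab \<psi> \<Longrightarrow> h' \<in> stab \<psi> \<Longrightarrow>
    (\<And>n. 1 \<le> n \<Longrightarrow> n \<le> int t \<Longrightarrow> h n = \<psi>) \<Longrightarrow> (\<And>n. 1 \<le> n \<Longrightarrow> n \<le> int t \<Longrightarrow> h' n = \<psi>) \<Longrightarrow>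
    ip HK (tvec i h) ((global_J \<psi> K T (dil_V \<phi>) ^^ t) (amp K a) (tvec j h')) =
    mel ((dil_T \<phi> q ^^ t) a) i j * ip K (T h) (T h')"
proof (induction t arbitrary: i j h h')
  case 0
  then show ?case
    by (simp add: tvec_def amp_vtens[OF a] ip_vtens mel_def)
next
  case (Suc t)
  note h = Suc.prems(1,2)
  let ?A = "(global_J \<psi> K T (dil_V \<phi>) ^^ t) (amp K a)"
  let ?S = "(dil_T \<phi> q ^^ t) a"
  let ?r = "\<lambda>g. complex_of_real (sqrt (pmf q g))"
  let ?s = "\<lambda>h n :: int. h (n + 1) :: 'g cvec"
  have A: "?A \<in> bop HK" by (rule global_J_funpow_bop[OF \<phi> a])
  have s: "?s h \<in> stab \<psi>" "?s h' \<in> stab \<psi>" using h by auto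
  have h1: "h 1 = \<psi>" "h' 1 = \<psi>" using Suc.prems(3,4)[of 1] by auto
  \<comment> \<open>The used noise has moved to site 0, where later steps do not act, so its two
    values must coincide; this is the condition in \<open>mel_dil_T\<close>.\<close>
  have IH: "ip HK (es 0 p (?s h)) (?A (es 0 p' (?s h'))) =
      (if snd p = snd p' then mel ?S (fst p) (fst p') else 0) * ip K (T h) (T h')" for p p'
  proof -
    have "ip HK (es 0 p (?s h)) (?A (es 0 p' (?s h'))) =
        mel ?S (fst p) (fst p') * ip K (T ((?s h)(0 := ket (snd p)))) (T ((?s h')(0 := ket (snd p'))))"
      unfolding es_def
    proof (rule Suc.IH)
      show "(?s h)(0 := ket (snd p)) \<in> stab \<psi>" by (rule stab_update[OF s(1)])
      show "(?s h')(0 := ket (snd p')) \<in> stab \<psi>" by (rule stab_update[OF s(2)])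
      fix n assume n: "1 \<le> n" "n \<le> int t"
      show "((?s h)(0 := ket (snd p))) n = \<psi>" "((?s h')(0 := ket (snd p'))) n = \<psi>"
        using n Suc.prems(3,4)[of "n + 1"] by auto
    qed
    then show ?thesis unfolding ip_T_update[OF s] ip_T_shift[OF h h1] by simp
  qed
  have v: "tvec i h \<in> vecs HK" "tvec j h' \<in> vecs HK" using h by auto
  have e: "es 0 p (?s h) \<in> vecs HK" "es 0 p (?s h') \<in> vecs HK" for p using s by auto
  have "ip HK (tvec i h) ((global_J \<psi> K T (dil_V \<phi>) ^^ Suc t) (amp K a) (tvec j h')) =
      ip HK (evol \<phi> (tvec i h)) (?A (evol \<phi> (tvec j h')))"
    unfolding global_J_funpow_Suc H.conj_by_def o_apply
    by (rule H.ip_adj_right[OF evol_bop v(1)]) (use v A in auto)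
  also have "\<dots> = (\<Sum>g\<in>UNIV. \<Sum>g'\<in>UNIV. ?r g * ?r g' * ip HK (es 0 (\<phi> (i, g)) (?s h)) (?A (es 0 (\<phi> (j, g')) (?s h'))))"
    unfolding evol_tvec[OF \<psi> h(1) h1(1)] evol_tvec[OF \<psi> h(2) h1(2)]
    using e A
    by (simp add: H.bop_sum[OF A] H.bop_scale[OF A] H.ip_sum_left H.ip_sum_right H.ip_scale_left
        H.ip_scale_right sum_distrib_left mult_ac) (subst sum.swap, simp add: mult_ac)
  also have "\<dots> = mel (dil_T \<phi> q ?S) i j * ip K (T h) (T h')"
    unfolding IH mel_dil_T[OF dil_T_funpow_bop[OF a]] sum_distrib_right by (simp only: mult.assoc)
  finally show ?case by simp
qed

lemma global_J_dilation:
  fixes \<phi> :: "'e \<times> 'g \<Rightarrow> 'e \<times> 'g"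
  assumes \<psi>: "\<psi> = dil_vec q" and \<phi>: "bij \<phi>" and a: "a \<in> bop L2U"
  shows "cond_exp K (T (\<lambda>_. \<psi>)) (T (\<lambda>_. \<psi>)) ((global_J \<psi> K T (dil_V \<phi>) ^^ t) (amp K a)) = (dil_T \<phi> q ^^ t) a"
proof -
  let ?A = "(global_J \<psi> K T (dil_V \<phi>) ^^ t) (amp K a)"
  have A: "?A \<in> bop HK" by (rule global_J_funpow_bop[OF \<phi> a])
  have v: "T (\<lambda>_. \<psi>) \<in> vecs K" by simp
  obtain S where S: "onb K S" using onb_exists by blast
  have n: "ip K (T (\<lambda>_. \<psi>)) (T (\<lambda>_. \<psi>)) = 1" by (simp add: ip_T ip_stable)
  show ?thesis
  proof (rule mel_ext)
    show "cond_exp K (T (\<lambda>_. \<psi>)) (T (\<lambda>_. \<psi>)) ?A \<in> bop L2U"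
      by (rule cond_exp(1)[OF S _ _ v v]) (use A H.bop_scale[OF A] in auto)
    show "(dil_T \<phi> q ^^ t) a \<in> bop L2U" using a by auto
    fix i j
    have "mel (cond_exp K (T (\<lambda>_. \<psi>)) (T (\<lambda>_. \<psi>)) ?A) i j = ip HK (tvec i (\<lambda>_. \<psi>)) (?A (tvec j (\<lambda>_. \<psi>)))"
      unfolding tvec_def by (rule cond_exp(2)[OF S _ _ v v]) (use A H.bop_scale[OF A] in auto)
    also have "\<dots> = mel ((dil_T \<phi> q ^^ t) a) i j * ip K (T (\<lambda>_. \<psi>)) (T (\<lambda>_. \<psi>))"
      by (rule global_J_funpow_tvec[OF \<psi> \<phi> a]) auto
    finally show "mel (cond_exp K (T (\<lambda>_. \<psi>)) (T (\<lambda>_. \<psi>)) ?A) i j = mel ((dil_T \<phi> q ^^ t) a) i j" by (simp add: n)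
  qed
qed

end

subsection \<open>The flow\<close>

lemma words_Suc: "words (Suc t) = (\<lambda>(ys, g). ys @ [g]) ` (words t \<times> UNIV)"
proof (intro equalityI subsetI)
  fix xs :: "'a list" assume "xs \<in> words (Suc t)"
  then have "xs = butlast xs @ [last xs]" "butlast xs \<in> words t" by (auto simp: words_def intro: append_butlast_last_id[symmetric])
  then show "xs \<in> (\<lambda>(ys, g). ys @ [g]) ` (words t \<times> UNIV)" by (intro image_eqI[of _ _ "(butlast xs, last xs)"]) auto
qed (auto simp: words_def)

lemma finite_words [simp]: "finite (words t :: 'g::finite list set)"
  by (induction t) (simp_all add: words_Suc, simp add: words_def)

lemma words_nonempty [simp]: "words t \<noteq> ({} :: 'g::finite list set)"
  by (induction t) (simp_all add: words_Suc, simp add: words_def)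

lemma sum_words_Suc: "(\<Sum>xs\<in>words (Suc t). f xs) = (\<Sum>ys\<in>words t. \<Sum>g\<in>UNIV. f (ys @ [g]))"
  for f :: "'g::finite list \<Rightarrow> complex"
proof -
  have inj: "inj_on (\<lambda>(ys, g). ys @ [g]) (words t \<times> UNIV)" by (auto simp: inj_on_def)
  show ?thesis unfolding words_Suc sum.reindex[OF inj]
    by (simp add: sum.cartesian_product case_prod_unfold)
qed

lemma card_words_Suc: "card (words (Suc t) :: 'g list set) = card (words t :: 'g list set) * CARD('g::finite)"
proof -
  have inj: "inj_on (\<lambda>(ys, g :: 'g). ys @ [g]) (words t \<times> UNIV)" by (auto simp: inj_on_def)
  show ?thesis unfolding words_Suc card_image[OF inj] by (simp add: card_cartesian_product)
qed

lemma tpower_0: "tpower 0 \<upsilon> [] = 1"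
  by (simp add: tpower_def words_def)

lemma tpower_append: "tpower (Suc t) \<upsilon> (ys @ [g]) = tpower t \<upsilon> ys * \<upsilon> g"
  by (simp add: tpower_def words_def)

lemma hilbert_words: "hilbert (L2 (words t :: 'g::finite list set))"
  by (rule hilbert.intro[OF hilbert_space_L2]) auto

lemma vecs_words: "\<Phi> \<in> vecs (Htens (L2 (words t))) \<longleftrightarrow> (\<forall>i xs. xs \<notin> words t \<longrightarrow> \<Phi> (i, xs) = 0)"
  by (auto simp: vecs_Htens slice_def L2_def)

lemma tpower_vecs [simp]: "tpower t \<upsilon> \<in> vecs (L2 (words t))"
  by (simp add: tpower_def L2_def)

text \<open>Just what the trace computation in \<open>cond_exp\<close> requires, so no bounds have
  to be carried through the recursion of the flow.\<close>

definition homogeneous :: "'x hilb \<Rightarrow> 'x operator \<Rightarrow> bool"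
  where "homogeneous K C \<longleftrightarrow> (\<forall>f\<in>vecs K. C f \<in> vecs K \<and> (\<forall>c. C (c \<cdot>\<^sub>v f) = c \<cdot>\<^sub>v C f))"

lemma append_ketbra:
  fixes C :: "('e::finite \<times> 'g::finite list) operator"
  assumes C: "homogeneous (Htens (L2 (words t))) C"
  shows homogeneous_append_ketbra: "homogeneous (Htens (L2 (words (Suc t)))) (append_ketbra t C z' z)"
    and ip_append_ketbra: "ip (Htens (L2 (words (Suc t)))) (f \<otimes>\<^sub>v tpower (Suc t) \<upsilon>) (append_ketbra t C z' z (f' \<otimes>\<^sub>v tpower (Suc t) \<upsilon>)) =
      ip L2U \<upsilon> z' * ip L2U z \<upsilon> * ip (Htens (L2 (words t))) (f \<otimes>\<^sub>v tpower t \<upsilon>) (C (f' \<otimes>\<^sub>v tpower t \<upsilon>))"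
proof -
  interpret W: hilbert "Htens (L2 (words (Suc t))) :: ('e \<times> 'g list) hilb" by (rule hilbert.hilbert_Htens[OF hilbert_words])
  \<comment> \<open>R contracts the last letter with z.\<close>
  define R where "R \<Phi> = (\<lambda>(j :: 'e, ys). ip L2U z (\<lambda>g. \<Phi> (j, ys @ [g])))" for \<Phi>
  have R: "R \<Phi> \<in> vecs (Htens (L2 (words t)))" if "\<Phi> \<in> vecs (Htens (L2 (words (Suc t))))" for \<Phi>
    unfolding vecs_words
  proof (intro allI impI)
    fix i xs assume "xs \<notin> (words t :: 'g list set)"
    then have "xs @ [g] \<notin> words (Suc t)" for g by (simp add: words_def)
    then have "\<Phi> (i, xs @ [g]) = 0" for g using that unfolding vecs_words by blast
    then show "R \<Phi> (i, xs) = 0" by (simp add: R_def L2_def)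
  qed
  have Rc: "R (c \<cdot>\<^sub>v \<Phi>) = c \<cdot>\<^sub>v R \<Phi>" for c \<Phi>
    by (auto simp: R_def fun_eq_iff scale_apply L2_def sum_distrib_left mult_ac)
  have eq: "append_ketbra t C z' z \<Phi> = (\<lambda>(i, xs). if xs \<in> words (Suc t) then C (R \<Phi>) (i, butlast xs) * z' (last xs) else 0)"
    if "\<Phi> \<in> vecs (Htens (L2 (words (Suc t))))" for \<Phi>
    using that unfolding append_ketbra_def R_def by (simp only: if_True)
  show "homogeneous (Htens (L2 (words (Suc t)))) (append_ketbra t C z' z)"
    unfolding homogeneous_def
  proof (intro ballI conjI allI)
    fix \<Phi> assume \<Phi>: "\<Phi> \<in> vecs (Htens (L2 (words (Suc t)))  :: ('e \<times> 'g list) hilb)"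
    show "append_ketbra t C z' z \<Phi> \<in> vecs (Htens (L2 (words (Suc t))))"
      unfolding eq[OF \<Phi>] vecs_words by simp
    fix c
    have "c \<cdot>\<^sub>v \<Phi> \<in> vecs (Htens (L2 (words (Suc t))))" using \<Phi> by simp
    moreover have "C (c \<cdot>\<^sub>v R \<Phi>) = c \<cdot>\<^sub>v C (R \<Phi>)" using C R[OF \<Phi>] unfolding homogeneous_def by blast
    ultimately show "append_ketbra t C z' z (c \<cdot>\<^sub>v \<Phi>) = c \<cdot>\<^sub>v append_ketbra t C z' z \<Phi>"
      using eq[OF \<Phi>] eq[of "c \<cdot>\<^sub>v \<Phi>"] by (auto simp: Rc fun_eq_iff scale_apply)
  qed
  let ?\<Psi> = "f' \<otimes>\<^sub>v tpower t \<upsilon>" and ?\<Phi> = "f' \<otimes>\<^sub>v tpower (Suc t) \<upsilon>"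
  interpret L: hilbert "L2 (words (Suc t)) :: 'g list hilb" by (rule hilbert_words)
  interpret L': hilbert "L2 (words t) :: 'g list hilb" by (rule hilbert_words)
  have \<Phi>: "?\<Phi> \<in> vecs (Htens (L2 (words (Suc t))))" by (rule L.vtens_vecs) simp
  have \<Psi>: "?\<Psi> \<in> vecs (Htens (L2 (words t)))" by (rule L'.vtens_vecs) simp
  have "R ?\<Phi> = ip L2U z \<upsilon> \<cdot>\<^sub>v ?\<Psi>"
    by (auto simp: R_def vtens_def tpower_append fun_eq_iff scale_apply L2_def sum_distrib_left sum_distrib_right mult_ac)
  then have CR: "C (R ?\<Phi>) = ip L2U z \<upsilon> \<cdot>\<^sub>v C ?\<Psi>" using C \<Psi> unfolding homogeneous_def by simp
  have sl: "ip (L2 (words (Suc t))) (f i \<cdot>\<^sub>v tpower (Suc t) \<upsilon>) (slice (append_ketbra t C z' z ?\<Phi>) i) =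
      ip L2U \<upsilon> z' * ip L2U z \<upsilon> * ip (L2 (words t)) (f i \<cdot>\<^sub>v tpower t \<upsilon>) (slice (C ?\<Psi>) i)" for i
  proof -
    have "(\<Sum>xs\<in>words (Suc t). cnj (f i * tpower (Suc t) \<upsilon> xs) * append_ketbra t C z' z ?\<Phi> (i, xs)) =
        (\<Sum>ys\<in>words t. \<Sum>g\<in>UNIV. cnj (f i * (tpower t \<upsilon> ys * \<upsilon> g)) * (ip L2U z \<upsilon> * C ?\<Psi> (i, ys) * z' g))"
      unfolding sum_words_Suc tpower_append eq[OF \<Phi>] CR
      by (intro sum.cong refl) (simp add: words_def scale_apply)
    also have "\<dots> = ip L2U z \<upsilon> * (\<Sum>ys\<in>words t. cnj (f i * tpower t \<upsilon> ys) * C ?\<Psi> (i, ys)) * (\<Sum>g\<in>UNIV. cnj (\<upsilon> g) * z' g)"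
      by (simp add: sum_distrib_left sum_distrib_right mult_ac)
    finally have e: "(\<Sum>xs\<in>words (Suc t). cnj (f i * tpower (Suc t) \<upsilon> xs) * append_ketbra t C z' z ?\<Phi> (i, xs)) = \<dots>" .
    show ?thesis
      unfolding L2_def hilb.simps slice_def scale_apply e card_words_Suc by (simp add: mult_ac)
  qed
  show "ip (Htens (L2 (words (Suc t)))) (f \<otimes>\<^sub>v tpower (Suc t) \<upsilon>) (append_ketbra t C z' z (f' \<otimes>\<^sub>v tpower (Suc t) \<upsilon>)) =
      ip L2U \<upsilon> z' * ip L2U z \<upsilon> * ip (Htens (L2 (words t))) (f \<otimes>\<^sub>v tpower t \<upsilon>) (C (f' \<otimes>\<^sub>v tpower t \<upsilon>))"
    unfolding ip_Htens slice_vtens sl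
    by (simp add: sum_distrib_left)
qed

lemma homogeneous_sum:
  assumes "hilbert K" "\<And>a. a \<in> I \<Longrightarrow> homogeneous K (C a)"
  shows "homogeneous K (\<Sum>a\<in>I. C a)"
proof -
  interpret hilbert K by fact
  have "(\<Sum>a\<in>I. c \<cdot>\<^sub>v C a f) = c \<cdot>\<^sub>v (\<Sum>a\<in>I. C a f)" for c f
    by (rule ext) (simp add: sum_fun_apply scale_apply sum_distrib_left)
  then show ?thesis using assms(2) unfolding homogeneous_def sum_fun_apply[of C] by auto
qed

text \<open>\<open>flow\<close> sums over Z, and a sum over an infinite set is 0 by
  convention.\<close>

lemma finite_onb_L2U:
  fixes Z :: "'g::finite cvec set"
  assumes "onb L2U Z"
  shows "finite Z"
proof (rule ccontr)
  assume inf: "infinite Z"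
  have on: "ip L2U z z = 1" if "z \<in> Z" for z using assms that by (simp add: onb_def)
  \<comment> \<open>Parseval for all canonical basis vectors, added up: for I = UNIV the sum over Z
    counts the elements of Z, and it has a finite value.\<close>
  have "((\<lambda>z. \<Sum>i\<in>I. ip L2U (ket i) z * ip L2U z (ket i)) has_sum (\<Sum>i\<in>I. ip L2U (ket i) (ket i))) Z" for I :: "'g set"
    by (induction I rule: infinite_finite_induct) (auto intro!: has_sum_add L2U.parseval[OF assms] simp del: ip_ket)
  from this[of UNIV]
  have "((\<lambda>z. \<Sum>i\<in>UNIV. ip L2U (ket i) z * ip L2U z (ket i)) has_sum (\<Sum>i\<in>(UNIV :: 'g set). ip L2U (ket i) (ket i))) Z" .
  moreover have "(\<Sum>i\<in>UNIV. ip L2U (ket i) z * ip L2U z (ket i)) = 1" if "z \<in> Z" for z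
    using ip_L2U_ket(3)[of z z] on[OF that] by (simp add: mult.commute)
  ultimately have "(\<lambda>z. 1 :: complex) summable_on Z"
    using has_sum_cong[of Z "\<lambda>z. \<Sum>i\<in>UNIV. ip L2U (ket i) z * ip L2U z (ket i)" "\<lambda>_. 1"] by (auto simp: summable_on_def)
  then have "(\<lambda>z. Re 1) summable_on Z" by (rule summable_on_Re)
  then show False using infsum_diverge_constant[OF inf, of "1 :: real"] by simp
qed

lemma compression_expand:
  fixes B :: "('e::finite \<times> 'g::finite) operator" and \<upsilon> :: "'g cvec"
  assumes Z: "onb L2U Z" and B: "B \<in> bop (Htens L2U)"
  shows "ip (Htens L2U) (f \<otimes>\<^sub>v \<upsilon>) (B (f' \<otimes>\<^sub>v \<upsilon>)) =
    (\<Sum>z\<in>Z. \<Sum>z'\<in>Z. ip L2U \<upsilon> z' * ip L2U z \<upsilon> * ip (Htens L2U) (f \<otimes>\<^sub>v z') (B (f' \<otimes>\<^sub>v z)))"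
proof -
  have e: "\<upsilon> = (\<Sum>z\<in>Z. ip L2U z \<upsilon> \<cdot>\<^sub>v z)" by (rule L2U.finite_onb_expand[OF Z finite_onb_L2U[OF Z]]) simp
  have v: "f \<otimes>\<^sub>v \<upsilon> = (\<Sum>z\<in>Z. ip L2U z \<upsilon> \<cdot>\<^sub>v (f \<otimes>\<^sub>v z))" for f :: "'e cvec"
    by (subst e) (simp add: vtens_sum vtens_simps)
  have c: "cnj (ip L2U z \<upsilon>) = ip L2U \<upsilon> z" for z by (simp add: ip_L2U_cnj)
  show ?thesis unfolding v
    by (simp add: HL.bop_sum[OF B] HL.bop_scale[OF B] HL.ip_sum_left HL.ip_sum_right HL.ip_scale_left
        HL.ip_scale_right c sum_distrib_left mult_ac)
qed

section \<open>The dilation property of the flow\<close>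

context
  fixes \<phi> :: "'e::finite \<times> 'g::finite \<Rightarrow> 'e \<times> 'g" and q :: "'g pmf" and Z :: "'g cvec set"
  assumes Z: "onb L2U Z"
begin

definition flow_block :: "'g cvec \<Rightarrow> 'g cvec \<Rightarrow> 'e operator \<Rightarrow> 'e operator"
  where "flow_block z z' a = cond_exp L2U z z' (adj (Htens L2U) (dil_V \<phi>) \<circ> amp L2U a \<circ> dil_V \<phi>)"

lemma flow_block:
  assumes a: "a \<in> bop L2U"
  shows "flow_block z z' a \<in> bop L2U"
    "mel (flow_block z z' a) i j =
      ip (Htens L2U) (ket i \<otimes>\<^sub>v z') ((adj (Htens L2U) (dil_V \<phi>) \<circ> amp L2U a \<circ> dil_V \<phi>) (ket j \<otimes>\<^sub>v z))"
proof -
  have B: "adj (Htens L2U) (dil_V \<phi>) \<circ> amp L2U a \<circ> dil_V \<phi> \<in> bop (Htens L2U)"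
    by (intro HL.bop_comp HL.adj_bop dil_V_bop L2U.amp_bop a)
  note c = L2U.cond_exp[OF Z _ _ vecs_L2U vecs_L2U, of "adj (Htens L2U) (dil_V \<phi>) \<circ> amp L2U a \<circ> dil_V \<phi>"]
  show "flow_block z z' a \<in> bop L2U" unfolding flow_block_def
    by (rule c) (use HL.bop_scale[OF B] in auto)
  show "mel (flow_block z z' a) i j =
      ip (Htens L2U) (ket i \<otimes>\<^sub>v z') ((adj (Htens L2U) (dil_V \<phi>) \<circ> amp L2U a \<circ> dil_V \<phi>) (ket j \<otimes>\<^sub>v z))"
    unfolding flow_block_def by (rule c) (use HL.bop_scale[OF B] in auto)
qed

text \<open>T is the compression by \<upsilon>, and expanding \<upsilon> in Z on both sides produces
  exactly the blocks of one step of the flow.\<close>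

lemma dil_T_flow_block:
  assumes a: "a \<in> bop L2U"
  shows "dil_T \<phi> q a = (\<Sum>z\<in>Z. \<Sum>z'\<in>Z. (ip L2U (dil_vec q) z' * ip L2U z (dil_vec q)) \<cdot>\<^sub>o flow_block z z' a)"
proof (rule mel_ext)
  have B: "adj (Htens L2U) (dil_V \<phi>) \<circ> amp L2U a \<circ> dil_V \<phi> \<in> bop (Htens L2U)"
    by (intro HL.bop_comp HL.adj_bop dil_V_bop L2U.amp_bop a)
  show "dil_T \<phi> q a \<in> bop L2U" using a by auto
  show "(\<Sum>z\<in>Z. \<Sum>z'\<in>Z. (ip L2U (dil_vec q) z' * ip L2U z (dil_vec q)) \<cdot>\<^sub>o flow_block z z' a) \<in> bop L2U"
    by (intro L2U.bop_sum_op L2U.bop_scale_op flow_block a)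
  fix i j
  have "mel (dil_T \<phi> q a) i j =
      ip (Htens L2U) (ket i \<otimes>\<^sub>v dil_vec q) ((adj (Htens L2U) (dil_V \<phi>) \<circ> amp L2U a \<circ> dil_V \<phi>) (ket j \<otimes>\<^sub>v dil_vec q))"
    unfolding dil_T_compression[OF a, symmetric] by (simp add: HL.ip_adj_right)
  then show "mel (dil_T \<phi> q a) i j =
      mel (\<Sum>z\<in>Z. \<Sum>z'\<in>Z. (ip L2U (dil_vec q) z' * ip L2U z (dil_vec q)) \<cdot>\<^sub>o flow_block z z' a) i j"
    unfolding compression_expand[OF Z B] mel_sum mel_scale flow_block(2)[OF a] .
qed

lemma dil_T_funpow_sum:
  assumes "\<And>x. x \<in> I \<Longrightarrow> A x \<in> bop L2U"
  shows "(dil_T \<phi> q ^^ t) (\<Sum>x\<in>I. c x \<cdot>\<^sub>o A x) = (\<Sum>x\<in>I. c x \<cdot>\<^sub>o (dil_T \<phi> q ^^ t) (A x))"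
proof (induction t)
  case (Suc t)
  \<comment> \<open>Empty and infinite sums are 0; linearity with coefficient -1 at a = b = 0 gives
    the value there.\<close>
  have z: "dil_T \<phi> q 0 = 0"
    using dil_T_linear[of 0 0 \<phi> q "-1"] by (simp add: L2U.scale_op_minus_one)
  have "dil_T \<phi> q (\<Sum>x\<in>I. c x \<cdot>\<^sub>o B x) = (\<Sum>x\<in>I. c x \<cdot>\<^sub>o dil_T \<phi> q (B x))" if "\<And>x. x \<in> I \<Longrightarrow> B x \<in> bop L2U" for B
    using that
  proof (induction I rule: infinite_finite_induct)
    case (insert x I)
    have "dil_T \<phi> q (c x \<cdot>\<^sub>o B x + (\<Sum>x\<in>I. c x \<cdot>\<^sub>o B x)) = c x \<cdot>\<^sub>o dil_T \<phi> q (B x) + dil_T \<phi> q (\<Sum>x\<in>I. c x \<cdot>\<^sub>o B x)"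
      by (rule dil_T_linear) (use insert.prems in \<open>auto intro!: L2U.bop_sum_op L2U.bop_scale_op\<close>)
    then show ?case using insert by simp
  qed (simp_all add: z)
  then show ?case using Suc assms by simp
qed simp

text \<open>The flow applies its one-step blocks to a first and the flow up to t afterwards. Hence a
  is arbitrary in the induction, and the powers are unfolded from the right.\<close>

lemma flow_expectation:
  "a \<in> bop L2U \<Longrightarrow> homogeneous (Htens (L2 (words t))) (flow Z (dil_V \<phi>) t a) \<and>
    (\<forall>i j. ip (Htens (L2 (words t))) (ket i \<otimes>\<^sub>v tpower t (dil_vec q)) (flow Z (dil_V \<phi>) t a (ket j \<otimes>\<^sub>v tpower t (dil_vec q))) =
      mel ((dil_T \<phi> q ^^ t) a) i j)"
proof (induction t arbitrary: a)
  case 0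
  interpret L: hilbert "L2 (words 0) :: 'g list hilb" by (rule hilbert_words)
  interpret W: hilbert "Htens (L2 (words 0)) :: ('e \<times> 'g list) hilb" by (rule L.hilbert_Htens)
  note b = L.amp_bop[OF 0]
  have w: "words 0 = {[] :: 'g list}" by (simp add: words_def)
  have "ip (L2 (words 0)) (tpower 0 (dil_vec q)) (tpower 0 (dil_vec q)) = 1"
    by (simp add: L2_def w tpower_0)
  then show ?case using W.bop_vecs[OF b] W.bop_scale[OF b]
    by (auto simp: homogeneous_def L.amp_vtens[OF 0] L.ip_vtens mel_def)
next
  case (Suc t)
  let ?C = "\<lambda>z z'. flow Z (dil_V \<phi>) t (flow_block z z' a)"
  let ?v = "tpower (Suc t) (dil_vec q)"
  have C: "homogeneous (Htens (L2 (words t))) (?C z z')"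
    "ip (Htens (L2 (words t))) (ket i \<otimes>\<^sub>v tpower t (dil_vec q)) (?C z z' (ket j \<otimes>\<^sub>v tpower t (dil_vec q))) =
      mel ((dil_T \<phi> q ^^ t) (flow_block z z' a)) i j" for z z' i j
    using Suc.IH[OF flow_block(1)[OF Suc.prems]] by auto
  have fl: "flow Z (dil_V \<phi>) (Suc t) a = (\<Sum>z\<in>Z. \<Sum>z'\<in>Z. append_ketbra t (?C z z') z' z)"
    by (simp add: flow_block_def)
  interpret L: hilbert "L2 (words (Suc t)) :: 'g list hilb" by (rule hilbert_words)
  interpret W: hilbert "Htens (L2 (words (Suc t))) :: ('e \<times> 'g list) hilb" by (rule L.hilbert_Htens)
  have hom: "homogeneous (Htens (L2 (words (Suc t)))) (append_ketbra t (?C z z') z' z)" for z z'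
    by (rule homogeneous_append_ketbra[OF C(1)])
  have vv: "ket i \<otimes>\<^sub>v ?v \<in> vecs (Htens (L2 (words (Suc t))))" for i :: 'e by (rule L.vtens_vecs) simp
  have av: "append_ketbra t (?C z z') z' z (ket j \<otimes>\<^sub>v ?v) \<in> vecs (Htens (L2 (words (Suc t))))" for z z' j
    using hom[of z z'] vv[of j] by (simp add: homogeneous_def)
  show ?case
  proof (intro conjI allI)
    show "homogeneous (Htens (L2 (words (Suc t)))) (flow Z (dil_V \<phi>) (Suc t) a)"
      unfolding fl by (intro homogeneous_sum W.hilbert_axioms hom)
    fix i j
    have "ip (Htens (L2 (words (Suc t)))) (ket i \<otimes>\<^sub>v ?v) (flow Z (dil_V \<phi>) (Suc t) a (ket j \<otimes>\<^sub>v ?v)) =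
        (\<Sum>z\<in>Z. \<Sum>z'\<in>Z. ip (Htens (L2 (words (Suc t)))) (ket i \<otimes>\<^sub>v ?v) (append_ketbra t (?C z z') z' z (ket j \<otimes>\<^sub>v ?v)))"
      unfolding fl sum_fun_apply[of "\<lambda>z. \<Sum>z'\<in>Z. append_ketbra t (?C z z') z' z"]
        sum_fun_apply[of "\<lambda>z'. append_ketbra t (?C z z') z' z" for z]
      using vv av by (simp add: W.ip_sum_right W.sum_vecs)
    also have "\<dots> = mel (\<Sum>z\<in>Z. \<Sum>z'\<in>Z. (ip L2U (dil_vec q) z' * ip L2U z (dil_vec q)) \<cdot>\<^sub>o (dil_T \<phi> q ^^ t) (flow_block z z' a)) i j"
      unfolding ip_append_ketbra[OF C(1)] C(2) mel_sum mel_scale ..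
    also have "\<dots> = mel (\<Sum>p\<in>Z \<times> Z. (ip L2U (dil_vec q) (snd p) * ip L2U (fst p) (dil_vec q)) \<cdot>\<^sub>o (dil_T \<phi> q ^^ t) (flow_block (fst p) (snd p) a)) i j"
      by (simp add: sum.cartesian_product case_prod_unfold)
    also have "\<dots> = mel ((dil_T \<phi> q ^^ t) (\<Sum>p\<in>Z \<times> Z. (ip L2U (dil_vec q) (snd p) * ip L2U (fst p) (dil_vec q)) \<cdot>\<^sub>o flow_block (fst p) (snd p) a)) i j"
      by (subst dil_T_funpow_sum) (auto intro: flow_block Suc.prems)
    also have "\<dots> = mel ((dil_T \<phi> q ^^ t) (dil_T \<phi> q a)) i j"
      unfolding dil_T_flow_block[OF Suc.prems] by (simp add: sum.cartesian_product case_prod_unfold)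
    finally show "ip (Htens (L2 (words (Suc t)))) (ket i \<otimes>\<^sub>v ?v) (flow Z (dil_V \<phi>) (Suc t) a (ket j \<otimes>\<^sub>v ?v)) =
      mel ((dil_T \<phi> q ^^ Suc t) a) i j"
      by (simp only: funpow_Suc_right o_apply)
  qed
qed

lemma flow_dilation:
  assumes a: "a \<in> bop L2U"
  shows "cond_exp (L2 (words t)) (tpower t (dil_vec q)) (tpower t (dil_vec q)) (flow Z (dil_V \<phi>) t a) = (dil_T \<phi> q ^^ t) a"
proof -
  interpret L: hilbert "L2 (words t) :: 'g list hilb" by (rule hilbert_words)
  note f = flow_expectation[OF a, of t]
  have S: "onb (L2 (words t :: 'g list set)) (point (words t) ` words t)" by (rule onb_L2) auto
  note c = L.cond_exp[OF S _ _ tpower_vecs tpower_vecs, of "flow Z (dil_V \<phi>) t a"]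
  show ?thesis
  proof (rule mel_ext)
    show "cond_exp (L2 (words t)) (tpower t (dil_vec q)) (tpower t (dil_vec q)) (flow Z (dil_V \<phi>) t a) \<in> bop L2U"
      by (rule c) (use f in \<open>auto simp: homogeneous_def\<close>)
    show "(dil_T \<phi> q ^^ t) a \<in> bop L2U" using a by auto
    fix i j
    have "mel (cond_exp (L2 (words t)) (tpower t (dil_vec q)) (tpower t (dil_vec q)) (flow Z (dil_V \<phi>) t a)) i j =
        ip (Htens (L2 (words t))) (ket i \<otimes>\<^sub>v tpower t (dil_vec q)) (flow Z (dil_V \<phi>) t a (ket j \<otimes>\<^sub>v tpower t (dil_vec q)))"
      by (rule c) (use f in \<open>auto simp: homogeneous_def\<close>)
    then show "mel (cond_exp (L2 (words t)) (tpower t (dil_vec q)) (tpower t (dil_vec q)) (flow Z (dil_V \<phi>) t a)) i j =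
        mel ((dil_T \<phi> q ^^ t) a) i j" using f by simp
  qed
qed

end

theorem theorem2:
  fixes P :: "'e::finite \<Rightarrow> 'e \<Rightarrow> real"
    and \<phi> :: "'e \<times> 'g::finite \<Rightarrow> 'e \<times> 'g"
    and q :: "'g pmf"
  assumes "stochastic P"
    and "standard_dilation P \<phi> q"
  shows "unitary_op (Htens L2U) (dil_V \<phi>) \<and>
    (\<forall>(\<psi> :: 'g cvec) (K :: 'x hilb) T. infinite_tensor \<psi> K T \<longrightarrow>
      star_automorphism (Htens K) (local_algebra \<psi> K T) (local_J \<psi> K T (dil_V \<phi>)) \<and>
      (\<forall>F\<in>cont_funs path_topology.
        local_J \<psi> K T (dil_V \<phi>) (mult_op \<psi> K T F) = mult_op \<psi> K T (F \<circ> alpha \<phi>))) \<and>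
    hnorm L2U (dil_vec q) = 1 \<and>
    (\<forall>(K :: 'x hilb) T. infinite_tensor (dil_vec q) K T \<longrightarrow>
      (\<forall>(k :: 'e) (F :: 'n::finite \<Rightarrow> ('e, 'g) path \<Rightarrow> complex) (\<eta> :: complex^'n \<Rightarrow> complex).
        (\<forall>j. F j \<in> cont_funs path_topology) \<and> continuous_on UNIV \<eta> \<and> bounded (range \<eta>) \<longrightarrow>
        (\<integral>\<omega>. \<eta> (\<chi> j. F j \<omega>) \<partial>path_measure q k) =
          htrace (Htens K)
            (joint_cfc (Htens K) (\<lambda>j. mult_op (dil_vec q) K T (F j)) \<eta> \<circ>
             ketbra (Htens K) (ket k \<otimes>\<^sub>v T (\<lambda>_. dil_vec q)) (ket k \<otimes>\<^sub>v T (\<lambda>_. dil_vec q)))) \<and>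
      qp_dilation K T (dil_V \<phi>) (dil_vec q) (dil_T \<phi> q)) \<and>
    qds_generator (dil_T \<phi> q) \<and>
    (\<forall>f. dil_T \<phi> q (mult_fun f) = mult_fun (markov_op P f))"
proof -
  have \<phi>: "bij \<phi>" using assms(2) by (simp add: standard_dilation_def)
  note V = dil_V_unitary(1)[OF \<phi>]
  have 1: "star_automorphism (Htens K) (local_algebra \<psi> K T) (local_J \<psi> K T (dil_V \<phi>)) \<and>
      (\<forall>F\<in>cont_funs path_topology.
        local_J \<psi> K T (dil_V \<phi>) (mult_op \<psi> K T F) = mult_op \<psi> K T (F \<circ> alpha \<phi>))"
    if "infinite_tensor \<psi> K T" for \<psi> and K :: "'x hilb" and T
  proof -
    interpret itensor \<psi> K T "TYPE('e)" by (rule itensor.intro[OF that])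
    show ?thesis using star_automorphism_local_J[OF \<phi>] local_J_mult_op[OF \<phi>] by blast
  qed
  have 2: "(\<integral>\<omega>. \<eta> (\<chi> j. F j \<omega>) \<partial>path_measure q k) =
          htrace (Htens K)
            (joint_cfc (Htens K) (\<lambda>j. mult_op (dil_vec q) K T (F j)) \<eta> \<circ>
             ketbra (Htens K) (ket k \<otimes>\<^sub>v T (\<lambda>_. dil_vec q)) (ket k \<otimes>\<^sub>v T (\<lambda>_. dil_vec q)))"
    if "infinite_tensor (dil_vec q) K T" "\<And>j. F j \<in> cont_funs path_topology" "continuous_on UNIV \<eta>"
    for K :: "'x hilb" and T k and F :: "'n \<Rightarrow> ('e, 'g) path \<Rightarrow> complex" and \<eta>
  proof -
    interpret itensor "dil_vec q" K T "TYPE('e)" by (rule itensor.intro[OF that(1)])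
    show ?thesis by (rule joint_cfc_expectation[OF refl that(2,3)])
  qed
  have 3: "qp_dilation K T (dil_V \<phi>) (dil_vec q) (dil_T \<phi> q)"
    if "infinite_tensor (dil_vec q) K T" for K :: "'x hilb" and T
  proof -
    interpret itensor "dil_vec q" K T "TYPE('e)" by (rule itensor.intro[OF that])
    show ?thesis unfolding qp_dilation_def
    proof (intro conjI ballI allI impI V hnorm_dil_vec that)
      fix a :: "'e operator" and t assume a: "a \<in> bop L2U"
      show "(dil_T \<phi> q ^^ t) a = cond_exp K (T (\<lambda>_. dil_vec q)) (T (\<lambda>_. dil_vec q)) ((global_J (dil_vec q) K T (dil_V \<phi>) ^^ t) (amp K a))"
        by (rule global_J_dilation[OF refl \<phi> a, symmetric])
      fix Z :: "'g cvec set" assume "onb L2U Z"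
      from flow_dilation[OF this a]
      show "(dil_T \<phi> q ^^ t) a = cond_exp (L2 (words t)) (tpower t (dil_vec q)) (tpower t (dil_vec q)) (flow Z (dil_V \<phi>) t a)"
        by (rule sym)
    qed
  qed
  show ?thesis
    using V 1 hnorm_dil_vec 2 3 qds_generator_dil_T[OF \<phi>] dil_T_mult_fun[OF assms(2)] by blast
qed

end
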